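(* Let $\alpha,\beta,\gamma\in\mathbb{C}$. Consider the system $$\frac{dx}{dt}=xy+\gamma,\qquad \frac{dy}{dt}=\frac32x^2-\frac12y^2+4\alpha x+2\beta .$$ After a series of blowing-ups in $\mathbb{P}^2$ one obtains a rational surface of type $E_6^{(1)}$. The phase space $\mathcal{X}$ of the system can be obtained by gluing four copies $U_j\times\mathbb{C}=\mathbb{C}^2\times\mathbb{C}\ni(x_j,y_j,t)$, $j=0,1,2,3$, via the birational and symplectic transformations $$\begin{aligned} 0)\;& x_0=x,\quad y_0=y,\\ 1)\;& x_1=\frac1x,\quad y_1=-\bigl((y-x-2\alpha)x+2\alpha^2-2\beta+\gamma\bigr)x,\\ 2)\;& x_2=\frac1x,\quad y_2=-\bigl((y+x+2\alpha)x-2\alpha^2+2\beta+\gamma\bigr)x,\\ 3)\;& x_3=-(xy+2\gamma)y,\quad y_3=\frac1y . \end{aligned}$$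
   Context: Symplectic means $dx_j\wedge dy_j=dx\wedge dy$ for fixed $t$. Gluing: points of different charts with the same $t$ are identified through the given birational relations wherever these are biregular. Phase space: the resulting complex manifold $\mathcal{X}$, fibred over the $t$-line $B$ (here $B=\mathbb{C}$), is the phase space (space of initial conditions) of the system if (i) rewritten in the coordinates $(x_j,y_j)$ of every chart, the system has right-hand sides that are polynomials in $(x_j,y_j)$ with coefficients holomorphic in $t$; and (ii) every solution $(x(t),y(t))$ that is meromorphic near a point $t_0\in B$ extends holomorphically across $t_0$ as a map into $\mathcal{X}$. Type: a rational surface of type $R$ (an affine Dynkin diagram) here means a smooth projective rational surface $S$ (obtained by successively blowing up $\mathbb{P}^2\supset\mathbb{C}^2\ni(x,y)$) containing the fibre $\mathcal{X}_t$ as an open subset such that $S\setminus\mathcal{X}_t$ is a union of smooth rational curves of self-intersection $-2$ whose dual intersection graph is the diagram $R$. *)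

theory Defs
  imports "HOL-Complex_Analysis.Complex_Analysis" "HOL-Computational_Algebra.Polynomial"
begin

section \<open>Complex manifolds\<close>

definition complex_linear :: "(complex ^ 'n \<Rightarrow> complex ^ 'm) \<Rightarrow> bool" where
  "complex_linear L \<longleftrightarrow> linear L \<and> (\<forall>c v. L (c *s v) = c *s L v)"

text \<open>Holomorphy in several variables: complex Frechet differentiability. Only used on open sets.\<close>

definition holo_on :: "(complex ^ 'n) set \<Rightarrow> (complex ^ 'n \<Rightarrow> complex ^ 'm) \<Rightarrow> bool" where
  "holo_on W f \<longleftrightarrow> (\<forall>z\<in>W. \<exists>L. (f has_derivative L) (at z) \<and> complex_linear L)"

record ('p, 'n) cmanifold =
  points :: "'p set"
  atlas :: "('p set \<times> ('p \<Rightarrow> complex ^ 'n::finite)) set"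

definition mtop :: "('p, 'n::finite) cmanifold \<Rightarrow> 'p topology" where
  "mtop M = topology (\<lambda>W. W \<subseteq> points M \<and> (\<forall>(U, \<phi>)\<in>atlas M. open (\<phi> ` (U \<inter> W))))"

definition complex_manifold :: "('p, 'n::finite) cmanifold \<Rightarrow> bool" where
  "complex_manifold M \<longleftrightarrow>
     (\<Union>(U, \<phi>)\<in>atlas M. U) = points M \<and>
     (\<forall>(U, \<phi>)\<in>atlas M. inj_on \<phi> U \<and> open (\<phi> ` U)) \<and>
     (\<forall>(U, \<phi>)\<in>atlas M. \<forall>(V, \<psi>)\<in>atlas M.
        open (\<phi> ` (U \<inter> V)) \<and> holo_on (\<phi> ` (U \<inter> V)) (\<psi> \<circ> inv_into U \<phi>)) \<and>
     Hausdorff_space (mtop M) \<and> second_countable (mtop M)"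

text \<open>The open submanifold on an open set of points.\<close>

definition submanifold :: "('p, 'n::finite) cmanifold \<Rightarrow> 'p set \<Rightarrow> ('p, 'n) cmanifold" where
  "submanifold M W = \<lparr>points = points M \<inter> W, atlas = {(U \<inter> W, \<phi>) |U \<phi>. (U, \<phi>) \<in> atlas M}\<rparr>"

definition holomorphic_map ::
  "('p, 'n::finite) cmanifold \<Rightarrow> ('q, 'm::finite) cmanifold \<Rightarrow> ('p \<Rightarrow> 'q) \<Rightarrow> bool" where
  "holomorphic_map M N f \<longleftrightarrow> f \<in> points M \<rightarrow> points N \<and>
     (\<forall>x\<in>points M. \<forall>(U, \<phi>)\<in>atlas M. \<forall>(V, \<psi>)\<in>atlas N. x \<in> U \<longrightarrow> f x \<in> V \<longrightarrow>
        (\<exists>W. open W \<and> \<phi> x \<in> W \<and> W \<subseteq> \<phi> ` U \<and> f ` inv_into U \<phi> ` W \<subseteq> V \<and>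
             holo_on W (\<psi> \<circ> f \<circ> inv_into U \<phi>)))"

definition biholomorphic ::
  "('p, 'n::finite) cmanifold \<Rightarrow> ('q, 'n) cmanifold \<Rightarrow> ('p \<Rightarrow> 'q) \<Rightarrow> bool" where
  "biholomorphic M N f \<longleftrightarrow> bij_betw f (points M) (points N) \<and>
     holomorphic_map M N f \<and> holomorphic_map N M (inv_into (points M) f)"

definition immersive_at ::
  "('p, 'n::finite) cmanifold \<Rightarrow> ('q, 'm::finite) cmanifold \<Rightarrow> ('p \<Rightarrow> 'q) \<Rightarrow> 'p \<Rightarrow> bool" where
  "immersive_at M N f x \<longleftrightarrow> (\<forall>(U, \<phi>)\<in>atlas M. \<forall>(V, \<psi>)\<in>atlas N. x \<in> U \<longrightarrow> f x \<in> V \<longrightarrow>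
     (\<exists>L. ((\<psi> \<circ> f \<circ> inv_into U \<phi>) has_derivative L) (at (\<phi> x)) \<and> inj L))"

definition submersive_at ::
  "('p, 'n::finite) cmanifold \<Rightarrow> ('q, 'm::finite) cmanifold \<Rightarrow> ('p \<Rightarrow> 'q) \<Rightarrow> 'p \<Rightarrow> bool" where
  "submersive_at M N f x \<longleftrightarrow> (\<forall>(U, \<phi>)\<in>atlas M. \<forall>(V, \<psi>)\<in>atlas N. x \<in> U \<longrightarrow> f x \<in> V \<longrightarrow>
     (\<exists>L. ((\<psi> \<circ> f \<circ> inv_into U \<phi>) has_derivative L) (at (\<phi> x)) \<and> surj L))"

definition affine_space :: "(complex ^ 'n, 'n::finite) cmanifold" where
  "affine_space = \<lparr>points = UNIV, atlas = {(UNIV, id)}\<rparr>"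

text \<open>The complex line with underlying type \<^typ>\<open>complex\<close> instead of \<^typ>\<open>complex ^ 1\<close>.\<close>

definition complex_line :: "(complex, 1) cmanifold" where
  "complex_line = \<lparr>points = UNIV, atlas = {(UNIV, vec)}\<rparr>"


section \<open>Projective spaces and blowing up\<close>

definition line_through :: "complex ^ 'm \<Rightarrow> (complex ^ 'm) set" where
  "line_through v = range (\<lambda>c. c *s v)"

definition line_coord :: "'m \<Rightarrow> (complex ^ 'm) set \<Rightarrow> complex ^ 'm" where
  "line_coord i l = (THE v. v \<in> l \<and> v $ i = 1)"

text \<open>
  The space of lines in \<^typ>\<open>complex ^ 'm\<close>, with the usual affine charts. As dimensions are
  types, the \<open>'n\<close> affine coordinates on the chart where the \<open>i\<close>-th homogeneous coordinate does
  not vanish have to be matched with the indices other than \<open>i\<close>; all bijections \<open>e\<close> are admitted.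
  Only meaningful for \<open>CARD('m) = CARD('n) + 1\<close>.
\<close>

definition projective_space :: "((complex ^ 'm::finite) set, 'n::finite) cmanifold" where
  "projective_space =
     \<lparr>points = {line_through v |v. v \<noteq> 0},
      atlas = {({line_through v |v. v $ i \<noteq> 0}, \<lambda>l. \<chi> k. line_coord i l $ e k) |i e.
                 bij_betw (e :: 'n \<Rightarrow> 'm) UNIV (UNIV - {i})}\<rparr>"

abbreviation P1 :: "((complex ^ 2) set, 1) cmanifold" where
  "P1 \<equiv> projective_space"

abbreviation P2 :: "((complex ^ 3) set, 2) cmanifold" where
  "P2 \<equiv> projective_space"

text \<open>
  The blow-up of the origin of the affine plane as incidence variety of points and lines. The
  coordinates of the \<open>i\<close>-th chart are \<open>z $ i\<close> (in position \<open>i\<close>) and the slope of the line.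
\<close>

definition blowup_origin :: "((complex ^ 2) \<times> (complex ^ 2) set, 2) cmanifold" where
  "blowup_origin =
     \<lparr>points = {(z, l). l \<in> points P1 \<and> z \<in> l},
      atlas = {({(z, line_through v) |z v. v $ i \<noteq> 0 \<and> z \<in> line_through v},
                \<lambda>(z, l). \<chi> j. if j = i then z $ i else line_coord i l $ j) |i. True}\<rparr>"

text \<open>
  \<open>\<pi> : S' \<rightarrow> S\<close> is the blow-up of the point \<open>p\<close> of the surface \<open>S\<close>: an isomorphism away from
  \<open>p\<close>, and the standard blow-up of the origin in suitable local coordinates \<open>\<phi>\<close> centred at \<open>p\<close>.
\<close>

definition is_blowup ::
  "('p, 2) cmanifold \<Rightarrow> 'p \<Rightarrow> ('q, 2) cmanifold \<Rightarrow> ('q \<Rightarrow> 'p) \<Rightarrow> bool" where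
  "is_blowup S p S' \<pi> \<longleftrightarrow>
     p \<in> points S \<and> complex_manifold S' \<and> holomorphic_map S' S \<pi> \<and>
     biholomorphic (submanifold S' {q. \<pi> q \<noteq> p}) (submanifold S {q. q \<noteq> p}) \<pi> \<and>
     (\<exists>U \<phi> \<psi>. openin (mtop S) U \<and> p \<in> U \<and> open (\<phi> ` U) \<and> \<phi> p = 0 \<and>
        biholomorphic (submanifold S U) (submanifold affine_space (\<phi> ` U)) \<phi> \<and>
        biholomorphic (submanifold S' {q. \<pi> q \<in> U})
                      (submanifold blowup_origin {(z, l). z \<in> \<phi> ` U}) \<psi> \<and>
        (\<forall>q\<in>points S'. \<pi> q \<in> U \<longrightarrow> fst (\<psi> q) = \<phi> (\<pi> q)))"

text \<open>
  Surfaces obtained from the projective plane by successively blowing up points, together with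
  the composite of the blow-downs. They are smooth, projective and rational.
\<close>

inductive iterated_blowup_P2 :: "('p, 2) cmanifold \<Rightarrow> ('p \<Rightarrow> (complex ^ 3) set) \<Rightarrow> bool" where
  plane: "complex_manifold S \<Longrightarrow> biholomorphic S P2 \<rho> \<Longrightarrow> iterated_blowup_P2 S \<rho>"
| blowup: "iterated_blowup_P2 S \<rho> \<Longrightarrow> is_blowup S p S' \<pi> \<Longrightarrow> iterated_blowup_P2 S' (\<rho> \<circ> \<pi>)"


section \<open>Rational curves and intersection numbers\<close>

text \<open>An injective immersion is an embedding here, as the projective line is compact.\<close>

definition embedded_P1 :: "('p, 2) cmanifold \<Rightarrow> ((complex ^ 2) set \<Rightarrow> 'p) \<Rightarrow> bool" where
  "embedded_P1 S f \<longleftrightarrow> holomorphic_map P1 S f \<and> inj_on f (points P1) \<and>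
     (\<forall>x\<in>points P1. immersive_at P1 S f x)"

text \<open>A reduced equation \<open>h = 0\<close> of the smooth curve \<open>D\<close> on the open set \<open>U\<close>.\<close>

definition local_equation :: "('p, 2) cmanifold \<Rightarrow> 'p set \<Rightarrow> 'p set \<Rightarrow> ('p \<Rightarrow> complex) \<Rightarrow> bool" where
  "local_equation S D U h \<longleftrightarrow> openin (mtop S) U \<and>
     holomorphic_map (submanifold S U) complex_line h \<and>
     D \<inter> U = {x \<in> U. h x = 0} \<and>
     (\<forall>x\<in>D \<inter> U. submersive_at (submanifold S U) complex_line h x)"

text \<open>\<open>s\<close> is meromorphic and not identically zero near the point \<open>x\<close> of the projective line,
  with order \<open>k\<close> (negative at poles).\<close>

definition has_order_at :: "((complex ^ 2) set \<Rightarrow> complex) \<Rightarrow> (complex ^ 2) set \<Rightarrow> int \<Rightarrow> bool" where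
  "has_order_at s x k \<longleftrightarrow> (\<forall>(V, \<phi>)\<in>atlas P1. x \<in> V \<longrightarrow>
     (\<lambda>w. s (inv_into V \<phi> (vec w))) meromorphic_on {\<phi> x $ 1} \<and>
     (\<forall>\<^sub>F w in at (\<phi> x $ 1). s (inv_into V \<phi> (vec w)) \<noteq> 0) \<and>
     zorder (\<lambda>w. s (inv_into V \<phi> (vec w))) (\<phi> x $ 1) = k)"

text \<open>
  The intersection number \<open>C \<cdot> D\<close> of the embedded rational curve \<open>C = f(P1)\<close> and the smooth
  curve \<open>D\<close>, which may coincide with \<open>C\<close>: the degree of the restriction to \<open>C\<close> of the line bundle
  \<open>O(D)\<close>. That bundle has transition functions \<open>g = h' / h\<close> for local equations \<open>h\<close>, \<open>h'\<close> of \<open>D\<close>,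
  and its degree is the total order \<open>n\<close> of a nonzero meromorphic section. The section is given by
  a set \<open>\<Sigma>\<close> of triples \<open>(U, h, s)\<close> where \<open>s\<close> is the section pulled back to the projective line, in
  the trivialization of \<open>O(D)\<close> on \<open>U\<close> belonging to \<open>h\<close>. The relation \<open>s' = g s\<close> is imposed at poles
  as well, where the (irrelevant) values of \<open>s\<close> can be taken to be \<open>0\<close>.
\<close>

definition has_intersection_number ::
  "('p, 2) cmanifold \<Rightarrow> ((complex ^ 2) set \<Rightarrow> 'p) \<Rightarrow> 'p set \<Rightarrow> int \<Rightarrow> bool" where
  "has_intersection_number S f D n \<longleftrightarrow> (\<exists>\<Sigma> k.
     (\<forall>(U, h, s)\<in>\<Sigma>. local_equation S D U h) \<and>
     f ` points P1 \<subseteq> (\<Union>(U, h, s)\<in>\<Sigma>. U) \<and>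
     (\<forall>(U, h, s)\<in>\<Sigma>. \<forall>x\<in>points P1. f x \<in> U \<longrightarrow> has_order_at s x (k x)) \<and>
     (\<forall>(U, h, s)\<in>\<Sigma>. \<forall>(U', h', s')\<in>\<Sigma>. \<exists>g.
        holomorphic_map (submanifold S (U \<inter> U')) complex_line g \<and>
        (\<forall>q\<in>U \<inter> U'. g q \<noteq> 0 \<and> h' q = g q * h q) \<and>
        (\<forall>x\<in>points P1. f x \<in> U \<inter> U' \<longrightarrow> s' x = g (f x) * s x)) \<and>
     finite {x \<in> points P1. k x \<noteq> 0} \<and>
     n = (\<Sum>x\<in>{x \<in> points P1. k x \<noteq> 0}. k x))"


section \<open>Rational surfaces of given type\<close>

text \<open>
  A simply laced diagram \<open>(N, E)\<close> consists of its nodes and its edges (two-element sets of nodes).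
  The diagram \<open>E\<^sub>6\<^sup>(\<^sup>1\<^sup>)\<close>: three arms of length two attached to the node \<open>0\<close>.
\<close>

type_synonym diagram = "nat set \<times> nat set set"

definition affine_E6 :: diagram where
  "affine_E6 = ({0..6}, {{0, 1}, {1, 2}, {0, 3}, {3, 4}, {0, 5}, {5, 6}})"

text \<open>
  \<open>X\<close> is the given surface and \<open>e\<close> the inclusion of the \<open>(x, y)\<close>-plane into it; \<open>\<iota>\<close> embeds \<open>X\<close> as an
  open subset of \<open>S\<close> in such a way that \<open>\<rho> \<circ> \<iota> \<circ> e\<close> is the standard inclusion of the affine plane
  into the projective plane. The \<open>f v\<close> parametrize the boundary curves; an edge of the dual
  intersection graph means intersection number 1, no edge means 0. The type of the points of \<open>S\<close>
  is no restriction: it is large enough for an isomorphic copy of any complex surface.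
\<close>

definition has_surface_of_type ::
  "diagram \<Rightarrow> ('q, 2) cmanifold \<Rightarrow> (complex ^ 2 \<Rightarrow> 'q) \<Rightarrow> bool" where
  "has_surface_of_type R X e \<longleftrightarrow>
     (\<exists>(S :: ((nat \<times> (complex ^ 2)) set, 2) cmanifold) \<rho> \<iota> f.
        iterated_blowup_P2 S \<rho> \<and>
        openin (mtop S) (\<iota> ` points X) \<and>
        biholomorphic X (submanifold S (\<iota> ` points X)) \<iota> \<and>
        (\<forall>z. \<rho> (\<iota> (e z)) = line_through (vector [1, z $ 1, z $ 2])) \<and>
        (\<forall>v\<in>fst R. embedded_P1 S (f v)) \<and>
        inj_on (\<lambda>v. f v ` points P1) (fst R) \<and>
        points S - \<iota> ` points X = (\<Union>v\<in>fst R. f v ` points P1) \<and>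
        (\<forall>v\<in>fst R. \<forall>w\<in>fst R. has_intersection_number S (f v) (f w ` points P1)
           (if v = w then -2 else if {v, w} \<in> snd R then 1 else 0)))"


section \<open>Birational maps of the affine plane\<close>

text \<open>A polynomial in two variables is a polynomial in \<open>z $ 2\<close> with coefficients polynomial in
  \<open>z $ 1\<close>.\<close>

definition peval :: "complex poly poly \<Rightarrow> complex ^ 2 \<Rightarrow> complex" where
  "peval P z = poly (poly P [:z $ 2:]) (z $ 1)"

text \<open>
  Rational maps are represented by total functions, considered up to equality on a nonempty
  Zariski open set. In particular, their values at points of indeterminacy (where the division
  of HOL yields 0) are irrelevant.
\<close>

definition generically :: "(complex ^ 2 \<Rightarrow> bool) \<Rightarrow> bool" where
  "generically \<Phi> \<longleftrightarrow> (\<exists>D. D \<noteq> 0 \<and> (\<forall>z. peval D z \<noteq> 0 \<longrightarrow> \<Phi> z))"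

definition rational_map :: "(complex ^ 2 \<Rightarrow> complex ^ 2) \<Rightarrow> bool" where
  "rational_map F \<longleftrightarrow>
     (\<forall>i. \<exists>P Q. Q \<noteq> 0 \<and> generically (\<lambda>z. F z $ i = peval P z / peval Q z))"

definition birational_map :: "(complex ^ 2 \<Rightarrow> complex ^ 2) \<Rightarrow> bool" where
  "birational_map F \<longleftrightarrow> rational_map F \<and>
     (\<exists>G. rational_map G \<and> generically (\<lambda>z. G (F z) = z) \<and> generically (\<lambda>z. F (G z) = z))"

text \<open>The rational map \<open>F\<close> is regular at \<open>p\<close> and has the value \<open>q\<close> there.\<close>

definition regular_value :: "(complex ^ 2 \<Rightarrow> complex ^ 2) \<Rightarrow> complex ^ 2 \<Rightarrow> complex ^ 2 \<Rightarrow> bool" where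
  "regular_value F p q \<longleftrightarrow>
     (\<forall>i. \<exists>P Q. peval Q p \<noteq> 0 \<and> generically (\<lambda>z. F z $ i = peval P z / peval Q z) \<and>
        q $ i = peval P p / peval Q p)"

text \<open>The pullback of \<open>dx \<and> dy\<close> under \<open>F\<close> is \<open>dx \<and> dy\<close>.\<close>

definition symplectic_map :: "(complex ^ 2 \<Rightarrow> complex ^ 2) \<Rightarrow> bool" where
  "symplectic_map F \<longleftrightarrow> generically (\<lambda>z. \<exists>L. (F has_derivative L) (at z) \<and> complex_linear L \<and>
     (\<forall>u v. L u $ 1 * L v $ 2 - L v $ 1 * L u $ 2 = u $ 1 * v $ 2 - v $ 1 * u $ 2))"


section \<open>Gluing and phase spaces\<close>

text \<open>
  Throughout, \<open>T j t\<close> is the birational map \<open>(x, y) \<mapsto> (x\<^sub>j, y\<^sub>j)\<close> at time \<open>t\<close>, for \<open>j < n\<close>. A point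
  \<open>(j, p, t)\<close> is the point with coordinates \<open>p\<close> of the \<open>j\<close>-th chart. It is identified with
  \<open>(k, q, t)\<close> iff the coordinate change \<open>g = T k t \<circ> (T j t)\<inverse>\<close> is biregular at \<open>p\<close>, i.e.\ both \<open>g\<close> is
  regular at \<open>p\<close> and its inverse \<open>h\<close> is regular at the image, and takes \<open>p\<close> to \<open>q\<close>.
\<close>

type_synonym chart_maps = "nat \<Rightarrow> complex \<Rightarrow> complex ^ 2 \<Rightarrow> complex ^ 2"

type_synonym chart_point = "nat \<times> (complex ^ 2) \<times> complex"

definition glue :: "nat \<Rightarrow> chart_maps \<Rightarrow> (chart_point \<times> chart_point) set" where
  "glue n T = {((j, p, t), (k, q, t')). j < n \<and> k < n \<and> t' = t \<and>
     (\<exists>g h. generically (\<lambda>z. g (T j t z) = T k t z) \<and> generically (\<lambda>z. h (T k t z) = T j t z) \<and>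
        regular_value g p q \<and> regular_value h q p)}"

definition glued_point :: "nat \<Rightarrow> chart_maps \<Rightarrow> nat \<Rightarrow> complex ^ 2 \<Rightarrow> complex \<Rightarrow> chart_point set" where
  "glued_point n T j p t = glue n T `` {(j, p, t)}"

text \<open>The total space, with coordinates \<open>(x\<^sub>j, y\<^sub>j, t)\<close> on the image of the \<open>j\<close>-th copy.\<close>

definition glued_space :: "nat \<Rightarrow> chart_maps \<Rightarrow> (chart_point set, 3) cmanifold" where
  "glued_space n T =
     \<lparr>points = {glued_point n T j p t |j p t. j < n},
      atlas = {({glued_point n T j p t |p t. True},
                \<lambda>P. THE v. (j, vector [v $ 1, v $ 2], v $ 3) \<in> P) |j. j < n}\<rparr>"

definition time_of :: "chart_point set \<Rightarrow> complex" where
  "time_of P = (THE t. \<exists>j p. (j, p, t) \<in> P)"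

definition glued_fibre :: "nat \<Rightarrow> chart_maps \<Rightarrow> complex \<Rightarrow> (chart_point set, 2) cmanifold" where
  "glued_fibre n T t =
     \<lparr>points = {P \<in> points (glued_space n T). time_of P = t},
      atlas = {({glued_point n T j p t |p. True}, \<lambda>P. THE p. (j, p, t) \<in> P) |j. j < n}\<rparr>"

definition poly_in_xy :: "(complex \<Rightarrow> complex ^ 2 \<Rightarrow> complex) \<Rightarrow> bool" where
  "poly_in_xy A \<longleftrightarrow> (\<exists>N a. (\<forall>k l. a k l holomorphic_on UNIV) \<and>
     (\<forall>t z. A t z = (\<Sum>k\<le>N. \<Sum>l\<le>N. a k l t * z $ 1 ^ k * z $ 2 ^ l)))"

text \<open>
  A system is given by its right-hand side \<open>V t z\<close>. Rewriting it with the time dependent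
  substitution \<open>F\<close> yields the right-hand side \<open>A\<close> iff \<open>c' = V\<close> at time \<open>t\<close> implies
  \<open>(F c)' = A\<close> at time \<open>t\<close> for every curve \<open>c\<close> passing through a generic point \<open>z\<close>.
\<close>

definition rewritten_system ::
  "(complex \<Rightarrow> complex ^ 2 \<Rightarrow> complex ^ 2) \<Rightarrow> (complex \<Rightarrow> complex ^ 2 \<Rightarrow> complex ^ 2) \<Rightarrow>
   (2 \<Rightarrow> complex \<Rightarrow> complex ^ 2 \<Rightarrow> complex) \<Rightarrow> bool" where
  "rewritten_system V F A \<longleftrightarrow> (\<forall>t. generically (\<lambda>z. \<forall>c.
     c t = z \<longrightarrow> (\<forall>i. ((\<lambda>s. c s $ i) has_field_derivative V t z $ i) (at t)) \<longrightarrow>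
     (\<forall>i. ((\<lambda>s. F s (c s) $ i) has_field_derivative A i t (F t z)) (at t))))"

definition meromorphic_solution_near ::
  "(complex \<Rightarrow> complex ^ 2 \<Rightarrow> complex ^ 2) \<Rightarrow> complex \<Rightarrow> (complex \<Rightarrow> complex ^ 2) \<Rightarrow> bool" where
  "meromorphic_solution_near V t0 c \<longleftrightarrow>
     (\<forall>i. (\<lambda>t. c t $ i) meromorphic_on {t0}) \<and>
     (\<forall>\<^sub>F t in at t0. \<forall>i. ((\<lambda>s. c s $ i) has_field_derivative V t (c t) $ i) (at t))"

text \<open>The chart with number 0 is assumed to be the original \<open>(x, y)\<close>-plane.\<close>

definition is_phase_space ::
  "(complex \<Rightarrow> complex ^ 2 \<Rightarrow> complex ^ 2) \<Rightarrow> nat \<Rightarrow> chart_maps \<Rightarrow> bool" where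
  "is_phase_space V n T \<longleftrightarrow>
     complex_manifold (glued_space n T) \<and>
     holomorphic_map (glued_space n T) complex_line time_of \<and>
     time_of ` points (glued_space n T) = UNIV \<and>
     (\<forall>P\<in>points (glued_space n T). submersive_at (glued_space n T) complex_line time_of P) \<and>
     (\<forall>j<n. \<exists>A. (\<forall>i. poly_in_xy (A i)) \<and> rewritten_system V (T j) A) \<and>
     (\<forall>t0 c. meromorphic_solution_near V t0 c \<longrightarrow>
        (\<exists>r>0. \<exists>\<gamma>. holomorphic_map (submanifold complex_line (ball t0 r)) (glued_space n T) \<gamma> \<and>
           (\<forall>t\<in>ball t0 r - {t0}. \<gamma> t = glued_point n T 0 (c t) t)))"


section \<open>The system and its charts\<close>

definition system_rhs ::
  "complex \<Rightarrow> complex \<Rightarrow> complex \<Rightarrow> complex \<Rightarrow> complex ^ 2 \<Rightarrow> complex ^ 2" where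
  "system_rhs \<alpha> \<beta> \<gamma> t z = (let x = z $ 1; y = z $ 2 in
     vector [x * y + \<gamma>, 3/2 * x^2 - 1/2 * y^2 + 4 * \<alpha> * x + 2 * \<beta>])"

definition system_charts :: "complex \<Rightarrow> complex \<Rightarrow> complex \<Rightarrow> chart_maps" where
  "system_charts \<alpha> \<beta> \<gamma> j t z = (let x = z $ 1; y = z $ 2 in
     if j = 0 then vector [x, y]
     else if j = 1 then vector [1 / x, - ((y - x - 2*\<alpha>) * x + 2*\<alpha>^2 - 2*\<beta> + \<gamma>) * x]
     else if j = 2 then vector [1 / x, - ((y + x + 2*\<alpha>) * x - 2*\<alpha>^2 + 2*\<beta> + \<gamma>) * x]
     else vector [- (x * y + 2*\<gamma>) * y, 1 / y])"

end

theory Submission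
  imports Defs
begin

no_notation fps_nth (infixl "$" 75)

text \<open>
  The system is Hamiltonian with Hamiltonian function
  \<open>H = x * y\<^sup>2 / 2 + \<gamma> * y - x\<^sup>3 / 2 - 2 * \<alpha> * x\<^sup>2 - 2 * \<beta> * x\<close>, so \<open>H\<close> is constant along solutions. The cubics
  \<open>H = const\<close> meet the line at infinity in the three points \<open>y / x = 1\<close>, \<open>y / x = -1\<close> and
  \<open>x / y = 0\<close>, and at each of them they have contact of order three with one another. Three successive blow-ups
  at each of the three points separate them. The last exceptional curve of each triple, minus the point
  where it meets the preceding one, is what the charts 1, 2 and 3 add to the \<open>(x, y)\<close>-plane. The line at
  infinity, of self-intersection 1 - 3, and the first two exceptional curves of each triple, of
  self-intersection -1 - 1, remain as boundary. A solution with a pole stays on a cubic \<open>H = h\<close>; solving this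
  equation for the second coordinate shows that its limit in one of the charts 1, 2, 3 is finite.
\<close>

section \<open>Holomorphic functions of several variables\<close>

text \<open>Near y / x = 1 a cubic of the pencil is y = x + 2 * \<alpha> - (2 * \<alpha>^2 - 2 *
  \<beta> + \<gamma>) / x + c / x^2 + ..., and only c depends on the member. This is the origin of
  the constants: the three centres over this point are given by the common coefficients, and y_1 is
  - c up to terms that vanish at infinity. The other two points at infinity are treated alike. Two
  things shape the formalization. All points of the surface must live in one prescribed type, sets
  of labelled points of C^2. A point of the projective plane becomes a set with labels 0, 1, 2, an
  exceptional point becomes its line tagged with a fresh label from 3 on, and old points keep their
  identity, so that each blow-up is a plain union of sets of points. Moreover
  \<open>holomorphic_map\<close>, \<open>immersive_at\<close> and \<open>submersive_at\<close> speak
  of all atlas charts, whereas every map here is known by a formula in one convenient chart; the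
  parametrizations \<open>mchart\<close> of the maximal atlas bridge this gap.\<close>

definition cdiff :: "(complex ^ 'n \<Rightarrow> complex) \<Rightarrow> complex ^ 'n \<Rightarrow> bool" where
  "cdiff f z \<longleftrightarrow> (\<exists>L. (f has_derivative L) (at z) \<and> (\<forall>c v. L (c *s v) = c * L v))"

lemma cdiff_const [intro]: "cdiff (\<lambda>_. c) z"
  unfolding cdiff_def by (rule exI[of _ "\<lambda>_. 0"]) auto

lemma cdiff_nth [intro]: "cdiff (\<lambda>z. z $ i) z"
  unfolding cdiff_def
  by (rule exI[of _ "\<lambda>v. v $ i"])
    (auto intro: bounded_linear_imp_has_derivative bounded_linear_vec_nth)

lemma cdiff_add [intro]:
  assumes "cdiff f z" "cdiff g z" shows "cdiff (\<lambda>z. f z + g z) z"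
proof -
  obtain L K where "(f has_derivative L) (at z)" "\<forall>c v. L (c *s v) = c * L v"
    "(g has_derivative K) (at z)" "\<forall>c v. K (c *s v) = c * K v"
    using assms unfolding cdiff_def by blast
  then show ?thesis unfolding cdiff_def
    by (intro exI[of _ "\<lambda>v. L v + K v"]) (auto intro: has_derivative_add simp: distrib_left)
qed

lemma cdiff_mult [intro]:
  assumes "cdiff f z" "cdiff g z" shows "cdiff (\<lambda>z. f z * g z) z"
proof -
  obtain L K where "(f has_derivative L) (at z)" "\<forall>c v. L (c *s v) = c * L v"
    "(g has_derivative K) (at z)" "\<forall>c v. K (c *s v) = c * K v"
    using assms unfolding cdiff_def by blast
  then show ?thesis unfolding cdiff_def
    by (intro exI[of _ "\<lambda>v. f z * K v + L v * g z"])
      (auto intro: has_derivative_mult simp: distrib_left mult.left_commute mult.assoc)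
qed

text \<open>The chain rule with a function of one variable outside. Negation, powers, reciprocals
  and one-variable polynomials all go through it, so that derivatives in several variables are
  computed by hand only for constants, coordinates, sums and products.\<close>

lemma cdiff_comp_field:
  assumes "cdiff f z" "(g has_field_derivative d) (at (f z))" shows "cdiff (\<lambda>z. g (f z)) z"
proof -
  obtain L where L: "(f has_derivative L) (at z)" "\<forall>c v. L (c *s v) = c * L v"
    using assms unfolding cdiff_def by blast
  have "((\<lambda>z. g (f z)) has_derivative (\<lambda>v. d * L v)) (at z)"
    using has_derivative_compose[OF L(1), of g "\<lambda>v. d * v"] assms(2)
    by (simp add: has_field_derivative_def)
  then show ?thesis unfolding cdiff_def using L(2)
    by (intro exI[of _ "\<lambda>v. d * L v"]) (auto simp: algebra_simps)
qed

lemma cdiff_uminus [intro]: "cdiff f z \<Longrightarrow> cdiff (\<lambda>z. - f z) z"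
  by (rule cdiff_comp_field[of f z uminus "-1"]) (auto intro!: derivative_eq_intros)

lemma cdiff_diff [intro]:
  assumes "cdiff f z" "cdiff g z" shows "cdiff (\<lambda>z. f z - g z) z"
  using cdiff_add[OF assms(1) cdiff_uminus[OF assms(2)]] by simp

lemma cdiff_power [intro]: "cdiff f z \<Longrightarrow> cdiff (\<lambda>z. f z ^ n) z"
  by (rule cdiff_comp_field[of f z "\<lambda>w. w ^ n" "of_nat n * f z ^ (n - 1)"])
    (auto intro!: derivative_eq_intros)

lemma cdiff_divide [intro]:
  assumes "cdiff f z" "cdiff g z" "g z \<noteq> 0" shows "cdiff (\<lambda>z. f z / g z) z"
proof -
  have "cdiff (\<lambda>z. inverse (g z)) z"
    using assms by (intro cdiff_comp_field[of g z inverse]) (auto intro!: derivative_eq_intros)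
  from cdiff_mult[OF assms(1) this] show ?thesis by (simp add: divide_inverse)
qed

lemma cdiff_cong_open:
  assumes "cdiff f z" "open W" "z \<in> W" "\<And>w. w \<in> W \<Longrightarrow> f w = g w" shows "cdiff g z"
  using assms has_derivative_transform_within_open[of f _ z UNIV W g]
  unfolding cdiff_def by blast

text \<open>A vector is the sum of its entries placed on the axes, and each \<open>axis i\<close> is
  bounded linear, so the coordinate derivatives add up to the derivative of the whole map.\<close>

lemma has_derivative_vec_nth:
  fixes F :: "'a::real_normed_vector \<Rightarrow> complex ^ 'm"
  assumes "\<And>i. ((\<lambda>w. F w $ i) has_derivative (\<lambda>v. L v $ i)) (at z)"
  shows "(F has_derivative L) (at z)"
proof -
  have "((\<lambda>w. \<Sum>i\<in>UNIV. axis i (F w $ i)) has_derivative (\<lambda>v. \<Sum>i\<in>UNIV. axis i (L v $ i))) (at z)"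
  proof (rule has_derivative_sum)
    fix i :: 'm
    have "bounded_linear (axis i :: complex \<Rightarrow> complex ^ 'm)"
      unfolding linear_conv_bounded_linear[symmetric]
      by (rule linearI) (auto simp: axis_def vec_eq_iff)
    from bounded_linear.has_derivative[OF this assms[of i]]
    show "((\<lambda>w. axis i (F w $ i)) has_derivative (\<lambda>v. axis i (L v $ i))) (at z)" .
  qed
  moreover have "(\<Sum>i\<in>UNIV. axis i (v $ i)) = v" for v :: "complex ^ 'm"
    by (simp add: vec_eq_iff axis_def sum.delta)
  ultimately show ?thesis by simp
qed

text \<open>Splitting into coordinates turns every later proof of holomorphy into applications of
  the scalar rules for \<open>cdiff\<close>. The coordinate derivatives assemble to a complex linear
  map because each of them is complex linear.\<close>

lemma holo_on_iff: "holo_on W F \<longleftrightarrow> (\<forall>z\<in>W. \<forall>i. cdiff (\<lambda>w. F w $ i) z)"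
proof (intro iffI ballI allI)
  fix z i assume "holo_on W F" "z \<in> W"
  then obtain L where L: "(F has_derivative L) (at z)" "complex_linear L"
    unfolding holo_on_def by blast
  have "((\<lambda>w. F w $ i) has_derivative (\<lambda>v. L v $ i)) (at z)"
    by (rule bounded_linear.has_derivative[OF bounded_linear_vec_nth L(1)])
  then show "cdiff (\<lambda>w. F w $ i) z" unfolding cdiff_def using L(2)
    by (intro exI[of _ "\<lambda>v. L v $ i"]) (auto simp: complex_linear_def)
next
  assume *: "\<forall>z\<in>W. \<forall>i. cdiff (\<lambda>w. F w $ i) z"
  show "holo_on W F" unfolding holo_on_def
  proof
    fix z assume "z \<in> W"
    with * obtain L where L: "\<And>i. ((\<lambda>w. F w $ i) has_derivative L i) (at z)"
      "\<And>i c v. L i (c *s v) = c * L i v"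
      unfolding cdiff_def by metis
    have "(F has_derivative (\<lambda>v. \<chi> i. L i v)) (at z)"
      by (rule has_derivative_vec_nth) (simp add: L)
    moreover from this have "complex_linear (\<lambda>v. \<chi> i. L i v)"
      unfolding complex_linear_def
      by (auto simp: has_derivative_linear vec_eq_iff L(2))
    ultimately show "\<exists>L. (F has_derivative L) (at z) \<and> complex_linear L" by blast
  qed
qed

lemma holo_on_subset: "holo_on W F \<Longrightarrow> V \<subseteq> W \<Longrightarrow> holo_on V F"
  unfolding holo_on_def by blast

lemma holo_on_continuous: "holo_on W F \<Longrightarrow> continuous_on W F"
  unfolding holo_on_def
  by (meson continuous_at_imp_continuous_on has_derivative_continuous)

lemma holo_on_preimage:
  assumes "holo_on W F" "open W" "open V" shows "open {z\<in>W. F z \<in> V}"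
  using continuous_open_preimage[OF holo_on_continuous[OF assms(1)] assms(2,3)]
  by (auto simp: vimage_def Int_def)

lemma holo_on_compose:
  assumes "holo_on W F" "holo_on V G" "F ` W \<subseteq> V" shows "holo_on W (G \<circ> F)"
  unfolding holo_on_def
proof
  fix z assume z: "z \<in> W"
  with assms obtain L K where "(F has_derivative L) (at z)" "complex_linear L"
    "(G has_derivative K) (at (F z))" "complex_linear K"
    unfolding holo_on_def by blast
  then show "\<exists>L. (G \<circ> F has_derivative L) (at z) \<and> complex_linear L"
    by (intro exI[of _ "K \<circ> L"]) (auto simp: complex_linear_def intro: diff_chain_at linear_compose)
qed

lemma cdiff_compose:
  assumes "holo_on W F" "z \<in> W" "cdiff g (F z)" shows "cdiff (\<lambda>w. g (F w)) z"
proof -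
  obtain L K where "(F has_derivative L) (at z)" "complex_linear L"
    "(g has_derivative K) (at (F z))" "\<forall>c v. K (c *s v) = c * K v"
    using assms unfolding holo_on_def cdiff_def by blast
  then show ?thesis unfolding cdiff_def
    using has_derivative_compose[of F L z UNIV g K]
    by (intro exI[of _ "\<lambda>v. K (L v)"]) (auto simp: complex_linear_def)
qed

lemma holo_on_cong:
  assumes "holo_on W F" "open W" "\<And>z. z \<in> W \<Longrightarrow> F z = G z" shows "holo_on W G"
  unfolding holo_on_def
proof
  fix z assume z: "z \<in> W"
  with assms(1) obtain L where "(F has_derivative L) (at z)" "complex_linear L"
    unfolding holo_on_def by blast
  with has_derivative_transform_within_open[of F L z UNIV W G] assms z
  show "\<exists>L. (G has_derivative L) (at z) \<and> complex_linear L" by blast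
qed

lemma holo_on_local:
  assumes "\<And>z. z \<in> W \<Longrightarrow> \<exists>V. z \<in> V \<and> holo_on V F" shows "holo_on W F"
  using assms unfolding holo_on_def by blast

lemma holo_on_id: "holo_on W (\<lambda>z. z)" and holo_on_id': "holo_on W id"
  unfolding holo_on_iff by auto

lemma holo_on_vector2:
  "holo_on W (\<lambda>z. vector [f z, g z] :: complex ^ 2) \<longleftrightarrow> (\<forall>z\<in>W. cdiff f z \<and> cdiff g z)"
  unfolding holo_on_iff by (simp add: forall_2)

lemma holo_on_vector3:
  "holo_on W (\<lambda>z. vector [f z, g z, h z] :: complex ^ 3) \<longleftrightarrow>
     (\<forall>z\<in>W. cdiff f z \<and> cdiff g z \<and> cdiff h z)"
  unfolding holo_on_iff by (simp add: forall_3)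

section \<open>Charts of a complex manifold\<close>

lemma complex_manifoldD:
  assumes "complex_manifold M"
  shows "(\<Union>(U, \<phi>)\<in>atlas M. U) = points M"
    and "(U, \<phi>) \<in> atlas M \<Longrightarrow> inj_on \<phi> U"
    and "(U, \<phi>) \<in> atlas M \<Longrightarrow> open (\<phi> ` U)"
    and "(U, \<phi>) \<in> atlas M \<Longrightarrow> (V, \<psi>) \<in> atlas M \<Longrightarrow> open (\<phi> ` (U \<inter> V))"
    and "(U, \<phi>) \<in> atlas M \<Longrightarrow> (V, \<psi>) \<in> atlas M \<Longrightarrow>
           holo_on (\<phi> ` (U \<inter> V)) (\<psi> \<circ> inv_into U \<phi>)"
    and "Hausdorff_space (mtop M)"
    and "second_countable (mtop M)"
    and "(U, \<phi>) \<in> atlas M \<Longrightarrow> U \<subseteq> points M"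
    and "x \<in> points M \<Longrightarrow> \<exists>U \<phi>. (U, \<phi>) \<in> atlas M \<and> x \<in> U"
proof -
  show 1: "(\<Union>(U, \<phi>)\<in>atlas M. U) = points M"
    using assms unfolding complex_manifold_def by blast
  have 2: "\<forall>(U, \<phi>)\<in>atlas M. inj_on \<phi> U \<and> open (\<phi> ` U)"
    using assms unfolding complex_manifold_def by blast
  have 3: "\<forall>(U, \<phi>)\<in>atlas M. \<forall>(V, \<psi>)\<in>atlas M.
      open (\<phi> ` (U \<inter> V)) \<and> holo_on (\<phi> ` (U \<inter> V)) (\<psi> \<circ> inv_into U \<phi>)"
    using assms unfolding complex_manifold_def by blast
  show "inj_on \<phi> U" "open (\<phi> ` U)" if "(U, \<phi>) \<in> atlas M" using bspec[OF 2 that] by auto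
  show "open (\<phi> ` (U \<inter> V))" "holo_on (\<phi> ` (U \<inter> V)) (\<psi> \<circ> inv_into U \<phi>)"
    if "(U, \<phi>) \<in> atlas M" "(V, \<psi>) \<in> atlas M"
    using bspec[OF 3 that(1)] that(2) by auto
  show "Hausdorff_space (mtop M)" "second_countable (mtop M)"
    using assms unfolding complex_manifold_def by blast+
  show "U \<subseteq> points M" if "(U, \<phi>) \<in> atlas M"
    unfolding 1[symmetric] using that by auto
  show "\<exists>U \<phi>. (U, \<phi>) \<in> atlas M \<and> x \<in> U" if "x \<in> points M"
    using that unfolding 1[symmetric] by auto
qed

lemma atlas_at:
  assumes "complex_manifold M" "x \<in> points M"
  obtains U \<phi> where "(U, \<phi>) \<in> atlas M" "x \<in> U"
  using complex_manifoldD(9)[OF assms] by blast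

text \<open>Images under charts commute with intersections because the charts are injective, which
  makes the predicate in \<open>mtop\<close> a topology. Only injectivity is assumed, since the
  lemma is applied while the other manifold axioms are still being verified.\<close>

lemma openin_mtop_inj:
  assumes "\<And>U \<phi>. (U, \<phi>) \<in> atlas M \<Longrightarrow> inj_on \<phi> U"
  shows "openin (mtop M) W \<longleftrightarrow>
           W \<subseteq> points M \<and> (\<forall>(U, \<phi>)\<in>atlas M. open (\<phi> ` (U \<inter> W)))"
proof -
  have "istopology (\<lambda>W. W \<subseteq> points M \<and> (\<forall>(U, \<phi>)\<in>atlas M. open (\<phi> ` (U \<inter> W))))"
    unfolding istopology_def
  proof (intro conjI allI impI)
    fix S T
    assume S: "S \<subseteq> points M \<and> (\<forall>(U, \<phi>)\<in>atlas M. open (\<phi> ` (U \<inter> S)))"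
      and T: "T \<subseteq> points M \<and> (\<forall>(U, \<phi>)\<in>atlas M. open (\<phi> ` (U \<inter> T)))"
    have "open (\<phi> ` (U \<inter> (S \<inter> T)))" if "(U, \<phi>) \<in> atlas M" for U \<phi>
    proof -
      have "\<phi> ` (U \<inter> (S \<inter> T)) = \<phi> ` (U \<inter> S) \<inter> \<phi> ` (U \<inter> T)"
        using assms[OF that] by (auto simp: inj_on_def)
      then show ?thesis using S T that by auto
    qed
    then show "\<forall>(U, \<phi>)\<in>atlas M. open (\<phi> ` (U \<inter> (S \<inter> T)))" by blast
    show "S \<inter> T \<subseteq> points M" using S by blast
  next
    fix K
    assume K: "\<forall>S\<in>K. S \<subseteq> points M \<and> (\<forall>(U, \<phi>)\<in>atlas M. open (\<phi> ` (U \<inter> S)))"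
    then show "\<Union>K \<subseteq> points M" by blast
    have "open (\<phi> ` (U \<inter> \<Union>K))" if "(U, \<phi>) \<in> atlas M" for U \<phi>
    proof -
      have "\<phi> ` (U \<inter> \<Union>K) = (\<Union>S\<in>K. \<phi> ` (U \<inter> S))" by auto
      moreover have "open (\<Union>S\<in>K. \<phi> ` (U \<inter> S))"
        by (rule open_UN) (use K that in blast)
      ultimately show ?thesis by simp
    qed
    then show "\<forall>(U, \<phi>)\<in>atlas M. open (\<phi> ` (U \<inter> \<Union>K))" by blast
  qed
  then show ?thesis unfolding mtop_def by simp
qed

lemma openin_mtop:
  "complex_manifold M \<Longrightarrow> openin (mtop M) W \<longleftrightarrow>
     W \<subseteq> points M \<and> (\<forall>(U, \<phi>)\<in>atlas M. open (\<phi> ` (U \<inter> W)))"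
  by (rule openin_mtop_inj) (rule complex_manifoldD)

lemma topspace_mtop: "complex_manifold M \<Longrightarrow> topspace (mtop M) = points M"
proof -
  assume M: "complex_manifold M"
  have "U \<inter> points M = U" if "(U, \<phi>) \<in> atlas M" for U \<phi>
    using complex_manifoldD(8)[OF M that] by blast
  then have "openin (mtop M) (points M)"
    unfolding openin_mtop[OF M] by (auto intro: complex_manifoldD(3)[OF M])
  then show ?thesis
    by (metis M openin_mtop openin_subset openin_topspace subset_antisym)
qed

text \<open>Charts of the maximal atlas, presented by their inverses, the local parametrizations.\<close>

definition mchart ::
  "('p, 'n::finite) cmanifold \<Rightarrow> (complex ^ 'n) set \<Rightarrow> (complex ^ 'n \<Rightarrow> 'p) \<Rightarrow> bool" where
  "mchart M O' \<sigma> \<longleftrightarrow> open O' \<and> inj_on \<sigma> O' \<and> \<sigma> ` O' \<subseteq> points M \<and>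
     (\<forall>(U, \<phi>)\<in>atlas M. open {z\<in>O'. \<sigma> z \<in> U} \<and> holo_on {z\<in>O'. \<sigma> z \<in> U} (\<phi> \<circ> \<sigma>) \<and>
        open (\<phi> ` (U \<inter> \<sigma> ` O')) \<and> holo_on (\<phi> ` (U \<inter> \<sigma> ` O')) (inv_into O' \<sigma> \<circ> inv_into U \<phi>))"

lemma mchartD:
  assumes "mchart M A \<sigma>"
  shows "open A" "inj_on \<sigma> A" "\<sigma> ` A \<subseteq> points M"
    and "(U, \<phi>) \<in> atlas M \<Longrightarrow> open {z\<in>A. \<sigma> z \<in> U}"
    and "(U, \<phi>) \<in> atlas M \<Longrightarrow> holo_on {z\<in>A. \<sigma> z \<in> U} (\<phi> \<circ> \<sigma>)"
    and "(U, \<phi>) \<in> atlas M \<Longrightarrow> open (\<phi> ` (U \<inter> \<sigma> ` A))"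
    and "(U, \<phi>) \<in> atlas M \<Longrightarrow> holo_on (\<phi> ` (U \<inter> \<sigma> ` A)) (inv_into A \<sigma> \<circ> inv_into U \<phi>)"
  using assms unfolding mchart_def by blast+

lemma mchart_atlas:
  assumes M: "complex_manifold M" and a: "(U, \<phi>) \<in> atlas M"
  shows "mchart M (\<phi> ` U) (inv_into U \<phi>)"
  unfolding mchart_def
proof (intro conjI ballI, safe)
  note inj = complex_manifoldD(2)[OF M a]
  show "open (\<phi> ` U)" using complex_manifoldD(3)[OF M a] .
  show "inj_on (inv_into U \<phi>) (\<phi> ` U)" by (rule inj_on_inv_into) simp
  show "inv_into U \<phi> (\<phi> x) \<in> points M" if "x \<in> U" for x
    using inj that complex_manifoldD(8)[OF M a] by auto
  fix V \<psi> assume b: "(V, \<psi>) \<in> atlas M"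
  have 1: "{z \<in> \<phi> ` U. inv_into U \<phi> z \<in> V} = \<phi> ` (U \<inter> V)"
    using inj by (auto simp: inv_into_f_f)
  have 2: "inv_into U \<phi> ` \<phi> ` U = U" using inj by force
  show "open {z \<in> \<phi> ` U. inv_into U \<phi> z \<in> V}"
    unfolding 1 by (rule complex_manifoldD(4)[OF M a b])
  show "holo_on {z \<in> \<phi> ` U. inv_into U \<phi> z \<in> V} (\<psi> \<circ> inv_into U \<phi>)"
    unfolding 1 by (rule complex_manifoldD(5)[OF M a b])
  show "open (\<psi> ` (V \<inter> inv_into U \<phi> ` \<phi> ` U))"
    unfolding 2 by (rule complex_manifoldD(4)[OF M b a])
  show "holo_on (\<psi> ` (V \<inter> inv_into U \<phi> ` \<phi> ` U)) (inv_into (\<phi> ` U) (inv_into U \<phi>) \<circ> inv_into V \<psi>)"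
    unfolding 2
  proof (rule holo_on_cong[OF complex_manifoldD(5)[OF M b a] complex_manifoldD(4)[OF M b a]])
    fix z assume "z \<in> \<psi> ` (V \<inter> U)"
    then obtain x where x: "x \<in> V" "x \<in> U" "z = \<psi> x" by blast
    have "inv_into V \<psi> z = x" using complex_manifoldD(2)[OF M b] x by simp
    moreover have "inv_into (\<phi> ` U) (inv_into U \<phi>) x = \<phi> x"
      using inj x by (metis inj_on_inv_into inv_into_f_f order_refl imageI)
    ultimately show "(\<phi> \<circ> inv_into V \<psi>) z = (inv_into (\<phi> ` U) (inv_into U \<phi>) \<circ> inv_into V \<psi>) z"
      by simp
  qed
qed

lemma mchart_at:
  assumes M: "complex_manifold M" and "x \<in> points M"
  obtains A \<sigma> z where "mchart M A \<sigma>" "z \<in> A" "\<sigma> z = x"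
proof -
  obtain U \<phi> where a: "(U, \<phi>) \<in> atlas M" "x \<in> U"
    using complex_manifoldD(9)[OF M assms(2)] by blast
  show ?thesis
    by (rule that[OF mchart_atlas[OF M a(1)], of "\<phi> x"])
      (use a complex_manifoldD(2)[OF M a(1)] in auto)
qed

text \<open>Near a common point both parametrizations are read in one atlas chart, and the
  transition is a composite of two holomorphic maps through it. Openness and holomorphy are local,
  so these pieces suffice.\<close>

lemma mchart_trans:
  assumes M: "complex_manifold M" and s: "mchart M A \<sigma>" and t: "mchart M B \<tau>"
  shows "open {z\<in>A. \<sigma> z \<in> \<tau> ` B}" and "holo_on {z\<in>A. \<sigma> z \<in> \<tau> ` B} (inv_into B \<tau> \<circ> \<sigma>)"
proof -
  have *: "\<exists>W. open W \<and> z \<in> W \<and> W \<subseteq> {z\<in>A. \<sigma> z \<in> \<tau> ` B} \<and> holo_on W (inv_into B \<tau> \<circ> \<sigma>)"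
    if z: "z \<in> A" "\<sigma> z \<in> \<tau> ` B" for z
  proof -
    obtain U \<phi> where a: "(U, \<phi>) \<in> atlas M" "\<sigma> z \<in> U"
      by (rule atlas_at[OF M, of "\<sigma> z"]) (use mchartD(3)[OF s] z in auto)
    note inj = complex_manifoldD(2)[OF M a(1)]
    define W where "W = {w \<in> {w\<in>A. \<sigma> w \<in> U}. (\<phi> \<circ> \<sigma>) w \<in> \<phi> ` (U \<inter> \<tau> ` B)}"
    have oW: "open W" unfolding W_def
      by (rule holo_on_preimage[OF mchartD(5,4)[OF s a(1)] mchartD(6)[OF t a(1)]])
    have W: "\<sigma> w \<in> U \<and> \<sigma> w \<in> \<tau> ` B \<and> w \<in> A" if "w \<in> W" for w
      using that inj unfolding W_def by (auto simp: inj_on_def)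
    have "holo_on W ((inv_into B \<tau> \<circ> inv_into U \<phi>) \<circ> (\<phi> \<circ> \<sigma>))"
      by (rule holo_on_compose[OF holo_on_subset[OF mchartD(5)[OF s a(1)]] mchartD(7)[OF t a(1)]])
        (use W in \<open>auto\<close>)
    then have "holo_on W (inv_into B \<tau> \<circ> \<sigma>)"
      by (rule holo_on_cong[OF _ oW]) (use W inj in auto)
    moreover have "z \<in> W" using z a unfolding W_def by auto
    ultimately show ?thesis using W oW by blast
  qed
  show "open {z\<in>A. \<sigma> z \<in> \<tau> ` B}" by (subst open_subopen) (use * in blast)
  show "holo_on {z\<in>A. \<sigma> z \<in> \<tau> ` B} (inv_into B \<tau> \<circ> \<sigma>)"
    by (rule holo_on_local) (use * in blast)
qed

lemma mchart_openin:
  assumes M: "complex_manifold M" and s: "mchart M A \<sigma>" and W: "open W" "W \<subseteq> A"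
  shows "openin (mtop M) (\<sigma> ` W)"
  unfolding openin_mtop[OF M]
proof (intro conjI ballI, safe)
  show "\<sigma> x \<in> points M" if "x \<in> W" for x using that mchartD(3)[OF s] W by blast
  fix U \<phi> assume a: "(U, \<phi>) \<in> atlas M"
  note inj = complex_manifoldD(2)[OF M a]
  have "\<phi> ` (U \<inter> \<sigma> ` W) = {v \<in> \<phi> ` (U \<inter> \<sigma> ` A). (inv_into A \<sigma> \<circ> inv_into U \<phi>) v \<in> W}"
  proof safe
    fix w assume "\<sigma> w \<in> U" "w \<in> W"
    moreover from this have "inv_into A \<sigma> (\<sigma> w) = w" using mchartD(2)[OF s] W by auto
    ultimately show "\<phi> (\<sigma> w) \<in> \<phi> ` (U \<inter> \<sigma> ` A)" "(inv_into A \<sigma> \<circ> inv_into U \<phi>) (\<phi> (\<sigma> w)) \<in> W"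
      using W inj by auto
  next
    fix w assume "\<sigma> w \<in> U" "w \<in> A" "(inv_into A \<sigma> \<circ> inv_into U \<phi>) (\<phi> (\<sigma> w)) \<in> W"
    moreover from this have "inv_into A \<sigma> (\<sigma> w) = w" using mchartD(2)[OF s] by auto
    ultimately show "\<phi> (\<sigma> w) \<in> \<phi> ` (U \<inter> \<sigma> ` W)" using inj by auto
  qed
  also have "open \<dots>" by (rule holo_on_preimage[OF mchartD(7,6)[OF s a] W(1)])
  finally show "open (\<phi> ` (U \<inter> \<sigma> ` W))" .
qed

lemma mchart_preimage_open:
  assumes M: "complex_manifold M" and s: "mchart M A \<sigma>" and W: "openin (mtop M) W"
  shows "open {z\<in>A. \<sigma> z \<in> W}"
proof (subst open_subopen, safe)
  fix z assume z: "z \<in> A" "\<sigma> z \<in> W"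
  obtain U \<phi> where a: "(U, \<phi>) \<in> atlas M" "\<sigma> z \<in> U"
    by (rule atlas_at[OF M, of "\<sigma> z"]) (use mchartD(3)[OF s] z in auto)
  note inj = complex_manifoldD(2)[OF M a(1)]
  have o: "open (\<phi> ` (U \<inter> W))" using W a unfolding openin_mtop[OF M] by blast
  define V where "V = {w \<in> {w\<in>A. \<sigma> w \<in> U}. (\<phi> \<circ> \<sigma>) w \<in> \<phi> ` (U \<inter> W)}"
  have "open V" unfolding V_def
    by (rule holo_on_preimage[OF mchartD(5,4)[OF s a(1)] o])
  moreover have "z \<in> V" using z a unfolding V_def by auto
  moreover have "V \<subseteq> {z \<in> A. \<sigma> z \<in> W}" unfolding V_def using inj by (auto simp: inj_on_def)
  ultimately show "\<exists>T. open T \<and> z \<in> T \<and> T \<subseteq> {z \<in> A. \<sigma> z \<in> W}" by blast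
qed

lemma openin_mtopI:
  assumes M: "complex_manifold M"
    and "\<And>x. x \<in> W \<Longrightarrow> \<exists>A \<sigma>. mchart M A \<sigma> \<and> x \<in> \<sigma> ` A \<and> \<sigma> ` A \<subseteq> W"
  shows "openin (mtop M) W"
proof (subst openin_subopen, safe)
  fix x assume "x \<in> W"
  with assms(2) obtain A \<sigma> where "mchart M A \<sigma>" "x \<in> \<sigma> ` A" "\<sigma> ` A \<subseteq> W" by blast
  moreover from this have "openin (mtop M) (\<sigma> ` A)"
    by (intro mchart_openin[OF M]) (auto dest: mchartD(1))
  ultimately show "\<exists>T. openin (mtop M) T \<and> x \<in> T \<and> T \<subseteq> W" by blast
qed

text \<open>Reparametrization of a chart. The caller supplies the holomorphic inverse
  \<open>\<kappa>\<close> and the openness of the image of \<open>\<tau>\<close>; both are explicit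
  for the restrictions, shears, sign changes and blow-downs to which this is applied.\<close>

lemma mchart_compose:
  assumes M: "complex_manifold M" and s: "mchart M A \<sigma>" and "open P" "holo_on P \<tau>" "open (\<tau> ` P)" "\<tau> ` P \<subseteq> A"
    and "holo_on (\<tau> ` P) \<kappa>" and k: "\<And>z. z \<in> P \<Longrightarrow> \<kappa> (\<tau> z) = z"
  shows "mchart M P (\<sigma> \<circ> \<tau>)"
  unfolding mchart_def
proof (intro conjI ballI)
  have injt: "inj_on \<tau> P" using k by (metis inj_onI)
  then show inj: "inj_on (\<sigma> \<circ> \<tau>) P"
    using comp_inj_on[OF injt inj_on_subset[OF mchartD(2)[OF s] assms(6)]] by blast
  show "open P" by fact
  show "(\<sigma> \<circ> \<tau>) ` P \<subseteq> points M" using mchartD(3)[OF s] assms(6) by auto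
  fix a assume a: "a \<in> atlas M"
  obtain U \<phi> where U: "a = (U, \<phi>)" by force
  then have a: "(U, \<phi>) \<in> atlas M" using a by simp
  have eq: "{z\<in>P. (\<sigma> \<circ> \<tau>) z \<in> U} = {z\<in>P. \<tau> z \<in> {z\<in>A. \<sigma> z \<in> U}}" using assms(6) by auto
  have 1: "open {z\<in>P. (\<sigma> \<circ> \<tau>) z \<in> U}"
    unfolding eq by (rule holo_on_preimage[OF assms(4,3) mchartD(4)[OF s a]])
  have "holo_on {z\<in>P. (\<sigma> \<circ> \<tau>) z \<in> U} ((\<phi> \<circ> \<sigma>) \<circ> \<tau>)"
    unfolding eq
    by (rule holo_on_compose[OF holo_on_subset[OF assms(4)] mchartD(5)[OF s a]]) auto
  then have 2: "holo_on {z\<in>P. (\<sigma> \<circ> \<tau>) z \<in> U} (\<phi> \<circ> (\<sigma> \<circ> \<tau>))" by (simp add: comp_assoc)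
  have that: "inj_on \<phi> U" by (rule complex_manifoldD(2)[OF M a])
  define V where "V = {v \<in> \<phi> ` (U \<inter> \<sigma> ` A). (inv_into A \<sigma> \<circ> inv_into U \<phi>) v \<in> \<tau> ` P}"
  have oV: "open V" unfolding V_def
    by (rule holo_on_preimage[OF mchartD(7,6)[OF s a] assms(5)])
  have Veq: "V = \<phi> ` (U \<inter> (\<sigma> \<circ> \<tau>) ` P)"
  proof safe
    fix v assume "v \<in> V"
    then obtain w z where "v = \<phi> (\<sigma> w)" "\<sigma> w \<in> U" "w \<in> A" "inv_into A \<sigma> (inv_into U \<phi> v) = \<tau> z" "z \<in> P"
      unfolding V_def by auto
    moreover from this have "w = \<tau> z" using that mchartD(2)[OF s] by auto
    ultimately show "v \<in> \<phi> ` (U \<inter> (\<sigma> \<circ> \<tau>) ` P)" by auto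
  next
    fix z assume "(\<sigma> \<circ> \<tau>) z \<in> U" "z \<in> P"
    then show "\<phi> ((\<sigma> \<circ> \<tau>) z) \<in> V" unfolding V_def using that mchartD(2)[OF s] assms(6)
      by (auto simp: subset_iff)
  qed
  have "holo_on V (\<kappa> \<circ> (inv_into A \<sigma> \<circ> inv_into U \<phi>))"
    by (rule holo_on_compose[OF holo_on_subset[OF mchartD(7)[OF s a]] assms(7)])
      (auto simp: V_def)
  then have 3: "holo_on V (inv_into P (\<sigma> \<circ> \<tau>) \<circ> inv_into U \<phi>)"
  proof (rule holo_on_cong[OF _ oV])
    fix v assume "v \<in> V"
    then obtain z where z: "z \<in> P" "\<sigma> (\<tau> z) \<in> U" "v = \<phi> (\<sigma> (\<tau> z))" unfolding Veq by auto
    have 1: "inv_into U \<phi> v = \<sigma> (\<tau> z)" using that z by simp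
    have 2: "inv_into A \<sigma> (\<sigma> (\<tau> z)) = \<tau> z" using mchartD(2)[OF s] assms(6) z by auto
    have 3: "inv_into P (\<sigma> \<circ> \<tau>) (\<sigma> (\<tau> z)) = z" using inv_into_f_f[OF inj z(1)] by simp
    show "(\<kappa> \<circ> (inv_into A \<sigma> \<circ> inv_into U \<phi>)) v = (inv_into P (\<sigma> \<circ> \<tau>) \<circ> inv_into U \<phi>) v"
      by (simp only: o_apply 1 2 3 k[OF z(1)])
  qed
  show "case a of (U, \<phi>) \<Rightarrow> open {z\<in>P. (\<sigma> \<circ> \<tau>) z \<in> U} \<and> holo_on {z\<in>P. (\<sigma> \<circ> \<tau>) z \<in> U} (\<phi> \<circ> (\<sigma> \<circ> \<tau>)) \<and>
        open (\<phi> ` (U \<inter> (\<sigma> \<circ> \<tau>) ` P)) \<and>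
        holo_on (\<phi> ` (U \<inter> (\<sigma> \<circ> \<tau>) ` P)) (inv_into P (\<sigma> \<circ> \<tau>) \<circ> inv_into U \<phi>)"
    using 1 2 3 oV Veq U by simp
qed

lemma mchart_restrict:
  assumes M: "complex_manifold M" and s: "mchart M A \<sigma>" and "open W" "W \<subseteq> A"
  shows "mchart M W \<sigma>"
  using mchart_compose[OF M s assms(3), of "\<lambda>z. z" "\<lambda>z. z"] assms(3,4)
  by (simp add: holo_on_id o_def)

text \<open>Allows the composite parametrizations produced by iterated blow-ups to be replaced by
  the closed formulas of the towers.\<close>

lemma mchart_cong:
  assumes s: "mchart M A \<sigma>" and eq: "\<And>z. z \<in> A \<Longrightarrow> \<sigma> z = \<tau> z"
  shows "mchart M A \<tau>"
proof -
  have 1: "inv_into A \<sigma> = inv_into A \<tau>"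
    unfolding inv_into_def fun_eq_iff using eq by (auto intro!: arg_cong[where f=Eps])
  have 2: "\<sigma> ` A = \<tau> ` A" using eq by auto
  have 3: "{z\<in>A. \<sigma> z \<in> U} = {z\<in>A. \<tau> z \<in> U}" for U using eq by auto
  have 4: "inj_on \<tau> A" using mchartD(2)[OF s] eq by (auto simp: inj_on_def)
  have 5: "holo_on {z\<in>A. \<tau> z \<in> U} (\<phi> \<circ> \<tau>)" if "(U, \<phi>) \<in> atlas M" for U \<phi>
    using mchartD(5)[OF s that] unfolding 3
    by (rule holo_on_cong) (use mchartD(4)[OF s that] eq in \<open>auto simp: 3\<close>)
  show ?thesis unfolding mchart_def
    using mchartD[OF s] 4 5 unfolding 1 2 3 by auto
qed

section \<open>Holomorphic maps in charts\<close>

text \<open>Holomorphy at a point through a single, conveniently chosen pair of charts of the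
  maximal atlases with a formula \<open>F\<close> between them, instead of through all pairs of
  atlas charts as in \<open>holomorphic_map\<close>.\<close>

definition hol_at ::
  "('p, 'n::finite) cmanifold \<Rightarrow> ('q, 'm::finite) cmanifold \<Rightarrow> ('p \<Rightarrow> 'q) \<Rightarrow> 'p \<Rightarrow> bool" where
  "hol_at M N f x \<longleftrightarrow> (\<exists>A \<sigma> B \<tau> F z. mchart M A \<sigma> \<and> mchart N B \<tau> \<and> z \<in> A \<and> \<sigma> z = x \<and>
     holo_on A F \<and> F ` A \<subseteq> B \<and> (\<forall>w\<in>A. f (\<sigma> w) = \<tau> (F w)))"

lemma hol_atI:
  assumes "mchart M A \<sigma>" "mchart N B \<tau>" "holo_on A F" "F ` A \<subseteq> B"
    "\<And>w. w \<in> A \<Longrightarrow> f (\<sigma> w) = \<tau> (F w)" "z \<in> A" "\<sigma> z = x"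
  shows "hol_at M N f x"
  using assms unfolding hol_at_def by blast

lemma hol_atE:
  assumes "hol_at M N f x"
  obtains A \<sigma> B \<tau> F z where "mchart M A \<sigma>" "mchart N B \<tau>" "holo_on A F" "F ` A \<subseteq> B"
    "\<forall>w\<in>A. f (\<sigma> w) = \<tau> (F w)" "z \<in> A" "\<sigma> z = x"
proof -
  obtain A \<sigma> B \<tau> F z where *: "mchart M A \<sigma> \<and> mchart N B \<tau> \<and> z \<in> A \<and> \<sigma> z = x \<and>
     holo_on A F \<and> F ` A \<subseteq> B \<and> (\<forall>w\<in>A. f (\<sigma> w) = \<tau> (F w))"
    using assms unfolding hol_at_def by (elim exE)
  show ?thesis by (rule that[of A \<sigma> B \<tau> F z]) (simp_all add: *)
qed

text \<open>A local formula \<open>F\<close> for \<open>f\<close> is rewritten in another pair of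
  charts. \<open>W\<close> is where the new formula makes sense, in a form that exhibits it as the
  preimage of an open set under a holomorphic map; by the last conclusion it is as large as
  possible.\<close>

lemma hol_transition:
  assumes M: "complex_manifold M" and N: "complex_manifold N"
    and c: "mchart M A \<sigma>" "mchart N B \<tau>" "holo_on A F" "F ` A \<subseteq> B"
      "\<And>w. w \<in> A \<Longrightarrow> f (\<sigma> w) = \<tau> (F w)"
    and d: "mchart M C \<mu>" "mchart N D \<nu>"
    and W: "W = {v \<in> {v\<in>C. \<mu> v \<in> \<sigma> ` A}. (F \<circ> (inv_into A \<sigma> \<circ> \<mu>)) v \<in> {z\<in>B. \<tau> z \<in> \<nu> ` D}}"
  shows "open W" "holo_on W ((inv_into D \<nu> \<circ> \<tau>) \<circ> F \<circ> (inv_into A \<sigma> \<circ> \<mu>))"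
    "\<And>v. v \<in> W \<Longrightarrow> f (\<mu> v) \<in> \<nu> ` D \<and>
        f (\<mu> v) = \<nu> (((inv_into D \<nu> \<circ> \<tau>) \<circ> F \<circ> (inv_into A \<sigma> \<circ> \<mu>)) v)"
    "\<And>v. v \<in> C \<Longrightarrow> \<mu> v \<in> \<sigma> ` A \<Longrightarrow> f (\<mu> v) \<in> \<nu> ` D \<Longrightarrow> v \<in> W"
proof -
  note t1 = mchart_trans[OF M d(1) c(1)] and t2 = mchart_trans[OF N c(2) d(2)]
  have h: "holo_on {v\<in>C. \<mu> v \<in> \<sigma> ` A} (F \<circ> (inv_into A \<sigma> \<circ> \<mu>))"
    by (rule holo_on_compose[OF t1(2) c(3)]) (auto intro: inv_into_into)
  show "open W" unfolding W by (rule holo_on_preimage[OF h t1(1) t2(1)])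
  show "holo_on W ((inv_into D \<nu> \<circ> \<tau>) \<circ> F \<circ> (inv_into A \<sigma> \<circ> \<mu>))"
    unfolding comp_assoc
    by (rule holo_on_compose[OF holo_on_subset[OF h] t2(2), unfolded comp_assoc])
      (auto simp: W)
  have f: "f (\<mu> v) = \<tau> (F (inv_into A \<sigma> (\<mu> v)))" if "\<mu> v \<in> \<sigma> ` A" for v
    using c(5)[of "inv_into A \<sigma> (\<mu> v)"] that by (simp add: f_inv_into_f inv_into_into)
  show "f (\<mu> v) \<in> \<nu> ` D \<and> f (\<mu> v) = \<nu> (((inv_into D \<nu> \<circ> \<tau>) \<circ> F \<circ> (inv_into A \<sigma> \<circ> \<mu>)) v)"
    if "v \<in> W" for v
    using that f[of v] by (simp add: W f_inv_into_f)
  show "v \<in> W" if "v \<in> C" "\<mu> v \<in> \<sigma> ` A" "f (\<mu> v) \<in> \<nu> ` D" for v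
  proof -
    have "F (inv_into A \<sigma> (\<mu> v)) \<in> B" using c(4) inv_into_into[OF that(2)] by blast
    then show ?thesis using that f[OF that(2)] by (simp add: W)
  qed
qed

text \<open>One good pair of charts at each point is enough: the transitions to arbitrary atlas
  charts are holomorphic, and the set \<open>W\<close> of \<open>hol_transition\<close> contains the
  point.\<close>

lemma holomorphic_mapI:
  assumes M: "complex_manifold M" and N: "complex_manifold N"
    and h: "\<And>x. x \<in> points M \<Longrightarrow> hol_at M N f x"
  shows "holomorphic_map M N f"
  unfolding holomorphic_map_def
proof (intro conjI)
  show "f \<in> points M \<rightarrow> points N"
  proof
    fix x assume x: "x \<in> points M"
    obtain A \<sigma> B \<tau> F z where "mchart M A \<sigma>" and t: "mchart N B \<tau>"
      and F: "holo_on A F" "F ` A \<subseteq> B" and cF: "\<forall>w\<in>A. f (\<sigma> w) = \<tau> (F w)"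
      and z: "z \<in> A" "\<sigma> z = x"
    by (rule hol_atE[OF h[OF x]])
    show "f x \<in> points N" using mchartD(3)[OF t] F(2) bspec[OF cF z(1)] z by (auto simp: image_subset_iff)
  qed
  have "\<exists>W. open W \<and> \<phi> x \<in> W \<and> W \<subseteq> \<phi> ` U \<and> f ` inv_into U \<phi> ` W \<subseteq> V \<and> holo_on W (\<psi> \<circ> f \<circ> inv_into U \<phi>)"
    if x: "x \<in> points M" and a: "(U, \<phi>) \<in> atlas M" and b: "(V, \<psi>) \<in> atlas N" and xU: "x \<in> U" and fx: "f x \<in> V" for x U \<phi> V \<psi>
  proof -
    obtain A \<sigma> B \<tau> F z where c0: "mchart M A \<sigma>" "mchart N B \<tau>" "holo_on A F" "F ` A \<subseteq> B"
      and cF: "\<forall>w\<in>A. f (\<sigma> w) = \<tau> (F w)" and z: "z \<in> A" "\<sigma> z = x"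
    by (rule hol_atE[OF h[OF x]])
    note c = c0 bspec[OF cF]
    note d = mchart_atlas[OF M a] mchart_atlas[OF N b]
    have iU: "inj_on \<phi> U" and iV: "inj_on \<psi> V" using complex_manifoldD(2)[OF M a] complex_manifoldD(2)[OF N b] by auto
    define W where "W = {v \<in> {v\<in>\<phi> ` U. inv_into U \<phi> v \<in> \<sigma> ` A}.
      (F \<circ> (inv_into A \<sigma> \<circ> inv_into U \<phi>)) v \<in> {z\<in>B. \<tau> z \<in> inv_into V \<psi> ` \<psi> ` V}}"
    note t = hol_transition[OF M N c d W_def]
    have 1: "inv_into V \<psi> ` \<psi> ` V = V" using iV by force
    have "\<phi> x \<in> W" by (rule t(4)) (use iU xU z fx 1 in auto)
    moreover have "W \<subseteq> \<phi> ` U" unfolding W_def by blast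
    moreover have "f ` inv_into U \<phi> ` W \<subseteq> V" using t(3) 1 by blast
    moreover have "holo_on W (\<psi> \<circ> f \<circ> inv_into U \<phi>)"
    proof (rule holo_on_cong[OF t(2,1)])
      fix v assume v: "v \<in> W"
      let ?F = "((inv_into (\<psi> ` V) (inv_into V \<psi>) \<circ> \<tau>) \<circ> F \<circ> (inv_into A \<sigma> \<circ> inv_into U \<phi>)) v"
      have m: "f (inv_into U \<phi> v) \<in> V" using t(3)[of v] v 1 by blast
      have "inv_into (\<psi> ` V) (inv_into V \<psi>) q = \<psi> q" if "q \<in> V" for q
      proof -
        have "inv_into V \<psi> (\<psi> q) = q" using that iV by simp
        then show ?thesis
          using inv_into_f_f[OF inj_on_inv_into[of "\<psi> ` V" \<psi> V], of "\<psi> q"] that by simp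
      qed
      moreover have "?F = inv_into (\<psi> ` V) (inv_into V \<psi>) (f (inv_into U \<phi> v))"
        using c(5)[of "inv_into A \<sigma> (inv_into U \<phi> v)"] v
        by (simp add: W_def f_inv_into_f inv_into_into)
      ultimately show "?F = (\<psi> \<circ> f \<circ> inv_into U \<phi>) v" using m by simp
    qed
    ultimately show ?thesis using t(1) by blast
  qed
  then show "\<forall>x\<in>points M. \<forall>(U, \<phi>)\<in>atlas M. \<forall>(V, \<psi>)\<in>atlas N. x \<in> U \<longrightarrow> f x \<in> V \<longrightarrow>
        (\<exists>W. open W \<and> \<phi> x \<in> W \<and> W \<subseteq> \<phi> ` U \<and> f ` inv_into U \<phi> ` W \<subseteq> V \<and> holo_on W (\<psi> \<circ> f \<circ> inv_into U \<phi>))"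
    by blast
qed

lemma holomorphic_mapD:
  assumes "holomorphic_map M N f" "x \<in> points M"
  shows "f x \<in> points N"
    and "(U, \<phi>) \<in> atlas M \<Longrightarrow> (V, \<psi>) \<in> atlas N \<Longrightarrow> x \<in> U \<Longrightarrow> f x \<in> V \<Longrightarrow>
      \<exists>W. open W \<and> \<phi> x \<in> W \<and> W \<subseteq> \<phi> ` U \<and> f ` inv_into U \<phi> ` W \<subseteq> V \<and>
        holo_on W (\<psi> \<circ> f \<circ> inv_into U \<phi>)"
proof -
  have 1: "f \<in> points M \<rightarrow> points N"
    and 2: "\<forall>x\<in>points M. \<forall>(U, \<phi>)\<in>atlas M. \<forall>(V, \<psi>)\<in>atlas N. x \<in> U \<longrightarrow> f x \<in> V \<longrightarrow>
        (\<exists>W. open W \<and> \<phi> x \<in> W \<and> W \<subseteq> \<phi> ` U \<and> f ` inv_into U \<phi> ` W \<subseteq> V \<and>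
             holo_on W (\<psi> \<circ> f \<circ> inv_into U \<phi>))"
    using assms(1) unfolding holomorphic_map_def by simp_all
  show "f x \<in> points N" using 1 assms(2) by auto
  assume a: "(U, \<phi>) \<in> atlas M" and b: "(V, \<psi>) \<in> atlas N" and "x \<in> U" "f x \<in> V"
  with bspec[OF bspec[OF 2 assms(2)] a] have "\<forall>(V, \<psi>)\<in>atlas N. f x \<in> V \<longrightarrow>
        (\<exists>W. open W \<and> \<phi> x \<in> W \<and> W \<subseteq> \<phi> ` U \<and> f ` inv_into U \<phi> ` W \<subseteq> V \<and>
             holo_on W (\<psi> \<circ> f \<circ> inv_into U \<phi>))" by auto
  from bspec[OF this b] \<open>f x \<in> V\<close> show "\<exists>W. open W \<and> \<phi> x \<in> W \<and> W \<subseteq> \<phi> ` U \<and>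
        f ` inv_into U \<phi> ` W \<subseteq> V \<and> holo_on W (\<psi> \<circ> f \<circ> inv_into U \<phi>)" by auto
qed

lemma holomorphic_map_hol_at:
  assumes M: "complex_manifold M" and N: "complex_manifold N"
    and f: "holomorphic_map M N f" and x: "x \<in> points M"
  shows "hol_at M N f x"
proof -
  have fx: "f x \<in> points N" by (rule holomorphic_mapD(1)[OF f x])
  obtain U \<phi> where a: "(U, \<phi>) \<in> atlas M" "x \<in> U" by (rule atlas_at[OF M x])
  obtain V \<psi> where b: "(V, \<psi>) \<in> atlas N" "f x \<in> V" by (rule atlas_at[OF N fx])
  have "\<exists>W. open W \<and> \<phi> x \<in> W \<and> W \<subseteq> \<phi> ` U \<and> f ` inv_into U \<phi> ` W \<subseteq> V \<and> holo_on W (\<psi> \<circ> f \<circ> inv_into U \<phi>)"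
    by (rule holomorphic_mapD(2)[OF f x a(1) b(1) a(2) b(2)])
  then obtain W where W: "open W" "\<phi> x \<in> W" "W \<subseteq> \<phi> ` U" "f ` inv_into U \<phi> ` W \<subseteq> V"
    "holo_on W (\<psi> \<circ> f \<circ> inv_into U \<phi>)" by blast
  show ?thesis
  proof (rule hol_atI[OF mchart_restrict[OF M mchart_atlas[OF M a(1)] W(1,3)] mchart_atlas[OF N b(1)] W(5)])
    show "(\<psi> \<circ> f \<circ> inv_into U \<phi>) ` W \<subseteq> \<psi> ` V" using W(4) by auto
    show "f (inv_into U \<phi> w) = inv_into V \<psi> ((\<psi> \<circ> f \<circ> inv_into U \<phi>) w)" if "w \<in> W" for w
      using W(4) that complex_manifoldD(2)[OF N b(1)] by (simp add: image_subset_iff)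
    show "\<phi> x \<in> W" by (rule W)
    show "inv_into U \<phi> (\<phi> x) = x" using a complex_manifoldD(2)[OF M a(1)] by simp
  qed
qed

lemma hol_at_continuous:
  assumes M: "complex_manifold M" and N: "complex_manifold N"
    and f: "holomorphic_map M N f" and W: "openin (mtop N) W"
  shows "openin (mtop M) {x\<in>points M. f x \<in> W}"
proof (rule openin_mtopI[OF M])
  fix x assume x: "x \<in> {x\<in>points M. f x \<in> W}"
  then have "hol_at M N f x" using holomorphic_map_hol_at[OF M N f] by simp
  then obtain A \<sigma> B \<tau> F z where c0: "mchart M A \<sigma>" "mchart N B \<tau>" "holo_on A F" "F ` A \<subseteq> B"
      and cF: "\<forall>w\<in>A. f (\<sigma> w) = \<tau> (F w)" and z: "z \<in> A" "\<sigma> z = x"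
    by (rule hol_atE)
    note c = c0 bspec[OF cF]
  let ?A = "{w\<in>A. F w \<in> {v\<in>B. \<tau> v \<in> W}}"
  have "open ?A"
    by (rule holo_on_preimage[OF c(3) mchartD(1)[OF c(1)] mchart_preimage_open[OF N c(2) W]])
  then have "mchart M ?A \<sigma>" by (rule mchart_restrict[OF M c(1)]) auto
  moreover have "z \<in> ?A" using z x c(4,5) by auto
  moreover have "\<sigma> ` ?A \<subseteq> {x\<in>points M. f x \<in> W}" using mchartD(3)[OF c(1)] c(5) by auto
  ultimately show "\<exists>A \<sigma>. mchart M A \<sigma> \<and> x \<in> \<sigma> ` A \<and> \<sigma> ` A \<subseteq> {x \<in> points M. f x \<in> W}"
    using z(2) by blast
qed

lemma hol_at_cong:
  assumes M: "complex_manifold M" and h: "hol_at M N f x"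
    and W: "openin (mtop M) W" "x \<in> W" and eq: "\<And>y. y \<in> W \<Longrightarrow> f y = g y"
  shows "hol_at M N g x"
proof -
  obtain A \<sigma> B \<tau> F z where c0: "mchart M A \<sigma>" "mchart N B \<tau>" "holo_on A F" "F ` A \<subseteq> B"
      and cF: "\<forall>w\<in>A. f (\<sigma> w) = \<tau> (F w)" and z: "z \<in> A" "\<sigma> z = x"
    by (rule hol_atE[OF h])
    note c = c0 bspec[OF cF]
  let ?A = "{w\<in>A. \<sigma> w \<in> W}"
  have "open ?A" by (rule mchart_preimage_open[OF M c(1) W(1)])
  then have "mchart M ?A \<sigma>" by (rule mchart_restrict[OF M c(1)]) auto
  then show ?thesis
    by (rule hol_atI[OF _ c(2) holo_on_subset[OF c(3)], where z = z])
      (use c(4) z W in \<open>auto simp: c(5)[symmetric] eq\<close>)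
qed

text \<open>The transition maps in the two directions are mutually inverse near the point. By the
  chain rule and the uniqueness of derivatives, so are their derivatives.\<close>

lemma mchart_trans_bij:
  assumes M: "complex_manifold M" and s: "mchart M A \<sigma>" and t: "mchart M B \<tau>"
    and z: "z \<in> A" "\<sigma> z \<in> \<tau> ` B" and L: "((inv_into B \<tau> \<circ> \<sigma>) has_derivative L) (at z)"
  shows "bij L"
proof -
  let ?G = "inv_into B \<tau> \<circ> \<sigma>" and ?H = "inv_into A \<sigma> \<circ> \<tau>"
  have w: "?G z \<in> B" "\<tau> (?G z) = \<sigma> z" using z by (auto simp: inv_into_into f_inv_into_f)
  then have w': "?G z \<in> {w\<in>B. \<tau> w \<in> \<sigma> ` A}" using z by auto
  obtain K where K: "(?H has_derivative K) (at (?G z))"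
    using mchart_trans(2)[OF M t s] w' unfolding holo_on_def by blast
  have Hz: "?H (?G z) = z" using w z mchartD(2)[OF s] by simp
  have 1: "(?H \<circ> ?G has_derivative K \<circ> L) (at z)" by (rule diff_chain_at[OF L K])
  have "(?H \<circ> ?G has_derivative id) (at z)"
  proof (rule has_derivative_transform_within_open[OF has_derivative_id[unfolded id_def[symmetric]] mchart_trans(1)[OF M s t]])
    show "z \<in> {z\<in>A. \<sigma> z \<in> \<tau> ` B}" using z by simp
    show "id y = (?H \<circ> ?G) y" if "y \<in> {z\<in>A. \<sigma> z \<in> \<tau> ` B}" for y
      using that mchartD(2)[OF s] by (auto simp: f_inv_into_f)
  qed
  then have KL: "K \<circ> L = id" using 1 has_derivative_unique by blast
  have 2: "(?G \<circ> ?H has_derivative L \<circ> K) (at (?G z))"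
    by (rule diff_chain_at[OF K]) (use L Hz in simp)
  have "(?G \<circ> ?H has_derivative id) (at (?G z))"
  proof (rule has_derivative_transform_within_open[OF has_derivative_id[unfolded id_def[symmetric]] mchart_trans(1)[OF M t s]])
    show "?G z \<in> {w\<in>B. \<tau> w \<in> \<sigma> ` A}" by (rule w')
    show "id y = (?G \<circ> ?H) y" if "y \<in> {w\<in>B. \<tau> w \<in> \<sigma> ` A}" for y
      using that mchartD(2)[OF t] by (auto simp: f_inv_into_f)
  qed
  then have LK: "L \<circ> K = id" using 2 has_derivative_unique by blast
  show ?thesis using o_bij[OF KL LK] .
qed

text \<open>Changing charts multiplies the derivative by bijections on both sides. Immersion and
  submersion can therefore be tested in one pair of charts.\<close>

lemma derivative_in_charts:
  assumes M: "complex_manifold M" and N: "complex_manifold N"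
    and c: "mchart M A \<sigma>" "mchart N B \<tau>" "holo_on A F" "F ` A \<subseteq> B"
      "\<And>w. w \<in> A \<Longrightarrow> f (\<sigma> w) = \<tau> (F w)" and z: "z \<in> A" "\<sigma> z = x"
    and L: "(F has_derivative L) (at z)"
    and a: "(U, \<phi>) \<in> atlas M" "x \<in> U" and b: "(V, \<psi>) \<in> atlas N" "f x \<in> V"
  shows "\<exists>P Q. bij P \<and> bij Q \<and>
     ((\<psi> \<circ> f \<circ> inv_into U \<phi>) has_derivative (P \<circ> L \<circ> Q)) (at (\<phi> x))"
proof -
  have iU: "inj_on \<phi> U" and iV: "inj_on \<psi> V"
    using complex_manifoldD(2)[OF M a(1)] complex_manifoldD(2)[OF N b(1)] by auto
  note d = mchart_atlas[OF M a(1)] mchart_atlas[OF N b(1)]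
  define W where "W = {v \<in> {v\<in>\<phi> ` U. inv_into U \<phi> v \<in> \<sigma> ` A}.
    (F \<circ> (inv_into A \<sigma> \<circ> inv_into U \<phi>)) v \<in> {z\<in>B. \<tau> z \<in> inv_into V \<psi> ` \<psi> ` V}}"
  note t = hol_transition[OF M N c d W_def]
  have 1: "inv_into V \<psi> ` \<psi> ` V = V" using iV by force
  have inv: "inv_into (\<psi> ` V) (inv_into V \<psi>) q = \<psi> q" if "q \<in> V" for q
  proof -
    have "inv_into V \<psi> (\<psi> q) = q" using that iV by simp
    then show ?thesis
      using inv_into_f_f[OF inj_on_inv_into[of "\<psi> ` V" \<psi> V], of "\<psi> q"] that by simp
  qed
  have xW: "\<phi> x \<in> W" by (rule t(4)) (use iU a z b 1 in auto)
  have ix: "inv_into U \<phi> (\<phi> x) = x" using iU a by simp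
  have sx: "inv_into A \<sigma> x = z" using mchartD(2)[OF c(1)] z by auto
  have x1: "\<phi> x \<in> {v\<in>\<phi> ` U. inv_into U \<phi> v \<in> \<sigma> ` A}" using xW unfolding W_def by blast
  then obtain Q where Q: "((inv_into A \<sigma> \<circ> inv_into U \<phi>) has_derivative Q) (at (\<phi> x))"
    using mchart_trans(2)[OF M d(1) c(1)] unfolding holo_on_def by blast
  have x2: "F z \<in> {z\<in>B. \<tau> z \<in> inv_into V \<psi> ` \<psi> ` V}" using xW unfolding W_def by (simp add: ix sx)
  then obtain P where P: "((inv_into (\<psi> ` V) (inv_into V \<psi>) \<circ> \<tau>) has_derivative P) (at (F z))"
    using mchart_trans(2)[OF N c(2) d(2)] unfolding holo_on_def by blast
  have "((inv_into (\<psi> ` V) (inv_into V \<psi>) \<circ> \<tau>) \<circ> F \<circ> (inv_into A \<sigma> \<circ> inv_into U \<phi>)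
      has_derivative P \<circ> L \<circ> Q) (at (\<phi> x))"
    by (rule diff_chain_at[OF Q diff_chain_at]) (use L P ix sx in \<open>auto simp: o_def\<close>)
  then have "((\<psi> \<circ> f \<circ> inv_into U \<phi>) has_derivative (P \<circ> L \<circ> Q)) (at (\<phi> x))"
  proof (rule has_derivative_transform_within_open[OF _ t(1) xW])
    fix v assume v: "v \<in> W"
    have "f (inv_into U \<phi> v) \<in> V" using t(3)[of v] v 1 by blast
    then show "((inv_into (\<psi> ` V) (inv_into V \<psi>) \<circ> \<tau>) \<circ> F \<circ> (inv_into A \<sigma> \<circ> inv_into U \<phi>)) v
        = (\<psi> \<circ> f \<circ> inv_into U \<phi>) v"
      using c(5)[of "inv_into A \<sigma> (inv_into U \<phi> v)"] v
      by (simp add: W_def f_inv_into_f inv_into_into inv)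
  qed
  moreover have "bij Q" by (rule mchart_trans_bij[OF M d(1) c(1) _ _ Q]) (use x1 in auto)
  moreover have "bij P" by (rule mchart_trans_bij[OF N c(2) d(2) _ _ P]) (use x2 in auto)
  ultimately show ?thesis by blast
qed

lemma immersive_atI:
  assumes M: "complex_manifold M" and N: "complex_manifold N"
    and c: "mchart M A \<sigma>" "mchart N B \<tau>" "holo_on A F" "F ` A \<subseteq> B"
      "\<And>w. w \<in> A \<Longrightarrow> f (\<sigma> w) = \<tau> (F w)" and z: "z \<in> A" "\<sigma> z = x"
    and L: "(F has_derivative L) (at z)" "inj L"
  shows "immersive_at M N f x"
  unfolding immersive_at_def
proof (intro ballI, safe)
  fix U \<phi> V \<psi> assume a: "(U, \<phi>) \<in> atlas M" "(V, \<psi>) \<in> atlas N" "x \<in> U" "f x \<in> V"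
  obtain P Q where "bij P" "bij Q"
    "((\<psi> \<circ> f \<circ> inv_into U \<phi>) has_derivative (P \<circ> L \<circ> Q)) (at (\<phi> x))"
    using derivative_in_charts[OF M N c z L(1) a(1,3,2,4)] by blast
  moreover from this L(2) have "inj (P \<circ> L \<circ> Q)" by (intro inj_compose) (auto simp: bij_def)
  ultimately show "\<exists>L. ((\<psi> \<circ> f \<circ> inv_into U \<phi>) has_derivative L) (at (\<phi> x)) \<and> inj L" by blast
qed

lemma submersive_atI:
  assumes M: "complex_manifold M" and N: "complex_manifold N"
    and c: "mchart M A \<sigma>" "mchart N B \<tau>" "holo_on A F" "F ` A \<subseteq> B"
      "\<And>w. w \<in> A \<Longrightarrow> f (\<sigma> w) = \<tau> (F w)" and z: "z \<in> A" "\<sigma> z = x"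
    and L: "(F has_derivative L) (at z)" "surj L"
  shows "submersive_at M N f x"
  unfolding submersive_at_def
proof (intro ballI, safe)
  fix U \<phi> V \<psi> assume a: "(U, \<phi>) \<in> atlas M" "(V, \<psi>) \<in> atlas N" "x \<in> U" "f x \<in> V"
  obtain P Q where "bij P" "bij Q"
    "((\<psi> \<circ> f \<circ> inv_into U \<phi>) has_derivative (P \<circ> L \<circ> Q)) (at (\<phi> x))"
    using derivative_in_charts[OF M N c z L(1) a(1,3,2,4)] by blast
  moreover from this L(2) have "surj (P \<circ> L \<circ> Q)" by (intro comp_surj) (auto simp: bij_def)
  ultimately show "\<exists>L. ((\<psi> \<circ> f \<circ> inv_into U \<phi>) has_derivative L) (at (\<phi> x)) \<and> surj L" by blast
qed

text \<open>The inverse is supplied as an explicit \<open>g\<close>. The term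
  \<open>inv_into (points M) f\<close> is known to agree with \<open>g\<close> only on the points of
  \<open>N\<close>, which is why holomorphy is transferred to it by \<open>hol_at_cong\<close> on
  the open set of all points.\<close>

lemma biholomorphicI:
  assumes M: "complex_manifold M" and N: "complex_manifold N"
    and f: "\<And>x. x \<in> points M \<Longrightarrow> hol_at M N f x" and g: "\<And>y. y \<in> points N \<Longrightarrow> hol_at N M g y"
    and gf: "\<And>x. x \<in> points M \<Longrightarrow> g (f x) = x" and fg: "\<And>y. y \<in> points N \<Longrightarrow> f (g y) = y"
  shows "biholomorphic M N f"
proof -
  have hf: "holomorphic_map M N f" and hg: "holomorphic_map N M g"
    using holomorphic_mapI[OF M N f] holomorphic_mapI[OF N M g] by auto
  then have mf: "f \<in> points M \<rightarrow> points N" and mg: "g \<in> points N \<rightarrow> points M"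
    by (auto dest: holomorphic_mapD(1))
  have bij: "bij_betw f (points M) (points N)"
    by (rule bij_betw_byWitness[of _ g]) (use gf fg mf mg in auto)
  have inv: "inv_into (points M) f y = g y" if "y \<in> points N" for y
    using inv_into_f_eq[of f "points M" "g y" y] that mg fg bij unfolding bij_betw_def by auto
  have "hol_at N M (inv_into (points M) f) y" if y: "y \<in> points N" for y
    by (rule hol_at_cong[OF N g[OF y], of "points N"])
      (use y inv openin_topspace[of "mtop N"] in \<open>auto simp: topspace_mtop[OF N]\<close>)
  then show ?thesis unfolding biholomorphic_def
    using bij hf holomorphic_mapI[OF N M] by blast
qed

section \<open>Building complex manifolds\<close>

text \<open>Second countability is automatic for countably many charts, as each has a countable base.\<close>

lemma complex_manifold_countable:
  fixes M :: "('p, 'n::finite) cmanifold"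
  assumes cov: "(\<Union>(U, \<phi>)\<in>atlas M. U) = points M"
    and ch: "\<And>U \<phi>. (U, \<phi>) \<in> atlas M \<Longrightarrow> inj_on \<phi> U \<and> open (\<phi> ` U)"
    and tr: "\<And>U \<phi> V \<psi>. (U, \<phi>) \<in> atlas M \<Longrightarrow> (V, \<psi>) \<in> atlas M \<Longrightarrow>
        open (\<phi> ` (U \<inter> V)) \<and> holo_on (\<phi> ` (U \<inter> V)) (\<psi> \<circ> inv_into U \<phi>)"
    and cnt: "countable (atlas M)"
    and haus: "\<And>x y. x \<in> points M \<Longrightarrow> y \<in> points M \<Longrightarrow> x \<noteq> y \<Longrightarrow>
        \<exists>A B. openin (mtop M) A \<and> openin (mtop M) B \<and> x \<in> A \<and> y \<in> B \<and> A \<inter> B = {}"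
  shows "complex_manifold M"
proof -
  have op: "openin (mtop M) W \<longleftrightarrow>
           W \<subseteq> points M \<and> (\<forall>(U, \<phi>)\<in>atlas M. open (\<phi> ` (U \<inter> W)))" for W
    by (rule openin_mtop_inj) (use ch in blast)
  have subs: "U \<subseteq> points M" if "(U, \<phi>) \<in> atlas M" for U \<phi>
    unfolding cov[symmetric] using that by auto
  have top: "topspace (mtop M) = points M"
  proof
    show "topspace (mtop M) \<subseteq> points M" using op openin_topspace by blast
    have "U \<inter> points M = U" if "(U, \<phi>) \<in> atlas M" for U \<phi> using subs[OF that] by blast
    then have "openin (mtop M) (points M)" unfolding op using ch by auto
    then show "points M \<subseteq> topspace (mtop M)" by (rule openin_subset)
  qed
  have H: "Hausdorff_space (mtop M)"
    unfolding Hausdorff_space_def top disjnt_def using haus by blast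
  obtain \<B> :: "(complex ^ 'n) set set" where B: "countable \<B>" "\<And>S. open S \<Longrightarrow> \<exists>\<U>. \<U> \<subseteq> \<B> \<and> S = \<Union>\<U>" "\<And>S. S \<in> \<B> \<Longrightarrow> open S"
    by (metis univ_second_countable)
  define \<C> where "\<C> = (\<lambda>((U, \<phi>), S). {x\<in>U. \<phi> x \<in> S}) ` (atlas M \<times> \<B>)"
  have oC: "openin (mtop M) {x\<in>U. \<phi> x \<in> S}" if a: "(U, \<phi>) \<in> atlas M" and S: "open S" for U \<phi> S
    unfolding op
  proof (intro conjI ballI, safe)
    show "x \<in> points M" if "x \<in> U" for x using subs[OF a] that by blast
    fix V \<psi> assume b: "(V, \<psi>) \<in> atlas M"
    have iV: "inj_on \<psi> V" using ch b by blast
    have "\<psi> ` (V \<inter> {x \<in> U. \<phi> x \<in> S}) = {v \<in> \<psi> ` (V \<inter> U). (\<phi> \<circ> inv_into V \<psi>) v \<in> S}"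
      using iV by auto
    also have "open \<dots>" by (rule holo_on_preimage[OF tr[OF b a, THEN conjunct2] tr[OF b a, THEN conjunct1] S])
    finally show "open (\<psi> ` (V \<inter> {x \<in> U. \<phi> x \<in> S}))" .
  qed
  have "second_countable (mtop M)"
    unfolding second_countable_def
  proof (intro exI[of _ \<C>] conjI allI impI ballI)
    show "countable \<C>" unfolding \<C>_def using cnt B(1) by blast
    show "openin (mtop M) V" if "V \<in> \<C>" for V
      using that oC B(3) unfolding \<C>_def by auto
    fix W x assume "openin (mtop M) W \<and> x \<in> W"
    then have W: "openin (mtop M) W" "x \<in> W" by auto
    then have "x \<in> points M" using op by blast
    then obtain U \<phi> where a: "(U, \<phi>) \<in> atlas M" "x \<in> U" unfolding cov[symmetric] by auto
    have "open (\<phi> ` (U \<inter> W))" using W a unfolding op by blast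
    then obtain \<U> where "\<U> \<subseteq> \<B>" "\<phi> ` (U \<inter> W) = \<Union>\<U>" using B(2) by blast
    then obtain S where S: "S \<in> \<B>" "\<phi> x \<in> S" "S \<subseteq> \<phi> ` (U \<inter> W)"
      using a W by (metis IntI UnionE Union_upper imageI subsetD)
    have "{x\<in>U. \<phi> x \<in> S} \<in> \<C>" unfolding \<C>_def using a(1) S(1)
      by (intro image_eqI[of _ _ "((U, \<phi>), S)"]) auto
    moreover have "{x\<in>U. \<phi> x \<in> S} \<subseteq> W"
    proof safe
      fix y assume y: "y \<in> U" "\<phi> y \<in> S"
      then obtain y' where "y' \<in> U" "y' \<in> W" "\<phi> y = \<phi> y'" using S(3) by blast
      then show "y \<in> W" using inj_onD[OF ch[OF a(1), THEN conjunct1], of y y'] y(1) by simp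
    qed
    moreover have "x \<in> {x\<in>U. \<phi> x \<in> S}" using a S by simp
    ultimately show "\<exists>V\<in>\<C>. x \<in> V \<and> V \<subseteq> W" by (intro bexI[of _ "{x\<in>U. \<phi> x \<in> S}"] conjI)
  qed
  moreover have "\<forall>(U, \<phi>)\<in>atlas M. inj_on \<phi> U \<and> open (\<phi> ` U)" using ch by blast
  moreover have "\<forall>(U, \<phi>)\<in>atlas M. \<forall>(V, \<psi>)\<in>atlas M.
        open (\<phi> ` (U \<inter> V)) \<and> holo_on (\<phi> ` (U \<inter> V)) (\<psi> \<circ> inv_into U \<phi>)" using tr by blast
  ultimately show ?thesis unfolding complex_manifold_def using cov H by blast
qed

text \<open>The common source of the concrete model spaces and of the glued spaces: countably many
  parametrizations \<open>\<sigma> i\<close> with left inverses \<open>\<phi> i\<close>. Transition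
  and separation are required only between different indices, since within one chart they follow
  from the left inverse and the Hausdorff property of affine space.\<close>

lemma complex_manifold_family:
  fixes M :: "('p, 'n::finite) cmanifold" and \<sigma> :: "'i \<Rightarrow> complex ^ 'n \<Rightarrow> 'p"
  assumes pts: "points M = (\<Union>i\<in>I. \<sigma> i ` A i)"
    and atl: "atlas M = (\<lambda>i. (\<sigma> i ` A i, \<phi> i)) ` I" and cnt: "countable I"
    and oA: "\<And>i. i \<in> I \<Longrightarrow> open (A i)"
    and inv: "\<And>i z. i \<in> I \<Longrightarrow> z \<in> A i \<Longrightarrow> \<phi> i (\<sigma> i z) = z"
    and tr: "\<And>i j. i \<in> I \<Longrightarrow> j \<in> I \<Longrightarrow> i \<noteq> j \<Longrightarrow> open {z\<in>A i. \<sigma> i z \<in> \<sigma> j ` A j} \<and>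
        holo_on {z\<in>A i. \<sigma> i z \<in> \<sigma> j ` A j} (\<lambda>z. \<phi> j (\<sigma> i z))"
    and haus: "\<And>i j x y. i \<in> I \<Longrightarrow> j \<in> I \<Longrightarrow> i \<noteq> j \<Longrightarrow> x \<in> A i \<Longrightarrow> y \<in> A j \<Longrightarrow> \<sigma> i x \<noteq> \<sigma> j y \<Longrightarrow>
        \<exists>V W. open V \<and> open W \<and> x \<in> V \<and> y \<in> W \<and> (\<forall>v\<in>V \<inter> A i. \<forall>w\<in>W \<inter> A j. \<sigma> i v \<noteq> \<sigma> j w)"
  shows "complex_manifold M" and "\<And>i. i \<in> I \<Longrightarrow> mchart M (A i) (\<sigma> i)"
proof -
  have inj: "inj_on (\<phi> i) (\<sigma> i ` A i)" "\<phi> i ` \<sigma> i ` A i = A i" if "i \<in> I" for i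
    using inv[OF that] by (auto simp: inj_on_def image_iff)
  have ii: "inv_into (\<sigma> i ` A i) (\<phi> i) z = \<sigma> i z" if "i \<in> I" "z \<in> A i" for i z
    using inj(1)[OF that(1)] inv[OF that] that(2) by (metis image_eqI inv_into_f_f)
  have im: "\<phi> i ` (\<sigma> i ` A i \<inter> W) = {z\<in>A i. \<sigma> i z \<in> W}" if "i \<in> I" for i W
    using inv[OF that] by (force simp: image_iff)
  have tr': "open {z\<in>A i. \<sigma> i z \<in> \<sigma> j ` A j} \<and>
        holo_on {z\<in>A i. \<sigma> i z \<in> \<sigma> j ` A j} (\<lambda>z. \<phi> j (\<sigma> i z))" if ij: "i \<in> I" "j \<in> I" for i j
  proof (cases "i = j")
    case True
    have "{z\<in>A j. \<sigma> j z \<in> \<sigma> j ` A j} = A j" by auto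
    moreover have "holo_on (A j) (\<lambda>z. \<phi> j (\<sigma> j z))"
      by (rule holo_on_cong[OF holo_on_id oA[OF ij(2)]]) (use inv[OF ij(2)] in auto)
    ultimately show ?thesis using oA[OF ij(2)] True by simp
  qed (use tr ij in blast)
  have inj': "inj_on \<phi> U" if "(U, \<phi>) \<in> atlas M" for U \<phi>
    using that inj(1) unfolding atl by auto
  have op: "openin (mtop M) (\<sigma> i ` (V \<inter> A i))" if i: "i \<in> I" and V: "open V" for i V
  proof (subst openin_mtop_inj[of M, OF inj'], assumption, intro conjI ballI)
    show "\<sigma> i ` (V \<inter> A i) \<subseteq> points M" unfolding pts using i by blast
    fix a assume "a \<in> atlas M"
    then obtain j where j: "j \<in> I" "a = (\<sigma> j ` A j, \<phi> j)" unfolding atl by blast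
    have "\<phi> j ` (\<sigma> j ` A j \<inter> \<sigma> i ` (V \<inter> A i)) = {z \<in> {z\<in>A j. \<sigma> j z \<in> \<sigma> i ` A i}. \<phi> i (\<sigma> j z) \<in> V}"
      unfolding im[OF j(1)] using inv[OF i] by auto
    also have "open \<dots>"
      by (rule holo_on_preimage) (use tr'[OF j(1) i] V in auto)
    finally show "case a of (U, \<phi>) \<Rightarrow> open (\<phi> ` (U \<inter> \<sigma> i ` (V \<inter> A i)))" using j by simp
  qed
  show M: "complex_manifold M"
  proof (rule complex_manifold_countable)
    show "(\<Union>(U, \<phi>)\<in>atlas M. U) = points M" unfolding pts atl by auto
    show "inj_on \<phi> U \<and> open (\<phi> ` U)" if "(U, \<phi>) \<in> atlas M" for U \<phi>
      using that inj oA unfolding atl by auto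
    show "countable (atlas M)" unfolding atl using cnt by simp
    fix U \<phi>' V \<psi>' assume "(U, \<phi>') \<in> atlas M" "(V, \<psi>') \<in> atlas M"
    then obtain i j where ij: "i \<in> I" "U = \<sigma> i ` A i" "\<phi>' = \<phi> i" "j \<in> I" "V = \<sigma> j ` A j" "\<psi>' = \<phi> j"
      unfolding atl by blast
    note t = tr'[OF ij(1,4)]
    have "holo_on {z\<in>A i. \<sigma> i z \<in> \<sigma> j ` A j} (\<phi> j \<circ> inv_into (\<sigma> i ` A i) (\<phi> i))"
      by (rule holo_on_cong[OF t[THEN conjunct2] t[THEN conjunct1]]) (use ii ij in auto)
    then show "open (\<phi>' ` (U \<inter> V)) \<and> holo_on (\<phi>' ` (U \<inter> V)) (\<psi>' \<circ> inv_into U \<phi>')"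
      unfolding ij(2,3,5,6) im[OF ij(1)] using t by blast
  next
    fix p q assume "p \<in> points M" "q \<in> points M" and neq: "p \<noteq> q"
    then obtain i j x y where ij: "i \<in> I" "j \<in> I" "x \<in> A i" "y \<in> A j" "p = \<sigma> i x" "q = \<sigma> j y"
      unfolding pts by blast
    have "\<exists>V W. open V \<and> open W \<and> x \<in> V \<and> y \<in> W \<and> (\<forall>v\<in>V \<inter> A i. \<forall>w\<in>W \<inter> A j. \<sigma> i v \<noteq> \<sigma> j w)"
    proof (cases "i = j")
      case True
      with neq ij have "x \<noteq> y" by blast
      then obtain V W where "open V" "open W" "x \<in> V" "y \<in> W" "V \<inter> W = {}"
        using hausdorff[OF \<open>x \<noteq> y\<close>] by (elim exE conjE)
      moreover have "\<sigma> i v \<noteq> \<sigma> j w" if vw: "v \<in> V \<inter> A i" "w \<in> W \<inter> A j" for v w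
      proof
        assume "\<sigma> i v = \<sigma> j w"
        then have "\<phi> j (\<sigma> j v) = \<phi> j (\<sigma> j w)" unfolding True by (rule arg_cong)
        then have "v = w" using inv[OF ij(2), of v] inv[OF ij(2), of w] vw True by auto
        then show False using that \<open>V \<inter> W = {}\<close> by blast
      qed
      ultimately show ?thesis by (intro exI[of _ V] exI[of _ W]) simp
    next
      case False
      show ?thesis by (rule haus[OF ij(1,2) False ij(3,4)]) (use neq ij in simp)
    qed
    then obtain V W where "open V" "open W" "x \<in> V" "y \<in> W" "\<forall>v\<in>V \<inter> A i. \<forall>w\<in>W \<inter> A j. \<sigma> i v \<noteq> \<sigma> j w"
      by (elim exE conjE)
    then show "\<exists>A B. openin (mtop M) A \<and> openin (mtop M) B \<and> p \<in> A \<and> q \<in> B \<and> A \<inter> B = {}"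
      using op[OF ij(1), of V] op[OF ij(2), of W] ij(3-6)
      by (intro exI[of _ "\<sigma> i ` (V \<inter> A i)"] exI[of _ "\<sigma> j ` (W \<inter> A j)"])
        (simp, blast)
  qed
  show "mchart M (A i) (\<sigma> i)" if i: "i \<in> I" for i
  proof -
    have "mchart M (\<phi> i ` \<sigma> i ` A i) (inv_into (\<sigma> i ` A i) (\<phi> i))"
      by (rule mchart_atlas[OF M]) (use i atl in blast)
    then have "mchart M (A i) (inv_into (\<sigma> i ` A i) (\<phi> i))" unfolding inj(2)[OF i] .
    then show ?thesis by (rule mchart_cong) (rule ii[OF i])
  qed
qed

section \<open>Submanifolds, transport of structure and unions\<close>

lemma openin_chart_domain:
  assumes M: "complex_manifold M" and a: "(U, \<phi>) \<in> atlas M"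
  shows "openin (mtop M) U"
  unfolding openin_mtop[OF M]
  using complex_manifoldD(8)[OF M a] complex_manifoldD(4)[OF M _ a] by auto

lemma openin_mchart_at:
  assumes M: "complex_manifold M" and W: "openin (mtop M) W" "x \<in> W"
  obtains A \<sigma> z where "mchart M A \<sigma>" "z \<in> A" "\<sigma> z = x" "\<sigma> ` A \<subseteq> W"
proof -
  have "x \<in> points M" using W openin_mtop[OF M] by blast
  then obtain A \<sigma> z where c: "mchart M A \<sigma>" "z \<in> A" "\<sigma> z = x" by (rule mchart_at[OF M])
  have "mchart M {z\<in>A. \<sigma> z \<in> W} \<sigma>"
    by (rule mchart_restrict[OF M c(1) mchart_preimage_open[OF M c(1) W(1)]]) auto
  then show ?thesis by (rule that[of _ _ z]) (use c W in auto)
qed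

section \<open>Open submanifolds\<close>

lemma inv_into_subset:
  assumes "inj_on \<phi> U" "x \<in> \<phi> ` V" "V \<subseteq> U" shows "inv_into V \<phi> x = inv_into U \<phi> x"
  using assms by (metis f_inv_into_f inj_on_subset inv_into_f_f inv_into_into subsetD image_mono)

lemma points_submanifold [simp]: "points (submanifold M W) = points M \<inter> W"
  by (simp add: submanifold_def)

lemma atlas_submanifoldE:
  assumes "(V, \<psi>) \<in> atlas (submanifold M W)"
  obtains U where "V = U \<inter> W" "(U, \<psi>) \<in> atlas M"
  using assms unfolding submanifold_def by auto

lemma atlas_submanifold:
  "atlas (submanifold M W) = (\<lambda>(U, \<phi>). (U \<inter> W, \<phi>)) ` atlas M"
  unfolding submanifold_def by (auto simp: image_iff Bex_def)

lemma countable_submanifold: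
  "countable (atlas M) \<Longrightarrow> countable (atlas (submanifold M W))"
  by (simp add: atlas_submanifold)

lemma openin_submanifold:
  assumes M: "complex_manifold M" and W: "openin (mtop M) (points M \<inter> W)"
  shows "openin (mtop (submanifold M W)) V \<longleftrightarrow> openin (mtop M) V \<and> V \<subseteq> W"
proof -
  have inj: "inj_on \<phi> U" if "(U, \<phi>) \<in> atlas (submanifold M W)" for U \<phi>
    using that by (rule atlas_submanifoldE) (auto intro: inj_on_subset complex_manifoldD(2)[OF M])
  have "(\<forall>(U, \<phi>)\<in>atlas (submanifold M W). open (\<phi> ` (U \<inter> V))) \<longleftrightarrow>
      (\<forall>(U, \<phi>)\<in>atlas M. open (\<phi> ` (U \<inter> W \<inter> V)))"
    by (simp add: atlas_submanifold split_beta)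
  moreover have "U \<inter> W \<inter> V = U \<inter> V" if "V \<subseteq> W" for U using that by blast
  ultimately show ?thesis
    unfolding openin_mtop[OF M] openin_mtop_inj[of "submanifold M W" V, OF inj, simplified]
    by auto
qed

lemma mchart_submanifold:
  assumes M: "complex_manifold M" and s: "mchart M A \<sigma>" and W: "\<sigma> ` A \<subseteq> W"
  shows "mchart (submanifold M W) A \<sigma>"
  unfolding mchart_def
proof (intro conjI ballI)
  show "open A" "inj_on \<sigma> A" "\<sigma> ` A \<subseteq> points (submanifold M W)"
    using mchartD[OF s] W by auto
  fix a assume "a \<in> atlas (submanifold M W)"
  then obtain U \<phi> where a: "a = (U \<inter> W, \<phi>)" "(U, \<phi>) \<in> atlas M"
    by (metis atlas_submanifoldE old.prod.exhaust)
  note inj = complex_manifoldD(2)[OF M a(2)]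
  have 1: "{z\<in>A. \<sigma> z \<in> U \<inter> W} = {z\<in>A. \<sigma> z \<in> U}" "U \<inter> W \<inter> \<sigma> ` A = U \<inter> \<sigma> ` A"
    using W by auto
  have "holo_on (\<phi> ` (U \<inter> \<sigma> ` A)) (inv_into A \<sigma> \<circ> inv_into (U \<inter> W) \<phi>)"
  proof (rule holo_on_cong[OF mchartD(7,6)[OF s a(2)]])
    fix z assume "z \<in> \<phi> ` (U \<inter> \<sigma> ` A)"
    then have "z \<in> \<phi> ` (U \<inter> W)" using W by blast
    then show "(inv_into A \<sigma> \<circ> inv_into U \<phi>) z = (inv_into A \<sigma> \<circ> inv_into (U \<inter> W) \<phi>) z"
      using inv_into_subset[OF inj, of z "U \<inter> W"] by simp
  qed
  then show "case a of (U, \<phi>) \<Rightarrow> open {z\<in>A. \<sigma> z \<in> U} \<and> holo_on {z\<in>A. \<sigma> z \<in> U} (\<phi> \<circ> \<sigma>) \<and>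
        open (\<phi> ` (U \<inter> \<sigma> ` A)) \<and> holo_on (\<phi> ` (U \<inter> \<sigma> ` A)) (inv_into A \<sigma> \<circ> inv_into U \<phi>)"
    unfolding a(1) prod.case 1 using mchartD[OF s] a(2) by simp
qed

text \<open>Countability of the atlas is assumed so that \<open>complex_manifold_countable\<close>
  supplies second countability of the open part; this is why countability accompanies the manifolds
  constructed below.\<close>

lemma complex_manifold_submanifold:
  assumes M: "complex_manifold M" and c: "countable (atlas M)"
    and W: "openin (mtop M) (points M \<inter> W)"
  shows "complex_manifold (submanifold M W)"
proof (rule complex_manifold_countable)
  show "(\<Union>(U, \<phi>)\<in>atlas (submanifold M W). U) = points (submanifold M W)"
    unfolding atlas_submanifold points_submanifold complex_manifoldD(1)[OF M, symmetric] by auto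
  show "countable (atlas (submanifold M W))" by (rule countable_submanifold[OF c])
  have oU: "openin (mtop M) (U \<inter> W)" if "(U, \<phi>) \<in> atlas M" for U \<phi>
  proof -
    have "U \<inter> W = U \<inter> (points M \<inter> W)" using complex_manifoldD(8)[OF M that] by blast
    then show ?thesis using openin_Int[OF openin_chart_domain[OF M that] W] by simp
  qed
  show "inj_on \<phi> V \<and> open (\<phi> ` V)" if a: "(V, \<phi>) \<in> atlas (submanifold M W)" for V \<phi>
  proof -
    obtain U where U: "V = U \<inter> W" "(U, \<phi>) \<in> atlas M" using a by (rule atlas_submanifoldE)
    have "open (\<phi> ` (U \<inter> (U \<inter> W)))" using oU[OF U(2)] U(2) unfolding openin_mtop[OF M] by blast
    then show ?thesis using inj_on_subset[OF complex_manifoldD(2)[OF M U(2)]] U(1) by auto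
  qed
  fix U' \<phi> V' \<psi>
  assume "(U', \<phi>) \<in> atlas (submanifold M W)" "(V', \<psi>) \<in> atlas (submanifold M W)"
  then obtain U V where U: "U' = U \<inter> W" "(U, \<phi>) \<in> atlas M" and V: "V' = V \<inter> W" "(V, \<psi>) \<in> atlas M"
    by (metis atlas_submanifoldE)
  have "U \<inter> (V \<inter> W) = U' \<inter> V'" using U V by blast
  moreover have "open (\<phi> ` (U \<inter> (V \<inter> W)))"
    using oU[OF V(2)] U(2) unfolding openin_mtop[OF M] by blast
  ultimately have o: "open (\<phi> ` (U' \<inter> V'))" by simp
  have "holo_on (\<phi> ` (U' \<inter> V')) (\<psi> \<circ> inv_into U \<phi>)"
    by (rule holo_on_subset[OF complex_manifoldD(5)[OF M U(2) V(2)]]) (use U V in auto)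
  then have "holo_on (\<phi> ` (U' \<inter> V')) (\<psi> \<circ> inv_into U' \<phi>)"
  proof (rule holo_on_cong[OF _ o])
    fix z assume "z \<in> \<phi> ` (U' \<inter> V')"
    then have "z \<in> \<phi> ` U'" by blast
    from inv_into_subset[OF complex_manifoldD(2)[OF M U(2)] this]
    show "(\<psi> \<circ> inv_into U \<phi>) z = (\<psi> \<circ> inv_into U' \<phi>) z" using U(1) by simp
  qed
  with o show "open (\<phi> ` (U' \<inter> V')) \<and> holo_on (\<phi> ` (U' \<inter> V')) (\<psi> \<circ> inv_into U' \<phi>)" by simp
next
  fix x y assume xy: "x \<in> points (submanifold M W)" "y \<in> points (submanifold M W)" "x \<noteq> y"
  then have "x \<in> topspace (mtop M)" "y \<in> topspace (mtop M)" by (auto simp: topspace_mtop[OF M])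
  then obtain A B where AB: "openin (mtop M) A" "openin (mtop M) B" "x \<in> A" "y \<in> B" "disjnt A B"
    using complex_manifoldD(6)[OF M] xy(3) unfolding Hausdorff_space_def by blast
  show "\<exists>A B. openin (mtop (submanifold M W)) A \<and> openin (mtop (submanifold M W)) B \<and>
      x \<in> A \<and> y \<in> B \<and> A \<inter> B = {}"
    unfolding openin_submanifold[OF M W]
    using AB xy openin_Int[OF AB(1) W] openin_Int[OF AB(2) W]
    by (intro exI[of _ "A \<inter> (points M \<inter> W)"] exI[of _ "B \<inter> (points M \<inter> W)"]) (auto simp: disjnt_def)
qed

lemma hol_at_submanifold:
  assumes M: "complex_manifold M" and h: "hol_at M N f x"
    and W: "openin (mtop M) (points M \<inter> W)" "x \<in> W"
  shows "hol_at (submanifold M W) N f x"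
proof -
  obtain A \<sigma> B \<tau> F z where c0: "mchart M A \<sigma>" "mchart N B \<tau>" "holo_on A F" "F ` A \<subseteq> B"
    and cF: "\<forall>w\<in>A. f (\<sigma> w) = \<tau> (F w)" and z: "z \<in> A" "\<sigma> z = x"
    using h by (rule hol_atE)
  let ?A = "{w\<in>A. \<sigma> w \<in> points M \<inter> W}"
  have "mchart M ?A \<sigma>"
    by (rule mchart_restrict[OF M c0(1) mchart_preimage_open[OF M c0(1) W(1)]]) auto
  then have "mchart (submanifold M W) ?A \<sigma>" by (rule mchart_submanifold[OF M]) auto
  then show ?thesis
    by (rule hol_atI[OF _ c0(2) holo_on_subset[OF c0(3)], where z = z])
      (use c0(4) cF z W mchartD(3)[OF c0(1)] in auto)
qed

lemma hol_at_mchart_id: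
  assumes "mchart M A \<sigma>" "mchart N A \<sigma>" "z \<in> A" "\<sigma> z = x" "\<And>w. w \<in> A \<Longrightarrow> f (\<sigma> w) = \<sigma> w"
  shows "hol_at M N f x"
  by (rule hol_atI[OF assms(1,2) holo_on_id]) (use assms in auto)

text \<open>Transport of structure along an injection. It moves the projective plane and the model
  of a blow-up into the fixed type of labelled points.\<close>

definition push :: "('p \<Rightarrow> 'q) \<Rightarrow> ('p, 'n::finite) cmanifold \<Rightarrow> ('q, 'n) cmanifold" where
  "push b M = \<lparr>points = b ` points M,
     atlas = (\<lambda>(U, \<phi>). (b ` U, \<phi> \<circ> inv_into (points M) b)) ` atlas M\<rparr>"

lemma complex_manifold_push:
  assumes M: "complex_manifold M" and c: "countable (atlas M)" and b: "inj_on b (points M)"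
  shows "complex_manifold (push b M)" "countable (atlas (push b M))"
    "\<And>A \<sigma>. mchart M A \<sigma> \<Longrightarrow> mchart (push b M) A (b \<circ> \<sigma>)"
    "points (push b M) = b ` points M"
proof -
  show pts: "points (push b M) = b ` points M" by (simp add: push_def)
  show cnt: "countable (atlas (push b M))" using c by (simp add: push_def)
  have at: "\<exists>U \<phi>. a = (b ` U, \<phi> \<circ> inv_into (points M) b) \<and> (U, \<phi>) \<in> atlas M"
    if "a \<in> atlas (push b M)" for a using that unfolding push_def by auto
  have bi: "inv_into (points M) b (b x) = x" if "x \<in> points M" for x using b that by simp
  have ba: "b x = b y \<longleftrightarrow> x = y" if "x \<in> points M" "y \<in> points M" for x y
    using b that by (auto dest: inj_onD)
  note sub = complex_manifoldD(8)[OF M]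
  have injc: "inj_on (\<phi> \<circ> inv_into (points M) b) (b ` U)" if a: "(U, \<phi>) \<in> atlas M" for U \<phi>
    using complex_manifoldD(2)[OF M a] sub[OF a] by (auto simp: inj_on_def bi subset_iff)
  have im: "(\<phi> \<circ> inv_into (points M) b) ` (b ` U \<inter> b ` V) = \<phi> ` (U \<inter> V)"
    if "U \<subseteq> points M" "V \<subseteq> points M" for U V and \<phi> :: "_ \<Rightarrow> complex ^ 'b"
  proof -
    have "b ` U \<inter> b ` V = b ` (U \<inter> V)" by (rule inj_on_image_Int[OF b that, symmetric])
    then show ?thesis using that by (force simp: image_iff bi subset_iff)
  qed
  have inv: "inv_into (b ` U) (\<phi> \<circ> inv_into (points M) b) z = b (inv_into U \<phi> z)"
    if a: "(U, \<phi>) \<in> atlas M" and z: "z \<in> \<phi> ` U" for U \<phi> z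
    by (rule inv_into_f_eq[OF injc[OF a]])
      (use z sub[OF a] in \<open>auto simp: bi subset_iff inv_into_into f_inv_into_f complex_manifoldD(2)[OF M a]\<close>)
  have op: "openin (mtop (push b M)) (b ` W)" if W: "openin (mtop M) W" for W
  proof (subst openin_mtop_inj[of "push b M"])
    show "inj_on \<phi> U" if "(U, \<phi>) \<in> atlas (push b M)" for U \<phi> using at[OF that] injc by auto
    have WM: "W \<subseteq> points M" using W openin_mtop[OF M] by blast
    have "open (\<phi> ` (U \<inter> b ` W))" if a: "(U, \<phi>) \<in> atlas (push b M)" for U \<phi>
    proof -
      obtain V \<psi> where V: "U = b ` V" "\<phi> = \<psi> \<circ> inv_into (points M) b" "(V, \<psi>) \<in> atlas M"
        using at[OF a] by auto
      show ?thesis unfolding V(1,2) im[OF sub[OF V(3)] WM]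
        using W V(3) unfolding openin_mtop[OF M] by blast
    qed
    then show "b ` W \<subseteq> points (push b M) \<and> (\<forall>(U, \<phi>)\<in>atlas (push b M). open (\<phi> ` (U \<inter> b ` W)))"
      unfolding pts using WM by auto
  qed
  show "complex_manifold (push b M)"
  proof (rule complex_manifold_countable)
    show "(\<Union>(U, \<phi>)\<in>atlas (push b M). U) = points (push b M)"
      unfolding push_def complex_manifoldD(1)[OF M, symmetric] by (auto simp: image_iff)
    show "countable (atlas (push b M))" by (rule cnt)
    fix U \<phi> assume "(U, \<phi>) \<in> atlas (push b M)"
    then obtain V \<psi> where V: "U = b ` V" "\<phi> = \<psi> \<circ> inv_into (points M) b" "(V, \<psi>) \<in> atlas M"
      using at by blast
    show "inj_on \<phi> U \<and> open (\<phi> ` U)"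
      using injc[OF V(3)] im[of V V \<psi>] sub[OF V(3)] complex_manifoldD(3)[OF M V(3)] unfolding V(1,2)
      by simp
    fix U' \<phi>' assume "(U', \<phi>') \<in> atlas (push b M)"
    then obtain V' \<psi>' where V': "U' = b ` V'" "\<phi>' = \<psi>' \<circ> inv_into (points M) b" "(V', \<psi>') \<in> atlas M"
      using at by blast
    note o = complex_manifoldD(4)[OF M V(3) V'(3)]
    have "holo_on (\<psi> ` (V \<inter> V')) (\<psi>' \<circ> inv_into (points M) b \<circ> inv_into (b ` V) (\<psi> \<circ> inv_into (points M) b))"
    proof (rule holo_on_cong[OF complex_manifoldD(5)[OF M V(3) V'(3)] o])
      fix z assume z: "z \<in> \<psi> ` (V \<inter> V')"
      then have "z \<in> \<psi> ` V" by blast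
      then have "inv_into V \<psi> z \<in> points M" using sub[OF V(3)] inv_into_into[OF \<open>z \<in> \<psi> ` V\<close>] by blast
      then show "(\<psi>' \<circ> inv_into V \<psi>) z =
          (\<psi>' \<circ> inv_into (points M) b \<circ> inv_into (b ` V) (\<psi> \<circ> inv_into (points M) b)) z"
        using inv[OF V(3) \<open>z \<in> \<psi> ` V\<close>] by (simp add: bi)
    qed
    with o show "open (\<phi> ` (U \<inter> U')) \<and> holo_on (\<phi> ` (U \<inter> U')) (\<phi>' \<circ> inv_into U \<phi>)"
      unfolding V(1,2) V'(1,2) im[OF sub[OF V(3)] sub[OF V'(3)]] by simp
  next
    fix p q assume "p \<in> points (push b M)" "q \<in> points (push b M)" "p \<noteq> q"
    then obtain x y where xy: "p = b x" "q = b y" "x \<in> points M" "y \<in> points M" "x \<noteq> y"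
      unfolding pts by blast
    then have "x \<in> topspace (mtop M)" "y \<in> topspace (mtop M)" by (auto simp: topspace_mtop[OF M])
    then obtain A B where AB: "openin (mtop M) A" "openin (mtop M) B" "x \<in> A" "y \<in> B" "disjnt A B"
      using complex_manifoldD(6)[OF M] xy(5) unfolding Hausdorff_space_def by blast
    moreover have "A \<subseteq> points M" "B \<subseteq> points M" using AB openin_mtop[OF M] by blast+
    ultimately have "b ` A \<inter> b ` B = {}"
      using inj_on_image_Int[OF b, of A B] by (simp add: disjnt_def)
    then show "\<exists>A B. openin (mtop (push b M)) A \<and> openin (mtop (push b M)) B \<and>
        p \<in> A \<and> q \<in> B \<and> A \<inter> B = {}"
      using op[OF AB(1)] op[OF AB(2)] AB(3,4) xy(1,2)
      by (intro exI[of _ "b ` A"] exI[of _ "b ` B"]) simp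
  qed
  fix A :: "(complex ^ 'b) set" and \<sigma> assume s: "mchart M A \<sigma>"
  note sM = mchartD(3)[OF s]
  show "mchart (push b M) A (b \<circ> \<sigma>)"
    unfolding mchart_def
  proof (intro conjI ballI)
    show "open A" by (rule mchartD(1)[OF s])
    show inj: "inj_on (b \<circ> \<sigma>) A" by (rule comp_inj_on[OF mchartD(2)[OF s] inj_on_subset[OF b sM]])
    show "(b \<circ> \<sigma>) ` A \<subseteq> points (push b M)" using sM unfolding pts by auto
    fix a assume "a \<in> atlas (push b M)"
    then obtain V \<psi> where V: "a = (b ` V, \<psi> \<circ> inv_into (points M) b)" "(V, \<psi>) \<in> atlas M"
      using at by blast
    have 1: "{z\<in>A. (b \<circ> \<sigma>) z \<in> b ` V} = {z\<in>A. \<sigma> z \<in> V}"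
      using sM sub[OF V(2)] by (auto simp: image_iff ba subset_iff)
    have 2: "(\<psi> \<circ> inv_into (points M) b) ` (b ` V \<inter> (b \<circ> \<sigma>) ` A) = \<psi> ` (V \<inter> \<sigma> ` A)"
      using im[OF sub[OF V(2)] sM] by (simp add: image_comp)
    have 3: "holo_on {z\<in>A. \<sigma> z \<in> V} (\<psi> \<circ> inv_into (points M) b \<circ> (b \<circ> \<sigma>))"
      by (rule holo_on_cong[OF mchartD(5,4)[OF s V(2)]]) (use sM in \<open>auto simp: bi subset_iff\<close>)
    have 4: "holo_on (\<psi> ` (V \<inter> \<sigma> ` A)) (inv_into A (b \<circ> \<sigma>) \<circ> inv_into (b ` V) (\<psi> \<circ> inv_into (points M) b))"
    proof (rule holo_on_cong[OF mchartD(7,6)[OF s V(2)]])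
      fix z assume "z \<in> \<psi> ` (V \<inter> \<sigma> ` A)"
      then obtain w where w: "w \<in> A" "\<sigma> w \<in> V" "z = \<psi> (\<sigma> w)" by blast
      have 1: "inv_into V \<psi> z = \<sigma> w" using w complex_manifoldD(2)[OF M V(2)] by simp
      have 2: "inv_into (b ` V) (\<psi> \<circ> inv_into (points M) b) z = b (\<sigma> w)"
        using inv[OF V(2), of z] w 1 by simp
      have 3: "inv_into A (b \<circ> \<sigma>) (b (\<sigma> w)) = w" using inv_into_f_f[OF inj w(1)] by simp
      show "(inv_into A \<sigma> \<circ> inv_into V \<psi>) z =
          (inv_into A (b \<circ> \<sigma>) \<circ> inv_into (b ` V) (\<psi> \<circ> inv_into (points M) b)) z"
        by (simp only: o_apply 1 2 3 inv_into_f_f[OF mchartD(2)[OF s] w(1)])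
    qed
    show "case a of (U, \<phi>) \<Rightarrow> open {z\<in>A. (b \<circ> \<sigma>) z \<in> U} \<and> holo_on {z\<in>A. (b \<circ> \<sigma>) z \<in> U} (\<phi> \<circ> (b \<circ> \<sigma>)) \<and>
        open (\<phi> ` (U \<inter> (b \<circ> \<sigma>) ` A)) \<and>
        holo_on (\<phi> ` (U \<inter> (b \<circ> \<sigma>) ` A)) (inv_into A (b \<circ> \<sigma>) \<circ> inv_into U \<phi>)"
      unfolding V(1) prod.case 1 2 using 3 4 mchartD(4,6)[OF s V(2)] by simp
  qed
qed

text \<open>Equal points are identified simply by being equal, and both atlases are kept; this is
  sensible only for \<open>compatible\<close> pieces.\<close>

definition munion :: "('p, 'n::finite) cmanifold \<Rightarrow> ('p, 'n) cmanifold \<Rightarrow> ('p, 'n) cmanifold" where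
  "munion M N = \<lparr>points = points M \<union> points N, atlas = atlas M \<union> atlas N\<rparr>"

text \<open>A chart common to both structures around every common point forces the overlap to be
  open in both pieces and the two complex structures to agree on it.\<close>

definition compatible :: "('p, 'n::finite) cmanifold \<Rightarrow> ('p, 'n) cmanifold \<Rightarrow> bool" where
  "compatible M N \<longleftrightarrow> (\<forall>x\<in>points M \<inter> points N. \<exists>A \<sigma>. mchart M A \<sigma> \<and> mchart N A \<sigma> \<and> x \<in> \<sigma> ` A)"

lemma compatible_trans:
  assumes M: "complex_manifold M" and N: "complex_manifold N" and MN: "compatible M N"
    and s: "mchart M A \<sigma>" and t: "mchart N B \<tau>"
  shows "open {z\<in>A. \<sigma> z \<in> \<tau> ` B}" and "holo_on {z\<in>A. \<sigma> z \<in> \<tau> ` B} (inv_into B \<tau> \<circ> \<sigma>)"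
proof -
  have *: "\<exists>W. open W \<and> z \<in> W \<and> W \<subseteq> {z\<in>A. \<sigma> z \<in> \<tau> ` B} \<and> holo_on W (inv_into B \<tau> \<circ> \<sigma>)"
    if z: "z \<in> A" "\<sigma> z \<in> \<tau> ` B" for z
  proof -
    have "\<sigma> z \<in> points M \<inter> points N" using z mchartD(3)[OF s] mchartD(3)[OF t] by blast
    then obtain C \<mu> where c: "mchart M C \<mu>" "mchart N C \<mu>" "\<sigma> z \<in> \<mu> ` C"
      using MN unfolding compatible_def by blast
    note t1 = mchart_trans[OF M s c(1)] and t2 = mchart_trans[OF N c(2) t]
    define W where "W = {w \<in> {w\<in>A. \<sigma> w \<in> \<mu> ` C}. (inv_into C \<mu> \<circ> \<sigma>) w \<in> {v\<in>C. \<mu> v \<in> \<tau> ` B}}"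
    have oW: "open W" unfolding W_def by (rule holo_on_preimage[OF t1(2,1) t2(1)])
    have W: "w \<in> A" "\<sigma> w \<in> \<mu> ` C" "\<sigma> w \<in> \<tau> ` B" if "w \<in> W" for w
      using that unfolding W_def by (auto simp: f_inv_into_f)
    have "holo_on W ((inv_into B \<tau> \<circ> \<mu>) \<circ> (inv_into C \<mu> \<circ> \<sigma>))"
      by (rule holo_on_compose[OF holo_on_subset[OF t1(2)] t2(2)]) (auto simp: W_def)
    then have "holo_on W (inv_into B \<tau> \<circ> \<sigma>)"
      by (rule holo_on_cong[OF _ oW]) (use W in \<open>auto simp: f_inv_into_f\<close>)
    moreover have "z \<in> W" using z c(3) by (auto simp: W_def f_inv_into_f inv_into_into)
    ultimately show ?thesis using W oW by (intro exI[of _ W]) auto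
  qed
  show "open {z\<in>A. \<sigma> z \<in> \<tau> ` B}" by (subst open_subopen) (use * in blast)
  show "holo_on {z\<in>A. \<sigma> z \<in> \<tau> ` B} (inv_into B \<tau> \<circ> \<sigma>)"
    by (rule holo_on_local) (use * in blast)
qed

lemma compatible_sym: "compatible M N \<Longrightarrow> compatible N M"
  unfolding compatible_def by blast

lemma atlas_image_eq:
  assumes "inj_on \<phi> U"
  shows "\<phi> ` (U \<inter> V) = {z\<in>\<phi> ` U. inv_into U \<phi> z \<in> V}" "inv_into U \<phi> ` \<phi> ` U = U"
  using assms by (force simp: inv_into_f_f)+

lemma compatible_openin:
  assumes M: "complex_manifold M" and N: "complex_manifold N" and MN: "compatible M N"
    and W: "openin (mtop M) W" and b: "(V, \<psi>) \<in> atlas N"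
  shows "open (\<psi> ` (V \<inter> W))"
proof (subst open_subopen, safe)
  note inj = complex_manifoldD(2)[OF N b]
  fix x assume x: "x \<in> V" "x \<in> W"
  obtain A \<sigma> z where c: "mchart M A \<sigma>" "z \<in> A" "\<sigma> z = x" "\<sigma> ` A \<subseteq> W"
    using openin_mchart_at[OF M W x(2)] by blast
  have "open {w\<in>\<psi> ` V. inv_into V \<psi> w \<in> \<sigma> ` A}"
    by (rule compatible_trans(1)[OF N M compatible_sym[OF MN] mchart_atlas[OF N b] c(1)])
  then have "open (\<psi> ` (V \<inter> \<sigma> ` A))" unfolding atlas_image_eq(1)[OF inj] .
  then show "\<exists>T. open T \<and> \<psi> x \<in> T \<and> T \<subseteq> \<psi> ` (V \<inter> W)"
    using c x by (intro exI[of _ "\<psi> ` (V \<inter> \<sigma> ` A)"]) auto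
qed

lemma mchart_munion_left:
  assumes M: "complex_manifold M" and N: "complex_manifold N" and MN: "compatible M N"
    and s: "mchart M A \<sigma>"
  shows "mchart (munion M N) A \<sigma>"
  unfolding mchart_def
proof (intro conjI ballI)
  show "open A" "inj_on \<sigma> A" "\<sigma> ` A \<subseteq> points (munion M N)"
    using mchartD[OF s] by (auto simp: munion_def)
  fix a assume "a \<in> atlas (munion M N)"
  then consider U \<phi> where "a = (U, \<phi>)" "(U, \<phi>) \<in> atlas M" | U \<phi> where "a = (U, \<phi>)" "(U, \<phi>) \<in> atlas N"
    by (cases a) (auto simp: munion_def)
  then show "case a of (U, \<phi>) \<Rightarrow> open {z\<in>A. \<sigma> z \<in> U} \<and> holo_on {z\<in>A. \<sigma> z \<in> U} (\<phi> \<circ> \<sigma>) \<and>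
        open (\<phi> ` (U \<inter> \<sigma> ` A)) \<and> holo_on (\<phi> ` (U \<inter> \<sigma> ` A)) (inv_into A \<sigma> \<circ> inv_into U \<phi>)"
  proof cases
    case 1 then show ?thesis using mchartD[OF s] by simp
  next
    case 2
    note inj = complex_manifoldD(2)[OF N 2(2)]
    note t1 = compatible_trans[OF M N MN s mchart_atlas[OF N 2(2)], unfolded atlas_image_eq(2)[OF inj]]
    note t2 = compatible_trans[OF N M compatible_sym[OF MN] mchart_atlas[OF N 2(2)] s]
    have "holo_on {z\<in>A. \<sigma> z \<in> U} (\<phi> \<circ> \<sigma>)"
      by (rule holo_on_cong[OF t1(2,1)])
        (use inv_into_f_f[OF inj_on_inv_into[of "\<phi> ` U" \<phi> U]] inj in
          \<open>auto simp: inv_into_f_f intro!: inv_into_f_eq inj_on_inv_into\<close>)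
    then show ?thesis using 2 t1(1) t2 by (simp add: atlas_image_eq(1)[OF inj])
  qed
qed

lemma munion_comm: "munion M N = munion N M"
  by (auto simp: munion_def)

lemma mchart_munion_right:
  assumes "complex_manifold M" "complex_manifold N" "compatible M N" "mchart N A \<sigma>"
  shows "mchart (munion M N) A \<sigma>"
  using mchart_munion_left[OF assms(2,1) compatible_sym[OF assms(3)] assms(4)]
  by (simp add: munion_comm)

text \<open>Two points of one piece are separated in that piece. The pairs that remain for the
  Hausdorff property have one point in each difference of the pieces, and these are the subject of
  \<open>sep\<close>.\<close>

lemma complex_manifold_munion:
  assumes M: "complex_manifold M" and N: "complex_manifold N" and MN: "compatible M N"
    and cM: "countable (atlas M)" and cN: "countable (atlas N)"
    and sep: "\<And>x y. x \<in> points M - points N \<Longrightarrow> y \<in> points N - points M \<Longrightarrow>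
        \<exists>A B. openin (mtop M) A \<and> openin (mtop N) B \<and> x \<in> A \<and> y \<in> B \<and> A \<inter> B = {}"
  shows "complex_manifold (munion M N)"
proof -
  have at: "(U, \<phi>) \<in> atlas M \<or> (U, \<phi>) \<in> atlas N" if "(U, \<phi>) \<in> atlas (munion M N)" for U \<phi>
    using that by (simp add: munion_def)
  have injm: "inj_on \<phi> U" if "(U, \<phi>) \<in> atlas (munion M N)" for U \<phi>
    using at[OF that] complex_manifoldD(2)[OF M] complex_manifoldD(2)[OF N] by blast
  have op: "openin (mtop (munion P Q)) W"
    if P: "complex_manifold P" and Q: "complex_manifold Q" and c: "compatible P Q" and W: "openin (mtop P) W"
      and i: "\<And>U \<phi>. (U, \<phi>) \<in> atlas (munion P Q) \<Longrightarrow> inj_on \<phi> U" for P Q :: "('a, 'b) cmanifold" and W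
  proof (subst openin_mtop_inj[OF i], assumption, intro conjI ballI, goal_cases)
    case 1 then show ?case using W openin_mtop[OF P] by (auto simp: munion_def)
  next
    case (2 a)
    obtain U \<phi> where a: "a = (U, \<phi>)" by force
    have "open (\<phi> ` (U \<inter> W))"
    proof (cases "(U, \<phi>) \<in> atlas P")
      case True then show ?thesis using W unfolding openin_mtop[OF P] by blast
    next
      case False
      then have "(U, \<phi>) \<in> atlas Q" using 2 a by (simp add: munion_def)
      then show ?thesis by (rule compatible_openin[OF P Q c W])
    qed
    then show ?case by (simp add: a)
  qed
  have o1: "openin (mtop (munion M N)) W" if "openin (mtop M) W" for W
    by (rule op[OF M N MN that injm])
  have o2: "openin (mtop (munion M N)) W" if "openin (mtop N) W" for W
    using op[OF N M compatible_sym[OF MN] that] injm by (simp add: munion_comm)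
  have tr: "open (\<phi> ` (U \<inter> V)) \<and> holo_on (\<phi> ` (U \<inter> V)) (\<psi> \<circ> inv_into U \<phi>)"
    if P: "complex_manifold P" and Q: "complex_manifold Q" and c: "compatible P Q"
      and a: "(U, \<phi>) \<in> atlas P" and b: "(V, \<psi>) \<in> atlas Q" for P Q :: "('a, 'b) cmanifold" and U \<phi> V \<psi>
  proof -
    note iU = complex_manifoldD(2)[OF P a] and iV = complex_manifoldD(2)[OF Q b]
    note t = compatible_trans[OF P Q c mchart_atlas[OF P a] mchart_atlas[OF Q b],
        unfolded atlas_image_eq(2)[OF iV], folded atlas_image_eq(1)[OF iU]]
    have "holo_on (\<phi> ` (U \<inter> V)) (\<psi> \<circ> inv_into U \<phi>)"
      by (rule holo_on_cong[OF t(2,1)])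
        (use iU iV in \<open>auto simp: inv_into_f_f intro!: inv_into_f_eq inj_on_inv_into\<close>)
    with t(1) show ?thesis by simp
  qed
  show ?thesis
  proof (rule complex_manifold_countable)
    show "(\<Union>(U, \<phi>)\<in>atlas (munion M N). U) = points (munion M N)"
      unfolding munion_def using complex_manifoldD(1)[OF M] complex_manifoldD(1)[OF N] by simp
    show "countable (atlas (munion M N))" using cM cN by (simp add: munion_def)
    fix U \<phi> assume a: "(U, \<phi>) \<in> atlas (munion M N)"
    show "inj_on \<phi> U \<and> open (\<phi> ` U)"
      using at[OF a] injm[OF a] complex_manifoldD(3)[OF M] complex_manifoldD(3)[OF N] by blast
    fix V \<psi> assume b: "(V, \<psi>) \<in> atlas (munion M N)"
    from at[OF a] at[OF b] show "open (\<phi> ` (U \<inter> V)) \<and> holo_on (\<phi> ` (U \<inter> V)) (\<psi> \<circ> inv_into U \<phi>)"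
      using complex_manifoldD(4,5)[OF M] complex_manifoldD(4,5)[OF N]
        tr[OF M N MN] tr[OF N M compatible_sym[OF MN]] by (elim disjE) simp_all
  next
    fix x y assume xy: "x \<in> points (munion M N)" "y \<in> points (munion M N)" "x \<noteq> y"
    have H: "\<exists>A B. openin (mtop P) A \<and> openin (mtop P) B \<and> x \<in> A \<and> y \<in> B \<and> A \<inter> B = {}"
      if P: "complex_manifold P" "x \<in> points P" "y \<in> points P" for P :: "('a, 'b) cmanifold"
      using complex_manifoldD(6)[OF P(1)] that xy(3)
      unfolding Hausdorff_space_def topspace_mtop[OF P(1)] disjnt_def by blast
    consider "x \<in> points M" "y \<in> points M" | "x \<in> points N" "y \<in> points N"
      | "x \<in> points M - points N" "y \<in> points N - points M"
      | "y \<in> points M - points N" "x \<in> points N - points M"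
      using xy by (auto simp: munion_def)
    then show "\<exists>A B. openin (mtop (munion M N)) A \<and> openin (mtop (munion M N)) B \<and>
        x \<in> A \<and> y \<in> B \<and> A \<inter> B = {}"
    proof cases
      case 1 from H[OF M 1] show ?thesis using o1 by blast
    next
      case 2 from H[OF N 2] show ?thesis using o2 by blast
    next
      case 3 from sep[OF 3] show ?thesis using o1 o2 by blast
    next
      case 4 from sep[OF 4] show ?thesis using o1 o2 by (metis Int_commute)
    qed
  qed
qed

section \<open>Model spaces\<close>

lemma affine_space_manifold:
  "complex_manifold (affine_space :: (complex ^ 'n::finite, 'n) cmanifold)"
  "mchart (affine_space :: (complex ^ 'n::finite, 'n) cmanifold) UNIV id"
  "countable (atlas (affine_space :: (complex ^ 'n::finite, 'n) cmanifold))"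
proof -
  note f = complex_manifold_family[of "affine_space :: (complex ^ 'n, 'n) cmanifold"
      "\<lambda>_. id" "\<lambda>_. UNIV" "{()}" "\<lambda>_. id"]
  show "complex_manifold (affine_space :: (complex ^ 'n, 'n) cmanifold)"
    by (rule f(1)) (auto simp: affine_space_def)
  show "mchart (affine_space :: (complex ^ 'n, 'n) cmanifold) UNIV id"
    by (rule f(2)) (auto simp: affine_space_def)
  show "countable (atlas (affine_space :: (complex ^ 'n, 'n) cmanifold))"
    by (simp add: affine_space_def)
qed

lemma complex_line_manifold:
  "complex_manifold complex_line" "mchart complex_line UNIV (\<lambda>z. z $ 1)"
  "countable (atlas complex_line)"
proof -
  have v: "vec (z $ 1) = z" for z :: "complex ^ 1" by (simp add: vec_eq_iff)
  have r: "range (\<lambda>z::complex ^ 1. z $ 1) = UNIV" by (metis surjI vec_component)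
  note f = complex_manifold_family[of "complex_line" "\<lambda>_ z. z $ 1" "\<lambda>_. UNIV" "{()}" "\<lambda>_. vec"]
  show "complex_manifold complex_line"
    by (rule f(1)) (auto simp: complex_line_def v r)
  show "mchart complex_line UNIV (\<lambda>z. z $ 1)"
    by (rule f(2)) (auto simp: complex_line_def v r)
  show "countable (atlas complex_line)" by (simp add: complex_line_def)
qed

section \<open>Lines through the origin and projective spaces\<close>

lemma smult_mem_line_through [intro, simp]: "c *s v \<in> line_through v"
  unfolding line_through_def by blast

lemma mem_line_through [intro, simp]: "v \<in> line_through v"
  unfolding line_through_def by (metis rangeI scaleR_one vector_smult_lid)

lemma line_through_smult: "c \<noteq> 0 \<Longrightarrow> line_through (c *s v) = line_through v"
proof
  assume c: "c \<noteq> 0"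
  show "line_through v \<subseteq> line_through (c *s v)"
  proof
    fix x assume "x \<in> line_through v"
    then obtain d where "x = d *s v" unfolding line_through_def by blast
    then have "x = (d / c) *s (c *s v)" using c by simp
    then show "x \<in> line_through (c *s v)" by blast
  qed
qed (auto simp: line_through_def)

lemma line_through_eq:
  assumes "w \<in> line_through v" "w \<noteq> 0" shows "line_through w = line_through v"
proof -
  obtain c where c: "w = c *s v" using assms(1) unfolding line_through_def by blast
  then have "c \<noteq> 0" using assms(2) by auto
  then show ?thesis unfolding c by (rule line_through_smult)
qed

text \<open>The right-hand side is the vanishing of all 2 by 2 minors. Their nonvanishing is an open
  condition on pairs, and this yields the Hausdorff property of projective spaces and of the blow-up
  of the origin.\<close>

lemma line_through_eq_iff:
  assumes "v \<noteq> 0" "w \<noteq> 0"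
  shows "line_through v = line_through w \<longleftrightarrow> (\<forall>a b. v $ a * w $ b = v $ b * w $ a)"
proof
  assume "line_through v = line_through w"
  then have "w \<in> line_through v" by auto
  then obtain c where "w = c *s v" unfolding line_through_def by blast
  then show "\<forall>a b. v $ a * w $ b = v $ b * w $ a" by (simp add: algebra_simps)
next
  assume eq: "\<forall>a b. v $ a * w $ b = v $ b * w $ a"
  obtain i where i: "v $ i \<noteq> 0" using assms(1) by (auto simp: vec_eq_iff)
  have w: "w = (w $ i / v $ i) *s v"
    using eq[THEN spec, of i] i by (auto simp: vec_eq_iff field_simps)
  then have "w \<in> line_through v" by (metis smult_mem_line_through)
  then show "line_through v = line_through w" using line_through_eq assms(2) by blast
qed

lemma line_coord_line_through:
  assumes "v $ i \<noteq> 0" shows "line_coord i (line_through v) = (1 / v $ i) *s v"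
  unfolding line_coord_def
proof (rule the_equality)
  show "(1 / v $ i) *s v \<in> line_through v \<and> ((1 / v $ i) *s v) $ i = 1" using assms by simp
  fix w assume "w \<in> line_through v \<and> w $ i = 1"
  then obtain c where c: "w = c *s v" unfolding line_through_def by blast
  then have "c * v $ i = 1" using \<open>w \<in> line_through v \<and> w $ i = 1\<close> by simp
  with c show "w = (1 / v $ i) *s v" using assms by (simp add: field_simps)
qed

text \<open>Homogeneous coordinates normalized to 1 at the index \<open>i\<close>: the inverse of
  the affine chart that belongs to \<open>i\<close> and to the matching \<open>e\<close> of the
  remaining indices.\<close>

definition hcoord :: "'m \<Rightarrow> ('n \<Rightarrow> 'm) \<Rightarrow> complex ^ 'n \<Rightarrow> complex ^ 'm" where
  "hcoord i e z = (\<chi> m. if m = i then 1 else z $ inv e m)"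

lemma projective_space_manifold:
  fixes P :: "((complex ^ 'm::finite) set, 'n::finite) cmanifold"
  defines "P \<equiv> projective_space"
  assumes card: "CARD('m) = Suc CARD('n)"
  shows "complex_manifold P" "countable (atlas P)"
    "\<And>i e. bij_betw e UNIV (UNIV - {i}) \<Longrightarrow> mchart P UNIV (\<lambda>z. line_through (hcoord i e z))"
proof -
  define I where "I = {(i :: 'm, e :: 'n \<Rightarrow> 'm). bij_betw e UNIV (UNIV - {i})}"
  define \<sigma> :: "'m \<times> ('n \<Rightarrow> 'm) \<Rightarrow> complex ^ 'n \<Rightarrow> (complex ^ 'm) set"
    where "\<sigma> = (\<lambda>(i, e) z. line_through (hcoord i e z))"
  define \<phi> :: "'m \<times> ('n \<Rightarrow> 'm) \<Rightarrow> (complex ^ 'm) set \<Rightarrow> complex ^ 'n"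
    where "\<phi> = (\<lambda>(i, e) l. \<chi> k. line_coord i l $ e k)"
  have hi: "hcoord i e z $ i = 1" for i and e :: "'n \<Rightarrow> 'm" and z by (simp add: hcoord_def)
  have hn: "hcoord i e z \<noteq> 0" for i and e :: "'n \<Rightarrow> 'm" and z
    using hi[of i e z] by (metis zero_index zero_neq_one)
  have he: "hcoord i e z $ e k = z $ k" if "bij_betw e UNIV (UNIV - {i})" for i e k and z :: "complex ^ 'n"
  proof -
    have "e k \<noteq> i" using that by (auto simp: bij_betw_def)
    moreover have "inv e (e k) = k" using that by (simp add: bij_betw_def)
    ultimately show ?thesis by (simp add: hcoord_def)
  qed
  have im: "range (\<sigma> (i, e)) = {line_through v |v. v $ i \<noteq> 0}" if b: "bij_betw e UNIV (UNIV - {i})" for i and e :: "'n \<Rightarrow> 'm"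
  proof safe
    show "\<exists>v. \<sigma> (i, e) z = line_through v \<and> v $ i \<noteq> 0" for z
      using hi[of i e z] by (auto simp: \<sigma>_def intro!: exI[of _ "hcoord i e z"])
    fix v :: "complex ^ 'm" assume v: "v $ i \<noteq> 0"
    have "hcoord i e (\<chi> k. v $ e k / v $ i) = (1 / v $ i) *s v"
    proof -
      have "e (inv e m) = m" if "m \<noteq> i" for m
      proof -
        have "m \<in> range e" using b that unfolding bij_betw_def by simp
        then show ?thesis by (rule f_inv_into_f)
      qed
      then show ?thesis using v by (auto simp: hcoord_def vec_eq_iff)
    qed
    then have "\<sigma> (i, e) (\<chi> k. v $ e k / v $ i) = line_through v"
      using v line_through_smult[of "1 / v $ i" v] by (simp add: \<sigma>_def)
    then show "line_through v \<in> range (\<sigma> (i, e))" by (rule range_eqI[OF sym])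
  qed
  have ex: "\<exists>e :: 'n \<Rightarrow> 'm. bij_betw e UNIV (UNIV - {i})" for i :: 'm
    by (rule finite_same_card_bij) (auto simp: card card_Diff_singleton)
  have cd: "cdiff (\<lambda>z. hcoord i e z $ m) z" for i m z and e :: "'n \<Rightarrow> 'm"
    by (cases "m = i") (auto simp: hcoord_def)
  have p1: "points P = (\<Union>x\<in>I. \<sigma> x ` UNIV)"
  proof -
    have "(\<Union>x\<in>I. \<sigma> x ` UNIV) = (\<Union>i. {line_through v |v. v $ i \<noteq> 0})"
    proof (intro equalityI UN_least)
      fix x assume "x \<in> I"
      then obtain i and e :: "'n \<Rightarrow> 'm" where "x = (i, e)" "bij_betw e UNIV (UNIV - {i})" unfolding I_def by auto
      then show "\<sigma> x ` UNIV \<subseteq> (\<Union>i. {line_through v |v. v $ i \<noteq> 0})"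
        using im[of e i] by (simp only:) (rule UN_upper, simp)
    next
      fix i
      obtain e :: "'n \<Rightarrow> 'm" where e: "bij_betw e UNIV (UNIV - {i})" using ex by blast
      then have "(i, e) \<in> I" by (simp add: I_def)
      then show "{line_through v |v. v $ i \<noteq> 0} \<subseteq> (\<Union>x\<in>I. \<sigma> x ` UNIV)"
        unfolding im[OF e, symmetric] by (rule UN_upper)
    qed
    also have "\<dots> = points P" unfolding P_def projective_space_def by (auto simp: vec_eq_iff)
    finally show ?thesis by simp
  qed
  have p2: "atlas P = (\<lambda>x. (\<sigma> x ` UNIV, \<phi> x)) ` I"
  proof -
    have "(\<lambda>x. (\<sigma> x ` UNIV, \<phi> x)) ` I = (\<lambda>(i, e). ({line_through v |v. v $ i \<noteq> 0}, \<lambda>l. \<chi> k. line_coord i l $ e k)) ` I"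
    proof (rule image_cong[OF refl])
      fix x assume "x \<in> I"
      then obtain i and e :: "'n \<Rightarrow> 'm" where x: "x = (i, e)" "bij_betw e UNIV (UNIV - {i})"
        unfolding I_def by auto
      show "(\<sigma> x ` UNIV, \<phi> x) = (case x of (i, e) \<Rightarrow>
          ({line_through v |v. v $ i \<noteq> 0}, \<lambda>l. \<chi> k. line_coord i l $ e k))"
        unfolding x(1) im[OF x(2)] by (simp add: \<phi>_def)
    qed
    also have "\<dots> = atlas P" unfolding P_def projective_space_def I_def by auto
    finally show ?thesis by simp
  qed
  have p3: "\<phi> x (\<sigma> x z) = z" if "x \<in> I" for x z
    using that he by (auto simp: \<phi>_def \<sigma>_def I_def line_coord_line_through hi vec_eq_iff)
  have p4: "open {z\<in>UNIV. \<sigma> x z \<in> \<sigma> y ` UNIV} \<and> holo_on {z\<in>UNIV. \<sigma> x z \<in> \<sigma> y ` UNIV} (\<lambda>z. \<phi> y (\<sigma> x z))"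
    if xy: "x \<in> I" "y \<in> I" for x y
  proof -
    obtain i e j e' where x: "x = (i, e)" "bij_betw e UNIV (UNIV - {i})" and y: "y = (j, e')" "bij_betw e' UNIV (UNIV - {j})"
      using xy unfolding I_def by auto
    have nz: "line_through v \<in> range (\<sigma> y) \<longleftrightarrow> v $ j \<noteq> 0" if "v \<noteq> 0" for v
    proof
      assume "line_through v \<in> range (\<sigma> y)"
      then obtain w where w: "line_through v = line_through w" "w $ j \<noteq> 0"
        unfolding y(1) im[OF y(2)] by blast
      then have "w \<in> line_through v" by simp
      then show "v $ j \<noteq> 0" using w(2) unfolding line_through_def by auto
    qed (auto simp: y(1) im[OF y(2)])
    have eq: "{z\<in>UNIV. \<sigma> x z \<in> \<sigma> y ` UNIV} = {z. hcoord i e z $ j \<noteq> 0}"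
      using nz[OF hn] by (simp add: x(1) \<sigma>_def)
    have "continuous_on UNIV (\<lambda>z. hcoord i e z $ j)"
      by (cases "j = i"; simp add: hcoord_def; intro continuous_intros)
    then have o: "open {z. hcoord i e z $ j \<noteq> 0}" by (intro open_Collect_neq) auto
    have "holo_on {z. hcoord i e z $ j \<noteq> 0} (\<lambda>z. \<chi> k. hcoord i e z $ e' k / hcoord i e z $ j)"
      unfolding holo_on_iff by (auto intro!: cd)
    then have "holo_on {z. hcoord i e z $ j \<noteq> 0} (\<lambda>z. \<phi> y (\<sigma> x z))"
      by (rule holo_on_cong[OF _ o]) (simp add: x(1) y(1) \<sigma>_def \<phi>_def line_coord_line_through)
    with o show ?thesis unfolding eq by simp
  qed
  have p5: "\<exists>V W. open V \<and> open W \<and> z \<in> V \<and> z' \<in> W \<and> (\<forall>v\<in>V \<inter> UNIV. \<forall>w\<in>W \<inter> UNIV. \<sigma> x v \<noteq> \<sigma> y w)"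
    if xy: "\<sigma> x z \<noteq> \<sigma> y z'" for x y z z'
  proof -
    obtain i e j e' where x: "x = (i, e)" "y = (j, e')" by (metis surj_pair)
    obtain a b where ab: "hcoord i e z $ a * hcoord j e' z' $ b \<noteq> hcoord i e z $ b * hcoord j e' z' $ a"
      using xy line_through_eq_iff[of "hcoord i e z" "hcoord j e' z'", OF hn hn] by (auto simp: \<sigma>_def x)
    define Q where "Q = {(v, w). hcoord i e v $ a * hcoord j e' w $ b \<noteq> hcoord i e v $ b * hcoord j e' w $ a}"
    have cont: "continuous_on UNIV (\<lambda>p. hcoord i e (fst p) $ a)"
       "continuous_on UNIV (\<lambda>p. hcoord i e (snd p) $ a)" for i a and e :: "'n \<Rightarrow> 'm"
      by (cases "a = i"; simp add: hcoord_def; intro continuous_intros)+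
    have "open Q" unfolding Q_def split_beta
      by (intro open_Collect_neq continuous_on_mult cont)
    moreover have "(z, z') \<in> Q" using ab by (simp add: Q_def)
    ultimately obtain V W where VW: "open V" "open W" "(z, z') \<in> V \<times> W" "V \<times> W \<subseteq> Q"
      by (rule open_prod_elim)
    have "\<sigma> x v \<noteq> \<sigma> y w" if "v \<in> V" "w \<in> W" for v w
      using VW(4) that line_through_eq_iff[of "hcoord i e v" "hcoord j e' w", OF hn hn] by (auto simp: \<sigma>_def x Q_def)
    then show ?thesis using VW by (intro exI[of _ V] exI[of _ W]) auto
  qed
  have fin: "countable I" by (rule countable_finite) simp
  show "complex_manifold P"
    by (rule complex_manifold_family(1)[OF p1 p2 fin]) (use p3 p4 p5 in auto)
  show "countable (atlas P)" unfolding p2 using fin by simp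
  fix i and e :: "'n \<Rightarrow> 'm" assume "bij_betw e UNIV (UNIV - {i})"
  then have "(i, e) \<in> I" by (simp add: I_def)
  then have "mchart P UNIV (\<sigma> (i, e))"
    by (intro complex_manifold_family(2)[OF p1 p2 fin]) (use p3 p4 p5 in auto)
  then show "mchart P UNIV (\<lambda>z. line_through (hcoord i e z))" by (simp add: \<sigma>_def)
qed

lemma P1_manifold:
  "complex_manifold P1" "countable (atlas P1)"
  "mchart P1 UNIV (\<lambda>z. line_through (vector [1, z $ 1]))"
  "mchart P1 UNIV (\<lambda>z. line_through (vector [z $ 1, 1]))"
proof -
  have "CARD(2) = Suc CARD(1)" by simp
  note p = projective_space_manifold[OF this]
  show "complex_manifold P1" "countable (atlas P1)" using p(1,2) .
  have u1: "(UNIV :: 2 set) - {1} = {2}" and u2: "(UNIV :: 2 set) - {2} = {1}"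
    by (auto simp: UNIV_2)
  have b1: "bij_betw (\<lambda>_::1. 2::2) UNIV (UNIV - {1})" and b2: "bij_betw (\<lambda>_::1. 1::2) UNIV (UNIV - {2})"
    unfolding u1 u2 by (auto simp: bij_betw_def inj_on_def)
  have inv1: "inv_into A f b = (1::1)" for A and f :: "1 \<Rightarrow> 2" and b by (rule num1_eq1)
  have "hcoord 1 (\<lambda>_::1. 2::2) z = vector [1, z $ 1]" "hcoord 2 (\<lambda>_::1. 1::2) z = vector [z $ 1, 1]" for z
    by (auto simp: hcoord_def vec_eq_iff forall_2 inv1)
  then show "mchart P1 UNIV (\<lambda>z. line_through (vector [1, z $ 1]))"
    "mchart P1 UNIV (\<lambda>z. line_through (vector [z $ 1, 1]))"
    using p(3)[OF b1] p(3)[OF b2] by simp_all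
qed

lemma P2_manifold:
  "complex_manifold P2" "countable (atlas P2)"
  "mchart P2 UNIV (\<lambda>z. line_through (vector [1, z $ 1, z $ 2]))"
  "mchart P2 UNIV (\<lambda>z. line_through (vector [z $ 1, 1, z $ 2]))"
  "mchart P2 UNIV (\<lambda>z. line_through (vector [z $ 1, z $ 2, 1]))"
proof -
  have "CARD(3) = Suc CARD(2)" by simp
  note p = projective_space_manifold[OF this]
  show "complex_manifold P2" "countable (atlas P2)" using p(1,2) .
  have *: "mchart P2 UNIV (\<lambda>z. line_through (hcoord i e z)) \<and> inv e (e 1) = 1 \<and> inv e (e 2) = 2"
    if "{e 1, e 2} = UNIV - {i}" "e 1 \<noteq> e 2" for i :: 3 and e :: "2 \<Rightarrow> 3"
  proof -
    have "inj e" unfolding inj_def forall_2 using that(2) by auto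
    moreover have "range e = UNIV - {i}" using that(1) by (simp add: UNIV_2)
    ultimately show ?thesis using p(3)[of e i] by (simp add: bij_betw_def)
  qed
  have d: "(2::3) \<noteq> 1" "(3::3) \<noteq> 1" "(3::3) \<noteq> 2" "(1::3) \<noteq> 2" "(1::3) \<noteq> 3" "(2::3) \<noteq> 3" "(2::2) \<noteq> 1" by simp_all
  define e1 e2 e3 :: "2 \<Rightarrow> 3" where "e1 = (\<lambda>k. if k = 1 then 2 else 3)"
    and "e2 = (\<lambda>k. if k = 1 then 1 else 3)" and "e3 = (\<lambda>k. if k = 1 then 1 else 2)"
  have 1: "{e1 1, e1 2} = UNIV - {1}" "e1 1 \<noteq> e1 2" and 2: "{e2 1, e2 2} = UNIV - {2}" "e2 1 \<noteq> e2 2"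
    and 3: "{e3 1, e3 2} = UNIV - {3}" "e3 1 \<noteq> e3 2"
    unfolding e1_def e2_def e3_def using exhaust_3 d by auto
  have "hcoord 1 e1 z = vector [1, z $ 1, z $ 2]" for z
    using *[OF 1] d by (auto simp: hcoord_def vec_eq_iff forall_3 e1_def)
  moreover have "hcoord 2 e2 z = vector [z $ 1, 1, z $ 2]" for z
    using *[OF 2] d by (auto simp: hcoord_def vec_eq_iff forall_3 e2_def)
  moreover have "hcoord 3 e3 z = vector [z $ 1, z $ 2, 1]" for z
    using *[OF 3] d by (auto simp: hcoord_def vec_eq_iff forall_3 e3_def)
  ultimately show "mchart P2 UNIV (\<lambda>z. line_through (vector [1, z $ 1, z $ 2]))"
    "mchart P2 UNIV (\<lambda>z. line_through (vector [z $ 1, 1, z $ 2]))"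
    "mchart P2 UNIV (\<lambda>z. line_through (vector [z $ 1, z $ 2, 1]))"
    using *[OF 1] *[OF 2] *[OF 3] by simp_all
qed

text \<open>A point of the \<open>i\<close>-th chart of the blow-up of the origin has slope vector
  \<open>slope i z\<close> and lies over \<open>bdown i z\<close>.\<close>

definition slope :: "2 \<Rightarrow> complex ^ 2 \<Rightarrow> complex ^ 2" where
  "slope i z = (\<chi> j. if j = i then 1 else z $ j)"

definition bdown :: "2 \<Rightarrow> complex ^ 2 \<Rightarrow> complex ^ 2" where
  "bdown i z = z $ i *s slope i z"

lemma slope_nth [simp]: "slope i z $ i = 1" "j \<noteq> i \<Longrightarrow> slope i z $ j = z $ j"
  by (simp_all add: slope_def)

lemma slope_nz [simp]: "slope i z \<noteq> 0"
  by (metis slope_nth(1) zero_index zero_neq_one)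

lemma bdown_nth: "bdown i z $ j = (if j = i then z $ i else z $ i * z $ j)"
  by (simp add: bdown_def)

lemma bdown_eq_0_iff: "bdown i z = 0 \<longleftrightarrow> z $ i = 0"
  by (simp add: bdown_def)

lemma cdiff_slope [intro]: "cdiff (\<lambda>z. slope i z $ j) z"
  by (cases "j = i") (auto simp: slope_def)

lemma cdiff_bdown [intro]: "cdiff (\<lambda>z. bdown i z $ j) z"
  by (cases "j = i") (auto simp: bdown_nth)

lemma holo_on_bdown: "holo_on W (bdown i)"
  unfolding holo_on_iff by auto

lemma blowup_origin_manifold:
  "complex_manifold blowup_origin" "countable (atlas blowup_origin)"
  "mchart blowup_origin UNIV (\<lambda>z. (bdown i z, line_through (slope i z)))"
  "points blowup_origin = (\<Union>i. range (\<lambda>z. (bdown i z, line_through (slope i z))))"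
proof -
  define \<sigma> where "\<sigma> = (\<lambda>i z. (bdown i z, line_through (slope i z)))"
  define \<phi> :: "2 \<Rightarrow> (complex ^ 2) \<times> (complex ^ 2) set \<Rightarrow> complex ^ 2"
    where "\<phi> = (\<lambda>i (z, l). \<chi> j. if j = i then z $ i else line_coord i l $ j)"
  have im: "range (\<sigma> i) = {(z, line_through v) |z v. v $ i \<noteq> 0 \<and> z \<in> line_through v}" for i
  proof (intro equalityI subsetI)
    fix q assume "q \<in> range (\<sigma> i)"
    then obtain z where "q = \<sigma> i z" by blast
    then show "q \<in> {(z, line_through v) |z v. v $ i \<noteq> 0 \<and> z \<in> line_through v}"
      by (auto simp: \<sigma>_def bdown_def intro!: exI[of _ "slope i z"])
  next
    fix q assume "q \<in> {(z, line_through v) |z v. v $ i \<noteq> 0 \<and> z \<in> line_through v}"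
    then obtain z v where q: "q = (z, line_through v)" and v: "v $ i \<noteq> 0" "z \<in> line_through v"
      by blast
    define w where "w = (\<chi> j. if j = i then z $ i else v $ j / v $ i)"
    have s: "slope i w = (1 / v $ i) *s v" using v by (auto simp: slope_def w_def vec_eq_iff)
    obtain c where "z = c *s v" using v(2) unfolding line_through_def by blast
    moreover have "w $ i = z $ i" by (simp add: w_def)
    ultimately have "bdown i w = z" using v by (simp add: bdown_def s)
    then have "\<sigma> i w = (z, line_through v)" unfolding \<sigma>_def s using v line_through_smult[of "1 / v $ i" v] by simp
    then show "q \<in> range (\<sigma> i)" unfolding q by (rule range_eqI[OF sym])
  qed
  have p1: "points blowup_origin = (\<Union>x\<in>UNIV. \<sigma> x ` UNIV)"
  proof -
    have "points blowup_origin = {(z, line_through v) |z v. v \<noteq> 0 \<and> z \<in> line_through v}"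
      unfolding blowup_origin_def projective_space_def by auto
    also have "\<dots> = (\<Union>x\<in>UNIV. \<sigma> x ` UNIV)" unfolding im by (auto simp: vec_eq_iff)
    finally show ?thesis .
  qed
  have p2: "atlas blowup_origin = (\<lambda>x. (\<sigma> x ` UNIV, \<phi> x)) ` UNIV"
    unfolding im \<phi>_def blowup_origin_def by auto
  have p3: "\<phi> i (\<sigma> i z) = z" for i z
    by (simp add: \<phi>_def \<sigma>_def line_coord_line_through bdown_nth vec_eq_iff)
  have nz: "(u, line_through v) \<in> range (\<sigma> j) \<longleftrightarrow> v $ j \<noteq> 0" if "v \<noteq> 0" "u \<in> line_through v" for u v j
  proof
    assume "(u, line_through v) \<in> range (\<sigma> j)"
    then obtain w where w: "line_through v = line_through w" "w $ j \<noteq> 0" unfolding im by blast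
    then have "w \<in> line_through v" by simp
    then show "v $ j \<noteq> 0" using w(2) unfolding line_through_def by auto
  qed (use that in \<open>auto simp: im\<close>)
  have p4: "open {z\<in>UNIV. \<sigma> i z \<in> \<sigma> j ` UNIV} \<and> holo_on {z\<in>UNIV. \<sigma> i z \<in> \<sigma> j ` UNIV} (\<lambda>z. \<phi> j (\<sigma> i z))"
    for i j
  proof -
    have eq: "{z\<in>UNIV. \<sigma> i z \<in> \<sigma> j ` UNIV} = {z. slope i z $ j \<noteq> 0}"
      using nz by (simp add: \<sigma>_def bdown_def)
    have "continuous_on UNIV (\<lambda>z. slope i z $ j)"
      by (cases "j = i") (auto simp: slope_def intro!: continuous_intros)
    then have o: "open {z. slope i z $ j \<noteq> 0}" by (intro open_Collect_neq) auto
    have "holo_on {z. slope i z $ j \<noteq> 0} (\<lambda>z. \<chi> k. if k = j then bdown i z $ j else slope i z $ k / slope i z $ j)"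
      unfolding holo_on_iff
    proof (intro ballI allI)
      fix z k assume "z \<in> {z. slope i z $ j \<noteq> 0}"
      then show "cdiff (\<lambda>w. (\<chi> k. if k = j then bdown i w $ j else slope i w $ k / slope i w $ j) $ k) z"
        by (cases "k = j") auto
    qed
    then have "holo_on {z. slope i z $ j \<noteq> 0} (\<lambda>z. \<phi> j (\<sigma> i z))"
      by (rule holo_on_cong[OF _ o]) (simp add: \<sigma>_def \<phi>_def line_coord_line_through vec_eq_iff)
    with o show ?thesis unfolding eq by simp
  qed
  have p5: "\<exists>V W. open V \<and> open W \<and> z \<in> V \<and> z' \<in> W \<and> (\<forall>v\<in>V \<inter> UNIV. \<forall>w\<in>W \<inter> UNIV. \<sigma> i v \<noteq> \<sigma> j w)"
    if xy: "\<sigma> i z \<noteq> \<sigma> j z'" for i j z z'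
  proof -
    \<comment> \<open>Two points of the incidence variety differ iff their base points differ or
      some minor of their slope vectors does not vanish. Each alternative is open, so
      \<open>Q\<close> contains a product neighbourhood of each of its pairs.\<close>
    define Q where "Q = {(v, w). bdown i v \<noteq> bdown j w} \<union>
       (\<Union>a. \<Union>b. {(v, w). slope i v $ a * slope j w $ b \<noteq> slope i v $ b * slope j w $ a})"
    have ev: "\<sigma> i v \<noteq> \<sigma> j w \<longleftrightarrow> (v, w) \<in> Q" for v w
      by (auto simp: \<sigma>_def Q_def line_through_eq_iff)
    have cs: "continuous_on UNIV (\<lambda>p. slope i (fst p) $ a)" "continuous_on UNIV (\<lambda>p. slope i (snd p) $ a)" for i a
      by (cases "a = i"; simp add: slope_def; intro continuous_intros)+
    have cb: "continuous_on UNIV (\<lambda>p. bdown i (fst p))" "continuous_on UNIV (\<lambda>p. bdown i (snd p))" for i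
      by (rule continuous_on_compose2[OF holo_on_continuous[OF holo_on_bdown[of UNIV]]]; intro continuous_intros subset_UNIV)+
    have "open Q" unfolding Q_def split_beta
      by (intro open_Un open_UN ballI open_Collect_neq continuous_on_mult cs cb)
    moreover have "(z, z') \<in> Q" using xy ev by simp
    ultimately obtain V W where VW: "open V" "open W" "(z, z') \<in> V \<times> W" "V \<times> W \<subseteq> Q"
      by (rule open_prod_elim)
    then show ?thesis using ev by (intro exI[of _ V] exI[of _ W]) auto
  qed
  have fin: "countable (UNIV :: 2 set)" by (rule countable_finite) simp
  show "complex_manifold blowup_origin"
    by (rule complex_manifold_family(1)[OF p1 p2 fin]) (use p3 p4 p5 in auto)
  show "countable (atlas blowup_origin)" unfolding p2 by simp
  have "mchart blowup_origin UNIV (\<sigma> i)"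
    by (rule complex_manifold_family(2)[OF p1 p2 fin]) (use p3 p4 p5 in auto)
  then show "mchart blowup_origin UNIV (\<lambda>z. (bdown i z, line_through (slope i z)))"
    by (simp add: \<sigma>_def)
  show "points blowup_origin = (\<Union>i. range (\<lambda>z. (bdown i z, line_through (slope i z))))"
    using p1 unfolding \<sigma>_def by simp
qed

section \<open>Blowing up a point\<close>

text \<open>The exceptional points are labelled by a number that does not occur in the points of the
  surface.\<close>

definition exc :: "nat \<Rightarrow> (complex ^ 2) set \<Rightarrow> (nat \<times> (complex ^ 2)) set" where
  "exc n l = Pair n ` l"

text \<open>Off the exceptional curve a point of the model is sent to the old point of the surface
  itself, so that the blow-up literally contains the surface minus its centre.\<close>

definition bmap ::
  "nat \<Rightarrow> (complex ^ 2 \<Rightarrow> (nat \<times> (complex ^ 2)) set) \<Rightarrow> (complex ^ 2) \<times> (complex ^ 2) set \<Rightarrow> (nat \<times> (complex ^ 2)) set"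
  where "bmap n \<sigma> = (\<lambda>(z, l). if z = 0 then exc n l else \<sigma> z)"

definition bparam ::
  "nat \<Rightarrow> (complex ^ 2 \<Rightarrow> (nat \<times> (complex ^ 2)) set) \<Rightarrow> 2 \<Rightarrow> complex ^ 2 \<Rightarrow> (nat \<times> (complex ^ 2)) set"
  where "bparam n \<sigma> i z = (if z $ i = 0 then exc n (line_through (slope i z)) else \<sigma> (bdown i z))"

definition bdom :: "(complex ^ 2) set \<Rightarrow> 2 \<Rightarrow> (complex ^ 2) set" where
  "bdom A i = {z. bdown i z \<in> A}"

text \<open>As old points keep their identity, gluing the punctured surface to the model over
  \<open>A\<close> is a plain union. The centre is the origin of the chart
  \<open>\<sigma>\<close>.\<close>

definition blow ::
  "nat \<Rightarrow> (complex ^ 2) set \<Rightarrow> (complex ^ 2 \<Rightarrow> (nat \<times> (complex ^ 2)) set) \<Rightarrow>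
   ((nat \<times> (complex ^ 2)) set, 2) cmanifold \<Rightarrow> ((nat \<times> (complex ^ 2)) set, 2) cmanifold" where
  "blow n A \<sigma> S = munion (submanifold S (- {\<sigma> 0}))
     (push (bmap n \<sigma>) (submanifold blowup_origin {(z, l). z \<in> A}))"

definition bproj ::
  "nat \<Rightarrow> (complex ^ 2 \<Rightarrow> (nat \<times> (complex ^ 2)) set) \<Rightarrow> (nat \<times> (complex ^ 2)) set \<Rightarrow> (nat \<times> (complex ^ 2)) set"
  where "bproj n \<sigma> q = (if q \<in> exc n ` points P1 then \<sigma> 0 else q)"

lemma points_P1: "points P1 = {line_through v |v. v \<noteq> 0}"
  by (simp add: projective_space_def)

lemma points_blowup_origin: "points blowup_origin = {(z, l). l \<in> points P1 \<and> z \<in> l}"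
  by (simp add: blowup_origin_def)

lemma zero_mem_line_through [simp]: "0 \<in> line_through v"
  using smult_mem_line_through[of 0 v] by simp

lemma fst_exc: "l \<in> points P1 \<Longrightarrow> n \<in> fst ` exc m l \<longleftrightarrow> n = m"
  unfolding points_P1 exc_def by force

lemma exc_eq_iff: "l \<in> points P1 \<Longrightarrow> exc n l = exc m l' \<longleftrightarrow> n = m \<and> l = l'"
  unfolding points_P1 exc_def by (auto 4 4 simp: set_eq_iff image_iff)

lemma line_through_in_P1 [simp]: "v \<noteq> 0 \<Longrightarrow> line_through v \<in> points P1"
  unfolding points_P1 by blast

lemma bmap_chart: "bmap n \<sigma> (bdown i z, line_through (slope i z)) = bparam n \<sigma> i z"
  by (simp add: bmap_def bparam_def bdown_eq_0_iff)

text \<open>No point of \<open>S\<close> contains a pair labelled \<open>n\<close>; this is what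
  makes the sets \<open>exc n l\<close> new points.\<close>

locale blowup_data =
  fixes S :: "((nat \<times> (complex ^ 2)) set, 2) cmanifold" and A :: "(complex ^ 2) set"
    and \<sigma> :: "complex ^ 2 \<Rightarrow> (nat \<times> (complex ^ 2)) set" and n :: nat
  assumes S: "complex_manifold S" and cS: "countable (atlas S)" and chart: "mchart S A \<sigma>"
    and zero: "0 \<in> A" and fresh: "\<And>P. P \<in> points S \<Longrightarrow> n \<notin> fst ` P"
begin

abbreviation "S1 \<equiv> submanifold S (- {\<sigma> 0})"
abbreviation "BO \<equiv> submanifold blowup_origin {(z, l). z \<in> A}"
abbreviation "S2 \<equiv> push (bmap n \<sigma>) BO"

lemma exc_notin: "l \<in> points P1 \<Longrightarrow> exc n l \<notin> points S"
  using fresh fst_exc[of l n n] by blast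

lemma sigma_in: "z \<in> A \<Longrightarrow> \<sigma> z \<in> points S"
  using mchartD(3)[OF chart] by blast

lemma sigma_eq: "z \<in> A \<Longrightarrow> w \<in> A \<Longrightarrow> \<sigma> z = \<sigma> w \<longleftrightarrow> z = w"
  using mchartD(2)[OF chart] by (auto dest: inj_onD)

lemma exc_neq_sigma: "l \<in> points P1 \<Longrightarrow> z \<in> A \<Longrightarrow> exc n l \<noteq> \<sigma> z"
  using exc_notin sigma_in by metis

lemma open_S1: "openin (mtop S) (points S \<inter> - {\<sigma> 0})"
proof -
  have "t1_space (mtop S)" by (rule Hausdorff_imp_t1_space[OF complex_manifoldD(6)[OF S]])
  then have "closedin (mtop S) {\<sigma> 0}"
    using sigma_in[OF zero] by (simp add: t1_space_closedin_singleton topspace_mtop[OF S])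
  then have "openin (mtop S) (topspace (mtop S) - {\<sigma> 0})" by blast
  then show ?thesis by (simp add: topspace_mtop[OF S] Diff_eq)
qed

lemma open_bdom: "open (bdom A i)"
  using holo_on_preimage[OF holo_on_bdown open_UNIV mchartD(1)[OF chart], of i]
  by (simp add: bdom_def)

lemma mchart_bo: "mchart blowup_origin (bdom A i) (\<lambda>z. (bdown i z, line_through (slope i z)))"
  by (rule mchart_restrict[OF blowup_origin_manifold(1,3) open_bdom]) simp

lemma BO_covered:
  assumes "q \<in> points blowup_origin \<inter> {(z, l). z \<in> A}"
  obtains i z where "z \<in> bdom A i" "q = (bdown i z, line_through (slope i z))"
proof -
  from assms obtain i z where "q = (bdown i z, line_through (slope i z))"
    unfolding blowup_origin_manifold(4) by blast
  then show ?thesis using assms that[of z i] by (auto simp: bdom_def)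
qed

lemma open_BO: "openin (mtop blowup_origin) (points blowup_origin \<inter> {(z, l). z \<in> A})"
proof (rule openin_mtopI[OF blowup_origin_manifold(1)])
  fix q assume "q \<in> points blowup_origin \<inter> {(z, l). z \<in> A}"
  then obtain i z where z: "z \<in> bdom A i" "q = (bdown i z, line_through (slope i z))"
    by (rule BO_covered)
  then show "\<exists>C \<mu>. mchart blowup_origin C \<mu> \<and> q \<in> \<mu> ` C \<and>
      \<mu> ` C \<subseteq> points blowup_origin \<inter> {(z, l). z \<in> A}"
    using mchart_bo[of i] mchartD(3)[OF mchart_bo[of i]]
    by (intro exI[of _ "bdom A i"] exI[of _ "\<lambda>z. (bdown i z, line_through (slope i z))"])
      (auto simp: bdom_def)
qed

lemma BO_manifold: "complex_manifold BO" "countable (atlas BO)"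
  by (rule complex_manifold_submanifold[OF blowup_origin_manifold(1,2) open_BO])
    (rule countable_submanifold[OF blowup_origin_manifold(2)])

lemma mchart_BO: "mchart BO (bdom A i) (\<lambda>z. (bdown i z, line_through (slope i z)))"
  by (rule mchart_submanifold[OF blowup_origin_manifold(1) mchart_bo]) (auto simp: bdom_def)

lemma BO_points: "q \<in> points BO \<longleftrightarrow> (\<exists>z l. q = (z, l) \<and> l \<in> points P1 \<and> z \<in> l \<and> z \<in> A)"
  by (auto simp: points_blowup_origin)

lemma line_determined: "l \<in> points P1 \<Longrightarrow> z \<in> l \<Longrightarrow> z \<noteq> 0 \<Longrightarrow> l = line_through z"
  unfolding points_P1 using line_through_eq by auto

text \<open>A nonzero vector lies on just one line through the origin, so over
  \<open>z \<noteq> 0\<close> the line is determined by \<open>z\<close>; over \<open>0\<close> the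
  labelled line itself is recorded.\<close>

lemma inj_bmap: "inj_on (bmap n \<sigma>) (points BO)"
proof (rule inj_onI)
  fix p q assume pq: "p \<in> points BO" "q \<in> points BO" and eq: "bmap n \<sigma> p = bmap n \<sigma> q"
  obtain z l where p: "p = (z, l)" "l \<in> points P1" "z \<in> l" "z \<in> A" using pq(1) unfolding BO_points by blast
  obtain w k where q: "q = (w, k)" "k \<in> points P1" "w \<in> k" "w \<in> A" using pq(2) unfolding BO_points by blast
  show "p = q"
    using eq p q exc_eq_iff[of l n n k] exc_neq_sigma[OF p(2) q(4)] exc_neq_sigma[OF q(2) p(4)]
      sigma_eq[OF p(4) q(4)] line_determined[OF p(2,3)] line_determined[OF q(2,3)]
    by (auto simp: bmap_def split: if_splits)
qed

lemma S1_manifold: "complex_manifold S1" "countable (atlas S1)"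
  by (rule complex_manifold_submanifold[OF S cS open_S1]) (rule countable_submanifold[OF cS])

lemma S2_manifold: "complex_manifold S2" "countable (atlas S2)"
  and points_S2: "points S2 = bmap n \<sigma> ` points BO"
  using complex_manifold_push[OF BO_manifold inj_bmap] by blast+

lemma mchart_S2: "mchart S2 (bdom A i) (bparam n \<sigma> i)"
  using complex_manifold_push(3)[OF BO_manifold inj_bmap mchart_BO[of i]]
  by (simp add: o_def bmap_chart)

lemma points_S2': "points S2 = exc n ` points P1 \<union> \<sigma> ` (A - {0})"
proof (intro equalityI subsetI)
  fix q assume "q \<in> points S2"
  then show "q \<in> exc n ` points P1 \<union> \<sigma> ` (A - {0})"
    unfolding points_S2 by (auto simp: bmap_def points_blowup_origin)
next
  fix q assume "q \<in> exc n ` points P1 \<union> \<sigma> ` (A - {0})"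
  then consider l where "l \<in> points P1" "q = exc n l" | z where "z \<in> A" "z \<noteq> 0" "q = \<sigma> z" by blast
  then show "q \<in> points S2"
  proof cases
    case 1
    then have "(0, l) \<in> points BO" using zero unfolding BO_points by (auto simp: points_P1)
    moreover have "bmap n \<sigma> (0, l) = q" using 1 by (simp add: bmap_def)
    ultimately show ?thesis unfolding points_S2 by blast
  next
    case 2
    then have "(z, line_through z) \<in> points BO" unfolding BO_points by auto
    moreover have "bmap n \<sigma> (z, line_through z) = q" using 2 by (simp add: bmap_def)
    ultimately show ?thesis unfolding points_S2 by blast
  qed
qed

lemma bdom_punctured:
  assumes "z \<in> A" "z $ i \<noteq> 0"
  shows "bdown i (\<chi> j. if j = i then z $ i else z $ j / z $ i) = z"
  using assms by (simp add: vec_eq_iff bdown_nth)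

text \<open>Off the exceptional curve the blow-down in chart \<open>i\<close> is inverted by
  dividing the other coordinate by \<open>z $ i\<close>, so it is an admissible reparametrization of
  \<open>\<sigma>\<close>.\<close>

lemma mchart_S_blowdown: "mchart S {w\<in>bdom A i. w $ i \<noteq> 0} (\<sigma> \<circ> bdown i)"
proof -
  let ?P = "{w\<in>bdom A i. w $ i \<noteq> 0}"
  let ?k = "\<lambda>v. \<chi> j. if j = i then v $ i else v $ j / v $ i"
  have oi: "open {w::complex ^ 2. w $ i \<noteq> 0}"
    by (intro open_Collect_neq continuous_intros)
  have im: "bdown i ` ?P = {v\<in>A. v $ i \<noteq> 0}"
  proof (intro equalityI subsetI)
    fix v assume "v \<in> {v\<in>A. v $ i \<noteq> 0}"
    then have v: "v \<in> A" "v $ i \<noteq> 0" by auto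
    have "?k v \<in> ?P" using v bdom_punctured[OF v] by (simp add: bdom_def)
    then show "v \<in> bdown i ` ?P" 
      by (intro image_eqI[where x = "?k v"]) (simp add: bdom_punctured[OF v])
  qed (auto simp: bdom_def bdown_nth)
  have P: "?P = bdom A i \<inter> {w. w $ i \<noteq> 0}" "{v\<in>A. v $ i \<noteq> 0} = A \<inter> {w. w $ i \<noteq> 0}" by auto
  show ?thesis
  proof (rule mchart_compose[OF S chart, of ?P "bdown i" ?k])
    show "open ?P" unfolding P by (intro open_Int open_bdom oi)
    show "holo_on ?P (bdown i)" by (rule holo_on_bdown)
    show "open (bdown i ` ?P)" 
      unfolding im by (subst P(2)) (intro open_Int mchartD(1)[OF chart] oi)
    show "bdown i ` ?P \<subseteq> A" unfolding im by blast
    show "holo_on (bdown i ` ?P) ?k" unfolding im holo_on_iff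
    proof (intro ballI allI)
      fix z j assume "z \<in> {v\<in>A. v $ i \<noteq> 0}"
      then show "cdiff (\<lambda>v. ?k v $ j) z" by (cases "j = i") auto
    qed
    show "?k (bdown i z) = z" if "z \<in> ?P" for z
      using that by (simp add: vec_eq_iff bdown_nth)
  qed
qed

lemma bparam_blowdown: "w $ i \<noteq> 0 \<Longrightarrow> bparam n \<sigma> i w = \<sigma> (bdown i w)"
  by (simp add: bparam_def)

text \<open>A common point of the two pieces is an old point other than the centre. If its
  \<open>i\<close>-th coordinate is nonzero, the \<open>i\<close>-th chart of the model off the
  exceptional curve is also \<open>\<sigma>\<close> after \<open>bdown i\<close>, hence a chart of
  both pieces.\<close>

lemma compat: "compatible S1 S2"
  unfolding compatible_def
proof
  fix x assume x: "x \<in> points S1 \<inter> points S2"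
  then have "x \<in> points S" by simp
  with x exc_notin obtain z where z: "z \<in> A" "z \<noteq> 0" "x = \<sigma> z" unfolding points_S2' by blast
  then obtain i where i: "z $ i \<noteq> 0" by (auto simp: vec_eq_iff)
  let ?P = "{w\<in>bdom A i. w $ i \<noteq> 0}"
  have "mchart S ?P (bparam n \<sigma> i)"
    by (rule mchart_cong[OF mchart_S_blowdown]) (simp add: bparam_blowdown)
  moreover have "bparam n \<sigma> i ` ?P \<subseteq> - {\<sigma> 0}"
  proof
    fix q assume "q \<in> bparam n \<sigma> i ` ?P"
    then obtain w where w: "bdown i w \<in> A" "w $ i \<noteq> 0" "q = \<sigma> (bdown i w)"
      by (auto simp: bdom_def bparam_blowdown)
    then have "q \<noteq> \<sigma> 0" using sigma_eq[OF w(1) zero] bdown_eq_0_iff[of i w] by simp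
    then show "q \<in> - {\<sigma> 0}" by simp
  qed
  ultimately have 1: "mchart S1 ?P (bparam n \<sigma> i)" by (rule mchart_submanifold[OF S])
  have 2: "mchart S2 ?P (bparam n \<sigma> i)"
    by (rule mchart_restrict[OF S2_manifold(1) mchart_S2 mchartD(1)[OF 1]]) auto
  let ?w = "\<chi> j. if j = i then z $ i else z $ j / z $ i"
  have "?w \<in> ?P" using z i bdom_punctured[OF z(1) i] by (simp add: bdom_def)
  moreover have "bparam n \<sigma> i ?w = x" using i z bdom_punctured[OF z(1) i] by (simp add: bparam_blowdown)
  ultimately show "\<exists>C \<mu>. mchart S1 C \<mu> \<and> mchart S2 C \<mu> \<and> x \<in> \<mu> ` C"
    using 1 2 by blast
qed

text \<open>Here \<open>x\<close> is an old point outside the image of \<open>A\<close> and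
  \<open>y\<close> lies on the exceptional curve. Disjoint neighbourhoods of \<open>x\<close> and of
  the centre exist in \<open>S\<close>; the latter lifts to the neighbourhood \<open>K\<close> of
  the whole exceptional curve.\<close>

lemma separation:
  assumes x: "x \<in> points S1 - points S2" and y: "y \<in> points S2 - points S1"
  shows "\<exists>G H. openin (mtop S1) G \<and> openin (mtop S2) H \<and> x \<in> G \<and> y \<in> H \<and> G \<inter> H = {}"
proof -
  have xS: "x \<in> points S" "x \<noteq> \<sigma> 0" using x by auto
  obtain l where l: "l \<in> points P1" "y = exc n l"
    using y sigma_in sigma_eq[OF _ zero] unfolding points_S2' by auto
  obtain G H where GH: "openin (mtop S) G" "openin (mtop S) H" "x \<in> G" "\<sigma> 0 \<in> H" "disjnt G H"
    using complex_manifoldD(6)[OF S] xS sigma_in[OF zero]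
    unfolding Hausdorff_space_def topspace_mtop[OF S] by blast
  define V where "V = {z\<in>A. \<sigma> z \<in> H}"
  have oV: "open V" unfolding V_def by (rule mchart_preimage_open[OF S chart GH(2)])
  define K where "K = exc n ` points P1 \<union> \<sigma> ` (V - {0})"
  have "openin (mtop S2) K"
  proof (rule openin_mtopI[OF S2_manifold(1)])
    fix q assume q: "q \<in> K"
    then have "q \<in> points S2" unfolding K_def points_S2' V_def by blast
    then obtain r where r: "r \<in> points BO" "q = bmap n \<sigma> r" unfolding points_S2 by blast
    from r(1) have "r \<in> points blowup_origin \<inter> {(z, l). z \<in> A}" by simp
    then obtain i z where z: "z \<in> bdom A i" "r = (bdown i z, line_through (slope i z))"
      by (rule BO_covered)
    then have qz: "q = bparam n \<sigma> i z" using r by (simp add: bmap_chart)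
    let ?C = "{w. bdown i w \<in> V}"
    have oC: "open ?C" using holo_on_preimage[OF holo_on_bdown open_UNIV oV, of i] by simp
    have C: "mchart S2 ?C (bparam n \<sigma> i)"
      by (rule mchart_restrict[OF S2_manifold(1) mchart_S2 oC]) (auto simp: bdom_def V_def)
    have "z \<in> ?C"
    proof (cases "z $ i = 0")
      case True
      then have "bdown i z = 0" by (simp add: bdown_eq_0_iff)
      then show ?thesis using zero GH(4) by (simp add: V_def)
    next
      case False
      then have "q = \<sigma> (bdown i z)" using qz by (simp add: bparam_def)
      moreover have bA: "bdown i z \<in> A" using z by (simp add: bdom_def)
      ultimately have "q \<notin> exc n ` points P1" using exc_neq_sigma by blast
      then obtain v where "v \<in> V" "q = \<sigma> v" using q unfolding K_def by blast
      then show ?thesis using sigma_eq[OF bA, of v] \<open>q = \<sigma> (bdown i z)\<close> by (simp add: V_def)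
    qed
    moreover have "bparam n \<sigma> i ` ?C \<subseteq> K"
      by (auto simp: K_def bparam_def bdown_eq_0_iff)
    ultimately show "\<exists>C \<mu>. mchart S2 C \<mu> \<and> q \<in> \<mu> ` C \<and> \<mu> ` C \<subseteq> K" using C qz by blast
  qed
  moreover have "openin (mtop S1) (G \<inter> (points S \<inter> - {\<sigma> 0}))"
    unfolding openin_submanifold[OF S open_S1] using openin_Int[OF GH(1) open_S1] by auto
  moreover have "G \<inter> (points S \<inter> - {\<sigma> 0}) \<inter> K = {}"
    using exc_notin GH(5) by (auto simp: K_def V_def disjnt_def)
  moreover have "y \<in> K" using l unfolding K_def by blast
  moreover have "x \<in> G \<inter> (points S \<inter> - {\<sigma> 0})" using GH(3) xS by simp
  ultimately show ?thesis
    by (intro exI[of _ "G \<inter> (points S \<inter> - {\<sigma> 0})"] exI[of _ K] conjI)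
qed

abbreviation "S' \<equiv> blow n A \<sigma> S"

lemma blow_manifold: "complex_manifold S'"
  unfolding blow_def
  by (rule complex_manifold_munion[OF S1_manifold(1) S2_manifold(1) compat S1_manifold(2) S2_manifold(2) separation])

lemma blow_countable: "countable (atlas S')"
  unfolding blow_def munion_def using S1_manifold(2) S2_manifold(2) by simp

lemma mchart_blow_old: "mchart S B \<tau> \<Longrightarrow> \<sigma> 0 \<notin> \<tau> ` B \<Longrightarrow> mchart S' B \<tau>"
  unfolding blow_def
  by (rule mchart_munion_left[OF S1_manifold(1) S2_manifold(1) compat mchart_submanifold[OF S]]) auto

lemma mchart_blow_new: "mchart S' (bdom A i) (bparam n \<sigma> i)"
  unfolding blow_def
  by (rule mchart_munion_right[OF S1_manifold(1) S2_manifold(1) compat mchart_S2])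

lemma points_blow: "points S' = (points S - {\<sigma> 0}) \<union> exc n ` points P1"
proof -
  have "points S' = (points S - {\<sigma> 0}) \<union> (exc n ` points P1 \<union> \<sigma> ` (A - {0}))"
    unfolding blow_def munion_def points_S2' by auto
  moreover have "\<sigma> ` (A - {0}) \<subseteq> points S - {\<sigma> 0}"
    using sigma_in sigma_eq[OF _ zero] by auto
  ultimately show ?thesis by blast
qed

lemma bproj_old: "q \<in> points S \<Longrightarrow> bproj n \<sigma> q = q"
  using exc_notin unfolding bproj_def by auto

lemma bproj_new: "l \<in> points P1 \<Longrightarrow> bproj n \<sigma> (exc n l) = \<sigma> 0"
  unfolding bproj_def by auto

lemma bproj_bparam: "z \<in> bdom A i \<Longrightarrow> bproj n \<sigma> (bparam n \<sigma> i z) = \<sigma> (bdown i z)"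
  using bproj_old[OF sigma_in] bproj_new[of "line_through (slope i z)"]
  by (auto simp: bparam_def bdom_def bdown_eq_0_iff[symmetric])

lemma new_point:
  assumes "l \<in> points P1"
  obtains i z where "z \<in> bdom A i" "bparam n \<sigma> i z = exc n l"
proof -
  have "(0, l) \<in> points blowup_origin \<inter> {(z, l). z \<in> A}"
    using assms zero by (auto simp: points_blowup_origin points_P1)
  then obtain i z where "z \<in> bdom A i" "(0, l) = (bdown i z, line_through (slope i z))"
    by (rule BO_covered)
  then show ?thesis using that[of z i] bdown_eq_0_iff[of i z] by (auto simp: bparam_def)
qed

lemma old_chart:
  assumes "x \<in> points S" "x \<noteq> \<sigma> 0"
  obtains B \<tau> z where "mchart S B \<tau>" "mchart S' B \<tau>" "z \<in> B" "\<tau> z = x" "\<sigma> 0 \<notin> \<tau> ` B"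
proof -
  have "x \<in> points S \<inter> - {\<sigma> 0}" using assms by simp
  with openin_mchart_at[OF S open_S1] obtain B \<tau> z
    where c: "mchart S B \<tau>" "z \<in> B" "\<tau> z = x" "\<tau> ` B \<subseteq> points S \<inter> - {\<sigma> 0}" by metis
  then have "\<sigma> 0 \<notin> \<tau> ` B" by blast
  then show ?thesis using that c mchart_blow_old by blast
qed

lemma hol_at_bproj: assumes q: "q \<in> points S'" shows "hol_at S' S (bproj n \<sigma>) q"
proof -
  consider "q \<in> points S" "q \<noteq> \<sigma> 0" | l where "l \<in> points P1" "q = exc n l"
    using q unfolding points_blow by blast
  then show ?thesis
  proof cases
    case 1
    obtain B \<tau> z where c: "mchart S B \<tau>" "mchart S' B \<tau>" "z \<in> B" "\<tau> z = q" "\<sigma> 0 \<notin> \<tau> ` B"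
      using 1 by (rule old_chart)
    show ?thesis
      by (rule hol_at_mchart_id[OF c(2,1,3,4)]) (use mchartD(3)[OF c(1)] bproj_old in blast)
  next
    case 2
    obtain i z where z: "z \<in> bdom A i" "bparam n \<sigma> i z = exc n l" using 2(1) by (rule new_point)
    show ?thesis
      by (rule hol_atI[OF mchart_blow_new chart holo_on_bdown _ bproj_bparam z(1)])
        (use z 2 in \<open>auto simp: bdom_def\<close>)
  qed
qed

lemma bproj_preimage:
  assumes W: "openin (mtop S) (points S \<inter> W)"
  shows "openin (mtop S') (points S' \<inter> {q. bproj n \<sigma> q \<in> W})"
proof -
  have h: "holomorphic_map S' S (bproj n \<sigma>)" by (rule holomorphic_mapI[OF blow_manifold S hol_at_bproj])
  have "points S' \<inter> {q. bproj n \<sigma> q \<in> W} = {q\<in>points S'. bproj n \<sigma> q \<in> points S \<inter> W}"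
    using holomorphic_mapD(1)[OF h] by blast
  then show ?thesis using hol_at_continuous[OF blow_manifold S h W] by simp
qed

lemma bproj_neq: "q \<in> points S' \<Longrightarrow> bproj n \<sigma> q \<noteq> \<sigma> 0 \<longleftrightarrow> q \<in> points S"
  using bproj_old bproj_new exc_notin unfolding points_blow by auto

lemma biholomorphic_away:
  "biholomorphic (submanifold S' {q. bproj n \<sigma> q \<noteq> \<sigma> 0}) (submanifold S {q. q \<noteq> \<sigma> 0}) (bproj n \<sigma>)"
proof -
  have o1: "openin (mtop S) (points S \<inter> {q. q \<noteq> \<sigma> 0})"
    using open_S1 by (simp add: Collect_neg_eq)
  have o2: "openin (mtop S') (points S' \<inter> {q. bproj n \<sigma> q \<noteq> \<sigma> 0})"
    using bproj_preimage[OF o1] by simp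
  note m1 = complex_manifold_submanifold[OF S cS o1]
    and m2 = complex_manifold_submanifold[OF blow_manifold blow_countable o2]
  have pt: "points (submanifold S' {q. bproj n \<sigma> q \<noteq> \<sigma> 0}) = points S - {\<sigma> 0}"
    "points (submanifold S {q. q \<noteq> \<sigma> 0}) = points S - {\<sigma> 0}"
    using bproj_neq bproj_old points_blow by auto
  have ch: "\<exists>B \<tau> z. mchart (submanifold S' {q. bproj n \<sigma> q \<noteq> \<sigma> 0}) B \<tau> \<and>
      mchart (submanifold S {q. q \<noteq> \<sigma> 0}) B \<tau> \<and> z \<in> B \<and> \<tau> z = x \<and> \<tau> ` B \<subseteq> points S"
    if x: "x \<in> points S - {\<sigma> 0}" for x
  proof -
    obtain B \<tau> z where c: "mchart S B \<tau>" "mchart S' B \<tau>" "z \<in> B" "\<tau> z = x" "\<sigma> 0 \<notin> \<tau> ` B"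
      by (rule old_chart[of x]) (use x in auto)
    have "mchart (submanifold S {q. q \<noteq> \<sigma> 0}) B \<tau>"
      by (rule mchart_submanifold[OF S c(1)]) (use c(5) in auto)
    moreover have "mchart (submanifold S' {q. bproj n \<sigma> q \<noteq> \<sigma> 0}) B \<tau>"
      by (rule mchart_submanifold[OF blow_manifold c(2)])
        (use c(5) bproj_old mchartD(3)[OF c(1)] in \<open>auto simp: image_iff subset_iff\<close>)
    ultimately show ?thesis using c mchartD(3)[OF c(1)] by blast
  qed
  show ?thesis
  proof (rule biholomorphicI[OF m2 m1, where g = "\<lambda>q. q"], unfold pt)
    fix x assume x: "x \<in> points S - {\<sigma> 0}"
    obtain B \<tau> z where c: "mchart (submanifold S' {q. bproj n \<sigma> q \<noteq> \<sigma> 0}) B \<tau>"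
      "mchart (submanifold S {q. q \<noteq> \<sigma> 0}) B \<tau>" "z \<in> B" "\<tau> z = x" "\<tau> ` B \<subseteq> points S"
      using ch[OF x] by blast
    show "hol_at (submanifold S' {q. bproj n \<sigma> q \<noteq> \<sigma> 0}) (submanifold S {q. q \<noteq> \<sigma> 0}) (bproj n \<sigma>) x"
      by (rule hol_at_mchart_id[OF c(1-4)]) (use c(5) bproj_old in blast)
    show "hol_at (submanifold S {q. q \<noteq> \<sigma> 0}) (submanifold S' {q. bproj n \<sigma> q \<noteq> \<sigma> 0}) (\<lambda>q. q) x"
      by (rule hol_at_mchart_id[OF c(2,1,3,4)]) simp
    show "bproj n \<sigma> x = x" using x bproj_old by simp
    then show "bproj n \<sigma> x = x" .
  qed
qed

lemma sigma_inv [simp]: "z \<in> A \<Longrightarrow> inv_into A \<sigma> (\<sigma> z) = z"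
  using mchartD(2)[OF chart] by simp

lemma inv_image [simp]: "inv_into A \<sigma> ` \<sigma> ` A = A"
  by force

lemma open_image: "openin (mtop S) (\<sigma> ` A)"
  by (rule mchart_openin[OF S chart mchartD(1)[OF chart] order_refl])

lemma open_image': "openin (mtop S) (points S \<inter> \<sigma> ` A)"
proof -
  have "points S \<inter> \<sigma> ` A = \<sigma> ` A" using sigma_in by blast
  then show ?thesis using open_image by simp
qed

lemma biholomorphic_chart:
  "biholomorphic (submanifold S (\<sigma> ` A)) (submanifold affine_space A) (inv_into A \<sigma>)"
proof -
  have oA: "openin (mtop affine_space) (points affine_space \<inter> A)"
    using mchart_openin[OF affine_space_manifold(1,2) mchartD(1)[OF chart]]
    by (simp add: affine_space_def)
  note m1 = complex_manifold_submanifold[OF S cS open_image']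
    and m2 = complex_manifold_submanifold[OF affine_space_manifold(1,3) oA]
  have c1: "mchart (submanifold S (\<sigma> ` A)) A \<sigma>" by (rule mchart_submanifold[OF S chart order_refl])
  have "mchart affine_space A id"
    by (rule mchart_restrict[OF affine_space_manifold(1,2) mchartD(1)[OF chart]]) simp
  then have c2: "mchart (submanifold affine_space A) A id"
    by (rule mchart_submanifold[OF affine_space_manifold(1)]) simp
  show ?thesis
  proof (rule biholomorphicI[OF m1 m2, where g = \<sigma>])
    fix x assume "x \<in> points (submanifold S (\<sigma> ` A))"
    then obtain z where z: "z \<in> A" "x = \<sigma> z" by auto
    show "hol_at (submanifold S (\<sigma> ` A)) (submanifold affine_space A) (inv_into A \<sigma>) x"
      by (rule hol_atI[OF c1 c2 holo_on_id]) (use z in auto)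
    show "\<sigma> (inv_into A \<sigma> x) = x" using z by simp
  next
    fix y assume "y \<in> points (submanifold affine_space A)"
    then have y: "y \<in> A" by simp
    show "hol_at (submanifold affine_space A) (submanifold S (\<sigma> ` A)) \<sigma> y"
      by (rule hol_atI[OF c2 c1 holo_on_id]) (use y in auto)
    show "inv_into A \<sigma> (\<sigma> y) = y" using y by simp
  qed
qed

lemma bproj_in_chart: "q \<in> points S' \<Longrightarrow> bproj n \<sigma> q \<in> \<sigma> ` A \<longleftrightarrow> q \<in> points S2"
  unfolding points_blow points_S2'
  using bproj_old bproj_new zero sigma_in exc_notin by auto

lemma biholomorphic_model:
  "biholomorphic (submanifold S' {q. bproj n \<sigma> q \<in> \<sigma> ` A}) BO (inv_into (points BO) (bmap n \<sigma>))"
proof -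
  note m = complex_manifold_submanifold[OF blow_manifold blow_countable bproj_preimage[OF open_image']]
  have pt: "points (submanifold S' {q. bproj n \<sigma> q \<in> \<sigma> ` A}) = bmap n \<sigma> ` points BO"
  proof -
    have "points S2 \<subseteq> points S'" unfolding blow_def munion_def by simp
    then show ?thesis using bproj_in_chart unfolding points_S2[symmetric] by auto
  qed
  have ii: "inv_into (points BO) (bmap n \<sigma>) (bmap n \<sigma> r) = r" if "r \<in> points BO" for r
    using inj_bmap that by simp
  have c1: "mchart (submanifold S' {q. bproj n \<sigma> q \<in> \<sigma> ` A}) (bdom A i) (bparam n \<sigma> i)" for i
    by (rule mchart_submanifold[OF blow_manifold mchart_blow_new])
      (auto simp: bproj_bparam bdom_def)
  have iib: "inv_into (points BO) (bmap n \<sigma>) (bparam n \<sigma> i w) = (bdown i w, line_through (slope i w))"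
    if "w \<in> bdom A i" for i w
    using ii[of "(bdown i w, line_through (slope i w))"] mchartD(3)[OF mchart_BO[of i]] that
    by (auto simp: bmap_chart)
  have cov: "\<exists>i z. z \<in> bdom A i \<and> r = (bdown i z, line_through (slope i z))" if "r \<in> points BO" for r
  proof -
    have "r \<in> points blowup_origin \<inter> {(z, l). z \<in> A}" using that by simp
    then show ?thesis using BO_covered by metis
  qed
  show ?thesis
  proof (rule biholomorphicI[OF m BO_manifold(1), where g = "bmap n \<sigma>"], unfold pt)
    fix x assume "x \<in> bmap n \<sigma> ` points BO"
    then obtain r where r: "r \<in> points BO" "x = bmap n \<sigma> r" by blast
    obtain i z where z: "z \<in> bdom A i" "r = (bdown i z, line_through (slope i z))" using cov[OF r(1)] by blast
    show "hol_at (submanifold S' {q. bproj n \<sigma> q \<in> \<sigma> ` A}) BO (inv_into (points BO) (bmap n \<sigma>)) x"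
      by (rule hol_atI[OF c1 mchart_BO holo_on_id _ iib z(1)]) (use z r in \<open>auto simp: bmap_chart\<close>)
    show "bmap n \<sigma> (inv_into (points BO) (bmap n \<sigma>) x) = x" using ii r by simp
  next
    fix r assume r: "r \<in> points BO"
    obtain i z where z: "z \<in> bdom A i" "r = (bdown i z, line_through (slope i z))" using cov[OF r] by blast
    show "hol_at BO (submanifold S' {q. bproj n \<sigma> q \<in> \<sigma> ` A}) (bmap n \<sigma>) r"
      by (rule hol_atI[OF mchart_BO c1 holo_on_id _ bmap_chart z(1)]) (use z in auto)
    show "inv_into (points BO) (bmap n \<sigma>) (bmap n \<sigma> r) = r" by (rule ii[OF r])
  qed
qed

theorem is_blowup_blow: "is_blowup S (\<sigma> 0) S' (bproj n \<sigma>)"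
  unfolding is_blowup_def
proof (intro conjI exI)
  show "\<sigma> 0 \<in> points S" by (rule sigma_in[OF zero])
  show "complex_manifold S'" by (rule blow_manifold)
  show "holomorphic_map S' S (bproj n \<sigma>)" by (rule holomorphic_mapI[OF blow_manifold S hol_at_bproj])
  show "biholomorphic (submanifold S' {q. bproj n \<sigma> q \<noteq> \<sigma> 0}) (submanifold S {q. q \<noteq> \<sigma> 0}) (bproj n \<sigma>)"
    by (rule biholomorphic_away)
  show "openin (mtop S) (\<sigma> ` A)" by (rule open_image)
  show "\<sigma> 0 \<in> \<sigma> ` A" using zero by blast
  show "open (inv_into A \<sigma> ` \<sigma> ` A)" using mchartD(1)[OF chart] by simp
  show "inv_into A \<sigma> (\<sigma> 0) = 0" using zero by simp
  show "biholomorphic (submanifold S (\<sigma> ` A)) (submanifold affine_space (inv_into A \<sigma> ` \<sigma> ` A)) (inv_into A \<sigma>)"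
    using biholomorphic_chart by simp
  show "biholomorphic (submanifold S' {q. bproj n \<sigma> q \<in> \<sigma> ` A})
      (submanifold blowup_origin {(z, l). z \<in> inv_into A \<sigma> ` \<sigma> ` A}) (inv_into (points BO) (bmap n \<sigma>))"
    using biholomorphic_model by simp
  show "\<forall>q\<in>points S'. bproj n \<sigma> q \<in> \<sigma> ` A \<longrightarrow>
      fst (inv_into (points BO) (bmap n \<sigma>) q) = inv_into A \<sigma> (bproj n \<sigma> q)"
  proof (intro ballI impI)
    fix q assume "q \<in> points S'" "bproj n \<sigma> q \<in> \<sigma> ` A"
    then have "q \<in> points S2" using bproj_in_chart by blast
    then obtain r where r: "r \<in> points BO" "q = bmap n \<sigma> r" unfolding points_S2 by blast
    obtain z l where zl: "r = (z, l)" "l \<in> points P1" "z \<in> l" "z \<in> A" using r(1) unfolding BO_points by blast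
    have "inv_into (points BO) (bmap n \<sigma>) q = r" using r inj_bmap by simp
    moreover have "bproj n \<sigma> q = \<sigma> z"
      using r zl bproj_new bproj_old[OF sigma_in] by (auto simp: bmap_def)
    ultimately show "fst (inv_into (points BO) (bmap n \<sigma>) q) = inv_into A \<sigma> (bproj n \<sigma> q)"
      using zl by simp
  qed
qed

end

section \<open>Three infinitely near points\<close>

abbreviation "line \<equiv> \<lambda>a b :: complex. line_through (vector [a, b] :: complex ^ 2)"

lemma vector2_eq_iff: "v = w \<longleftrightarrow> v $ 1 = w $ 1 \<and> v $ 2 = w $ 2" for v w :: "'a ^ 2"
  by (simp add: vec_eq_iff forall_2)

lemma vector2_eta [simp]: "vector [z $ 1, z $ 2] = z" for z :: "complex ^ 2"
  by (simp add: vector2_eq_iff)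

lemma vector2_eq_0: "vector [a, b] = (0 :: complex ^ 2) \<longleftrightarrow> a = 0 \<and> b = 0"
  by (simp add: vector2_eq_iff)

lemma line_eq_iff:
  assumes "a \<noteq> 0 \<or> b \<noteq> 0" "c \<noteq> 0 \<or> d \<noteq> 0"
  shows "line a b = line c d \<longleftrightarrow> a * d = b * c"
  using assms by (subst line_through_eq_iff) (auto simp: vector2_eq_0 forall_2 algebra_simps)

lemma slope1: "slope 1 z = vector [1, z $ 2]" and slope2: "slope 2 z = vector [z $ 1, 1]"
  by (simp_all add: slope_def vector2_eq_iff)

lemma bdown1: "bdown 1 z = vector [z $ 1, z $ 1 * z $ 2]"
  and bdown2: "bdown 2 z = vector [z $ 2 * z $ 1, z $ 2]"
  by (simp_all add: bdown_def slope1 slope2 vector2_eq_iff)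

text \<open>
  Three successive blow-ups at the intersections of the exceptional curves with the strict
  transform of the curve \<open>z $ 2 = 0\<close>. In the coordinates \<open>(u, v)\<close> of \<open>\<sigma>\<close> the four new charts are
  \<open>(u / v, v)\<close>, \<open>(u\<^sup>2 / v, v / u)\<close>, \<open>(u\<^sup>3 / v, v / u\<^sup>2)\<close> and \<open>(u, v / u\<^sup>3)\<close>.
\<close>

definition tower1 :: "nat \<Rightarrow> (complex ^ 2 \<Rightarrow> (nat \<times> (complex ^ 2)) set) \<Rightarrow> complex ^ 2 \<Rightarrow> (nat \<times> (complex ^ 2)) set" where
  "tower1 n \<sigma> z = (if z $ 2 = 0 then exc n (line (z $ 1) 1) else \<sigma> (vector [z $ 1 * z $ 2, z $ 2]))"

definition tower2 :: "nat \<Rightarrow> (complex ^ 2 \<Rightarrow> (nat \<times> (complex ^ 2)) set) \<Rightarrow> complex ^ 2 \<Rightarrow> (nat \<times> (complex ^ 2)) set" where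
  "tower2 n \<sigma> z = (if z $ 2 = 0 then exc (n + 1) (line (z $ 1) 1)
     else if z $ 1 = 0 then exc n (line 1 (z $ 2))
     else \<sigma> (vector [z $ 1 * z $ 2, z $ 1 * z $ 2 ^ 2]))"

definition tower3 :: "nat \<Rightarrow> (complex ^ 2 \<Rightarrow> (nat \<times> (complex ^ 2)) set) \<Rightarrow> complex ^ 2 \<Rightarrow> (nat \<times> (complex ^ 2)) set" where
  "tower3 n \<sigma> z = (if z $ 2 = 0 then exc (n + 2) (line (z $ 1) 1)
     else if z $ 1 = 0 then exc (n + 1) (line 1 (z $ 2))
     else \<sigma> (vector [z $ 1 * z $ 2, z $ 1 ^ 2 * z $ 2 ^ 3]))"

definition tower_top :: "nat \<Rightarrow> (complex ^ 2 \<Rightarrow> (nat \<times> (complex ^ 2)) set) \<Rightarrow> complex ^ 2 \<Rightarrow> (nat \<times> (complex ^ 2)) set" where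
  "tower_top n \<sigma> z = (if z $ 1 = 0 then exc (n + 2) (line 1 (z $ 2))
     else \<sigma> (vector [z $ 1, z $ 1 ^ 3 * z $ 2]))"

lemma triple_blowup:
  assumes it: "iterated_blowup_P2 S \<rho>" and S: "complex_manifold S" and cS: "countable (atlas S)"
    and ch: "mchart S A \<sigma>" and dom: "\<And>z. z $ 1 \<noteq> 0 \<or> z $ 2 = 0 \<Longrightarrow> z \<in> A"
    and fresh: "\<And>P. P \<in> points S \<Longrightarrow> fst ` P \<subseteq> {..<n}"
  obtains S' \<rho>' where "iterated_blowup_P2 S' \<rho>'" "complex_manifold S'" "countable (atlas S')"
    "points S' = (points S - {\<sigma> 0}) \<union> exc n ` (points P1 - {line 1 0}) \<union>
       exc (n + 1) ` (points P1 - {line 1 0}) \<union> exc (n + 2) ` points P1"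
    "\<forall>q\<in>points S - {\<sigma> 0}. \<rho>' q = \<rho> q"
    "\<forall>B \<tau>. mchart S B \<tau> \<longrightarrow> mchart S' {z\<in>B. \<tau> z \<noteq> \<sigma> 0} \<tau>"
    "mchart S' (bdom A 2) (tower1 n \<sigma>)" "mchart S' UNIV (tower2 n \<sigma>)"
    "mchart S' UNIV (tower3 n \<sigma>)" "mchart S' UNIV (tower_top n \<sigma>)"
proof -
  have l0: "line 1 0 \<in> points P1" "line a 1 \<in> points P1" "line 1 a \<in> points P1" for a
    by (simp_all add: vector2_eq_0)
  have l01: "line a 1 \<noteq> line 1 0" for a by (simp add: line_eq_iff)
  interpret b0: blowup_data S A \<sigma> n
    by unfold_locales (use S cS ch fresh dom in auto)
  \<comment> \<open>Chart 1 of the blow-up, with coordinates u and v / u, has the direction of v = 0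
    as its origin, so the next centre is again the origin of a chart.\<close>
  define \<sigma>1 A1 S1 where "\<sigma>1 = bparam n \<sigma> 1" and "A1 = bdom A 1" and "S1 = blow n A \<sigma> S"
  have s10: "\<sigma>1 0 = exc n (line 1 0)" by (simp add: \<sigma>1_def bparam_def slope1)
  have p1: "points S1 = (points S - {\<sigma> 0}) \<union> exc n ` points P1"
    unfolding S1_def by (rule b0.points_blow)
  interpret b1: blowup_data S1 A1 \<sigma>1 "n + 1"
  proof
    show "complex_manifold S1" "countable (atlas S1)" "mchart S1 A1 \<sigma>1"
      unfolding S1_def A1_def \<sigma>1_def by (fact b0.blow_manifold b0.blow_countable b0.mchart_blow_new)+
    show "0 \<in> A1" using dom by (simp add: A1_def bdom_def bdown1)
    show "n + 1 \<notin> fst ` P" if P: "P \<in> points S1" for P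
    proof -
      consider "P \<in> points S" | l where "l \<in> points P1" "P = exc n l" using P unfolding p1 by blast
      then show ?thesis by cases (use fresh[of P] fst_exc[of _ "n + 1" n] in auto)
    qed
  qed
  define \<sigma>2 A2 S2 where "\<sigma>2 = bparam (n + 1) \<sigma>1 1" and "A2 = bdom A1 1" and "S2 = blow (n + 1) A1 \<sigma>1 S1"
  have s20: "\<sigma>2 0 = exc (n + 1) (line 1 0)" by (simp add: \<sigma>2_def bparam_def slope1)
  have p2: "points S2 = (points S1 - {\<sigma>1 0}) \<union> exc (n + 1) ` points P1"
    unfolding S2_def by (rule b1.points_blow)
  interpret b2: blowup_data S2 A2 \<sigma>2 "n + 2"
  proof
    show "complex_manifold S2" "countable (atlas S2)" "mchart S2 A2 \<sigma>2"
      unfolding S2_def A2_def \<sigma>2_def by (fact b1.blow_manifold b1.blow_countable b1.mchart_blow_new)+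
    show "0 \<in> A2" using dom by (simp add: A2_def A1_def bdom_def bdown1)
    show "n + 2 \<notin> fst ` P" if P: "P \<in> points S2" for P
    proof -
      consider "P \<in> points S" | l where "l \<in> points P1" "P = exc n l"
        | l where "l \<in> points P1" "P = exc (n + 1) l" using P unfolding p2 p1 by blast
      then show ?thesis
        by cases (use fresh[of P] fst_exc[of _ "n + 2" n] fst_exc[of _ "n + 2" "n + 1"] in auto)
    qed
  qed
  define S3 where "S3 = blow (n + 2) A2 \<sigma>2 S2"
  have p3: "points S3 = (points S2 - {\<sigma>2 0}) \<union> exc (n + 2) ` points P1"
    unfolding S3_def by (rule b2.points_blow)
  note up1 = b0.mchart_blow_old[folded S1_def] and up2 = b1.mchart_blow_old[folded S2_def]
    and up3 = b2.mchart_blow_old[folded S3_def]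
  have nS: "\<sigma>1 0 \<notin> points S" "\<sigma>2 0 \<notin> points S1"
    unfolding s10 s20 using b0.exc_notin[OF l0(1)] b1.exc_notin[OF l0(1)] by auto
  have ne: "exc n l \<notin> points S" "exc (n + 1) l \<notin> points S1" if "l \<in> points P1" for l
    using b0.exc_notin[OF that] b1.exc_notin[OF that] by auto
  have D: "bdom A1 2 = UNIV" "bdom A2 2 = UNIV" "bdom A2 1 = UNIV"
    using dom by (auto simp: A1_def A2_def bdom_def bdown1 bdown2)
  have dom1: "z \<in> A1" if "z $ 1 \<noteq> 0 \<or> z $ 2 = 0" for z
    using that dom by (simp add: A1_def bdom_def bdown1)
  show ?thesis
  proof (rule that[of S3 "\<rho> \<circ> bproj n \<sigma> \<circ> bproj (n + 1) \<sigma>1 \<circ> bproj (n + 2) \<sigma>2"])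
    show "iterated_blowup_P2 S3 (\<rho> \<circ> bproj n \<sigma> \<circ> bproj (n + 1) \<sigma>1 \<circ> bproj (n + 2) \<sigma>2)"
      unfolding S3_def
      by (rule iterated_blowup_P2.blowup[OF _ b2.is_blowup_blow], unfold S2_def,
          rule iterated_blowup_P2.blowup[OF _ b1.is_blowup_blow], unfold S1_def,
          rule iterated_blowup_P2.blowup[OF it b0.is_blowup_blow])
    show "complex_manifold S3" "countable (atlas S3)"
      unfolding S3_def by (fact b2.blow_manifold b2.blow_countable)+
    have e1: "exc n l = exc n (line 1 0) \<longleftrightarrow> l = line 1 0" "exc n l \<noteq> exc (n + 1) (line 1 0)"
      "exc (n + 1) l = exc (n + 1) (line 1 0) \<longleftrightarrow> l = line 1 0" "exc (n + 1) l \<noteq> exc n (line 1 0)"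
      if "l \<in> points P1" for l using exc_eq_iff[OF that] by auto
    show "points S3 = (points S - {\<sigma> 0}) \<union> exc n ` (points P1 - {line 1 0}) \<union>
       exc (n + 1) ` (points P1 - {line 1 0}) \<union> exc (n + 2) ` points P1"
    proof -
      have "exc n ` points P1 - {exc n (line 1 0)} = exc n ` (points P1 - {line 1 0})"
        "exc (n + 1) ` points P1 - {exc (n + 1) (line 1 0)} = exc (n + 1) ` (points P1 - {line 1 0})"
        using e1 by blast+
      moreover have "points S1 - {exc n (line 1 0)} - {exc (n + 1) (line 1 0)} = points S1 - {exc n (line 1 0)}"
        using nS s20 by auto
      moreover have "points S - {\<sigma> 0} - {exc n (line 1 0)} = points S - {\<sigma> 0}"
        using nS s10 by auto
      ultimately show ?thesis unfolding p3 p2 s10 s20 by (simp add: Un_Diff p1)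
    qed
    show "\<forall>q\<in>points S - {\<sigma> 0}. (\<rho> \<circ> bproj n \<sigma> \<circ> bproj (n + 1) \<sigma>1 \<circ> bproj (n + 2) \<sigma>2) q = \<rho> q"
    proof
      fix q assume q: "q \<in> points S - {\<sigma> 0}"
      then have q1: "q \<in> points S1" unfolding p1 by blast
      then have "q \<in> points S2" unfolding p2 using q nS(1) by auto
      then show "(\<rho> \<circ> bproj n \<sigma> \<circ> bproj (n + 1) \<sigma>1 \<circ> bproj (n + 2) \<sigma>2) q = \<rho> q"
        using q q1 b0.bproj_old b1.bproj_old b2.bproj_old by simp
    qed
    show "\<forall>B \<tau>. mchart S B \<tau> \<longrightarrow> mchart S3 {z\<in>B. \<tau> z \<noteq> \<sigma> 0} \<tau>"
    proof (intro allI impI)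
      fix B \<tau> assume t: "mchart S B \<tau>"
      have eq: "{z\<in>B. \<tau> z \<noteq> \<sigma> 0} = {z\<in>B. \<tau> z \<in> points S \<inter> - {\<sigma> 0}}"
        using mchartD(3)[OF t] by auto
      have c: "mchart S {z\<in>B. \<tau> z \<noteq> \<sigma> 0} \<tau>"
        unfolding eq by (rule mchart_restrict[OF S t mchart_preimage_open[OF S t b0.open_S1]]) auto
      have c1: "mchart S1 {z\<in>B. \<tau> z \<noteq> \<sigma> 0} \<tau>" by (rule up1[OF c]) auto
      have c2: "mchart S2 {z\<in>B. \<tau> z \<noteq> \<sigma> 0} \<tau>"
        by (rule up2[OF c1]) (use mchartD(3)[OF c] nS in blast)
      show "mchart S3 {z\<in>B. \<tau> z \<noteq> \<sigma> 0} \<tau>"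
        by (rule up3[OF c2]) (use mchartD(3)[OF c1] nS in blast)
    qed
    have n1: "\<sigma>1 0 \<notin> bparam n \<sigma> 2 ` bdom A 2"
    proof
      assume "\<sigma>1 0 \<in> bparam n \<sigma> 2 ` bdom A 2"
      then obtain z where z: "z \<in> bdom A 2" "exc n (line 1 0) = bparam n \<sigma> 2 z" unfolding s10 by blast
      then have "z $ 2 = 0" using b0.exc_neq_sigma[OF l0(1), of "bdown 2 z"]
        by (auto simp: bparam_def bdom_def split: if_splits)
      with z show False using exc_eq_iff[OF l0(1), of n n] l01[of "z $ 1"]
        by (auto simp: bparam_def slope2)
    qed
    have n2: "\<sigma>2 0 \<notin> bparam (n + 1) \<sigma>1 2 ` bdom A1 2"
    proof
      assume "\<sigma>2 0 \<in> bparam (n + 1) \<sigma>1 2 ` bdom A1 2"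
      then obtain z where z: "z \<in> bdom A1 2" "exc (n + 1) (line 1 0) = bparam (n + 1) \<sigma>1 2 z" unfolding s20 by blast
      then have "z $ 2 = 0" using b1.exc_neq_sigma[OF l0(1), of "bdown 2 z"]
        by (auto simp: bparam_def bdom_def split: if_splits)
      with z show False using exc_eq_iff[OF l0(1), of "n + 1" "n + 1"] l01[of "z $ 1"]
        by (auto simp: bparam_def slope2)
    qed
    have c1: "mchart S1 (bdom A 2) (bparam n \<sigma> 2)" unfolding S1_def by (rule b0.mchart_blow_new)
    have c2: "mchart S2 (bdom A 2) (bparam n \<sigma> 2)" by (rule up2[OF c1 n1])
    have "mchart S3 (bdom A 2) (bparam n \<sigma> 2)"
      by (rule up3[OF c2]) (use mchartD(3)[OF c1] nS in blast)
    then show "mchart S3 (bdom A 2) (tower1 n \<sigma>)"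
      by (rule mchart_cong) (simp add: tower1_def bparam_def slope2 bdown2 mult.commute)
    have c3: "mchart S2 UNIV (bparam (n + 1) \<sigma>1 2)"
      using b1.mchart_blow_new[of 2] unfolding S2_def D .
    have "mchart S3 UNIV (bparam (n + 1) \<sigma>1 2)" by (rule up3[OF c3 n2[unfolded D]])
    then show "mchart S3 UNIV (tower2 n \<sigma>)"
      by (rule mchart_cong)
        (simp add: tower2_def bparam_def slope2 slope1 bdown1 bdown2 \<sigma>1_def power2_eq_square ac_simps)
    have "mchart S3 UNIV (bparam (n + 2) \<sigma>2 2)"
      using b2.mchart_blow_new[of 2] unfolding S3_def D .
    then show "mchart S3 UNIV (tower3 n \<sigma>)"
      by (rule mchart_cong)
        (simp add: tower3_def bparam_def slope2 slope1 bdown1 bdown2 \<sigma>1_def \<sigma>2_def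
          power2_eq_square power3_eq_cube ac_simps)
    have "mchart S3 UNIV (bparam (n + 2) \<sigma>2 1)"
      using b2.mchart_blow_new[of 1] unfolding S3_def D .
    then show "mchart S3 UNIV (tower_top n \<sigma>)"
      by (rule mchart_cong)
        (simp add: tower_top_def bparam_def slope2 slope1 bdown1 bdown2 \<sigma>1_def \<sigma>2_def
          power2_eq_square power3_eq_cube ac_simps)
  qed
qed

lemmas cdiff_intros = cdiff_const cdiff_nth cdiff_add cdiff_diff cdiff_mult cdiff_uminus cdiff_power

text \<open>A shear is inverted by subtracting \<open>p\<close>. With a quadratic \<open>p\<close>
  it will remove the part of the expansion at a base point that all cubics of the pencil
  share.\<close>

lemma mchart_shear:
  fixes p :: "complex \<Rightarrow> complex" and B :: "(complex ^ 2) set"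
  assumes M: "complex_manifold M" and X: "mchart M B X" and p: "\<And>z :: complex ^ 2. cdiff (\<lambda>z. p (z $ 1)) z"
  shows "mchart M {z. vector [z $ 1, p (z $ 1) + z $ 2] \<in> B} (\<lambda>z. X (vector [z $ 1, p (z $ 1) + z $ 2]))"
proof -
  let ?t = "\<lambda>z :: complex ^ 2. vector [z $ 1, p (z $ 1) + z $ 2] :: complex ^ 2"
  let ?k = "\<lambda>z :: complex ^ 2. vector [z $ 1, z $ 2 - p (z $ 1)] :: complex ^ 2"
  have h: "holo_on W ?t" "holo_on W ?k" for W
    unfolding holo_on_vector2 using p by auto
  have im: "?t ` {z. ?t z \<in> B} = B"
  proof (intro equalityI subsetI)
    fix w assume "w \<in> B"
    moreover have "?t (?k w) = w" by (simp add: vector2_eq_iff)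
    ultimately show "w \<in> ?t ` {z. ?t z \<in> B}" by (intro image_eqI[where x = "?k w"]) auto
  qed auto
  have "mchart M {z. ?t z \<in> B} (X \<circ> ?t)"
    by (rule mchart_compose[OF M X, where \<kappa> = ?k])
      (use h im mchartD(1)[OF X] holo_on_preimage[OF h(1) open_UNIV mchartD(1)[OF X]] in
        \<open>auto simp: vector2_eq_iff\<close>)
  then show ?thesis by (simp add: o_def)
qed

section \<open>The nine-fold blow-up of the projective plane\<close>

text \<open>A line in C^3 is recorded by its intersections with the three hyperplanes on which one
  coordinate is 1. This moves the projective plane into the prescribed type of points and leaves the
  labels from 3 on for exceptional curves.\<close>

definition plane_label :: "(complex ^ 3) set \<Rightarrow> (nat \<times> (complex ^ 2)) set" where
  "plane_label l = Pair 0 ` {z. vector [1, z $ 1, z $ 2] \<in> l} \<union> Pair 1 ` {z. vector [z $ 1, 1, z $ 2] \<in> l}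
     \<union> Pair 2 ` {z. vector [z $ 1, z $ 2, 1] \<in> l}"

lemma vector3_eq_iff: "v = w \<longleftrightarrow> v $ 1 = w $ 1 \<and> v $ 2 = w $ 2 \<and> v $ 3 = w $ 3" for v w :: "'a ^ 3"
  by (simp add: vec_eq_iff forall_3)

lemma points_P2: "points P2 = {line_through v |v. v \<noteq> 0}"
  by (simp add: projective_space_def)

text \<open>Every line meets one of the three hyperplanes, necessarily in a nonzero vector. Equal
  label sets put this vector on both lines, and a line is spanned by any of its nonzero
  vectors.\<close>

lemma inj_plane_label: "inj_on plane_label (points P2)"
proof (rule inj_onI)
  fix l l' assume l: "l \<in> points P2" "l' \<in> points P2" and eq: "plane_label l = plane_label l'"
  have "(0, z) \<in> plane_label k \<longleftrightarrow> vector [1, z $ 1, z $ 2] \<in> k"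
    "(1, z) \<in> plane_label k \<longleftrightarrow> vector [z $ 1, 1, z $ 2] \<in> k"
    "(2, z) \<in> plane_label k \<longleftrightarrow> vector [z $ 1, z $ 2, 1] \<in> k" for z k
    unfolding plane_label_def by (auto simp: image_iff)
  then have c: "vector [1, z $ 1, z $ 2] \<in> l \<longleftrightarrow> vector [1, z $ 1, z $ 2] \<in> l'"
    "vector [z $ 1, 1, z $ 2] \<in> l \<longleftrightarrow> vector [z $ 1, 1, z $ 2] \<in> l'"
    "vector [z $ 1, z $ 2, 1] \<in> l \<longleftrightarrow> vector [z $ 1, z $ 2, 1] \<in> l'" for z :: "complex ^ 2"
    using eq by metis+
  obtain v where v: "l = line_through v" "v \<noteq> 0" using l unfolding points_P2 by blast
  have *: "\<exists>w. w \<noteq> 0 \<and> w \<in> l \<and> w \<in> l'"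
  proof -
    consider "v $ 1 \<noteq> 0" | "v $ 2 \<noteq> 0" | "v $ 3 \<noteq> 0" using v(2) by (auto simp: vector3_eq_iff)
    then show ?thesis
    proof cases
      case 1
      let ?z = "vector [v $ 2 / v $ 1, v $ 3 / v $ 1] :: complex ^ 2"
      have "vector [1, ?z $ 1, ?z $ 2] = (1 / v $ 1) *s v" using 1 by (simp add: vector3_eq_iff)
      then have "vector [1, ?z $ 1, ?z $ 2] \<in> l" unfolding v(1) by simp
      moreover from this have "vector [1, ?z $ 1, ?z $ 2] \<in> l'" using c(1)[of ?z] by simp
      moreover have "vector [1, ?z $ 1, ?z $ 2] \<noteq> (0 :: complex ^ 3)" by (simp add: vector3_eq_iff)
      ultimately show ?thesis by blast
    next
      case 2
      let ?z = "vector [v $ 1 / v $ 2, v $ 3 / v $ 2] :: complex ^ 2"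
      have "vector [?z $ 1, 1, ?z $ 2] = (1 / v $ 2) *s v" using 2 by (simp add: vector3_eq_iff)
      then have "vector [?z $ 1, 1, ?z $ 2] \<in> l" unfolding v(1) by simp
      moreover from this have "vector [?z $ 1, 1, ?z $ 2] \<in> l'" using c(2)[of ?z] by simp
      moreover have "vector [?z $ 1, 1, ?z $ 2] \<noteq> (0 :: complex ^ 3)" by (simp add: vector3_eq_iff)
      ultimately show ?thesis by blast
    next
      case 3
      let ?z = "vector [v $ 1 / v $ 3, v $ 2 / v $ 3] :: complex ^ 2"
      have "vector [?z $ 1, ?z $ 2, 1] = (1 / v $ 3) *s v" using 3 by (simp add: vector3_eq_iff)
      then have "vector [?z $ 1, ?z $ 2, 1] \<in> l" unfolding v(1) by simp
      moreover from this have "vector [?z $ 1, ?z $ 2, 1] \<in> l'" using c(3)[of ?z] by simp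
      moreover have "vector [?z $ 1, ?z $ 2, 1] \<noteq> (0 :: complex ^ 3)" by (simp add: vector3_eq_iff)
      ultimately show ?thesis by blast
    qed
  qed
  then obtain w where w: "w \<noteq> 0" "w \<in> l" "w \<in> l'" by blast
  obtain v' where v': "l' = line_through v'" using l unfolding points_P2 by blast
  show "l = l'" using line_through_eq[of w v] line_through_eq[of w v'] w v(1) v' by simp
qed

text \<open>The first homogeneous coordinate is the one that vanishes at infinity:
  \<open>hpoint 1 x y\<close> is the affine point, and \<open>hpoint 0 b c\<close> is the direction
  with y / x = c / b.\<close>

definition hpoint :: "complex \<Rightarrow> complex \<Rightarrow> complex \<Rightarrow> (nat \<times> (complex ^ 2)) set" where
  "hpoint a b c = plane_label (line_through (vector [a, b, c]))"

lemma hpoint_eq_iff: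
  assumes "a \<noteq> 0 \<or> b \<noteq> 0 \<or> c \<noteq> 0" "a' \<noteq> 0 \<or> b' \<noteq> 0 \<or> c' \<noteq> 0"
  shows "hpoint a b c = hpoint a' b' c' \<longleftrightarrow> a * b' = b * a' \<and> a * c' = c * a' \<and> b * c' = c * b'"
proof -
  have nz: "vector [a, b, c] \<noteq> (0 :: complex ^ 3)" "vector [a', b', c'] \<noteq> (0 :: complex ^ 3)"
    using assms by (auto simp: vector3_eq_iff)
  have "hpoint a b c = hpoint a' b' c' \<longleftrightarrow>
      line_through (vector [a, b, c]) = line_through (vector [a', b', c'] :: complex ^ 3)"
    unfolding hpoint_def
    by (rule inj_on_eq_iff[OF inj_plane_label]) (use nz in \<open>auto simp: points_P2\<close>)
  also have "\<dots> \<longleftrightarrow> a * b' = b * a' \<and> a * c' = c * a' \<and> b * c' = c * b'"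
    by (subst line_through_eq_iff[OF nz]) (auto simp: forall_3 algebra_simps)
  finally show ?thesis .
qed

text \<open>
  Coordinates centred at the three base points of the pencil of cubics
  \<open>x * y\<^sup>2 / 2 + \<gamma> * y - x\<^sup>3 / 2 - 2 * \<alpha> * x\<^sup>2 - 2 * \<beta> * x = const\<close>, in which its members are tangent to \<open>z $ 2 = 0\<close>
  to third order.
\<close>

definition base_chart :: "complex \<Rightarrow> complex \<Rightarrow> complex \<Rightarrow> nat \<Rightarrow> complex ^ 2 \<Rightarrow> (nat \<times> (complex ^ 2)) set" where
  "base_chart \<alpha> \<beta> \<gamma> j z =
     (if j = 0 then hpoint (z $ 1) 1 (1 + 2*\<alpha> * z $ 1 - (2*\<alpha>^2 - 2*\<beta> + \<gamma>) * (z $ 1)^2 + z $ 2)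
      else if j = 1 then hpoint (z $ 1) 1 (- 1 - 2*\<alpha> * z $ 1 + (2*\<alpha>^2 - 2*\<beta> - \<gamma>) * (z $ 1)^2 + z $ 2)
      else hpoint (z $ 1) (- 2*\<gamma> * (z $ 1)^2 + z $ 2) 1)"

definition base_point :: "nat \<Rightarrow> (nat \<times> (complex ^ 2)) set" where
  "base_point j = (if j = 0 then hpoint 0 1 1 else if j = 1 then hpoint 0 1 (- 1) else hpoint 0 0 1)"

lemma base_chart_0: "base_chart \<alpha> \<beta> \<gamma> j 0 = base_point j"
  by (simp add: base_chart_def base_point_def)

lemma fst_hpoint: "fst ` hpoint a b c \<subseteq> {..<3}"
  unfolding hpoint_def plane_label_def by auto

lemma exc_neq_hpoint: "l \<in> points P1 \<Longrightarrow> n \<ge> 3 \<Longrightarrow> exc n l \<noteq> hpoint a b c"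
proof
  assume "l \<in> points P1" "n \<ge> 3" "exc n l = hpoint a b c"
  then have "n \<in> fst ` hpoint a b c" using fst_exc[of l n n] by simp
  then show False using fst_hpoint[of a b c] \<open>n \<ge> 3\<close> by auto
qed

lemma base_point_hpoint: "\<exists>b c. base_point k = hpoint 0 b c \<and> (b \<noteq> 0 \<or> c \<noteq> 0)"
  unfolding base_point_def by (metis one_neq_zero)

lemma exc_neq_base_point: "l \<in> points P1 \<Longrightarrow> n \<ge> 3 \<Longrightarrow> exc n l \<noteq> base_point k"
  using base_point_hpoint[of k] exc_neq_hpoint by metis

lemma hpoint_neq_base_point:
  assumes "a \<noteq> 0" shows "hpoint a b c \<noteq> base_point k"
proof -
  obtain b' c' where "base_point k = hpoint 0 b' c'" "b' \<noteq> 0 \<or> c' \<noteq> 0" using base_point_hpoint by blast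
  then show ?thesis using assms hpoint_eq_iff[of a b c 0 b' c'] by auto
qed

lemma base_chart_neq: "z $ 1 \<noteq> 0 \<Longrightarrow> base_chart \<alpha> \<beta> \<gamma> j z \<noteq> base_point k"
  unfolding base_chart_def using hpoint_neq_base_point by auto

lemma base_point_neq: "base_point 0 \<noteq> base_point 1" "base_point 0 \<noteq> base_point 2" "base_point 1 \<noteq> base_point 2"
  by (auto simp: base_point_def hpoint_eq_iff)

lemma in_P1_line: "line a 1 \<in> points P1" "line 1 a \<in> points P1"
  by (simp_all add: vector2_eq_0)

text \<open>The charts over one base point do not run into another centre; only
  \<open>tower1\<close>, off its exceptional curve, can follow the line at infinity into one. Later
  blow-ups therefore leave these charts intact, up to a smaller domain of
  \<open>tower1\<close>.\<close>

lemma tower_neq_base_point: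
  assumes "n \<ge> 3"
  shows "z $ 2 = 0 \<Longrightarrow> tower1 n (base_chart \<alpha> \<beta> \<gamma> j) z \<noteq> base_point k"
    "tower2 n (base_chart \<alpha> \<beta> \<gamma> j) z \<noteq> base_point k"
    "tower3 n (base_chart \<alpha> \<beta> \<gamma> j) z \<noteq> base_point k"
    "tower_top n (base_chart \<alpha> \<beta> \<gamma> j) z \<noteq> base_point k"
  using assms by (auto simp: tower1_def tower2_def tower3_def tower_top_def
      base_chart_neq exc_neq_base_point[OF in_P1_line(1)] exc_neq_base_point[OF in_P1_line(2)])

lemma all_less_3: "(\<forall>j<3::nat. P j) \<longleftrightarrow> P 0 \<and> P 1 \<and> P 2"
  by (auto simp: numeral_3_eq_3 less_Suc_eq numeral_2_eq_2)

lemma lessThan_3: "{..<3::nat} = {0, 1, 2}"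
  by auto

text \<open>Base point \<open>j\<close> uses the labels \<open>3 + 3 * j\<close>,
  \<open>4 + 3 * j\<close> and \<open>5 + 3 * j\<close> for its successive exceptional curves; these
  stay clear of the labels 0, 1, 2 of the plane and of each other, which provides freshness at every
  stage.\<close>

lemma nine_fold_blowup:
  fixes \<alpha> \<beta> \<gamma> :: complex
  obtains S \<rho> where "iterated_blowup_P2 S \<rho>" "complex_manifold S" "countable (atlas S)"
    "\<forall>z :: complex ^ 2. \<rho> (hpoint 1 (z $ 1) (z $ 2)) = line_through (vector [1, z $ 1, z $ 2])"
    "points S = (plane_label ` points P2 - base_point ` {..<3}) \<union>
       (\<Union>j<3. exc (3 + 3 * j) ` (points P1 - {line 1 0}) \<union> exc (4 + 3 * j) ` (points P1 - {line 1 0})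
          \<union> exc (5 + 3 * j) ` points P1)"
    "mchart S UNIV (\<lambda>z. hpoint 1 (z $ 1) (z $ 2))"
    "mchart S {z. \<forall>j<3. hpoint (z $ 1) 1 (z $ 2) \<noteq> base_point j} (\<lambda>z. hpoint (z $ 1) 1 (z $ 2))"
    "\<forall>j<3. \<exists>D. mchart S D (tower1 (3 + 3 * j) (base_chart \<alpha> \<beta> \<gamma> j)) \<and> (\<forall>z. z $ 2 = 0 \<longrightarrow> z \<in> D)"
    "\<forall>j<3. mchart S UNIV (tower2 (3 + 3 * j) (base_chart \<alpha> \<beta> \<gamma> j))"
    "\<forall>j<3. mchart S UNIV (tower3 (3 + 3 * j) (base_chart \<alpha> \<beta> \<gamma> j))"
    "\<forall>j<3. mchart S UNIV (tower_top (3 + 3 * j) (base_chart \<alpha> \<beta> \<gamma> j))"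
proof -
  let ?s = "base_chart \<alpha> \<beta> \<gamma>"
  define S0 where "S0 = push plane_label P2"
  note pp = complex_manifold_push[OF P2_manifold(1,2) inj_plane_label, folded S0_def]
  let ?r = "inv_into (points P2) plane_label"
  have rl: "?r (plane_label l) = l" if "l \<in> points P2" for l using inj_plane_label that by simp
  have it0: "iterated_blowup_P2 S0 ?r"
  proof (rule iterated_blowup_P2.plane[OF pp(1) biholomorphicI[OF pp(1) P2_manifold(1), where g = plane_label]])
    fix x assume "x \<in> points S0"
    then obtain l where l: "l \<in> points P2" "x = plane_label l" unfolding pp(4) by blast
    obtain B \<tau> z where c: "mchart P2 B \<tau>" "z \<in> B" "\<tau> z = l" using mchart_at[OF P2_manifold(1) l(1)] by metis
    show "hol_at S0 P2 ?r x"
      by (rule hol_atI[OF pp(3)[OF c(1)] c(1) holo_on_id])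
        (use c(2,3) l rl mchartD(3)[OF c(1)] in auto)
    show "plane_label (?r x) = x" using l rl by simp
  next
    fix l assume l: "l \<in> points P2"
    obtain B \<tau> z where c: "mchart P2 B \<tau>" "z \<in> B" "\<tau> z = l" using mchart_at[OF P2_manifold(1) l] by metis
    show "hol_at P2 S0 plane_label l"
      by (rule hol_atI[OF c(1) pp(3)[OF c(1)] holo_on_id]) (use c(2,3) in auto)
    show "?r (plane_label l) = l" using l rl by simp
  qed
  have X0: "mchart S0 UNIV (\<lambda>z. hpoint 1 (z $ 1) (z $ 2))"
    and X1: "mchart S0 UNIV (\<lambda>z. hpoint (z $ 1) 1 (z $ 2))"
    and X2: "mchart S0 UNIV (\<lambda>z. hpoint (z $ 1) (z $ 2) 1)"
    using pp(3)[OF P2_manifold(3)] pp(3)[OF P2_manifold(4)] pp(3)[OF P2_manifold(5)]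
    by (simp_all add: o_def hpoint_def)
  have c0: "mchart S0 UNIV (?s 0)"
  proof -
    have "cdiff (\<lambda>z. (\<lambda>u. 1 + 2*\<alpha> * u - (2*\<alpha>^2 - 2*\<beta> + \<gamma>) * u^2) (z $ 1)) z" for z :: "complex ^ 2" by (intro cdiff_intros)
    from mchart_shear[OF pp(1) X1 this] show ?thesis by (simp add: base_chart_def[abs_def])
  qed
  have c1: "mchart S0 UNIV (?s 1)"
  proof -
    have "cdiff (\<lambda>z. (\<lambda>u. - 1 - 2*\<alpha> * u + (2*\<alpha>^2 - 2*\<beta> - \<gamma>) * u^2) (z $ 1)) z" for z :: "complex ^ 2" by (intro cdiff_intros)
    from mchart_shear[OF pp(1) X1 this] show ?thesis by (simp add: base_chart_def[abs_def])
  qed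
  have c2: "mchart S0 UNIV (?s 2)"
  proof -
    have "cdiff (\<lambda>z. (\<lambda>u. - 2*\<gamma> * u^2) (z $ 1)) z" for z :: "complex ^ 2" by (intro cdiff_intros)
    from mchart_shear[OF pp(1) X2 this] show ?thesis by (simp add: base_chart_def[abs_def])
  qed
  have f0: "fst ` P \<subseteq> {..<3}" if "P \<in> points S0" for P
    using that unfolding pp(4) plane_label_def by auto
  have fe: "fst ` P \<subseteq> {..<m}" if "P \<in> exc k ` X" "k < m" for P k m X
    using that unfolding exc_def by auto
  obtain S1 \<rho>1 where S1: "iterated_blowup_P2 S1 \<rho>1" "complex_manifold S1" "countable (atlas S1)"
    "points S1 = (points S0 - {?s 0 0}) \<union> exc 3 ` (points P1 - {line 1 0}) \<union>
       exc (3 + 1) ` (points P1 - {line 1 0}) \<union> exc (3 + 2) ` points P1"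
    "\<forall>q\<in>points S0 - {?s 0 0}. \<rho>1 q = ?r q"
    "\<forall>B \<tau>. mchart S0 B \<tau> \<longrightarrow> mchart S1 {z\<in>B. \<tau> z \<noteq> ?s 0 0} \<tau>"
    "mchart S1 (bdom UNIV 2) (tower1 3 (?s 0))" "mchart S1 UNIV (tower2 3 (?s 0))"
    "mchart S1 UNIV (tower3 3 (?s 0))" "mchart S1 UNIV (tower_top 3 (?s 0))"
    by (rule triple_blowup[OF it0 pp(1,2) c0 _ f0]) auto
  note old1 = S1(6)[rule_format, unfolded base_chart_0]
  have f1: "fst ` P \<subseteq> {..<6}" if "P \<in> points S1" for P
    using that f0[of P] fe[of P 3 _ 6] fe[of P "3 + 1" _ 6] fe[of P "3 + 2" _ 6] unfolding S1(4) by fastforce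
  \<comment> \<open>The chart at the second base point also covers the first one, which is gone
    after the first tower and must be cut out. It lies on z $ 1 = 0 with z $ 2 nonzero, where
    \<open>triple_blowup\<close> permits it.\<close>
  let ?A1 = "{z\<in>UNIV. ?s 1 z \<noteq> base_point 0}"
  have A1: "z \<in> ?A1" if "z $ 1 \<noteq> 0 \<or> z $ 2 = 0" for z
  proof (cases "z $ 1 = 0")
    case True
    then have "z = 0" using that by (simp add: vector2_eq_iff)
    then show ?thesis using base_point_neq by (simp add: base_chart_0)
  qed (simp add: base_chart_neq)
  obtain S2 \<rho>2 where S2: "iterated_blowup_P2 S2 \<rho>2" "complex_manifold S2" "countable (atlas S2)"
    "points S2 = (points S1 - {?s 1 0}) \<union> exc 6 ` (points P1 - {line 1 0}) \<union>
       exc (6 + 1) ` (points P1 - {line 1 0}) \<union> exc (6 + 2) ` points P1"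
    "\<forall>q\<in>points S1 - {?s 1 0}. \<rho>2 q = \<rho>1 q"
    "\<forall>B \<tau>. mchart S1 B \<tau> \<longrightarrow> mchart S2 {z\<in>B. \<tau> z \<noteq> ?s 1 0} \<tau>"
    "mchart S2 (bdom ?A1 2) (tower1 6 (?s 1))" "mchart S2 UNIV (tower2 6 (?s 1))"
    "mchart S2 UNIV (tower3 6 (?s 1))" "mchart S2 UNIV (tower_top 6 (?s 1))"
    by (rule triple_blowup[OF S1(1-3) old1[OF c1] A1 f1]) auto
  note old2 = S2(6)[rule_format, unfolded base_chart_0]
  have f2: "fst ` P \<subseteq> {..<9}" if "P \<in> points S2" for P
    using that f1[of P] fe[of P 6 _ 9] fe[of P "6 + 1" _ 9] fe[of P "6 + 2" _ 9] unfolding S2(4) by fastforce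
  let ?A2 = "{z\<in>{z\<in>UNIV. ?s 2 z \<noteq> base_point 0}. ?s 2 z \<noteq> base_point 1}"
  have A2: "z \<in> ?A2" if "z $ 1 \<noteq> 0 \<or> z $ 2 = 0" for z
  proof (cases "z $ 1 = 0")
    case True
    then have "z = 0" using that by (simp add: vector2_eq_iff)
    then show ?thesis using base_point_neq by (simp add: base_chart_0)
  qed (simp add: base_chart_neq)
  obtain S3 \<rho>3 where S3: "iterated_blowup_P2 S3 \<rho>3" "complex_manifold S3" "countable (atlas S3)"
    "points S3 = (points S2 - {?s 2 0}) \<union> exc 9 ` (points P1 - {line 1 0}) \<union>
       exc (9 + 1) ` (points P1 - {line 1 0}) \<union> exc (9 + 2) ` points P1"
    "\<forall>q\<in>points S2 - {?s 2 0}. \<rho>3 q = \<rho>2 q"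
    "\<forall>B \<tau>. mchart S2 B \<tau> \<longrightarrow> mchart S3 {z\<in>B. \<tau> z \<noteq> ?s 2 0} \<tau>"
    "mchart S3 (bdom ?A2 2) (tower1 9 (?s 2))" "mchart S3 UNIV (tower2 9 (?s 2))"
    "mchart S3 UNIV (tower3 9 (?s 2))" "mchart S3 UNIV (tower_top 9 (?s 2))"
    by (rule triple_blowup[OF S2(1-3) old2[OF old1[OF c2]] A2 f2]) auto
  note old3 = S3(6)[rule_format, unfolded base_chart_0]
  have t23: "mchart S3 UNIV \<tau>" if "mchart S2 UNIV \<tau>" "\<And>z. \<tau> z \<noteq> base_point 2" for \<tau>
    using old3[OF that(1)] that(2) by simp
  have t13: "mchart S3 UNIV \<tau>" if "mchart S1 UNIV \<tau>" "\<And>z. \<tau> z \<noteq> base_point 1" "\<And>z. \<tau> z \<noteq> base_point 2" for \<tau>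
    using t23[OF _ that(3)] old2[OF that(1)] that(2) by simp
  have "(3::nat) \<le> 6" by simp
  note ne = tower_neq_base_point[where n = 3, OF order_refl] tower_neq_base_point[where n = 6, OF this]
  have pS0: "points S0 = plane_label ` points P2" by (rule pp(4))
  show ?thesis
  proof (rule that[OF S3(1-3)])
    show "\<forall>z :: complex ^ 2. \<rho>3 (hpoint 1 (z $ 1) (z $ 2)) = line_through (vector [1, z $ 1, z $ 2])"
    proof
      fix z :: "complex ^ 2"
      let ?q = "hpoint 1 (z $ 1) (z $ 2)"
      have l: "line_through (vector [1, z $ 1, z $ 2] :: complex ^ 3) \<in> points P2"
        unfolding points_P2 by (auto simp: vector3_eq_iff)
      have b: "?q \<noteq> base_point k" for k by (rule hpoint_neq_base_point) simp
      have q0: "?q \<in> points S0" unfolding pS0 hpoint_def using l by blast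
      then have q1: "?q \<in> points S1" using b unfolding S1(4) base_chart_0 by blast
      then have q2: "?q \<in> points S2" using b unfolding S2(4) base_chart_0 by blast
      have "\<rho>3 ?q = \<rho>2 ?q" using S3(5) q2 b unfolding base_chart_0 by blast
      also have "\<dots> = \<rho>1 ?q" using S2(5) q1 b unfolding base_chart_0 by blast
      also have "\<dots> = ?r ?q" using S1(5) q0 b unfolding base_chart_0 by blast
      also have "\<dots> = line_through (vector [1, z $ 1, z $ 2])" unfolding hpoint_def by (rule rl[OF l])
      finally show "\<rho>3 ?q = line_through (vector [1, z $ 1, z $ 2])" .
    qed
    have d: "exc m ` X - {base_point k} = exc m ` X" if "X \<subseteq> points P1" "m \<ge> 3" for m X k
      using exc_neq_base_point[of _ m k] that by blast
    have dd: "points P1 - {line 1 0} \<subseteq> points P1" by blast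
    have "points S3 = (points S0 - {base_point 0} - {base_point 1} - {base_point 2}) \<union>
       (exc 3 ` (points P1 - {line 1 0}) \<union> exc 4 ` (points P1 - {line 1 0}) \<union> exc 5 ` points P1) \<union>
       (exc 6 ` (points P1 - {line 1 0}) \<union> exc 7 ` (points P1 - {line 1 0}) \<union> exc 8 ` points P1) \<union>
       (exc 9 ` (points P1 - {line 1 0}) \<union> exc 10 ` (points P1 - {line 1 0}) \<union> exc 11 ` points P1)"
      unfolding S3(4) S2(4) S1(4) base_chart_0 by (simp add: Un_Diff d[OF dd] d[OF order_refl] Un_ac)
    moreover have "points S0 - {base_point 0} - {base_point 1} - {base_point 2} = points S0 - base_point ` {..<3}"
      unfolding lessThan_3 by auto
    ultimately show "points S3 = (plane_label ` points P2 - base_point ` {..<3}) \<union>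
       (\<Union>j<3. exc (3 + 3 * j) ` (points P1 - {line 1 0}) \<union> exc (4 + 3 * j) ` (points P1 - {line 1 0})
          \<union> exc (5 + 3 * j) ` points P1)"
      unfolding pS0 lessThan_3 by (simp add: Un_ac)
    have "mchart S3 {z\<in>{z\<in>{z\<in>UNIV. hpoint 1 (z $ 1) (z $ 2) \<noteq> base_point 0}. hpoint 1 (z $ 1) (z $ 2) \<noteq> base_point 1}.
        hpoint 1 (z $ 1) (z $ 2) \<noteq> base_point 2} (\<lambda>z. hpoint 1 (z $ 1) (z $ 2))"
      by (rule old3[OF old2[OF old1[OF X0]]])
    then show "mchart S3 UNIV (\<lambda>z. hpoint 1 (z $ 1) (z $ 2))" by (simp add: hpoint_neq_base_point)
    have "mchart S3 {z\<in>{z\<in>{z\<in>UNIV. hpoint (z $ 1) 1 (z $ 2) \<noteq> base_point 0}. hpoint (z $ 1) 1 (z $ 2) \<noteq> base_point 1}.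
        hpoint (z $ 1) 1 (z $ 2) \<noteq> base_point 2} (\<lambda>z. hpoint (z $ 1) 1 (z $ 2))"
      by (rule old3[OF old2[OF old1[OF X1]]])
    moreover have "{z\<in>{z\<in>{z\<in>(UNIV :: (complex ^ 2) set). hpoint (z $ 1) 1 (z $ 2) \<noteq> base_point 0}. hpoint (z $ 1) 1 (z $ 2) \<noteq> base_point 1}.
        hpoint (z $ 1) 1 (z $ 2) \<noteq> base_point 2} = {z. \<forall>j<3. hpoint (z $ 1) 1 (z $ 2) \<noteq> base_point j}"
      unfolding all_less_3 by auto
    ultimately show "mchart S3 {z. \<forall>j<3. hpoint (z $ 1) 1 (z $ 2) \<noteq> base_point j} (\<lambda>z. hpoint (z $ 1) 1 (z $ 2))"
      by (simp only:)
    have v00: "vector [0, 0] = (0 :: complex ^ 2)" by (simp add: vector2_eq_iff)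
    have A0: "z \<in> bdom X 2" if "z $ 2 = 0" "0 \<in> X" for z X
      using that by (simp add: bdom_def bdown2 v00)
    have z0: "(0 :: complex ^ 2) $ 1 \<noteq> 0 \<or> (0 :: complex ^ 2) $ 2 = 0" by simp
    show "\<forall>j<3. \<exists>D. mchart S3 D (tower1 (3 + 3 * j) (?s j)) \<and> (\<forall>z. z $ 2 = 0 \<longrightarrow> z \<in> D)"
      unfolding all_less_3
    proof (intro conjI)
      show "\<exists>D. mchart S3 D (tower1 (3 + 3 * 0) (?s 0)) \<and> (\<forall>z. z $ 2 = 0 \<longrightarrow> z \<in> D)"
        using old3[OF old2[OF S1(7)]] ne(1) A0[OF _ UNIV_I] by (intro exI conjI) (simp, simp)
      show "\<exists>D. mchart S3 D (tower1 (3 + 3 * 1) (?s 1)) \<and> (\<forall>z. z $ 2 = 0 \<longrightarrow> z \<in> D)"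
        using old3[OF S2(7)] ne(5) A0[OF _ A1[OF z0]] by (intro exI conjI) (simp, simp)
      show "\<exists>D. mchart S3 D (tower1 (3 + 3 * 2) (?s 2)) \<and> (\<forall>z. z $ 2 = 0 \<longrightarrow> z \<in> D)"
        using S3(7) A0[OF _ A2[OF z0]] by (intro exI conjI) (simp, simp)
    qed
    show "\<forall>j<3. mchart S3 UNIV (tower2 (3 + 3 * j) (?s j))"
      unfolding all_less_3 using t13[OF S1(8) ne(2) ne(2)] t23[OF S2(8) ne(6)] S3(8) by simp
    show "\<forall>j<3. mchart S3 UNIV (tower3 (3 + 3 * j) (?s j))"
      unfolding all_less_3 using t13[OF S1(9) ne(3) ne(3)] t23[OF S2(9) ne(7)] S3(9) by simp
    show "\<forall>j<3. mchart S3 UNIV (tower_top (3 + 3 * j) (?s j))"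
      unfolding all_less_3 using t13[OF S1(10) ne(4) ne(4)] t23[OF S2(10) ne(8)] S3(10) by simp
  qed
qed

section \<open>Curves and intersection numbers\<close>

lemma P1_cases:
  assumes "x \<in> points P1"
  obtains w where "x = line 1 w" | w where "x = line w 1"
proof -
  obtain v where v: "x = line_through v" "v \<noteq> 0" using assms unfolding points_P1 by blast
  then consider "v $ 1 \<noteq> 0" | "v $ 2 \<noteq> 0" by (auto simp: vector2_eq_iff)
  then show ?thesis
  proof cases
    case 1
    have "vector [1, v $ 2 / v $ 1] = (1 / v $ 1) *s v" using 1 by (simp add: vector2_eq_iff)
    then show ?thesis using that(1)[of "v $ 2 / v $ 1"] line_through_smult[of "1 / v $ 1" v] 1 v by simp
  next
    case 2
    have "vector [v $ 1 / v $ 2, 1] = (1 / v $ 2) *s v" using 2 by (simp add: vector2_eq_iff)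
    then show ?thesis using that(2)[of "v $ 1 / v $ 2"] line_through_smult[of "1 / v $ 2" v] 2 v by simp
  qed
qed

lemma line_flip: "w \<noteq> 0 \<Longrightarrow> line w 1 = line 1 (1 / w)"
  by (simp add: line_eq_iff)

lemma P1_cases':
  assumes "x \<in> points P1"
  obtains w where "x = line 1 w" | "x = line 0 1"
  using assms
proof (rule P1_cases)
  fix w assume "x = line w 1"
  then show ?thesis using that line_flip[of w] by (cases "w = 0") auto
qed (rule that(1))

lemma P1_discs: "points P1 = (\<lambda>z. line 1 (z $ 1)) ` cball (0 :: complex ^ 1) 1 \<union>
    (\<lambda>z. line (z $ 1) 1) ` cball (0 :: complex ^ 1) 1"
proof (intro equalityI subsetI)
  have *: "x \<in> (\<lambda>z. g (z $ 1)) ` cball (0 :: complex ^ 1) 1" if "x = g w" "norm w \<le> 1" for x w and g :: "complex \<Rightarrow> (complex ^ 2) set"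
    using that by (intro image_eqI[of _ _ "vec w"]) (auto simp: norm_vector_1)
  fix x assume x: "x \<in> points P1"
  then show "x \<in> (\<lambda>z. line 1 (z $ 1)) ` cball (0 :: complex ^ 1) 1 \<union>
    (\<lambda>z. line (z $ 1) 1) ` cball (0 :: complex ^ 1) 1"
  proof (rule P1_cases')
    fix w assume w: "x = line 1 w"
    show ?thesis
    proof (cases "norm w \<le> 1")
      case False
      then have "w \<noteq> 0" "norm (1 / w) \<le> 1" by (auto simp: norm_divide divide_le_eq)
      then have "x = line (1 / w) 1" using w line_flip[of "1 / w"] by simp
      then show ?thesis using *[of x "\<lambda>w. line w 1", OF _ \<open>norm (1 / w) \<le> 1\<close>] by blast
    qed (use *[of x "\<lambda>w. line 1 w", OF w] in blast)
  next
    assume "x = line 0 1"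
    then show ?thesis using *[of x "\<lambda>w. line w 1" 0] by simp
  qed
qed (auto simp: vector2_eq_0)

text \<open>The curve is a union of two continuous images of closed discs, hence compact, hence
  closed in the Hausdorff surface. Its open complement can then serve as a set on which the curve
  has the equation 1.\<close>

lemma curve_closed:
  assumes S: "complex_manifold S" and f: "holomorphic_map P1 S f"
  shows "openin (mtop S) (points S - f ` points P1)"
proof -
  note P = P1_manifold(1)
  have cpt: "compactin (mtop S) (f ` \<sigma> ` cball (0 :: complex ^ 1) 1)"
    if s: "mchart P1 UNIV \<sigma>" for \<sigma> :: "complex ^ 1 \<Rightarrow> _"
  proof -
    have "continuous_map (top_of_set UNIV) (mtop S) (f \<circ> \<sigma>)"
      unfolding continuous_map_def
    proof (intro conjI allI impI)
      show "f \<circ> \<sigma> \<in> topspace (top_of_set UNIV) \<rightarrow> topspace (mtop S)"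
        using mchartD(3)[OF s] holomorphic_mapD(1)[OF f] by (auto simp: topspace_mtop[OF S])
      fix U assume U: "openin (mtop S) U"
      have "{z. \<sigma> z \<in> {x\<in>points P1. f x \<in> U}} = {z. f (\<sigma> z) \<in> U}"
        using mchartD(3)[OF s] by auto
      then show "openin (top_of_set UNIV) {x \<in> topspace (top_of_set UNIV). (f \<circ> \<sigma>) x \<in> U}"
        using mchart_preimage_open[OF P s hol_at_continuous[OF P S f U]] by simp
    qed
    then have "compactin (mtop S) ((f \<circ> \<sigma>) ` cball 0 1)"
      by (rule image_compactin[rotated]) (simp add: compactin_subtopology)
    then show ?thesis by (simp add: image_comp)
  qed
  have "compactin (mtop S) (f ` points P1)"
    unfolding P1_discs image_Un
    by (intro compactin_Un cpt P1_manifold(3,4)[unfolded image_comp])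
  then have "closedin (mtop S) (f ` points P1)"
    by (rule compactin_imp_closedin[OF complex_manifoldD(6)[OF S]])
  then show ?thesis by (simp add: closedin_def topspace_mtop[OF S])
qed

section \<open>Curves that are coordinate axes in charts\<close>

definition axis_line :: "2 \<Rightarrow> complex \<Rightarrow> complex ^ 1 \<Rightarrow> complex ^ 2" where
  "axis_line i c z = (\<chi> j. if j = i then z $ 1 + c else 0)"

text \<open>In suitable charts the curve runs along the \<open>i\<close>-th coordinate axis, up to a
  shift \<open>c\<close> of the parameter, so that the injectivity of its derivative is
  immediate.\<close>

definition straight_at ::
  "('p, 2) cmanifold \<Rightarrow> ((complex ^ 2) set \<Rightarrow> 'p) \<Rightarrow> (complex ^ 2) set \<Rightarrow> bool" where
  "straight_at S f x \<longleftrightarrow> (\<exists>W \<sigma> A \<tau> i c z. mchart P1 W \<sigma> \<and> mchart S A \<tau> \<and> z \<in> W \<and> \<sigma> z = x \<and>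
     (\<forall>w\<in>W. axis_line i c w \<in> A \<and> f (\<sigma> w) = \<tau> (axis_line i c w)))"

lemma holo_on_axis_line: "holo_on W (axis_line i c)"
  unfolding holo_on_iff
proof (intro ballI allI)
  fix z j show "cdiff (\<lambda>w. axis_line i c w $ j) z"
    by (cases "j = i") (auto simp: axis_line_def)
qed

lemma axis_line_derivative: "(axis_line i c has_derivative axis_line i 0) (at z)"
proof (rule has_derivative_vec_nth)
  fix j
  have "((\<lambda>w :: complex ^ 1. w $ 1) has_derivative (\<lambda>v. v $ 1)) (at z)"
    by (intro bounded_linear_imp_has_derivative bounded_linear_vec_nth)
  then show "((\<lambda>w. axis_line i c w $ j) has_derivative (\<lambda>v. axis_line i 0 v $ j)) (at z)"
    by (cases "j = i") (auto simp: axis_line_def intro!: derivative_eq_intros)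
qed

lemma embedded_P1I:
  assumes S: "complex_manifold S" and inj: "inj_on f (points P1)"
    and st: "\<And>x. x \<in> points P1 \<Longrightarrow> straight_at S f x"
  shows "embedded_P1 S f"
  unfolding embedded_P1_def
proof (intro conjI ballI)
  note P = P1_manifold(1)
  show "inj_on f (points P1)" by (rule inj)
  have *: "hol_at P1 S f x \<and> immersive_at P1 S f x" if "x \<in> points P1" for x
  proof -
    obtain W \<sigma> A \<tau> i c z where c: "mchart P1 W \<sigma>" "mchart S A \<tau>" and z: "z \<in> W" "\<sigma> z = x"
      and w: "\<forall>w\<in>W. axis_line i c w \<in> A \<and> f (\<sigma> w) = \<tau> (axis_line i c w)"
      using st[OF \<open>x \<in> points P1\<close>] unfolding straight_at_def by (elim exE conjE)
    have s: "axis_line i c ` W \<subseteq> A" using w by blast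
    have e: "f (\<sigma> v) = \<tau> (axis_line i c v)" if "v \<in> W" for v using w that by blast
    have "inj (axis_line i 0)"
      by (rule injI) (auto simp: axis_line_def vec_eq_iff split: if_splits)
    then show ?thesis
      using immersive_atI[OF P S c holo_on_axis_line s e z axis_line_derivative]
        hol_atI[OF c holo_on_axis_line s e z] by blast
  qed
  show "holomorphic_map P1 S f" by (rule holomorphic_mapI[OF P S]) (use * in blast)
  show "immersive_at P1 S f x" if "x \<in> points P1" for x using * that by blast
qed

section \<open>Complex-valued holomorphic functions on open sets\<close>

definition hfun :: "('p, 'n::finite) cmanifold \<Rightarrow> 'p set \<Rightarrow> ('p \<Rightarrow> complex) \<Rightarrow> bool" where
  "hfun S U g \<longleftrightarrow> (\<forall>A \<sigma>. mchart S A \<sigma> \<longrightarrow> (\<forall>z\<in>A. \<sigma> z \<in> U \<longrightarrow> cdiff (\<lambda>w. g (\<sigma> w)) z))"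

lemma hfunI:
  assumes S: "complex_manifold S"
    and h: "\<And>x. x \<in> U \<Longrightarrow> \<exists>A \<sigma> z. mchart S A \<sigma> \<and> z \<in> A \<and> \<sigma> z = x \<and> cdiff (\<lambda>w. g (\<sigma> w)) z"
  shows "hfun S U g"
  unfolding hfun_def
proof (intro allI impI ballI)
  fix B \<tau> y assume t: "mchart S B \<tau>" and y: "y \<in> B" "\<tau> y \<in> U"
  obtain A \<sigma> z where s: "mchart S A \<sigma>" and z: "z \<in> A" "\<sigma> z = \<tau> y" "cdiff (\<lambda>w. g (\<sigma> w)) z"
    using h[OF y(2)] by blast
  note t' = mchart_trans[OF S t s]
  have "\<tau> y \<in> \<sigma> ` A" using z(1) unfolding z(2)[symmetric] by (rule imageI)
  then have yW: "y \<in> {w\<in>B. \<tau> w \<in> \<sigma> ` A}" using y by simp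
  have "(inv_into A \<sigma> \<circ> \<tau>) y = z" using mchartD(2)[OF s] z by (metis comp_apply inv_into_f_f)
  then have "cdiff (\<lambda>w. g (\<sigma> ((inv_into A \<sigma> \<circ> \<tau>) w))) y"
    using cdiff_compose[OF t'(2) yW, of "\<lambda>w. g (\<sigma> w)"] z(3) by simp
  then show "cdiff (\<lambda>w. g (\<tau> w)) y"
    by (rule cdiff_cong_open[OF _ t'(1) yW]) (auto simp: f_inv_into_f)
qed

lemma hfunD: "hfun S U g \<Longrightarrow> mchart S A \<sigma> \<Longrightarrow> z \<in> A \<Longrightarrow> \<sigma> z \<in> U \<Longrightarrow> cdiff (\<lambda>w. g (\<sigma> w)) z"
  unfolding hfun_def by blast

lemma hfun_const: "hfun S U (\<lambda>_. c)"
  unfolding hfun_def by auto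

lemma hfun_subset: "hfun S U g \<Longrightarrow> V \<subseteq> U \<Longrightarrow> hfun S V g"
  unfolding hfun_def by blast

lemma hfun_divide:
  assumes "hfun S U g" "hfun S U h" "\<And>x. x \<in> U \<Longrightarrow> h x \<noteq> 0" shows "hfun S U (\<lambda>x. g x / h x)"
  unfolding hfun_def
proof (intro allI impI ballI)
  fix A \<sigma> z assume "mchart S A \<sigma>" "z \<in> A" "\<sigma> z \<in> U"
  then show "cdiff (\<lambda>w. g (\<sigma> w) / h (\<sigma> w)) z"
    using assms(1,2)[THEN hfunD] assms(3) by (intro cdiff_divide)
qed

lemma hfun_power: "hfun S U g \<Longrightarrow> hfun S U (\<lambda>x. g x ^ n)"
  unfolding hfun_def by auto

lemma hfun_chart:
  assumes S: "complex_manifold S" and s: "mchart S A \<sigma>" and g: "\<And>z. z \<in> A \<Longrightarrow> cdiff g z"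
  shows "hfun S (\<sigma> ` A) (\<lambda>q. g (inv_into A \<sigma> q))"
proof (rule hfunI[OF S])
  fix x assume "x \<in> \<sigma> ` A"
  then obtain z where z: "z \<in> A" "x = \<sigma> z" by blast
  have "cdiff (\<lambda>w. g (inv_into A \<sigma> (\<sigma> w))) z"
    by (rule cdiff_cong_open[OF g[OF z(1)] mchartD(1)[OF s] z(1)]) (use mchartD(2)[OF s] in simp)
  then show "\<exists>A' \<sigma>' z. mchart S A' \<sigma>' \<and> z \<in> A' \<and> \<sigma>' z = x \<and> cdiff (\<lambda>w. g (inv_into A \<sigma> (\<sigma>' w))) z"
    using s z by blast
qed

lemma hfun_hol_at:
  assumes S: "complex_manifold S" and g: "hfun S U g" and U: "openin (mtop S) U" and x: "x \<in> U"
  shows "hol_at S complex_line g x"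
proof -
  obtain A \<sigma> z where c: "mchart S A \<sigma>" "z \<in> A" "\<sigma> z = x" "\<sigma> ` A \<subseteq> U"
    by (rule openin_mchart_at[OF S U x])
  have "holo_on A (\<lambda>w. vec (g (\<sigma> w)) :: complex ^ 1)"
    unfolding holo_on_iff using hfunD[OF g c(1)] c(4) by auto
  then show ?thesis
    by (rule hol_atI[OF c(1) complex_line_manifold(2)]) (use c in auto)
qed

lemma hfun_holomorphic_map:
  assumes S: "complex_manifold S" "countable (atlas S)" and U: "openin (mtop S) U" and g: "hfun S U g"
  shows "holomorphic_map (submanifold S U) complex_line g"
proof -
  have U': "openin (mtop S) (points S \<inter> U)"
    using U openin_mtop[OF S(1)] by (metis inf.absorb_iff2)
  show ?thesis
    by (rule holomorphic_mapI[OF complex_manifold_submanifold[OF S U'] complex_line_manifold(1)])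
      (rule hol_at_submanifold[OF S(1) hfun_hol_at[OF S(1) g U] U'], auto)
qed

lemma hfun_pullback:
  assumes S: "complex_manifold S" and f: "holomorphic_map P1 S f" and g: "hfun S U g"
    and V: "openin (mtop S) U"
  shows "hfun P1 {x\<in>points P1. f x \<in> U} (\<lambda>x. g (f x))"
proof (rule hfunI[OF P1_manifold(1)])
  fix x assume x: "x \<in> {x\<in>points P1. f x \<in> U}"
  have "hol_at P1 S f x" by (rule holomorphic_map_hol_at[OF P1_manifold(1) S f]) (use x in simp)
  then obtain A \<sigma> B \<tau> F z where c: "mchart P1 A \<sigma>" "mchart S B \<tau>" "holo_on A F" "F ` A \<subseteq> B"
    and cF: "\<forall>w\<in>A. f (\<sigma> w) = \<tau> (F w)" and z: "z \<in> A" "\<sigma> z = x"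
    by (rule hol_atE)
  have "cdiff (\<lambda>w. g (\<tau> w)) (F z)"
    by (rule hfunD[OF g c(2)]) (use c(4) cF z x in auto)
  then have "cdiff (\<lambda>w. g (\<tau> (F w))) z" by (rule cdiff_compose[OF c(3) z(1)])
  then have "cdiff (\<lambda>w. g (f (\<sigma> w))) z"
    by (rule cdiff_cong_open[OF _ mchartD(1)[OF c(1)] z(1)]) (use cF in simp)
  then show "\<exists>A \<sigma> z. mchart P1 A \<sigma> \<and> z \<in> A \<and> \<sigma> z = x \<and> cdiff (\<lambda>w. g (f (\<sigma> w))) z"
    using c z by blast
qed

section \<open>Orders of zeros and poles on the projective line\<close>

lemma cdiff_field_differentiable:
  assumes "cdiff (\<lambda>z :: complex ^ 1. g (z $ 1)) (vec w)"
  shows "g field_differentiable (at w)"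
proof -
  obtain L where L: "((\<lambda>z :: complex ^ 1. g (z $ 1)) has_derivative L) (at (vec w))"
    "\<And>c v. L (c *s v) = c * L v" using assms unfolding cdiff_def by blast
  have "((vec :: complex \<Rightarrow> complex ^ 1) has_derivative vec) (at w)"
    by (rule has_derivative_vec_nth) auto
  from has_derivative_compose[OF this L(1)]
  have "(g has_derivative (\<lambda>h. L (vec h))) (at w)" by simp
  moreover have "L (vec h) = L (vec 1) * h" for h
  proof -
    have "(vec h :: complex ^ 1) = h *s vec 1" by (simp add: vec_eq_iff)
    then show ?thesis using L(2)[of h "vec 1"] by simp
  qed
  ultimately have "(g has_field_derivative L (vec 1)) (at w)"
    by (simp add: has_field_derivative_def fun_eq_iff)
  then show ?thesis unfolding field_differentiable_def by blast
qed

text \<open>The order in factored form, with a nonvanishing holomorphic cofactor. Meromorphy,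
  nonvanishing and the value of \<open>zorder\<close> follow from it, and it passes easily to
  reciprocals of powers.\<close>

definition ord_at :: "(complex \<Rightarrow> complex) \<Rightarrow> complex \<Rightarrow> int \<Rightarrow> bool" where
  "ord_at F w k \<longleftrightarrow> (\<exists>T g. open T \<and> w \<in> T \<and> g holomorphic_on T \<and> (\<forall>v\<in>T. g v \<noteq> 0) \<and>
     (\<forall>v\<in>T - {w}. F v = g v * (v - w) powi k))"

lemma ord_atI:
  assumes "open T" "w \<in> T" "g holomorphic_on T" "\<And>v. v \<in> T \<Longrightarrow> g v \<noteq> 0"
    "\<And>v. v \<in> T \<Longrightarrow> v \<noteq> w \<Longrightarrow> F v = g v * (v - w) powi k"
  shows "ord_at F w k"
  using assms unfolding ord_at_def by blast

lemma ord_at_facts: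
  assumes "ord_at F w k"
  shows "F meromorphic_on {w}" "\<forall>\<^sub>F v in at w. F v \<noteq> 0" "zorder F w = k"
proof -
  obtain T g where T: "open T" "w \<in> T" "g holomorphic_on T" "\<And>v. v \<in> T \<Longrightarrow> g v \<noteq> 0"
    "\<And>v. v \<in> T \<Longrightarrow> v \<noteq> w \<Longrightarrow> F v = g v * (v - w) powi k"
    using assms unfolding ord_at_def by blast
  have ev: "\<forall>\<^sub>F v in at w. v \<in> T - {w}" using T(1,2) unfolding eventually_at_topological by auto
  have "g analytic_on {w}" using T analytic_at by blast
  then have "(\<lambda>v. g v * (v - w) powi k) meromorphic_on {w}"
    by (intro meromorphic_intros analytic_on_imp_meromorphic_on) auto
  moreover have "\<forall>\<^sub>F v in at w. F v = g v * (v - w) powi k"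
    using ev by eventually_elim (use T(5) in auto)
  ultimately show "F meromorphic_on {w}" by (subst meromorphic_on_cong[of "{w}" F _ "{w}"]) auto
  show "\<forall>\<^sub>F v in at w. F v \<noteq> 0"
    using ev by eventually_elim (use T(4,5) in auto)
  show "zorder F w = k" by (rule zorder_eqI[OF T(1-3) T(4)[OF T(2)] T(5)])
qed

lemma ord_at_divide:
  assumes "ord_at F w k" shows "ord_at (\<lambda>v. 1 / F v ^ n) w (- int n * k)"
proof -
  obtain T g where T: "open T" "w \<in> T" "g holomorphic_on T" "\<And>v. v \<in> T \<Longrightarrow> g v \<noteq> 0"
    "\<And>v. v \<in> T \<Longrightarrow> v \<noteq> w \<Longrightarrow> F v = g v * (v - w) powi k"
    using assms unfolding ord_at_def by blast
  show ?thesis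
  proof (rule ord_atI[OF T(1,2), of "\<lambda>v. 1 / g v ^ n"])
    show "(\<lambda>v. 1 / g v ^ n) holomorphic_on T" using T(3,4) by (intro holomorphic_intros) auto
    fix v assume v: "v \<in> T"
    show "1 / g v ^ n \<noteq> 0" using T(4)[OF v] by simp
    assume "v \<noteq> w"
    have "((v - w) powi k) ^ n = (v - w) powi (k * int n)"
      by (simp add: power_int_mult)
    moreover have "(v - w) powi (- int n * k) = inverse ((v - w) powi (k * int n))"
      by (simp add: power_int_minus mult.commute)
    ultimately show "1 / F v ^ n = 1 / g v ^ n * (v - w) powi (- int n * k)"
      using T(5)[OF v \<open>v \<noteq> w\<close>] by (simp add: power_mult_distrib divide_simps)
  qed
qed

text \<open>The order is read in both affine parameters of the projective line. Every atlas chart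
  gives one of these two, because the index \<open>e 1\<close> can only be the one different from
  \<open>i\<close>.\<close>

definition p1_order :: "((complex ^ 2) set \<Rightarrow> complex) \<Rightarrow> (complex ^ 2) set \<Rightarrow> int \<Rightarrow> bool" where
  "p1_order s x k \<longleftrightarrow> (\<forall>w. x = line 1 w \<longrightarrow> ord_at (\<lambda>v. s (line 1 v)) w k) \<and>
     (\<forall>w. x = line w 1 \<longrightarrow> ord_at (\<lambda>v. s (line v 1)) w k)"

lemma p1_order_divide: "p1_order s x k \<Longrightarrow> p1_order (\<lambda>x. 1 / s x ^ n) x (- int n * k)"
  unfolding p1_order_def using ord_at_divide by blast

lemma has_order_at_p1_order:
  assumes "p1_order s x k" shows "has_order_at s x k"
  unfolding has_order_at_def
proof (intro ballI, safe)
  fix V and \<phi> :: "(complex ^ 2) set \<Rightarrow> complex ^ 1" assume a: "(V, \<phi>) \<in> atlas P1" and x: "x \<in> V"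
  obtain i and e :: "1 \<Rightarrow> 2" where V: "V = {line_through v |v. v $ i \<noteq> 0}"
    and \<phi>: "\<phi> = (\<lambda>l. \<chi> k. line_coord i l $ e k)" and e: "bij_betw e UNIV (UNIV - {i})"
    using a unfolding projective_space_def by auto
  define L where "L = (\<lambda>w. if i = 1 then line 1 w else line w 1)"
  have e1: "e 1 \<noteq> i" using e by (auto simp: bij_betw_def)
  have Lmem: "L w \<in> V" for w
  proof (cases "i = 1")
    case False
    then have "i = 2" using exhaust_2[of i] by blast
    then show ?thesis unfolding V L_def by (auto intro!: exI[of _ "vector [w, 1]"])
  qed (auto simp: V L_def intro!: exI[of _ "vector [1, w]"])
  have pL: "\<phi> (L w) = vec w" for w
  proof (cases "i = 1")
    case True
    then have "e 1 = 2" using e1 exhaust_2[of "e 1"] by auto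
    then show ?thesis using True by (simp add: \<phi> L_def line_coord_line_through vec_eq_iff)
  next
    case False
    then have "i = 2" "e 1 = 1" using e1 exhaust_2[of i] exhaust_2[of "e 1"] by auto
    then show ?thesis by (simp add: \<phi> L_def line_coord_line_through vec_eq_iff)
  qed
  have inj: "inj_on \<phi> V" by (rule complex_manifoldD(2)[OF P1_manifold(1) a])
  have ii: "inv_into V \<phi> (vec w) = L w" for w
    by (rule inv_into_f_eq[OF inj Lmem pL])
  have "L (\<phi> x $ 1) = x"
  proof -
    have "vec (\<phi> x $ 1) = \<phi> x" by (simp add: vec_eq_iff)
    then show ?thesis using ii[of "\<phi> x $ 1"] inj x by simp
  qed
  then have "ord_at (\<lambda>w. s (L w)) (\<phi> x $ 1) k"
    using assms unfolding p1_order_def L_def by (cases "i = 1") auto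
  from ord_at_facts[OF this]
  show "(\<lambda>w. s (inv_into V \<phi> (vec w))) meromorphic_on {\<phi> x $ 1}"
    "\<forall>\<^sub>F w in at (\<phi> x $ 1). s (inv_into V \<phi> (vec w)) \<noteq> 0"
    "zorder (\<lambda>w. s (inv_into V \<phi> (vec w))) (\<phi> x $ 1) = k" unfolding ii .
qed

lemma p1_order_0:
  assumes U: "openin (mtop P1) U" "x \<in> U" and s: "hfun P1 U s" and nz: "\<And>y. y \<in> U \<Longrightarrow> s y \<noteq> 0"
  shows "p1_order s x 0"
proof -
  have "continuous_on UNIV (\<lambda>v :: complex. \<chi> i :: 1. v)"
    by (intro continuous_on_vec_lambda continuous_on_id)
  then have cv: "continuous_on UNIV (vec :: complex \<Rightarrow> complex ^ 1)" by (simp add: vec_def[abs_def])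
  have *: "ord_at (\<lambda>v. s (L v)) w 0" if L: "mchart P1 UNIV (\<lambda>z. L (z $ 1))" and w: "x = L w" for L w
  proof -
    let ?T = "{v. L v \<in> U}"
    have "open {z :: complex ^ 1. L (z $ 1) \<in> U}"
      using mchart_preimage_open[OF P1_manifold(1) L U(1)] by simp
    then have "open (vec -` {z :: complex ^ 1. L (z $ 1) \<in> U})"
      by (rule open_vimage[OF _ cv])
    then have "open ?T" by simp
    moreover have "(\<lambda>v. s (L v)) holomorphic_on ?T"
      unfolding holomorphic_on_def
    proof
      fix v assume v: "v \<in> ?T"
      have "cdiff (\<lambda>z :: complex ^ 1. s (L (z $ 1))) (vec v)"
        by (rule hfunD[OF s L]) (use v in auto)
      then show "(\<lambda>v. s (L v)) field_differentiable at v within ?T"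
        by (rule field_differentiable_at_within[OF cdiff_field_differentiable[of "\<lambda>v. s (L v)"]])
    qed
    ultimately show ?thesis
      by (intro ord_atI[of ?T w "\<lambda>v. s (L v)"]) (use U(2) nz w in auto)
  qed
  show ?thesis unfolding p1_order_def
  proof (intro conjI allI impI)
    show "ord_at (\<lambda>v. s (line 1 v)) w 0" if "x = line 1 w" for w
      by (rule *[of "\<lambda>w. line 1 w", OF P1_manifold(3) that])
    show "ord_at (\<lambda>v. s (line v 1)) w 0" if "x = line w 1" for w
      by (rule *[of "\<lambda>w. line w 1", OF P1_manifold(4) that])
  qed
qed

text \<open>In the parameter v of the other chart the function is 1 / v - c = - (c / v) * (v - 1 /
  c), so for c \<noteq> 0 the simple zero is visible there as well.\<close>

lemma p1_order_affine:
  assumes T: "open T" "c \<in> T" and s: "\<And>v. v \<in> T \<Longrightarrow> s (line 1 v) = v - c"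
  shows "p1_order s (line 1 c) 1"
  unfolding p1_order_def
proof (intro conjI allI impI)
  fix w assume "line 1 c = line 1 w"
  then have "w = c" by (simp add: line_eq_iff)
  then show "ord_at (\<lambda>v. s (line 1 v)) w 1"
    by (intro ord_atI[OF T(1), of w "\<lambda>_. 1"]) (use T s in auto)
next
  fix w assume "line 1 c = line w 1"
  then have w: "c * w = 1" by (simp add: line_eq_iff mult.commute)
  then have nz: "c \<noteq> 0" "w \<noteq> 0" by auto
  then have cw: "c = 1 / w" using w by (simp add: eq_divide_eq)
  let ?T = "{v \<in> - {0}. 1 / v \<in> T}"
  have "continuous_on (- {0}) (\<lambda>v::complex. 1 / v)" by (intro continuous_intros) auto
  from continuous_open_preimage[OF this _ T(1)]
  have "open ?T" by (auto simp: vimage_def Int_def)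
  then show "ord_at (\<lambda>v. s (line v 1)) w 1"
  proof (rule ord_atI[of _ _ "\<lambda>v. - c / v"])
    fix v assume v: "v \<in> ?T"
    then have "s (line v 1) = 1 / v - c" using s[of "1 / v"] line_flip[of v] by simp
    also have "\<dots> = - c / v * (v - w) powi 1" using w v by (simp add: field_simps)
    finally show "s (line v 1) = - c / v * (v - w) powi 1" .
  qed (use nz cw T in \<open>auto intro!: holomorphic_intros\<close>)
qed

lemma p1_order_infinity:
  assumes T: "open T" "0 \<in> T" and s: "\<And>v. v \<in> T \<Longrightarrow> s (line v 1) = v"
  shows "p1_order s (line 0 1) 1"
  unfolding p1_order_def
proof (intro conjI allI impI)
  fix w assume "line 0 1 = line w 1"
  then have "w = 0" by (simp add: line_eq_iff)
  then show "ord_at (\<lambda>v. s (line v 1)) w 1"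
    by (intro ord_atI[OF T(1), of w "\<lambda>_. 1"]) (use T s in auto)
qed (simp add: line_eq_iff)

section \<open>Local equations and intersection numbers\<close>

lemma local_equation_coord:
  assumes S: "complex_manifold S" "countable (atlas S)" and s: "mchart S A \<sigma>"
    and D: "\<And>z. z \<in> A \<Longrightarrow> \<sigma> z \<in> D \<longleftrightarrow> z $ i = 0"
  shows "local_equation S D (\<sigma> ` A) (\<lambda>q. inv_into A \<sigma> q $ i)"
proof -
  have oU: "openin (mtop S) (\<sigma> ` A)" by (rule mchart_openin[OF S(1) s mchartD(1)[OF s] order_refl])
  have oU': "openin (mtop S) (points S \<inter> \<sigma> ` A)"
    using oU mchartD(3)[OF s] by (metis inf.absorb_iff2)
  have ii: "inv_into A \<sigma> (\<sigma> z) = z" if "z \<in> A" for z using mchartD(2)[OF s] that by simp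
  have h: "hfun S (\<sigma> ` A) (\<lambda>q. inv_into A \<sigma> q $ i)" by (rule hfun_chart[OF S(1) s]) auto
  have sub: "submersive_at (submanifold S (\<sigma> ` A)) complex_line (\<lambda>q. inv_into A \<sigma> q $ i) x"
    if "x \<in> \<sigma> ` A" for x
  proof -
    obtain z where z: "z \<in> A" "x = \<sigma> z" using \<open>x \<in> \<sigma> ` A\<close> by blast
    have d: "((\<lambda>z. vec (z $ i) :: complex ^ 1) has_derivative (\<lambda>v. vec (v $ i))) (at z)"
      by (rule has_derivative_vec_nth)
        (simp add: bounded_linear_imp_has_derivative bounded_linear_vec_nth)
    have "surj (\<lambda>v :: complex ^ 2. vec (v $ i) :: complex ^ 1)"
    proof (rule surjI)
      show "vec ((vec (w $ 1) :: complex ^ 2) $ i) = w" for w :: "complex ^ 1" by (simp add: vec_eq_iff)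
    qed
    with d show ?thesis
      by (intro submersive_atI[OF complex_manifold_submanifold[OF S oU'] complex_line_manifold(1)
            mchart_submanifold[OF S(1) s order_refl] complex_line_manifold(2), of "\<lambda>z. vec (z $ i)" _ z])
        (use z ii in \<open>auto simp: holo_on_iff\<close>)
  qed
  show ?thesis unfolding local_equation_def
    using oU hfun_holomorphic_map[OF S oU h] sub D ii by auto
qed

lemma local_equation_away:
  assumes S: "complex_manifold S" "countable (atlas S)" and D: "openin (mtop S) (points S - D)"
  shows "local_equation S D (points S - D) (\<lambda>_. 1)"
  unfolding local_equation_def
  using D hfun_holomorphic_map[OF S D hfun_const] by auto

text \<open>
  The section is \<open>1\<close> in the trivialization over \<open>U0\<close>; zeros and poles can only occur at the
  points of \<open>X\<close>, the points of the curve outside \<open>U0\<close>.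
\<close>

lemma intersection_number:
  fixes k :: "(complex ^ 2) set \<Rightarrow> int"
  assumes S: "complex_manifold S" "countable (atlas S)" and f: "holomorphic_map P1 S f"
    and le0: "local_equation S D U0 h0"
    and X: "finite X" "X \<subseteq> points P1" "\<And>x. x \<in> points P1 \<Longrightarrow> f x \<in> U0 \<longleftrightarrow> x \<notin> X"
    and le: "\<And>x. x \<in> X \<Longrightarrow> local_equation S D (U x) (h x)" "\<And>x. x \<in> X \<Longrightarrow> f x \<in> U x"
    and G: "\<And>x. x \<in> X \<Longrightarrow> hfun S (U0 \<inter> U x) (G x)"
      "\<And>x q. x \<in> X \<Longrightarrow> q \<in> U0 \<Longrightarrow> q \<in> U x \<Longrightarrow> G x q \<noteq> 0 \<and> h x q = G x q * h0 q"
    and sep: "\<And>x y. x \<in> X \<Longrightarrow> y \<in> X \<Longrightarrow> x \<noteq> y \<Longrightarrow> U x \<inter> U y \<subseteq> U0"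
    and s: "\<And>x. x \<in> X \<Longrightarrow> p1_order (s x) x (k x)"
      "\<And>x y. x \<in> X \<Longrightarrow> y \<in> points P1 \<Longrightarrow> f y \<in> U0 \<Longrightarrow> f y \<in> U x \<Longrightarrow> s x y = G x (f y)"
  shows "has_intersection_number S f D (\<Sum>x\<in>X. k x)"
proof -
  define \<Sigma> where "\<Sigma> = insert (U0, h0, \<lambda>_. 1) ((\<lambda>x. (U x, h x, s x)) ` X)"
  define K where "K = (\<lambda>y. if y \<in> X then k y else 0)"
  have o0: "openin (mtop S) U0" using le0 unfolding local_equation_def by blast
  have oU: "openin (mtop S) (U x)" if "x \<in> X" for x using le(1)[OF that] unfolding local_equation_def by blast
  note hm = hfun_holomorphic_map[OF S]
  have trans: "\<exists>g. holomorphic_map (submanifold S (U1 \<inter> U2)) complex_line g \<and>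
        (\<forall>q\<in>U1 \<inter> U2. g q \<noteq> 0 \<and> h2 q = g q * h1 q) \<and>
        (\<forall>x\<in>points P1. f x \<in> U1 \<inter> U2 \<longrightarrow> s2 x = g (f x) * s1 x)"
    if m1: "(U1, h1, s1) \<in> \<Sigma>" and m2: "(U2, h2, s2) \<in> \<Sigma>" for U1 h1 s1 U2 h2 s2
  proof -
    have d1: "(U1 = U0 \<and> h1 = h0 \<and> s1 = (\<lambda>_. 1)) \<or> (\<exists>x\<in>X. U1 = U x \<and> h1 = h x \<and> s1 = s x)"
      using m1 unfolding \<Sigma>_def by auto
    have d2: "(U2 = U0 \<and> h2 = h0 \<and> s2 = (\<lambda>_. 1)) \<or> (\<exists>x\<in>X. U2 = U x \<and> h2 = h x \<and> s2 = s x)"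
      using m2 unfolding \<Sigma>_def by auto
    consider (same) "U1 = U2" "h1 = h2" "s1 = s2"
      | (left) x where "x \<in> X" "U1 = U0" "h1 = h0" "s1 = (\<lambda>_. 1)" "U2 = U x" "h2 = h x" "s2 = s x"
      | (right) x where "x \<in> X" "U2 = U0" "h2 = h0" "s2 = (\<lambda>_. 1)" "U1 = U x" "h1 = h x" "s1 = s x"
      | (both) x y where "x \<in> X" "y \<in> X" "x \<noteq> y" "U1 = U x" "h1 = h x" "s1 = s x" "U2 = U y" "h2 = h y" "s2 = s y"
      using d1 d2 by metis
    then show ?thesis
    proof cases
      case same
      have "openin (mtop S) U1"
        using m1 o0 oU unfolding \<Sigma>_def by auto
      then have "openin (mtop S) (U1 \<inter> U2)" using same by simp
      then show ?thesis using same by (intro exI[of _ "\<lambda>_. 1"]) (auto intro!: hm hfun_const)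
    next
      case left
      then show ?thesis
        using hm[OF openin_Int[OF o0 oU[OF left(1)]] G(1)[OF left(1)]] G(2)[OF left(1)] s(2)[OF left(1)]
        by (intro exI[of _ "G x"]) auto
    next
      case right
      have "hfun S (U x \<inter> U0) (\<lambda>q. 1 / G x q)"
        by (rule hfun_divide[OF hfun_const hfun_subset[OF G(1)[OF right(1)]]])
          (use G(2)[OF right(1)] in auto)
      then show ?thesis
        using right hm[OF openin_Int[OF oU[OF right(1)] o0]] G(2)[OF right(1)] s(2)[OF right(1)]
        by (intro exI[of _ "\<lambda>q. 1 / G x q"]) auto
    next
      case both
      \<comment> \<open>The overlap of two special charts lies in \<open>U0\<close>, where both
        equations are compared with \<open>h0\<close>; the quotient of the two factors is the
        transition function.\<close>
      note sub = sep[OF both(1-3)]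
      have "hfun S (U x \<inter> U y) (\<lambda>q. G y q / G x q)"
        by (rule hfun_divide[OF hfun_subset[OF G(1)[OF both(2)]] hfun_subset[OF G(1)[OF both(1)]]])
          (use sub G(2)[OF both(1)] in auto)
      then have 1: "holomorphic_map (submanifold S (U x \<inter> U y)) complex_line (\<lambda>q. G y q / G x q)"
        by (rule hm[OF openin_Int[OF oU[OF both(1)] oU[OF both(2)]]])
      have 2: "G y q / G x q \<noteq> 0 \<and> h y q = G y q / G x q * h x q" if "q \<in> U x \<inter> U y" for q
      proof -
        have "q \<in> U0" using sub that by blast
        then show ?thesis using G(2)[OF both(1), of q] G(2)[OF both(2), of q] that by auto
      qed
      have 3: "s y z = G y (f z) / G x (f z) * s x z" if "z \<in> points P1" "f z \<in> U x \<inter> U y" for z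
      proof -
        have "f z \<in> U0" using sub that by blast
        then show ?thesis
          using G(2)[OF both(1), of "f z"] s(2)[OF both(1), of z] s(2)[OF both(2), of z] that by auto
      qed
      show ?thesis unfolding both(4-9)
        by (intro exI[of _ "\<lambda>q. G y q / G x q"] conjI ballI impI 1 2 3)
    qed
  qed
  have ord: "has_order_at s1 x (K x)" if m: "(U1, h1, s1) \<in> \<Sigma>" and x: "x \<in> points P1" "f x \<in> U1" for U1 h1 s1 x
  proof -
    have P1top: "openin (mtop P1) (points P1)"
      using openin_topspace[of "mtop P1"] by (simp add: topspace_mtop[OF P1_manifold(1)])
    have "(U1 = U0 \<and> s1 = (\<lambda>_. 1)) \<or> (\<exists>y\<in>X. U1 = U y \<and> s1 = s y)"
      using m unfolding \<Sigma>_def by auto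
    then consider (base) "U1 = U0" "s1 = (\<lambda>_. 1)" | (pt) y where "y \<in> X" "U1 = U y" "s1 = s y"
      by (elim disjE bexE conjE)
    then show ?thesis
    proof cases
      case base
      then have "K x = 0" using x X(3) unfolding K_def by auto
      then show ?thesis using base
        by (auto intro!: has_order_at_p1_order p1_order_0[OF P1top x(1)] hfun_const)
    next
      case pt
      show ?thesis
      proof (cases "x = y")
        case True
        then show ?thesis using pt has_order_at_p1_order[OF s(1)[OF pt(1)]] by (simp add: K_def)
      next
        \<comment> \<open>Another point of the curve in the chart of \<open>y\<close> lies in
          \<open>U0\<close>, by \<open>sep\<close>. There the section is the pulled back unit
          \<open>G y\<close>, so its order is 0.\<close>
        case False
        have x0: "f x \<in> U0"
        proof (rule ccontr)
          assume "f x \<notin> U0"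
          then have "x \<in> X" using X(3) x(1) by blast
          then show False using sep[OF pt(1) _ False[symmetric]] le(2) x(2) pt(2) \<open>f x \<notin> U0\<close> by blast
        qed
        then have "K x = 0" using X(3)[OF x(1)] unfolding K_def by simp
        let ?V = "{z\<in>points P1. f z \<in> U0 \<inter> U y}"
        have o: "openin (mtop S) (U0 \<inter> U y)" by (rule openin_Int[OF o0 oU[OF pt(1)]])
        have oV: "openin (mtop P1) ?V" by (rule hol_at_continuous[OF P1_manifold(1) S(1) f o])
        have xV: "x \<in> ?V" using x x0 pt by simp
        have e: "s y z = G y (f z)" if "z \<in> ?V" for z using s(2)[OF pt(1)] that by auto
        have "hfun P1 ?V (\<lambda>z. G y (f z))" by (rule hfun_pullback[OF S(1) f G(1)[OF pt(1)] o])
        have "hfun P1 ?V (s y)"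
        proof (rule hfunI[OF P1_manifold(1)])
          fix v assume v: "v \<in> ?V"
          obtain A \<sigma> z where c: "mchart P1 A \<sigma>" "z \<in> A" "\<sigma> z = v" "\<sigma> ` A \<subseteq> ?V"
            by (rule openin_mchart_at[OF P1_manifold(1) oV v])
          have "cdiff (\<lambda>w. G y (f (\<sigma> w))) z"
            by (rule hfunD[OF \<open>hfun P1 ?V (\<lambda>z. G y (f z))\<close> c(1,2)]) (use c v in simp)
          then have "cdiff (\<lambda>w. s y (\<sigma> w)) z"
            by (rule cdiff_cong_open[OF _ mchartD(1)[OF c(1)] c(2)]) (use c(4) e in auto)
          then show "\<exists>A \<sigma> z. mchart P1 A \<sigma> \<and> z \<in> A \<and> \<sigma> z = v \<and> cdiff (\<lambda>w. s y (\<sigma> w)) z"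
            using c by blast
        qed
        then have "p1_order (s y) x 0"
          by (rule p1_order_0[OF oV xV]) (use e G(2)[OF pt(1)] in auto)
        then show ?thesis using has_order_at_p1_order pt \<open>K x = 0\<close> by simp
      qed
    qed
  qed
  have sum: "(\<Sum>x\<in>X. k x) = (\<Sum>x\<in>{x\<in>points P1. K x \<noteq> 0}. K x)"
    by (rule sum.mono_neutral_cong_right) (use X in \<open>auto simp: K_def\<close>)
  have fin: "finite {x\<in>points P1. K x \<noteq> 0}"
    by (rule finite_subset[OF _ X(1)]) (auto simp: K_def)
  have cov: "f ` points P1 \<subseteq> (\<Union>(U, h, s)\<in>\<Sigma>. U)"
  proof
    fix q assume "q \<in> f ` points P1"
    then obtain x where x: "x \<in> points P1" "q = f x" by blast
    show "q \<in> (\<Union>(U, h, s)\<in>\<Sigma>. U)"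
    proof (cases "x \<in> X")
      case True
      then show ?thesis using le(2)[OF True] x unfolding \<Sigma>_def by auto
    next
      case False
      then show ?thesis using X(3)[OF x(1)] x unfolding \<Sigma>_def by auto
    qed
  qed
  have les: "\<forall>(U, h, s)\<in>\<Sigma>. local_equation S D U h" using le0 le(1) unfolding \<Sigma>_def by auto
  show ?thesis unfolding has_intersection_number_def
    by (intro exI[of _ \<Sigma>] exI[of _ K] conjI les cov fin sum) (use ord trans in auto)
qed

lemma intersection_number_disjoint:
  assumes S: "complex_manifold S" "countable (atlas S)" and f: "holomorphic_map P1 S f"
    and D: "openin (mtop S) (points S - D)" and "\<And>x. x \<in> points P1 \<Longrightarrow> f x \<notin> D"
  shows "has_intersection_number S f D 0"
  using intersection_number[OF S f local_equation_away[OF S D], of "{}" "\<lambda>_. {}"] assms(5)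
    holomorphic_mapD(1)[OF f] by auto

text \<open>The complement of \<open>D\<close> carries the equation 1. Hence the local equation at
  the meeting point is itself the transition factor and, pulled back to the curve, the section; its
  single simple zero gives the number 1.\<close>

lemma intersection_number_transversal:
  assumes S: "complex_manifold S" "countable (atlas S)" and f: "holomorphic_map P1 S f"
    and D: "openin (mtop S) (points S - D)" and x0: "x0 \<in> points P1"
    and fD: "\<And>x. x \<in> points P1 \<Longrightarrow> f x \<in> D \<longleftrightarrow> x = x0"
    and c: "mchart S A \<tau>" "f x0 \<in> \<tau> ` A" "\<And>z. z \<in> A \<Longrightarrow> \<tau> z \<in> D \<longleftrightarrow> z $ i = 0"
    and s: "p1_order (\<lambda>x. inv_into A \<tau> (f x) $ i) x0 1"
  shows "has_intersection_number S f D 1"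
proof -
  have h: "hfun S (\<tau> ` A) (\<lambda>q. inv_into A \<tau> q $ i)" by (rule hfun_chart[OF S(1) c(1)]) auto
  have ii: "inv_into A \<tau> (\<tau> z) = z" if "z \<in> A" for z using mchartD(2)[OF c(1)] that by simp
  have "has_intersection_number S f D (\<Sum>x\<in>{x0}. 1)"
    by (rule intersection_number[OF S f local_equation_away[OF S D], where U = "\<lambda>_. \<tau> ` A"
          and h = "\<lambda>_ q. inv_into A \<tau> q $ i" and G = "\<lambda>_ q. inv_into A \<tau> q $ i"
          and s = "\<lambda>_ x. inv_into A \<tau> (f x) $ i"])
      (use x0 fD holomorphic_mapD(1)[OF f] c(2,3) s ii local_equation_coord[OF S c(1) c(3)]
        hfun_subset[OF h] in auto)
  then show ?thesis by simp
qed

section \<open>Rational functions of two variables\<close>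

lemma peval_simps [simp]:
  "peval (P + Q) z = peval P z + peval Q z" "peval (P * Q) z = peval P z * peval Q z"
  "peval (- P) z = - peval P z" "peval [:[:c:]:] z = c" "peval [:[:0, 1:]:] z = z $ 1"
  "peval [:0, 1:] z = z $ 2" "peval 0 z = 0" "peval 1 z = 1"
  "peval (pCons a P) z = poly a (z $ 1) + z $ 2 * peval P z"
  by (simp_all add: peval_def)

lemma peval_nz: "peval P z \<noteq> 0 \<Longrightarrow> P \<noteq> 0"
  by auto

lemma cdiff_peval: "cdiff (peval P) z"
proof (induction P)
  case 0
  have "peval 0 = (\<lambda>_. 0)" by auto
  then show ?case by auto
next
  case (pCons a P)
  have "cdiff (\<lambda>z. poly a (z $ 1)) z" by (rule cdiff_comp_field[OF cdiff_nth poly_DERIV])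
  then have "cdiff (\<lambda>z. poly a (z $ 1) + z $ 2 * peval P z) z" using pCons by (intro cdiff_intros)
  moreover have "peval (pCons a P) = (\<lambda>z. poly a (z $ 1) + z $ 2 * peval P z)" by auto
  ultimately show ?case by simp
qed

lemma cdiff_isCont:
  assumes "cdiff f z" shows "isCont f z"
  using assms has_derivative_continuous unfolding cdiff_def by blast

text \<open>An open set contains a product of two infinite sets. A polynomial that vanishes on such
  a product is zero, by counting roots in one variable and then in the other.\<close>

lemma peval_nonzero_dense:
  assumes D: "D \<noteq> 0" and W: "open W" "W \<noteq> {}"
  shows "\<exists>z\<in>W. peval D z \<noteq> 0"
proof (rule ccontr)
  assume "\<not> ?thesis"
  then have z: "peval D z = 0" if "z \<in> W" for z using that by blast
  obtain p where p: "p \<in> W" using W by blast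
  have "continuous_on UNIV (\<lambda>q. vector [fst q, snd q] :: complex ^ 2)"
  proof -
    have eq: "(\<lambda>q :: complex \<times> complex. vector [fst q, snd q] :: complex ^ 2) = (\<lambda>q. \<chi> i. if i = 1 then fst q else snd q)"
      by (auto simp: vector2_eq_iff)
    moreover have "continuous_on UNIV (\<lambda>q :: complex \<times> complex. if i = 1 then fst q else snd q)" for i :: 2
      by (cases "i = 1"; simp; intro continuous_intros)
    ultimately show ?thesis by (simp only: continuous_on_vec_lambda)
  qed
  from open_vimage[OF W(1) this] have "open {q. vector [fst q, snd q] \<in> W}" by (simp add: vimage_def)
  moreover have "(p $ 1, p $ 2) \<in> {q. vector [fst q, snd q] \<in> W}" using p by simp
  ultimately obtain A B where AB: "open A" "open B" "(p $ 1, p $ 2) \<in> A \<times> B"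
    "A \<times> B \<subseteq> {q. vector [fst q, snd q] \<in> W}" by (rule open_prod_elim)
  have "infinite V" if V: "open V" "v \<in> V" for V and v :: complex
  proof
    assume "finite V"
    obtain e where "e > 0" "ball v e \<subseteq> V" using V open_contains_ball by blast
    then show False using uncountable_ball[of e v] \<open>finite V\<close> by (meson countable_finite finite_subset)
  qed
  then have inf: "infinite A" "infinite B" using AB by blast+
  have "poly D [:b:] = 0" if b: "b \<in> B" for b
  proof (rule ccontr)
    assume "poly D [:b:] \<noteq> 0"
    then have "finite {a. poly (poly D [:b:]) a = 0}" by (rule poly_roots_finite)
    moreover have "A \<subseteq> {a. poly (poly D [:b:]) a = 0}"
    proof
      fix a assume "a \<in> A"
      then have "vector [a, b] \<in> W" using AB(4) b by auto
      from z[OF this] show "a \<in> {a. poly (poly D [:b:]) a = 0}" by (simp add: peval_def)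
    qed
    ultimately show False using inf(1) finite_subset by blast
  qed
  then have "(\<lambda>b. [:b:]) ` B \<subseteq> {q. poly D q = 0}" by auto
  moreover have "infinite ((\<lambda>b. [:b:]) ` B)"
    using inf(2) by (subst finite_image_iff) (auto simp: inj_on_def)
  moreover have "finite {q. poly D q = 0}" by (rule poly_roots_finite[OF D])
  ultimately show False using finite_subset by blast
qed

lemma open_peval: "open {z. peval D z \<noteq> 0}"
  using cdiff_isCont[OF cdiff_peval]
  by (intro open_Collect_neq continuous_on_const) (auto simp: continuous_on_eq_continuous_at)

text \<open>A nonzero polynomial does not vanish identically on an open set, so Zariski generic
  properties survive in every Euclidean neighbourhood. This is how rational maps and topology are
  compared when the gluing relation is analysed.\<close>

lemma generically_open:
  assumes "generically \<Phi>" "open W" "W \<noteq> {}"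
  obtains V where "open V" "V \<noteq> {}" "V \<subseteq> W" "\<And>z. z \<in> V \<Longrightarrow> \<Phi> z"
proof -
  obtain D where D: "D \<noteq> 0" "\<And>z. peval D z \<noteq> 0 \<Longrightarrow> \<Phi> z" using assms(1) unfolding generically_def by blast
  show ?thesis
    by (rule that[of "W \<inter> {z. peval D z \<noteq> 0}"])
      (use D assms open_peval[of D] peval_nonzero_dense[OF D(1) assms(2,3)] in auto)
qed

lemma generically_conj:
  assumes "generically \<Phi>" "generically \<Psi>" shows "generically (\<lambda>z. \<Phi> z \<and> \<Psi> z)"
proof -
  obtain D E where "D \<noteq> 0" "\<And>z. peval D z \<noteq> 0 \<Longrightarrow> \<Phi> z" "E \<noteq> 0" "\<And>z. peval E z \<noteq> 0 \<Longrightarrow> \<Psi> z"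
    using assms unfolding generically_def by blast
  then show ?thesis unfolding generically_def by (intro exI[of _ "D * E"]) simp
qed

lemma generically_mono: "generically \<Phi> \<Longrightarrow> (\<And>z. \<Phi> z \<Longrightarrow> \<Psi> z) \<Longrightarrow> generically \<Psi>"
  unfolding generically_def by blast

lemma generically_peval: "Q \<noteq> 0 \<Longrightarrow> generically (\<lambda>z. peval Q z \<noteq> 0)"
  unfolding generically_def by blast

lemma generically_always: "(\<And>z. \<Phi> z) \<Longrightarrow> generically \<Phi>"
  unfolding generically_def by (intro exI[of _ 1]) simp

lemma generically_coordinates:
  "generically (\<lambda>z. z $ 1 \<noteq> 0)" "generically (\<lambda>z. z $ 2 \<noteq> 0)"
  using generically_peval[of "[:[:0, 1:]:]"] generically_peval[of "[:0, 1:]"] by simp_all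

section \<open>Scalar rational functions with a regular value\<close>

definition ratreg :: "(complex ^ 2 \<Rightarrow> complex) \<Rightarrow> complex ^ 2 \<Rightarrow> complex \<Rightarrow> bool" where
  "ratreg f p v \<longleftrightarrow> (\<exists>P Q. peval Q p \<noteq> 0 \<and> generically (\<lambda>z. f z = peval P z / peval Q z) \<and>
     v = peval P p / peval Q p)"

lemma regular_value_iff: "regular_value F p q \<longleftrightarrow> (\<forall>i. ratreg (\<lambda>z. F z $ i) p (q $ i))"
  unfolding regular_value_def ratreg_def ..

lemma ratregI:
  assumes "peval Q p \<noteq> 0" "generically (\<lambda>z. f z = peval P z / peval Q z)" "v = peval P p / peval Q p"
  shows "ratreg f p v"
  using assms unfolding ratreg_def by blast

lemma ratreg_const: "ratreg (\<lambda>_. c) p c"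
  by (rule ratregI[of 1 _ _ "[:[:c:]:]"]) (auto intro!: generically_always)

lemma ratreg_nth: "ratreg (\<lambda>z. z $ 1) p (p $ 1)" "ratreg (\<lambda>z. z $ 2) p (p $ 2)"
  by (rule ratregI[of 1 _ _ "[:[:0, 1:]:]"], auto intro!: generically_always)
    (rule ratregI[of 1 _ _ "[:0, 1:]"], auto intro!: generically_always)

lemma ratreg_uminus:
  assumes "ratreg f p a" shows "ratreg (\<lambda>z. - f z) p (- a)"
proof -
  obtain P Q where *: "peval Q p \<noteq> 0" "generically (\<lambda>z. f z = peval P z / peval Q z)" "a = peval P p / peval Q p"
    using assms unfolding ratreg_def by blast
  show ?thesis
    by (rule ratregI[of Q _ _ "- P"]) (use * in \<open>auto intro: generically_mono[OF *(2)]\<close>)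
qed

lemma ratreg_add:
  assumes "ratreg f p a" "ratreg g p b" shows "ratreg (\<lambda>z. f z + g z) p (a + b)"
proof -
  obtain P Q where 1: "peval Q p \<noteq> 0" "generically (\<lambda>z. f z = peval P z / peval Q z)" "a = peval P p / peval Q p"
    using assms(1) unfolding ratreg_def by blast
  obtain R S where 2: "peval S p \<noteq> 0" "generically (\<lambda>z. g z = peval R z / peval S z)" "b = peval R p / peval S p"
    using assms(2) unfolding ratreg_def by blast
  show ?thesis
  proof (rule ratregI[of "Q * S" _ _ "P * S + R * Q"])
    show "generically (\<lambda>z. f z + g z = peval (P * S + R * Q) z / peval (Q * S) z)"
      by (rule generically_mono[OF generically_conj[OF generically_conj[OF 1(2) 2(2)]
          generically_conj[OF generically_peval[OF peval_nz[OF 1(1)]] generically_peval[OF peval_nz[OF 2(1)]]]]])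
        (auto simp: field_simps)
  qed (use 1 2 in \<open>auto simp: field_simps\<close>)
qed

lemma ratreg_mult:
  assumes "ratreg f p a" "ratreg g p b" shows "ratreg (\<lambda>z. f z * g z) p (a * b)"
proof -
  obtain P Q where 1: "peval Q p \<noteq> 0" "generically (\<lambda>z. f z = peval P z / peval Q z)" "a = peval P p / peval Q p"
    using assms(1) unfolding ratreg_def by blast
  obtain R S where 2: "peval S p \<noteq> 0" "generically (\<lambda>z. g z = peval R z / peval S z)" "b = peval R p / peval S p"
    using assms(2) unfolding ratreg_def by blast
  show ?thesis
    by (rule ratregI[of "Q * S" _ _ "P * R"], insert 1 2)
      (auto intro: generically_mono[OF generically_conj[OF 1(2) 2(2)]])
qed

lemma ratreg_divide:
  assumes "ratreg f p a" "ratreg g p b" "b \<noteq> 0" shows "ratreg (\<lambda>z. f z / g z) p (a / b)"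
proof -
  obtain P Q where 1: "peval Q p \<noteq> 0" "generically (\<lambda>z. f z = peval P z / peval Q z)" "a = peval P p / peval Q p"
    using assms(1) unfolding ratreg_def by blast
  obtain R S where 2: "peval S p \<noteq> 0" "generically (\<lambda>z. g z = peval R z / peval S z)" "b = peval R p / peval S p"
    using assms(2) unfolding ratreg_def by blast
  show ?thesis
    by (rule ratregI[of "Q * R" _ _ "P * S"], insert 1 2 assms(3))
      (auto intro: generically_mono[OF generically_conj[OF 1(2) 2(2)]])
qed

lemma ratreg_diff:
  assumes "ratreg f p a" "ratreg g p b" shows "ratreg (\<lambda>z. f z - g z) p (a - b)"
  using ratreg_add[OF assms(1) ratreg_uminus[OF assms(2)]] by simp

lemma ratreg_power: "ratreg f p a \<Longrightarrow> ratreg (\<lambda>z. f z ^ n) p (a ^ n)"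
  by (induction n) (auto intro: ratreg_const ratreg_mult)

lemmas ratreg_intros = ratreg_const ratreg_nth ratreg_add ratreg_diff ratreg_mult ratreg_uminus
  ratreg_power ratreg_divide

lemma regular_value_2:
  "regular_value F p q \<longleftrightarrow> ratreg (\<lambda>z. F z $ 1) p (q $ 1) \<and> ratreg (\<lambda>z. F z $ 2) p (q $ 2)"
  unfolding regular_value_iff by (simp add: forall_2)

lemma rational_mapI: "regular_value F p q \<Longrightarrow> rational_map F"
  unfolding rational_map_def regular_value_def using peval_nz by metis

text \<open>A function representing a rational map may have any value at \<open>p\<close>; it is a
  fraction equal to it generically that takes the value \<open>q\<close> there. So the points sought
  are generic points near \<open>p\<close> at which this fraction is close to
  \<open>q\<close>.\<close>

lemma regular_value_approx:
  assumes r: "regular_value g p q" and V: "open V" "p \<in> V" and W: "open W" "q \<in> W"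
    and G: "generically \<Phi>"
  obtains N where "open N" "N \<noteq> {}" "N \<subseteq> V" "\<And>w. w \<in> N \<Longrightarrow> g w \<in> W \<and> \<Phi> w"
proof -
  obtain P Q where PQ: "\<And>i. peval (Q i) p \<noteq> 0" "\<And>i. generically (\<lambda>z. g z $ i = peval (P i) z / peval (Q i) z)"
    "\<And>i. q $ i = peval (P i) p / peval (Q i) p"
  proof -
    have "\<forall>i. \<exists>R. peval (snd R) p \<noteq> 0 \<and> generically (\<lambda>z. g z $ i = peval (fst R) z / peval (snd R) z) \<and>
        q $ i = peval (fst R) p / peval (snd R) p"
      using r unfolding regular_value_def by simp
    from choice[OF this] obtain R where "\<forall>i. peval (snd (R i)) p \<noteq> 0 \<and>
        generically (\<lambda>z. g z $ i = peval (fst (R i)) z / peval (snd (R i)) z) \<and>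
        q $ i = peval (fst (R i)) p / peval (snd (R i)) p" by blast
    then show thesis by (intro that[of "\<lambda>i. snd (R i)" "\<lambda>i. fst (R i)"]) simp_all
  qed
  define h where "h = (\<lambda>z. \<chi> i. peval (P i) z / peval (Q i) z)"
  let ?V = "V \<inter> {z. peval (Q 1) z \<noteq> 0} \<inter> {z. peval (Q 2) z \<noteq> 0}"
  have oV: "open ?V" by (intro open_Int V open_peval)
  have Q: "peval (Q i) z \<noteq> 0" if "z \<in> ?V" for z i using that exhaust_2[of i] by auto
  have "holo_on ?V h" unfolding holo_on_iff h_def vec_lambda_beta
    by (intro ballI allI cdiff_divide cdiff_peval Q)
  from holo_on_preimage[OF this oV W(1)] have o: "open {z\<in>?V. h z \<in> W}" .
  have hp: "h p = q" unfolding h_def by (simp add: vec_eq_iff PQ(3))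
  have "p \<in> {z\<in>?V. h z \<in> W}" using V(2) W(2) PQ(1) hp by auto
  then have ne: "{z\<in>?V. h z \<in> W} \<noteq> {}" by blast
  have gen: "generically (\<lambda>z. (g z $ 1 = h z $ 1 \<and> g z $ 2 = h z $ 2) \<and> \<Phi> z)"
    unfolding h_def using generically_conj[OF generically_conj[OF PQ(2)[of 1] PQ(2)[of 2]] G] by simp
  obtain N where N: "open N" "N \<noteq> {}" "N \<subseteq> {z\<in>?V. h z \<in> W}"
    "\<And>z. z \<in> N \<Longrightarrow> (g z $ 1 = h z $ 1 \<and> g z $ 2 = h z $ 2) \<and> \<Phi> z"
    using generically_open[OF gen o ne] by blast
  show ?thesis
  proof (rule that[OF N(1,2)])
    show "N \<subseteq> V" using N(3) by blast
    fix w assume w: "w \<in> N"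
    then have "g w = h w" using N(4) by (simp add: vector2_eq_iff)
    then show "g w \<in> W \<and> \<Phi> w" using N(3,4) w by auto
  qed
qed

section \<open>The coordinate changes of the system\<close>

text \<open>Nonvanishing of \<open>den j\<close> marks the overlap of chart \<open>j\<close> with
  the (x, y)-plane. It can be read in the coordinates of either side, because x_1 = x_2 = 1 / x and
  y_3 = 1 / y.\<close>

definition den :: "nat \<Rightarrow> complex ^ 2 \<Rightarrow> complex" where
  "den j z = (if j = 0 then 1 else if j = 1 \<or> j = 2 then z $ 1 else z $ 2)"

locale cubic_system =
  fixes \<alpha> \<beta> \<gamma> :: complex
begin

abbreviation "T \<equiv> system_charts \<alpha> \<beta> \<gamma>"

text \<open>The inverse of \<open>T j t\<close>. For j = 1, 2 the second entry expands y in x_j = 1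
  / x along the cubics, with - y_j as the coefficient of x_j^2; for j = 3 the first entry expands x
  in y_3 = 1 / y, with - x_3 as the coefficient of y_3^2.\<close>

definition unchart :: "nat \<Rightarrow> complex ^ 2 \<Rightarrow> complex ^ 2" where
  "unchart j z = (if j = 0 then z
     else if j = 1 then vector [1 / z $ 1, 1 / z $ 1 + 2*\<alpha> - (2*\<alpha>^2 - 2*\<beta> + \<gamma>) * z $ 1 - z $ 2 * (z $ 1)^2]
     else if j = 2 then vector [1 / z $ 1, - (1 / z $ 1) - 2*\<alpha> + (2*\<alpha>^2 - 2*\<beta> - \<gamma>) * z $ 1 - z $ 2 * (z $ 1)^2]
     else vector [- 2*\<gamma> * z $ 2 - z $ 1 * (z $ 2)^2, 1 / z $ 2])"

lemma T_simps:
  "T 0 t z = z"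
  "T 1 t z = vector [1 / z $ 1, - ((z $ 2 - z $ 1 - 2*\<alpha>) * z $ 1 + 2*\<alpha>^2 - 2*\<beta> + \<gamma>) * z $ 1]"
  "T (Suc 0) t z = vector [1 / z $ 1, - ((z $ 2 - z $ 1 - 2*\<alpha>) * z $ 1 + 2*\<alpha>^2 - 2*\<beta> + \<gamma>) * z $ 1]"
  "T 2 t z = vector [1 / z $ 1, - ((z $ 2 + z $ 1 + 2*\<alpha>) * z $ 1 - 2*\<alpha>^2 + 2*\<beta> + \<gamma>) * z $ 1]"
  "T 3 t z = vector [- (z $ 1 * z $ 2 + 2*\<gamma>) * z $ 2, 1 / z $ 2]"
  by (simp_all add: system_charts_def Let_def)

lemma less_4_cases: "(j::nat) < 4 \<Longrightarrow> j = 0 \<or> j = 1 \<or> j = 2 \<or> j = 3"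
  by auto

lemma unchart_T:
  assumes "j < 4" "den j z \<noteq> 0"
  shows "den j (T j t z) \<noteq> 0" "unchart j (T j t z) = z"
  using less_4_cases[OF assms(1)] assms(2)
  by (auto simp: T_simps den_def unchart_def vector2_eq_iff field_simps power2_eq_square)

lemma T_unchart:
  assumes "j < 4" "den j z \<noteq> 0"
  shows "den j (unchart j z) \<noteq> 0" "T j t (unchart j z) = z"
  using less_4_cases[OF assms(1)] assms(2)
  by (auto simp: T_simps den_def unchart_def vector2_eq_iff field_simps power2_eq_square)

lemma generically_den: "generically (\<lambda>z. den j z \<noteq> 0)"
proof -
  consider "j = 0" | "j = 1 \<or> j = 2" | "j \<noteq> 0" "\<not> (j = 1 \<or> j = 2)" by blast
  then show ?thesis
  proof cases
    case 2
    then show ?thesis using generically_coordinates(1) by (elim disjE) (simp_all add: den_def)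
  qed (simp_all add: den_def[abs_def] generically_coordinates generically_always)
qed

lemma regular_T:
  assumes "j < 4" "den j z \<noteq> 0" shows "regular_value (T j t) z (T j t z)"
  using less_4_cases[OF assms(1)] assms(2)
  by (auto simp: regular_value_2 T_simps den_def intro!: ratreg_intros)

lemma holo_on_T:
  assumes "j < 4" shows "holo_on {z. den j z \<noteq> 0} (T j t)"
proof -
  have "cdiff (\<lambda>z. T j t z $ i) z" if "den j z \<noteq> 0" for z i
    using less_4_cases[OF assms] exhaust_2[of i] that
    by (auto simp: T_simps den_def intro!: cdiff_intros cdiff_divide)
  then show ?thesis unfolding holo_on_iff by blast
qed

end

section \<open>The glued spaces\<close>

context cubic_system
begin

abbreviation "B \<equiv> unchart"

text \<open>The explicit form of the gluing, see \<open>glue_iff\<close>: apart from equality within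
  one chart, points are identified only through a common point of the (x, y)-plane.\<close>

definition rel :: "nat \<Rightarrow> complex ^ 2 \<Rightarrow> nat \<Rightarrow> complex ^ 2 \<Rightarrow> bool" where
  "rel j p k q \<longleftrightarrow> j = k \<and> p = q \<or> den j p \<noteq> 0 \<and> den k q \<noteq> 0 \<and> B j p = B k q"

lemma rel_sym: "rel j p k q \<longleftrightarrow> rel k q j p"
  by (auto simp: rel_def)

lemma rel_refl [simp]: "rel j p j p"
  by (simp add: rel_def)

lemma rel_trans: "rel j p k q \<Longrightarrow> rel k q l r \<Longrightarrow> rel j p l r"
  by (auto simp: rel_def)

lemma rel_same: "j < 4 \<Longrightarrow> rel j p j q \<longleftrightarrow> p = q"
  using T_unchart(2)[of j p 0] T_unchart(2)[of j q 0] unfolding rel_def by metis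

lemma rel_other:
  assumes "j < 4" "k < 4" "j \<noteq> k"
  shows "rel j p k q \<longleftrightarrow> den j p \<noteq> 0 \<and> den k (B j p) \<noteq> 0 \<and> q = T k t (B j p)"
  using T_unchart(1)[of k q] T_unchart(2)[of k q t] unchart_T[of k "B j p" t] assms unfolding rel_def by metis

lemma inverse_eq_iff: "(b \<noteq> 0 \<and> a = 1 / b) \<longleftrightarrow> a * b = 1" for a b :: complex
  by (cases "b = 0") (auto simp: eq_divide_eq)

text \<open>Here and in the next lemmas clearing denominators turns the relation between two charts
  into polynomial equations. Such a relation is closed, and the Hausdorff property of the glued
  spaces rests on this. The condition \<open>v $ 1 \<noteq> 0\<close> is absorbed in a product being
  1.\<close>

lemma rel_01: "rel 0 w 1 v \<longleftrightarrow> w $ 1 * v $ 1 = 1 \<and>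
    w $ 2 = w $ 1 + 2*\<alpha> - (2*\<alpha>^2 - 2*\<beta> + \<gamma>) * v $ 1 - v $ 2 * (v $ 1)^2"
  unfolding inverse_eq_iff[symmetric] by (auto simp: rel_def den_def unchart_def vector2_eq_iff)

lemma rel_02: "rel 0 w 2 v \<longleftrightarrow> w $ 1 * v $ 1 = 1 \<and>
    w $ 2 = - w $ 1 - 2*\<alpha> + (2*\<alpha>^2 - 2*\<beta> - \<gamma>) * v $ 1 - v $ 2 * (v $ 1)^2"
  unfolding inverse_eq_iff[symmetric] by (auto simp: rel_def den_def unchart_def vector2_eq_iff)

lemma rel_03: "rel 0 w 3 v \<longleftrightarrow> w $ 2 * v $ 2 = 1 \<and> w $ 1 = - 2*\<gamma> * v $ 2 - v $ 1 * (v $ 2)^2"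
  unfolding inverse_eq_iff[symmetric] by (auto simp: rel_def den_def unchart_def vector2_eq_iff)

text \<open>Multiplying by \<open>w $ 1\<close> creates no false solutions: at
  \<open>w $ 1 = 0\<close> the second equation would read 1 = - 1, in accordance with the fact that
  charts 1 and 2 share no point outside the plane.\<close>

lemma rel_12: "rel 1 w 2 v \<longleftrightarrow> w $ 1 = v $ 1 \<and>
    1 + 2*\<alpha> * w $ 1 - (2*\<alpha>^2 - 2*\<beta> + \<gamma>) * (w $ 1)^2 - w $ 2 * (w $ 1)^3 =
    - 1 - 2*\<alpha> * w $ 1 + (2*\<alpha>^2 - 2*\<beta> - \<gamma>) * (w $ 1)^2 - v $ 2 * (w $ 1)^3"
proof -
  have eq: "a \<noteq> 0 \<Longrightarrow> (1 / a + c - d * a - e * a^2 = - (1 / a) - c + f * a - g * a^2) \<longleftrightarrow>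
      (1 + c * a - d * a^2 - e * a^3 = - 1 - c * a + f * a^2 - g * a^3)" for a c d e f g :: complex
  proof -
    assume a: "a \<noteq> 0"
    have "(1 / a + c - d * a - e * a^2 = - (1 / a) - c + f * a - g * a^2) \<longleftrightarrow>
        (a * (1 / a + c - d * a - e * a^2) = a * (- (1 / a) - c + f * a - g * a^2))" using a by simp
    also have "a * (1 / a + c - d * a - e * a^2) = 1 + c * a - d * a^2 - e * a^3"
      using a by (simp add: algebra_simps power2_eq_square power3_eq_cube)
    also have "a * (- (1 / a) - c + f * a - g * a^2) = - 1 - c * a + f * a^2 - g * a^3"
      using a by (simp add: algebra_simps power2_eq_square power3_eq_cube)
    finally show ?thesis .
  qed
  show ?thesis
  proof (cases "w $ 1 = 0")
    case True then show ?thesis by (auto simp: rel_def den_def)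
  next
    case False
    have "rel 1 w 2 v \<longleftrightarrow> v $ 1 \<noteq> 0 \<and> 1 / w $ 1 = 1 / v $ 1 \<and>
        1 / w $ 1 + 2*\<alpha> - (2*\<alpha>^2 - 2*\<beta> + \<gamma>) * w $ 1 - w $ 2 * (w $ 1)^2 =
        - (1 / v $ 1) - 2*\<alpha> + (2*\<alpha>^2 - 2*\<beta> - \<gamma>) * v $ 1 - v $ 2 * (v $ 1)^2"
      using False by (simp add: rel_def den_def unchart_def vector2_eq_iff)
    moreover have "v $ 1 \<noteq> 0 \<and> 1 / w $ 1 = 1 / v $ 1 \<longleftrightarrow> w $ 1 = v $ 1"
      using False by (metis inverse_eq_divide inverse_inverse_eq)
    ultimately show ?thesis
      using eq[OF False, of "2*\<alpha>" "2*\<alpha>^2 - 2*\<beta> + \<gamma>" "w $ 2" "2*\<alpha>^2 - 2*\<beta> - \<gamma>" "v $ 2"]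
      by metis
  qed
qed

text \<open>On the right-hand side \<open>u * a = 1\<close> makes \<open>a\<close> and
  \<open>u\<close> nonzero, and the hypothesis then makes \<open>b\<close> nonzero. In its uses
  \<open>b\<close> is \<open>v $ 2\<close> and \<open>u\<close>, the first coordinate of the point
  in the plane, is a multiple of it.\<close>

lemma field_equation_aux:
  fixes a b u Y :: complex
  assumes "b = 0 \<longrightarrow> u = 0"
  shows "(a \<noteq> 0 \<and> b \<noteq> 0 \<and> 1 / a = u \<and> Y / a = 1 / b) \<longleftrightarrow> u * a = 1 \<and> b * Y = a"
  using assms by (cases "a = 0"; cases "b = 0") (auto simp: field_simps)

lemma rel_13: "rel 1 w 3 v \<longleftrightarrow> (- 2*\<gamma> * v $ 2 - v $ 1 * (v $ 2)^2) * w $ 1 = 1 \<and>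
    v $ 2 * (1 + 2*\<alpha> * w $ 1 - (2*\<alpha>^2 - 2*\<beta> + \<gamma>) * (w $ 1)^2 - w $ 2 * (w $ 1)^3) = w $ 1"
proof -
  have "(1 + 2*\<alpha> * w $ 1 - (2*\<alpha>^2 - 2*\<beta> + \<gamma>) * (w $ 1)^2 - w $ 2 * (w $ 1)^3) / w $ 1 =
      1 / w $ 1 + 2*\<alpha> - (2*\<alpha>^2 - 2*\<beta> + \<gamma>) * w $ 1 - w $ 2 * (w $ 1)^2" if "w $ 1 \<noteq> 0"
    using that by (simp add: field_simps power2_eq_square power3_eq_cube)
  then have "rel 1 w 3 v \<longleftrightarrow> (w $ 1 \<noteq> 0 \<and> v $ 2 \<noteq> 0 \<and> 1 / w $ 1 = - 2*\<gamma> * v $ 2 - v $ 1 * (v $ 2)^2 \<and>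
      (1 + 2*\<alpha> * w $ 1 - (2*\<alpha>^2 - 2*\<beta> + \<gamma>) * (w $ 1)^2 - w $ 2 * (w $ 1)^3) / w $ 1 = 1 / v $ 2)"
    by (cases "w $ 1 = 0") (simp_all add: rel_def den_def unchart_def vector2_eq_iff)
  then show ?thesis by (subst (asm) field_equation_aux) simp_all
qed

lemma rel_23: "rel 2 w 3 v \<longleftrightarrow> (- 2*\<gamma> * v $ 2 - v $ 1 * (v $ 2)^2) * w $ 1 = 1 \<and>
    v $ 2 * (- 1 - 2*\<alpha> * w $ 1 + (2*\<alpha>^2 - 2*\<beta> - \<gamma>) * (w $ 1)^2 - w $ 2 * (w $ 1)^3) = w $ 1"
proof -
  have "(- 1 - 2*\<alpha> * w $ 1 + (2*\<alpha>^2 - 2*\<beta> - \<gamma>) * (w $ 1)^2 - w $ 2 * (w $ 1)^3) / w $ 1 =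
      - (1 / w $ 1) - 2*\<alpha> + (2*\<alpha>^2 - 2*\<beta> - \<gamma>) * w $ 1 - w $ 2 * (w $ 1)^2" if "w $ 1 \<noteq> 0"
    using that by (simp add: field_simps power2_eq_square power3_eq_cube)
  then have "rel 2 w 3 v \<longleftrightarrow> (w $ 1 \<noteq> 0 \<and> v $ 2 \<noteq> 0 \<and> 1 / w $ 1 = - 2*\<gamma> * v $ 2 - v $ 1 * (v $ 2)^2 \<and>
      (- 1 - 2*\<alpha> * w $ 1 + (2*\<alpha>^2 - 2*\<beta> - \<gamma>) * (w $ 1)^2 - w $ 2 * (w $ 1)^3) / w $ 1 = 1 / v $ 2)"
    by (cases "w $ 1 = 0") (simp_all add: rel_def den_def unchart_def vector2_eq_iff)
  then show ?thesis by (subst (asm) field_equation_aux) simp_all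
qed

lemma rel_closed:
  assumes "j < 4" "k < 4" shows "closed {p. rel j (fst p) k (snd p)}"
proof -
  have 1: "closed {p. rel j (fst p) k (snd p)}" if "j < k" "k < 4" for j k
  proof -
    from that consider "j = 0" "k = 1" | "j = 0" "k = 2" | "j = 0" "k = 3" | "j = 1" "k = 2"
      | "j = 1" "k = 3" | "j = 2" "k = 3" by linarith
    then show ?thesis
      by cases (simp_all only: rel_01 rel_02 rel_03 rel_12 rel_13 rel_23;
        intro closed_Collect_conj closed_Collect_eq continuous_intros)+
  qed
  consider "j = k" | "j < k" | "k < j" by linarith
  then show ?thesis
  proof cases
    case 1
    then have "{p. rel j (fst p) k (snd p)} = {p. fst p = snd p}" using rel_same[OF assms(1)] by auto
    then show ?thesis by (simp only:) (intro closed_Collect_eq continuous_intros)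
  next
    case 2 then show ?thesis using 1 assms by blast
  next
    case 3
    have "closed ((\<lambda>p. (snd p, fst p)) -` {p. rel k (fst p) j (snd p)})"
      by (rule closed_vimage[OF 1[OF 3 assms(1)]]) (intro continuous_intros)
    then show ?thesis by (simp add: vimage_def rel_sym[of j _ k])
  qed
qed

lemma rel_separate:
  assumes "j < 4" "k < 4" "\<not> rel j p k q"
  obtains V W where "open V" "open W" "p \<in> V" "q \<in> W" "\<And>v w. v \<in> V \<Longrightarrow> w \<in> W \<Longrightarrow> \<not> rel j v k w"
proof -
  have "open (- {p. rel j (fst p) k (snd p)})" using rel_closed[OF assms(1,2)] by (simp add: open_closed)
  moreover have "(p, q) \<in> - {p. rel j (fst p) k (snd p)}" using assms(3) by simp
  ultimately obtain V W where "open V" "open W" "(p, q) \<in> V \<times> W" "V \<times> W \<subseteq> - {p. rel j (fst p) k (snd p)}"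
    by (rule open_prod_elim)
  then show ?thesis by (intro that[of V W]) auto
qed

lemma ratreg_unchart:
  assumes "j < 4" "den j p \<noteq> 0"
  shows "ratreg (\<lambda>z. B j z $ 1) p (B j p $ 1)" "ratreg (\<lambda>z. B j z $ 2) p (B j p $ 2)"
  using less_4_cases[OF assms(1)] assms(2)
  by (auto simp: unchart_def den_def intro!: ratreg_intros)

lemma ratreg_T:
  assumes "k < 4" "den k v \<noteq> 0" "ratreg (\<lambda>z. F z $ 1) p (v $ 1)" "ratreg (\<lambda>z. F z $ 2) p (v $ 2)"
  shows "regular_value (\<lambda>z. T k t (F z)) p (T k t v)"
  using less_4_cases[OF assms(1)] assms(2)
  by (auto simp: regular_value_2 T_simps den_def intro!: ratreg_intros assms(3,4))

lemma regular_transition: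
  assumes "j < 4" "k < 4" "den j p \<noteq> 0" "den k q \<noteq> 0" "B j p = B k q"
  shows "regular_value (\<lambda>z. T k t (B j z)) p q"
  using ratreg_T[of k "B j p" "B j" p t, OF assms(2) _ ratreg_unchart[OF assms(1,3)]]
    T_unchart(1)[OF assms(2,4)] T_unchart(2)[OF assms(2,4), of t] assms(5) by simp

lemma generic_transition:
  assumes "j < 4" shows "generically (\<lambda>z. T k t (B j (T j t z)) = T k t z)"
  by (rule generically_mono[OF generically_den[of j]]) (simp add: unchart_T[OF assms])

text \<open>If the points are related, \<open>T k t\<close> after \<open>unchart j\<close> and its
  counterpart are regular at them; the identity serves for equal points of one chart. Conversely,
  unrelated points have neighbourhoods V and W without related pairs, as \<open>rel\<close> is
  closed. Near \<open>p\<close> there is an open set N of chart points that \<open>g\<close> sends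
  into W. A generic point z of the plane over N gives the related points \<open>T j t z\<close> in V
  and \<open>T k t z\<close> in W, a contradiction.\<close>

lemma glue_iff:
  "((j, p, t), (k, q, t')) \<in> glue 4 T \<longleftrightarrow> j < 4 \<and> k < 4 \<and> t' = t \<and> rel j p k q"
proof
  assume "j < 4 \<and> k < 4 \<and> t' = t \<and> rel j p k q"
  then have jk: "j < 4" "k < 4" "t' = t" and r: "rel j p k q" by auto
  have "\<exists>g h. generically (\<lambda>z. g (T j t z) = T k t z) \<and> generically (\<lambda>z. h (T k t z) = T j t z) \<and>
        regular_value g p q \<and> regular_value h q p"
  proof (cases "j = k \<and> p = q")
    case True
    have "regular_value (\<lambda>z. z) q q" by (simp add: regular_value_2 ratreg_nth)
    then show ?thesis using True by (intro exI[of _ "\<lambda>z. z"]) (auto intro: generically_always)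
  next
    case False
    then have *: "den j p \<noteq> 0" "den k q \<noteq> 0" "B j p = B k q" using r by (auto simp: rel_def)
    show ?thesis
      using generic_transition[OF jk(1), of k t] generic_transition[OF jk(2), of j t]
        regular_transition[OF jk(1,2) *] regular_transition[OF jk(2,1) *(2,1) *(3)[symmetric]]
      by (intro exI[of _ "\<lambda>z. T k t (B j z)"] exI[of _ "\<lambda>z. T j t (B k z)"] conjI)
  qed
  then show "((j, p, t), (k, q, t')) \<in> glue 4 T" using jk by (simp add: glue_def)
next
  assume "((j, p, t), (k, q, t')) \<in> glue 4 T"
  then obtain g where jk: "j < 4" "k < 4" "t' = t" and g: "generically (\<lambda>z. g (T j t z) = T k t z)"
    and r: "regular_value g p q" unfolding glue_def by auto
  have "rel j p k q"
  proof (rule ccontr)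
    assume n: "\<not> rel j p k q"
    obtain V W where VW: "open V" "open W" "p \<in> V" "q \<in> W" "\<And>v w. v \<in> V \<Longrightarrow> w \<in> W \<Longrightarrow> \<not> rel j v k w"
      using rel_separate[OF jk(1,2) n] by blast
    obtain N where N: "open N" "N \<noteq> {}" "N \<subseteq> V" "\<And>w. w \<in> N \<Longrightarrow> g w \<in> W \<and> den j w \<noteq> 0"
      using regular_value_approx[OF r VW(1,3,2,4) generically_den[of j]] by blast
    have od: "open {z. den j z \<noteq> 0}"
      by (cases "j = 0"; cases "j = 1 \<or> j = 2")
        (auto simp: den_def intro!: open_Collect_neq continuous_intros)
    let ?M = "{z\<in>{z. den j z \<noteq> 0}. T j t z \<in> N}"
    have o: "open ?M" by (rule holo_on_preimage[OF holo_on_T[OF jk(1)] od N(1)])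
    obtain w where "w \<in> N" using N(2) by blast
    then have "B j w \<in> ?M"
      using N(4) T_unchart(1)[OF jk(1), of w] T_unchart(2)[OF jk(1), of w t] by auto
    then have ne: "?M \<noteq> {}" by blast
    show False
    proof (rule generically_open[OF generically_conj[OF g generically_den[of k]] o ne])
      fix M assume M: "M \<noteq> {}" "M \<subseteq> ?M"
        "\<And>z. z \<in> M \<Longrightarrow> g (T j t z) = T k t z \<and> den k z \<noteq> 0"
      then obtain z where z: "z \<in> M" by blast
      then have z': "den j z \<noteq> 0" "T j t z \<in> N" "g (T j t z) = T k t z" "den k z \<noteq> 0"
        using M(2) M(3)[OF z] by auto
      have "rel j (T j t z) k (T k t z)"
        using unchart_T[OF jk(1) z'(1), of t] unchart_T[OF jk(2) z'(4), of t] by (auto simp: rel_def)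
      moreover have "T j t z \<in> V" "T k t z \<in> W" using z' N(3) N(4)[OF z'(2)] by auto
      ultimately show False using VW(5) by blast
    qed
  qed
  with jk show "j < 4 \<and> k < 4 \<and> t' = t \<and> rel j p k q" by simp
qed

section \<open>The glued fibres and the glued total space as manifolds\<close>

abbreviation "gp \<equiv> glued_point 4 T"

lemma mem_gp: "(k, q, t') \<in> gp j p t \<longleftrightarrow> j < 4 \<and> k < 4 \<and> t' = t \<and> rel j p k q"
  unfolding glued_point_def by (simp add: glue_iff)

lemma gp_eq_iff:
  assumes "j < 4" "k < 4" shows "gp j p t = gp k q t' \<longleftrightarrow> t = t' \<and> rel j p k q"
proof
  assume "gp j p t = gp k q t'"
  then have "(k, q, t') \<in> gp j p t" using assms by (simp add: mem_gp)
  then show "t = t' \<and> rel j p k q" by (simp add: mem_gp)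
next
  assume r: "t = t' \<and> rel j p k q"
  have "(l, r, s) \<in> gp j p t \<longleftrightarrow> (l, r, s) \<in> gp k q t'" for l r s
    using r assms rel_trans[of j p k q l r] rel_trans[of k q j p l r] rel_sym[of j p k q]
    by (auto simp: mem_gp)
  then show "gp j p t = gp k q t'" by auto
qed

lemma time_of_gp: "j < 4 \<Longrightarrow> time_of (gp j p t) = t"
  unfolding time_of_def
proof (rule the_equality)
  show "j < 4 \<Longrightarrow> \<exists>k q. (k, q, t) \<in> gp j p t"
    by (intro exI[of _ j] exI[of _ p]) (simp add: mem_gp)
qed (auto simp: mem_gp)

lemma transition_domain:
  assumes "i < 4" "j < 4"
  shows "open {z. den i z \<noteq> 0 \<and> den j (B i z) \<noteq> 0}"
    and "holo_on {z. den i z \<noteq> 0 \<and> den j (B i z) \<noteq> 0} (\<lambda>z. T j t (B i z))"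
proof -
  have od: "open {z. den i z \<noteq> 0}" for i
    by (cases "i = 0"; cases "i = 1 \<or> i = 2")
      (auto simp: den_def intro!: open_Collect_neq continuous_intros)
  have "cdiff (\<lambda>z. B i z $ k) z" if "den i z \<noteq> 0" for z k
    using less_4_cases[OF assms(1)] exhaust_2[of k] that
    by (auto simp: unchart_def den_def intro!: cdiff_intros cdiff_divide)
  then have hB: "holo_on {z. den i z \<noteq> 0} (B i)" unfolding holo_on_iff by blast
  have eq: "{z\<in>{z. den i z \<noteq> 0}. B i z \<in> {z. den j z \<noteq> 0}} = {z. den i z \<noteq> 0 \<and> den j (B i z) \<noteq> 0}" by auto
  show "open {z. den i z \<noteq> 0 \<and> den j (B i z) \<noteq> 0}"
    using holo_on_preimage[OF hB od od[of j]] unfolding eq .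
  have "holo_on {z. den i z \<noteq> 0 \<and> den j (B i z) \<noteq> 0} (T j t \<circ> B i)"
    by (rule holo_on_compose[OF holo_on_subset[OF hB] holo_on_T[OF assms(2)]]) auto
  then show "holo_on {z. den i z \<noteq> 0 \<and> den j (B i z) \<noteq> 0} (\<lambda>z. T j t (B i z))" by (simp add: o_def)
qed

lemma fibre_manifold:
  "complex_manifold (glued_fibre 4 T t)"
  "j < 4 \<Longrightarrow> mchart (glued_fibre 4 T t) UNIV (\<lambda>p. gp j p t)"
  "countable (atlas (glued_fibre 4 T t))"
  "points (glued_fibre 4 T t) = (\<Union>j<4. range (\<lambda>p. gp j p t))"
proof -
  define \<phi> where "\<phi> = (\<lambda>j P. THE p. (j, p, t) \<in> (P :: chart_point set))"
  have p1: "points (glued_fibre 4 T t) = (\<Union>j\<in>{..<4}. (\<lambda>p. gp j p t) ` UNIV)"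
    unfolding glued_fibre_def glued_space_def using time_of_gp by auto
  have p2: "atlas (glued_fibre 4 T t) = (\<lambda>j. ((\<lambda>p. gp j p t) ` UNIV, \<phi> j)) ` {..<4}"
    unfolding glued_fibre_def \<phi>_def by (auto simp: full_SetCompr_eq image_iff)
  have p3: "\<phi> j (gp j p t) = p" if "j < 4" for j p
    unfolding \<phi>_def using that rel_same[OF that] by (intro the_equality) (auto simp: mem_gp)
  have p3': "\<phi> j (gp i p t) = T j t (B i p)"
    if "i < 4" "j < 4" "i \<noteq> j" "den i p \<noteq> 0 \<and> den j (B i p) \<noteq> 0" for i j p
    unfolding \<phi>_def using that rel_other[OF that(1-3), of p _ t] by (intro the_equality) (auto simp: mem_gp)
  have dom: "{z\<in>UNIV. gp i z t \<in> range (\<lambda>p. gp j p t)} = {z. den i z \<noteq> 0 \<and> den j (B i z) \<noteq> 0}"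
    if "i < 4" "j < 4" "i \<noteq> j" for i j
    using rel_other[OF that, of _ _ t] gp_eq_iff[OF that(1,2)] by (auto simp: image_iff)
  have p4: "open {z\<in>UNIV. gp i z t \<in> range (\<lambda>p. gp j p t)} \<and>
      holo_on {z\<in>UNIV. gp i z t \<in> range (\<lambda>p. gp j p t)} (\<lambda>z. \<phi> j (gp i z t))"
    if "i < 4" "j < 4" "i \<noteq> j" for i j
    unfolding dom[OF that]
    using transition_domain(1)[OF that(1,2)]
      holo_on_cong[OF transition_domain(2)[OF that(1,2), of t] transition_domain(1)[OF that(1,2)],
        of "\<lambda>z. \<phi> j (gp i z t)"] p3'[OF that] by auto
  have p5: "\<exists>V W. open V \<and> open W \<and> x \<in> V \<and> y \<in> W \<and> (\<forall>v\<in>V \<inter> UNIV. \<forall>w\<in>W \<inter> UNIV. gp i v t \<noteq> gp j w t)"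
    if ij: "i < 4" "j < 4" and ne: "gp i x t \<noteq> gp j y t" for i j x y
  proof -
    have "\<not> rel i x j y" using ne gp_eq_iff[OF ij] by blast
    then obtain V W where "open V" "open W" "x \<in> V" "y \<in> W" "\<And>v w. v \<in> V \<Longrightarrow> w \<in> W \<Longrightarrow> \<not> rel i v j w"
      using rel_separate[OF ij] by blast
    then show ?thesis using gp_eq_iff[OF ij] by (intro exI[of _ V] exI[of _ W]) auto
  qed
  have cnt: "countable {..<4::nat}" by simp
  note fam = complex_manifold_family[OF p1 p2 cnt]
  show "complex_manifold (glued_fibre 4 T t)"
    by (rule fam(1)) (use p3 p4 p5 in auto)
  show "mchart (glued_fibre 4 T t) UNIV (\<lambda>p. gp j p t)" if "j < 4"
    by (rule fam(2)) (use p3 p4 p5 that in auto)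
  show "countable (atlas (glued_fibre 4 T t))" unfolding p2 by simp
  show "points (glued_fibre 4 T t) = (\<Union>j<4. range (\<lambda>p. gp j p t))" by (rule p1)
qed

lemma space_manifold:
  "complex_manifold (glued_space 4 T)"
  "j < 4 \<Longrightarrow> mchart (glued_space 4 T) UNIV (\<lambda>v. gp j (vector [v $ 1, v $ 2]) (v $ 3))"
  "countable (atlas (glued_space 4 T))"
  "points (glued_space 4 T) = (\<Union>j<4. range (\<lambda>v :: complex ^ 3. gp j (vector [v $ 1, v $ 2]) (v $ 3)))"
proof -
  define \<sigma> where "\<sigma> = (\<lambda>j (v :: complex ^ 3). gp j (vector [v $ 1, v $ 2]) (v $ 3))"
  define \<phi> where "\<phi> = (\<lambda>j P. THE v :: complex ^ 3. (j, vector [v $ 1, v $ 2], v $ 3) \<in> (P :: chart_point set))"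
  let ?pr = "\<lambda>v :: complex ^ 3. vector [v $ 1, v $ 2] :: complex ^ 2"
  have s: "gp j p t = \<sigma> j (vector [p $ 1, p $ 2, t])" for j p t by (simp add: \<sigma>_def)
  have eta3: "v = w \<longleftrightarrow> ?pr v = ?pr w \<and> v $ 3 = w $ 3" for v w
    by (auto simp: vector3_eq_iff vector2_eq_iff)
  have rng: "{gp j p t |p t. True} = range (\<sigma> j)" for j
  proof (intro equalityI subsetI)
    fix P assume "P \<in> {gp j p t |p t. True}"
    then obtain p t where "P = gp j p t" by blast
    then have "P = \<sigma> j (vector [p $ 1, p $ 2, t])" using s by simp
    then show "P \<in> range (\<sigma> j)" by blast
  qed (auto simp: \<sigma>_def)
  have p1: "points (glued_space 4 T) = (\<Union>j\<in>{..<4}. \<sigma> j ` UNIV)"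
  proof -
    have "points (glued_space 4 T) = (\<Union>j\<in>{..<4}. {gp j p t |p t. True})"
      unfolding glued_space_def by auto
    then show ?thesis unfolding rng .
  qed
  have p2: "atlas (glued_space 4 T) = (\<lambda>j. (\<sigma> j ` UNIV, \<phi> j)) ` {..<4}"
  proof -
    have "atlas (glued_space 4 T) = (\<lambda>j. ({gp j p t |p t. True}, \<phi> j)) ` {..<4}"
      unfolding glued_space_def \<phi>_def by auto
    then show ?thesis unfolding rng .
  qed
  have p3: "\<phi> j (\<sigma> j v) = v" if "j < 4" for j v
    unfolding \<phi>_def \<sigma>_def using that rel_same[OF that] eta3
    by (intro the_equality) (auto simp: mem_gp)
  have se: "\<sigma> i v = \<sigma> j w \<longleftrightarrow> v $ 3 = w $ 3 \<and> rel i (?pr v) j (?pr w)" if "i < 4" "j < 4" for i j v w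
    unfolding \<sigma>_def by (rule gp_eq_iff[OF that])
  \<comment> \<open>The chart maps do not depend on time, so time 0 may stand for every t, and the
    time coordinate is carried along unchanged.\<close>
  let ?F = "\<lambda>i j v. vector [T j 0 (B i (?pr v)) $ 1, T j 0 (B i (?pr v)) $ 2, v $ 3] :: complex ^ 3"
  have p3': "\<phi> j (\<sigma> i v) = ?F i j v"
    if "i < 4" "j < 4" "i \<noteq> j" "den i (?pr v) \<noteq> 0 \<and> den j (B i (?pr v)) \<noteq> 0" for i j v
    unfolding \<phi>_def \<sigma>_def using that rel_other[OF that(1-3), of "?pr v" _ 0]
    by (intro the_equality) (auto simp: mem_gp eta3)
  have dom: "{v\<in>UNIV. \<sigma> i v \<in> range (\<sigma> j)} = {v. ?pr v \<in> {z. den i z \<noteq> 0 \<and> den j (B i z) \<noteq> 0}}"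
    if "i < 4" "j < 4" "i \<noteq> j" for i j
  proof -
    have "\<sigma> i v \<in> range (\<sigma> j) \<longleftrightarrow> den i (?pr v) \<noteq> 0 \<and> den j (B i (?pr v)) \<noteq> 0" for v
    proof
      assume "\<sigma> i v \<in> range (\<sigma> j)"
      then show "den i (?pr v) \<noteq> 0 \<and> den j (B i (?pr v)) \<noteq> 0"
        using se[OF that(1,2)] rel_other[OF that, of _ _ 0] by auto
    next
      assume "den i (?pr v) \<noteq> 0 \<and> den j (B i (?pr v)) \<noteq> 0"
      then have "\<sigma> i v = \<sigma> j (?F i j v)"
        using se[OF that(1,2)] rel_other[OF that, of _ _ 0] by simp
      then show "\<sigma> i v \<in> range (\<sigma> j)" by blast
    qed
    then show ?thesis by auto
  qed
  have hp: "holo_on UNIV ?pr" by (auto simp: holo_on_vector2)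
  have p4: "open {v\<in>UNIV. \<sigma> i v \<in> range (\<sigma> j)} \<and>
      holo_on {v\<in>UNIV. \<sigma> i v \<in> range (\<sigma> j)} (\<lambda>v. \<phi> j (\<sigma> i v))"
    if "i < 4" "j < 4" "i \<noteq> j" for i j
  proof -
    let ?D = "{v. ?pr v \<in> {z. den i z \<noteq> 0 \<and> den j (B i z) \<noteq> 0}}"
    note t = transition_domain(1)[OF that(1,2)] transition_domain(2)[OF that(1,2), of 0]
    have o: "open ?D" using holo_on_preimage[OF hp open_UNIV t(1)] by simp
    have "holo_on ?D ((\<lambda>z. T j 0 (B i z)) \<circ> ?pr)"
      by (rule holo_on_compose[OF holo_on_subset[OF hp] t(2)]) auto
    then have "holo_on ?D (?F i j)" unfolding holo_on_vector3 holo_on_iff by auto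
    then have "holo_on ?D (\<lambda>v. \<phi> j (\<sigma> i v))"
      by (rule holo_on_cong[OF _ o]) (use p3'[OF that] in auto)
    with o show ?thesis unfolding dom[OF that] by blast
  qed
  have p5: "\<exists>V W. open V \<and> open W \<and> x \<in> V \<and> y \<in> W \<and> (\<forall>v\<in>V \<inter> UNIV. \<forall>w\<in>W \<inter> UNIV. \<sigma> i v \<noteq> \<sigma> j w)"
    if ij: "i < 4" "j < 4" and ne: "\<sigma> i x \<noteq> \<sigma> j y" for i j x y
  proof (cases "x $ 3 = y $ 3")
    case True
    then have "\<not> rel i (?pr x) j (?pr y)" using ne se[OF ij] by blast
    then obtain V W where VW: "open V" "open W" "?pr x \<in> V" "?pr y \<in> W" "\<And>v w. v \<in> V \<Longrightarrow> w \<in> W \<Longrightarrow> \<not> rel i v j w"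
      using rel_separate[OF ij] by blast
    show ?thesis
      using VW holo_on_preimage[OF hp open_UNIV VW(1)] holo_on_preimage[OF hp open_UNIV VW(2)] se[OF ij]
      by (intro exI[of _ "{v\<in>UNIV. ?pr v \<in> V}"] exI[of _ "{v\<in>UNIV. ?pr v \<in> W}"]) auto
  next
    case False
    obtain V W where VW: "open V" "open W" "x $ 3 \<in> V" "y $ 3 \<in> W" "V \<inter> W = {}"
      using hausdorff[OF False] by blast
    have o: "open {v :: complex ^ 3. v $ 3 \<in> V}" if "open V" for V
      using open_vimage[OF that, of "\<lambda>v. v $ 3"] by (simp add: vimage_def continuous_on_component)
    show ?thesis
      using VW o[OF VW(1)] o[OF VW(2)] se[OF ij]
      by (intro exI[of _ "{v. v $ 3 \<in> V}"] exI[of _ "{v. v $ 3 \<in> W}"]) auto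
  qed
  have cnt: "countable {..<4::nat}" by simp
  note fam = complex_manifold_family[OF p1 p2 cnt]
  show "complex_manifold (glued_space 4 T)"
    by (rule fam(1)) (use p3 p4 p5 in auto)
  have "mchart (glued_space 4 T) UNIV (\<sigma> j)" if "j < 4"
    by (rule fam(2)) (use p3 p4 p5 that in auto)
  then show "mchart (glued_space 4 T) UNIV (\<lambda>v. gp j (vector [v $ 1, v $ 2]) (v $ 3))" if "j < 4"
    using that unfolding \<sigma>_def .
  show "countable (atlas (glued_space 4 T))" unfolding p2 by simp
  show "points (glued_space 4 T) = (\<Union>j<4. range (\<lambda>v :: complex ^ 3. gp j (vector [v $ 1, v $ 2]) (v $ 3)))"
    using p1 unfolding \<sigma>_def .
qed

end

section \<open>Polynomial right-hand sides\<close>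

definition polyfun :: "(complex ^ 2 \<Rightarrow> complex) \<Rightarrow> bool" where
  "polyfun f \<longleftrightarrow> (\<exists>P. \<forall>z. f z = peval P z)"

lemma polyfun_intros:
  "polyfun (\<lambda>_. c)" "polyfun (\<lambda>z. z $ 1)" "polyfun (\<lambda>z. z $ 2)"
  "polyfun f \<Longrightarrow> polyfun g \<Longrightarrow> polyfun (\<lambda>z. f z + g z)"
  "polyfun f \<Longrightarrow> polyfun g \<Longrightarrow> polyfun (\<lambda>z. f z - g z)"
  "polyfun f \<Longrightarrow> polyfun g \<Longrightarrow> polyfun (\<lambda>z. f z * g z)"
  "polyfun f \<Longrightarrow> polyfun (\<lambda>z. - f z)"
proof -
  have peval_diff: "peval (P - Q) z = peval P z - peval Q z" for P Q z by (simp add: peval_def)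
  show "polyfun (\<lambda>_. c)" unfolding polyfun_def by (rule exI[of _ "[:[:c:]:]"]) simp
  show "polyfun (\<lambda>z. z $ 1)" unfolding polyfun_def by (rule exI[of _ "[:[:0, 1:]:]"]) simp
  show "polyfun (\<lambda>z. z $ 2)" unfolding polyfun_def by (rule exI[of _ "[:0, 1:]"]) simp
  show "polyfun (\<lambda>z. - f z)" if "polyfun f"
    using that unfolding polyfun_def by (metis peval_simps(3))
  assume "polyfun f" "polyfun g"
  then obtain P Q where "\<forall>z. f z = peval P z" "\<forall>z. g z = peval Q z" unfolding polyfun_def by blast
  then show "polyfun (\<lambda>z. f z + g z)" "polyfun (\<lambda>z. f z - g z)" "polyfun (\<lambda>z. f z * g z)"
    unfolding polyfun_def
    by (intro exI[of _ "P + Q"], simp, intro exI[of _ "P - Q"], simp add: peval_diff, intro exI[of _ "P * Q"], simp)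
qed

lemma polyfun_power: "polyfun f \<Longrightarrow> polyfun (\<lambda>z. f z ^ n)"
  by (induction n) (auto intro: polyfun_intros)

lemma poly_sum_le: "degree p \<le> n \<Longrightarrow> poly p x = (\<Sum>i\<le>n. coeff p i * x ^ i)"
  for x :: "'a::comm_ring_1"
  unfolding poly_altdef by (rule sum.mono_neutral_left) (auto simp: coeff_eq_0)

lemma poly_in_xy_polyfun:
  assumes "polyfun f" shows "poly_in_xy (\<lambda>_ z. f z)"
proof -
  obtain P where P: "\<And>z. f z = peval P z" using assms unfolding polyfun_def by blast
  \<comment> \<open>One number that bounds the degrees in both variables.\<close>
  define N where "N = degree P + Max ((\<lambda>l. degree (coeff P l)) ` {..degree P})"
  have dl: "degree (coeff P l) \<le> N" for l
  proof (cases "l \<le> degree P")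
    case True
    then have "degree (coeff P l) \<le> Max ((\<lambda>l. degree (coeff P l)) ` {..degree P})" by (intro Max_ge) auto
    then show ?thesis by (simp add: N_def)
  qed (simp add: coeff_eq_0)
  have "f z = (\<Sum>k\<le>N. \<Sum>l\<le>N. coeff (coeff P l) k * z $ 1 ^ k * z $ 2 ^ l)" for z
  proof -
    have "poly P [:z $ 2:] = (\<Sum>l\<le>N. coeff P l * [:z $ 2:] ^ l)"
      by (rule poly_sum_le) (simp add: N_def)
    then have "f z = (\<Sum>l\<le>N. poly (coeff P l) (z $ 1) * z $ 2 ^ l)"
      by (simp add: P peval_def poly_sum)
    also have "\<dots> = (\<Sum>l\<le>N. \<Sum>k\<le>N. coeff (coeff P l) k * z $ 1 ^ k * z $ 2 ^ l)"
      by (simp add: poly_sum_le[OF dl] sum_distrib_right)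
    also have "\<dots> = (\<Sum>k\<le>N. \<Sum>l\<le>N. coeff (coeff P l) k * z $ 1 ^ k * z $ 2 ^ l)" by (rule sum.swap)
    finally show ?thesis .
  qed
  then show ?thesis unfolding poly_in_xy_def
    by (intro exI[of _ N] exI[of _ "\<lambda>k l _. coeff (coeff P l) k"]) auto
qed

section \<open>The phase space\<close>

context cubic_system
begin

section \<open>Birational and symplectic coordinate changes\<close>

lemma birational: 
  assumes j: "j < 4" shows "birational_map (T j t)"
  unfolding birational_map_def
proof (intro conjI exI)
  \<comment> \<open>Any point at which \<open>den j\<close> does not vanish will do: regularity at a
    single point already provides fractions that represent the map generically.\<close>
  have d: "den j (vector [1, 1]) \<noteq> 0" by (simp add: den_def)
  show "rational_map (T j t)" by (rule rational_mapI[OF regular_T[OF j d]])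
  have "regular_value (B j) (vector [1, 1]) (B j (vector [1, 1]))"
    unfolding regular_value_2 using ratreg_unchart[OF j d] by blast
  then show "rational_map (B j)" by (rule rational_mapI)
  show "generically (\<lambda>z. B j (T j t z) = z)"
    by (rule generically_mono[OF generically_den[of j]]) (rule unchart_T(2)[OF j])
  show "generically (\<lambda>z. T j t (B j z) = z)"
    by (rule generically_mono[OF generically_den[of j]]) (rule T_unchart(2)[OF j])
qed

text \<open>Apart from the identity of chart 0, the Jacobian matrices are triangular, with diagonal
  entries - 1 / x^2 and - x^2 in charts 1 and 2 and - y^2 and - 1 / y^2 in chart 3, so the
  determinant is 1.\<close>

lemma symplectic:
  assumes j: "j < 4" shows "symplectic_map (T j t)"
  unfolding symplectic_map_def
proof (rule generically_mono[OF generically_den[of j]])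
  fix z assume d: "den j z \<noteq> 0"
  have n: "((\<lambda>z :: complex ^ 2. z $ i) has_derivative (\<lambda>u. u $ i)) (at z)" for i
    by (intro bounded_linear_imp_has_derivative bounded_linear_vec_nth)
  have inv: "((\<lambda>z :: complex ^ 2. 1 / z $ i) has_derivative (\<lambda>u. - (1 / (z $ i)^2) * u $ i)) (at z)" if "z $ i \<noteq> 0" for i
  proof -
    have "((\<lambda>w. 1 / w) has_field_derivative - (1 / (z $ i)^2)) (at (z $ i))"
      using that by (auto intro!: derivative_eq_intros simp: power2_eq_square)
    from has_derivative_compose[OF n this[unfolded has_field_derivative_def]] show ?thesis .
  qed
  have main: "\<exists>L. (T j t has_derivative L) (at z) \<and> complex_linear L \<and>
      (\<forall>u v. L u $ 1 * L v $ 2 - L v $ 1 * L u $ 2 = u $ 1 * v $ 2 - v $ 1 * u $ 2)"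
    if h: "((\<lambda>z. T j t z $ 1) has_derivative (\<lambda>u. a * u $ 1 + b * u $ 2)) (at z)"
      "((\<lambda>z. T j t z $ 2) has_derivative (\<lambda>u. c * u $ 1 + e * u $ 2)) (at z)" and det: "a * e - b * c = 1" for a b c e
  proof (intro exI conjI allI)
    let ?L = "\<lambda>u :: complex ^ 2. vector [a * u $ 1 + b * u $ 2, c * u $ 1 + e * u $ 2] :: complex ^ 2"
    show 1: "(T j t has_derivative ?L) (at z)"
    proof (rule has_derivative_vec_nth)
      fix i show "((\<lambda>w. T j t w $ i) has_derivative (\<lambda>v. ?L v $ i)) (at z)"
        using exhaust_2[of i] h by auto
    qed
    show "complex_linear ?L" unfolding complex_linear_def
      using has_derivative_linear[OF 1] by (simp add: vector2_eq_iff algebra_simps)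
    fix u v :: "complex ^ 2"
    have "?L u $ 1 * ?L v $ 2 - ?L v $ 1 * ?L u $ 2 = (a * e - b * c) * (u $ 1 * v $ 2 - v $ 1 * u $ 2)"
      by (simp add: algebra_simps)
    then show "?L u $ 1 * ?L v $ 2 - ?L v $ 1 * ?L u $ 2 = u $ 1 * v $ 2 - v $ 1 * u $ 2" using det by simp
  qed
  from less_4_cases[OF j] consider "j = 0" | "j = 1" "z $ 1 \<noteq> 0" | "j = 2" "z $ 1 \<noteq> 0" | "j = 3" "z $ 2 \<noteq> 0"
    using d by (auto simp: den_def)
  then show "\<exists>L. (T j t has_derivative L) (at z) \<and> complex_linear L \<and>
      (\<forall>u v. L u $ 1 * L v $ 2 - L v $ 1 * L u $ 2 = u $ 1 * v $ 2 - v $ 1 * u $ 2)"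
  proof cases
    case 1
    show ?thesis by (rule main[of 1 0 0 1]) (simp_all add: 1 T_simps n)
  next
    case 2
    let ?c = "- (2 * z $ 1 * z $ 2 - 3 * (z $ 1)^2 - 4*\<alpha> * z $ 1 + 2*\<alpha>^2 - 2*\<beta> + \<gamma>)"
    have "((\<lambda>z. - ((z $ 2 - z $ 1 - 2*\<alpha>) * z $ 1 + 2*\<alpha>^2 - 2*\<beta> + \<gamma>) * z $ 1) has_derivative
        (\<lambda>u. ?c * u $ 1 + - ((z $ 1)^2) * u $ 2)) (at z)"
      by (auto intro!: derivative_eq_intros n simp: fun_eq_iff algebra_simps power2_eq_square)
    then show ?thesis using 2 inv[of 1]
      by (intro main[of "- (1 / (z $ 1)^2)" 0 ?c "- ((z $ 1)^2)"]) (simp_all add: T_simps)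
  next
    case 3
    let ?c = "- (2 * z $ 1 * z $ 2 + 3 * (z $ 1)^2 + 4*\<alpha> * z $ 1 - 2*\<alpha>^2 + 2*\<beta> + \<gamma>)"
    have "((\<lambda>z. - ((z $ 2 + z $ 1 + 2*\<alpha>) * z $ 1 - 2*\<alpha>^2 + 2*\<beta> + \<gamma>) * z $ 1) has_derivative
        (\<lambda>u. ?c * u $ 1 + - ((z $ 1)^2) * u $ 2)) (at z)"
      by (auto intro!: derivative_eq_intros n simp: fun_eq_iff algebra_simps power2_eq_square)
    then show ?thesis using 3 inv[of 1]
      by (intro main[of "- (1 / (z $ 1)^2)" 0 ?c "- ((z $ 1)^2)"]) (simp_all add: T_simps)
  next
    case 4
    have "((\<lambda>z. - (z $ 1 * z $ 2 + 2*\<gamma>) * z $ 2) has_derivative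
        (\<lambda>u. - ((z $ 2)^2) * u $ 1 + - (2 * z $ 1 * z $ 2 + 2*\<gamma>) * u $ 2)) (at z)"
      by (auto intro!: derivative_eq_intros n simp: fun_eq_iff algebra_simps power2_eq_square)
    then show ?thesis using 4 inv[of 2]
      by (intro main[of "- ((z $ 2)^2)" "- (2 * z $ 1 * z $ 2 + 2*\<gamma>)" 0 "- (1 / (z $ 2)^2)"]) (simp_all add: T_simps)
  qed
qed

section \<open>The system in the coordinates of each chart\<close>

lemma rhs_simps: "system_rhs \<alpha> \<beta> \<gamma> t z $ 1 = z $ 1 * z $ 2 + \<gamma>"
  "system_rhs \<alpha> \<beta> \<gamma> t z $ 2 = 3/2 * (z $ 1)^2 - 1/2 * (z $ 2)^2 + 4*\<alpha> * z $ 1 + 2*\<beta>"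
  by (simp_all add: system_rhs_def Let_def)

text \<open>In each chart the system is Hamiltonian, with the polynomial Hamiltonian function
  \<open>x * y\<^sup>2 / 2 + \<gamma> * y - x\<^sup>3 / 2 - 2 * \<alpha> * x\<^sup>2 - 2 * \<beta> * x\<close> rewritten in the coordinates of the chart.\<close>

definition chart_rhs :: "nat \<Rightarrow> 2 \<Rightarrow> complex ^ 2 \<Rightarrow> complex" where
  "chart_rhs j i z =
     (if j = 0 then if i = 1 then z $ 1 * z $ 2 + \<gamma>
        else 3/2 * (z $ 1)^2 - 1/2 * (z $ 2)^2 + 4*\<alpha> * z $ 1 + 2*\<beta>
      else if j = 1 then let k = 2*\<alpha>^2 - 2*\<beta> + \<gamma> in
        if i = 1 then - 1 - 2*\<alpha> * z $ 1 + (k - \<gamma>) * (z $ 1)^2 + z $ 2 * (z $ 1)^3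
        else - 1/2 * k^2 + \<gamma> * k + (2*\<gamma> - 2*k) * z $ 1 * z $ 2 - 3/2 * (z $ 1)^2 * (z $ 2)^2 + 2*\<alpha> * z $ 2
      else if j = 2 then let k = 2*\<alpha>^2 - 2*\<beta> - \<gamma> in
        if i = 1 then 1 + 2*\<alpha> * z $ 1 - (k + \<gamma>) * (z $ 1)^2 + z $ 2 * (z $ 1)^3
        else - 1/2 * k^2 - \<gamma> * k + (2*k + 2*\<gamma>) * z $ 1 * z $ 2 - 3/2 * (z $ 1)^2 * (z $ 2)^2 - 2*\<alpha> * z $ 2
      else let X = - 2*\<gamma> * z $ 2 - z $ 1 * (z $ 2)^2 in
        if i = 1 then (3/2 * X^2 + 4*\<alpha> * X + 2*\<beta>) * (2*\<gamma> + 2 * z $ 1 * z $ 2)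
        else 1/2 - (3/2 * X^2 + 4*\<alpha> * X + 2*\<beta>) * (z $ 2)^2)"

lemma chart_rhs_poly: "poly_in_xy (\<lambda>_ z. chart_rhs j i z)"
proof (rule poly_in_xy_polyfun)
  show "polyfun (\<lambda>z. chart_rhs j i z)"
    by (cases "j = 0"; cases "j = 1"; cases "j = 2"; cases "i = 1";
      simp only: chart_rhs_def if_True if_False Let_def simp_thms; intro polyfun_intros polyfun_power)
qed

text \<open>Both sides are compared as functions of the original x and y: the derivative along a
  solution by the chain rule, \<open>chart_rhs\<close> by substituting the chart map.\<close>

lemma rewritten:
  assumes j: "j < 4"
  shows "rewritten_system (system_rhs \<alpha> \<beta> \<gamma>) (T j) (\<lambda>i _ z. chart_rhs j i z)"
  unfolding rewritten_system_def
proof (intro allI, rule generically_mono[OF generically_den[of j]], intro allI impI)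
  fix t z c and i :: 2 assume d: "den j z \<noteq> 0" and c: "c t = z"
    and V: "\<forall>i. ((\<lambda>s. c s $ i) has_field_derivative system_rhs \<alpha> \<beta> \<gamma> t z $ i) (at t)"
  define x y where "x = z $ 1" and "y = z $ 2"
  have X: "((\<lambda>s. c s $ 1) has_field_derivative x * y + \<gamma>) (at t)"
    and Y: "((\<lambda>s. c s $ 2) has_field_derivative 3/2 * x^2 - 1/2 * y^2 + 4*\<alpha> * x + 2*\<beta>) (at t)"
    using V[THEN spec, of 1] V[THEN spec, of 2] by (simp_all add: rhs_simps x_def y_def)
  have cx: "c t $ 1 = x" "c t $ 2 = y" by (simp_all add: c x_def y_def)
  from less_4_cases[OF j] consider "j = 0" | "j = 1" "x \<noteq> 0" | "j = 2" "x \<noteq> 0" | "j = 3" "y \<noteq> 0"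
    using d by (auto simp: den_def x_def y_def)
  then show "((\<lambda>s. T j s (c s) $ i) has_field_derivative chart_rhs j i (T j t z)) (at t)"
  proof cases
    case 1
    then show ?thesis using exhaust_2[of i] X Y by (auto simp: T_simps chart_rhs_def x_def y_def)
  next
    case 2
    have 1: "((\<lambda>s. 1 / c s $ 1) has_field_derivative - (x * y + \<gamma>) / x^2) (at t)"
      using 2 by (auto intro!: derivative_eq_intros X simp: cx power2_eq_square)
    have dy: "((\<lambda>s. - ((c s $ 2 - c s $ 1 - 2*\<alpha>) * c s $ 1 + 2*\<alpha>^2 - 2*\<beta> + \<gamma>) * c s $ 1) has_field_derivative
       - ((3/2 * x^2 - 1/2 * y^2 + 4*\<alpha> * x + 2*\<beta> - (x * y + \<gamma>)) * x + (y - x - 2*\<alpha>) * (x * y + \<gamma>)) * x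
       - ((y - x - 2*\<alpha>) * x + 2*\<alpha>^2 - 2*\<beta> + \<gamma>) * (x * y + \<gamma>)) (at t)"
      by (auto intro!: derivative_eq_intros X Y simp: cx algebra_simps)
    \<comment> \<open>With this p the chart coordinates are 1 / x and - p * x. Their product is - p,
      so the second component of the right-hand side becomes polynomial in x and y.\<close>
    define p where "p = (y - x - 2*\<alpha>) * x + 2*\<alpha>^2 - 2*\<beta> + \<gamma>"
    have z1: "T 1 t z = vector [1 / x, - p * x]" by (simp add: T_simps p_def x_def y_def)
    have e1: "chart_rhs 1 1 (T 1 t z) = - (x * y + \<gamma>) / x^2"
      using 2(2) unfolding z1 by (simp add: chart_rhs_def Let_def p_def field_simps power2_eq_square power3_eq_cube)
    have "chart_rhs 1 2 (T 1 t z) = - 1/2 * (2*\<alpha>^2 - 2*\<beta> + \<gamma>)^2 + \<gamma> * (2*\<alpha>^2 - 2*\<beta> + \<gamma>)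
        - (2*\<gamma> - 2*(2*\<alpha>^2 - 2*\<beta> + \<gamma>)) * p - 3/2 * p^2 - 2*\<alpha> * p * x"
      using 2(2) unfolding z1 by (simp add: chart_rhs_def Let_def power_mult_distrib power_divide)
    also have "\<dots> = - ((3/2 * x^2 - 1/2 * y^2 + 4*\<alpha> * x + 2*\<beta> - (x * y + \<gamma>)) * x + (y - x - 2*\<alpha>) * (x * y + \<gamma>)) * x
       - ((y - x - 2*\<alpha>) * x + 2*\<alpha>^2 - 2*\<beta> + \<gamma>) * (x * y + \<gamma>)"
      unfolding p_def by (simp add: algebra_simps power2_eq_square)
    finally show ?thesis using exhaust_2[of i] 1 dy e1 2(1) by (auto simp: T_simps)
  next
    case 3
    have 1: "((\<lambda>s. 1 / c s $ 1) has_field_derivative - (x * y + \<gamma>) / x^2) (at t)"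
      using 3 by (auto intro!: derivative_eq_intros X simp: cx power2_eq_square)
    have dy: "((\<lambda>s. - ((c s $ 2 + c s $ 1 + 2*\<alpha>) * c s $ 1 - 2*\<alpha>^2 + 2*\<beta> + \<gamma>) * c s $ 1) has_field_derivative
       - ((3/2 * x^2 - 1/2 * y^2 + 4*\<alpha> * x + 2*\<beta> + (x * y + \<gamma>)) * x + (y + x + 2*\<alpha>) * (x * y + \<gamma>)) * x
       - ((y + x + 2*\<alpha>) * x - 2*\<alpha>^2 + 2*\<beta> + \<gamma>) * (x * y + \<gamma>)) (at t)"
      by (auto intro!: derivative_eq_intros X Y simp: cx algebra_simps)
    define p where "p = (y + x + 2*\<alpha>) * x - 2*\<alpha>^2 + 2*\<beta> + \<gamma>"
    have z1: "T 2 t z = vector [1 / x, - p * x]" by (simp add: T_simps p_def x_def y_def)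
    have e1: "chart_rhs 2 1 (T 2 t z) = - (x * y + \<gamma>) / x^2"
      using 3(2) unfolding z1 by (simp add: chart_rhs_def Let_def p_def field_simps power2_eq_square power3_eq_cube)
    have "chart_rhs 2 2 (T 2 t z) = - 1/2 * (2*\<alpha>^2 - 2*\<beta> - \<gamma>)^2 - \<gamma> * (2*\<alpha>^2 - 2*\<beta> - \<gamma>)
        - (2*(2*\<alpha>^2 - 2*\<beta> - \<gamma>) + 2*\<gamma>) * p - 3/2 * p^2 + 2*\<alpha> * p * x"
      using 3(2) unfolding z1 by (simp add: chart_rhs_def Let_def power_mult_distrib power_divide)
    also have "\<dots> = - ((3/2 * x^2 - 1/2 * y^2 + 4*\<alpha> * x + 2*\<beta> + (x * y + \<gamma>)) * x + (y + x + 2*\<alpha>) * (x * y + \<gamma>)) * x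
       - ((y + x + 2*\<alpha>) * x - 2*\<alpha>^2 + 2*\<beta> + \<gamma>) * (x * y + \<gamma>)"
      unfolding p_def by (simp add: algebra_simps power2_eq_square)
    finally show ?thesis using exhaust_2[of i] 1 dy e1 3(1) by (auto simp: T_simps)
  next
    case 4
    have 1: "((\<lambda>s. 1 / c s $ 2) has_field_derivative - (3/2 * x^2 - 1/2 * y^2 + 4*\<alpha> * x + 2*\<beta>) / y^2) (at t)"
      using 4 by (auto intro!: derivative_eq_intros Y simp: cx power2_eq_square)
    have dy: "((\<lambda>s. - (c s $ 1 * c s $ 2 + 2*\<gamma>) * c s $ 2) has_field_derivative
       - ((x * y + \<gamma>) * y + x * (3/2 * x^2 - 1/2 * y^2 + 4*\<alpha> * x + 2*\<beta>)) * y
       - (x * y + 2*\<gamma>) * (3/2 * x^2 - 1/2 * y^2 + 4*\<alpha> * x + 2*\<beta>)) (at t)"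
      by (auto intro!: derivative_eq_intros X Y simp: cx field_simps)
    have z1: "T 3 t z = vector [- (x * y + 2*\<gamma>) * y, 1 / y]" by (simp add: T_simps x_def y_def)
    \<comment> \<open>The inner expression of \<open>chart_rhs\<close> in chart 3 is the original x.
      Naming it \<open>a\<close> lets it be replaced by x before anything is expanded.\<close>
    have cr: "chart_rhs 3 1 v = (3/2 * a^2 + 4*\<alpha> * a + 2*\<beta>) * (2*\<gamma> + 2 * v $ 1 * v $ 2)"
      "chart_rhs 3 2 v = 1/2 - (3/2 * a^2 + 4*\<alpha> * a + 2*\<beta>) * (v $ 2)^2"
      if "- 2*\<gamma> * v $ 2 - v $ 1 * (v $ 2)^2 = a" for v a
      using that by (auto simp: chart_rhs_def Let_def)
    have "- 2*\<gamma> * T 3 t z $ 2 - T 3 t z $ 1 * (T 3 t z $ 2)^2 = x"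
      unfolding z1 using 4(2) by (simp add: field_simps power2_eq_square)
    note cr = cr[OF this]
    have e2: "chart_rhs 3 2 (T 3 t z) = - (3/2 * x^2 - 1/2 * y^2 + 4*\<alpha> * x + 2*\<beta>) / y^2"
      unfolding cr unfolding z1 using 4(2) by (simp add: field_simps power2_eq_square)
    have "chart_rhs 3 1 (T 3 t z) = (3/2 * x^2 + 4*\<alpha> * x + 2*\<beta>) * (- 2 * x * y - 2*\<gamma>)"
      unfolding cr unfolding z1 using 4(2) by (simp add: algebra_simps)
    also have "\<dots> = - ((x * y + \<gamma>) * y + x * (3/2 * x^2 - 1/2 * y^2 + 4*\<alpha> * x + 2*\<beta>)) * y
       - (x * y + 2*\<gamma>) * (3/2 * x^2 - 1/2 * y^2 + 4*\<alpha> * x + 2*\<beta>)"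
      by (simp add: algebra_simps power2_eq_square)
    finally show ?thesis using exhaust_2[of i] 1 dy e2 4(1) by (auto simp: T_simps)
  qed
qed

section \<open>The time projection and the extension of solutions across poles\<close>

lemma time_submersive: "P \<in> points (glued_space 4 T) \<Longrightarrow>
    hol_at (glued_space 4 T) complex_line time_of P \<and> submersive_at (glued_space 4 T) complex_line time_of P"
proof -
  assume "P \<in> points (glued_space 4 T)"
  then obtain j and v :: "complex ^ 3" where j: "j < 4" and v: "P = gp j (vector [v $ 1, v $ 2]) (v $ 3)"
    unfolding space_manifold(4) by blast
  have h: "holo_on UNIV (\<lambda>v :: complex ^ 3. vec (v $ 3) :: complex ^ 1)" unfolding holo_on_iff by auto
  have d: "((\<lambda>v :: complex ^ 3. vec (v $ 3) :: complex ^ 1) has_derivative (\<lambda>u. vec (u $ 3))) (at v)"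
    by (rule has_derivative_vec_nth) (simp add: bounded_linear_imp_has_derivative bounded_linear_vec_nth)
  have "surj (\<lambda>v :: complex ^ 3. vec (v $ 3) :: complex ^ 1)"
  proof (rule surjI)
    show "vec ((vec (w $ 1) :: complex ^ 3) $ 3) = w" for w :: "complex ^ 1" by (simp add: vec_eq_iff)
  qed
  note c = space_manifold(2)[OF j] complex_line_manifold(2) h
  show ?thesis
    using hol_atI[OF c, of time_of v P] submersive_atI[OF space_manifold(1) complex_line_manifold(1) c, of time_of v P, OF _ _ _ _ d]
      \<open>surj _\<close> v time_of_gp[OF j] by simp
qed

text \<open>Finite limits of both coordinates in chart \<open>j\<close> make them holomorphic across
  \<open>t0\<close>, by removability of the singularity. The extension is the glued point with the
  extended coordinates; for t \<noteq> t0 this is the original point of the plane because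
  \<open>unchart j\<close> inverts the chart map.\<close>

lemma solution_extends_in_chart:
  assumes j: "j < 4" and ode: "\<forall>\<^sub>F t in at t0. (\<forall>i. (\<lambda>s. c s $ i) field_differentiable at t) \<and> den j (c t) \<noteq> 0"
    and lim: "((\<lambda>t. T j 0 (c t) $ 1) \<longlongrightarrow> a) (at t0)" "((\<lambda>t. T j 0 (c t) $ 2) \<longlongrightarrow> b) (at t0)"
  shows "\<exists>r>0. \<exists>\<delta>. holomorphic_map (submanifold complex_line (ball t0 r)) (glued_space 4 T) \<delta> \<and>
           (\<forall>t\<in>ball t0 r - {t0}. \<delta> t = gp 0 (c t) t)"
proof -
  obtain r where r: "r > 0" "\<And>t. t \<in> ball t0 r \<Longrightarrow> t \<noteq> t0 \<Longrightarrow> (\<forall>i. (\<lambda>s. c s $ i) field_differentiable at t) \<and> den j (c t) \<noteq> 0"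
    using ode unfolding eventually_at by (auto simp: dist_commute)
  have hc: "(\<lambda>t. c t $ i) holomorphic_on ball t0 r - {t0}" for i
    unfolding holomorphic_on_def using r(2) by (auto intro: field_differentiable_at_within)
  have dn: "den j (c t) \<noteq> 0" if "t \<in> ball t0 r - {t0}" for t using r(2) that by blast
  have hT: "(\<lambda>t. T j 0 (c t) $ 1) holomorphic_on ball t0 r - {t0}" "(\<lambda>t. T j 0 (c t) $ 2) holomorphic_on ball t0 r - {t0}"
    using less_4_cases[OF j] dn
    by (auto simp: T_simps den_def intro!: holomorphic_intros hc)
  define f g where "f = (\<lambda>t. if t = t0 then a else T j 0 (c t) $ 1)" and "g = (\<lambda>t. if t = t0 then b else T j 0 (c t) $ 2)"
  have hf: "f holomorphic_on ball t0 r" "g holomorphic_on ball t0 r"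
    unfolding f_def g_def by (intro removable_singularity hT lim open_ball)+
  define \<delta> where "\<delta> = (\<lambda>t. gp j (vector [f t, g t]) t)"
  have ob: "open {z :: complex ^ 1. z $ 1 \<in> ball t0 r}"
    using open_vimage[OF open_ball, of "\<lambda>z. z $ 1"] by (simp add: vimage_def continuous_on_component)
  have c1: "mchart complex_line {z. z $ 1 \<in> ball t0 r} (\<lambda>z. z $ 1)"
    by (rule mchart_restrict[OF complex_line_manifold(1,2) ob]) simp
  have im: "(\<lambda>z :: complex ^ 1. z $ 1) ` {z. z $ 1 \<in> ball t0 r} = ball t0 r"
    by (auto simp: image_iff intro!: exI[of _ "vec _"])
  have oB: "openin (mtop complex_line) (points complex_line \<inter> ball t0 r)"
    using mchart_openin[OF complex_line_manifold(1) c1 ob order_refl] unfolding im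
    by (simp add: complex_line_def)
  have c2: "mchart (submanifold complex_line (ball t0 r)) {z. z $ 1 \<in> ball t0 r} (\<lambda>z. z $ 1)"
    by (rule mchart_submanifold[OF complex_line_manifold(1) c1]) auto
  have "cdiff (\<lambda>z. f (z $ 1)) z \<and> cdiff (\<lambda>z. g (z $ 1)) z" if "z $ 1 \<in> ball t0 r" for z :: "complex ^ 1"
  proof -
    have "f field_differentiable at (z $ 1)" "g field_differentiable at (z $ 1)"
      using hf that by (auto simp: holomorphic_on_open field_differentiable_def)
    then show ?thesis unfolding field_differentiable_def by (auto intro: cdiff_comp_field)
  qed
  then have hF: "holo_on {z :: complex ^ 1. z $ 1 \<in> ball t0 r} (\<lambda>z. vector [f (z $ 1), g (z $ 1), z $ 1] :: complex ^ 3)"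
    unfolding holo_on_vector3 by auto
  have "holomorphic_map (submanifold complex_line (ball t0 r)) (glued_space 4 T) \<delta>"
  proof (rule holomorphic_mapI[OF complex_manifold_submanifold[OF complex_line_manifold(1,3) oB] space_manifold(1)])
    fix t assume "t \<in> points (submanifold complex_line (ball t0 r))"
    then have t: "t \<in> ball t0 r" by simp
    show "hol_at (submanifold complex_line (ball t0 r)) (glued_space 4 T) \<delta> t"
      by (rule hol_atI[OF c2 space_manifold(2)[OF j] hF, of _ "vec t"]) (use t in \<open>auto simp: \<delta>_def\<close>)
  qed
  moreover have "\<delta> t = gp 0 (c t) t" if t: "t \<in> ball t0 r - {t0}" for t
  proof -
    have "vector [f t, g t] = T j 0 (c t)" using t by (simp add: f_def g_def)
    moreover have "rel j (T j 0 (c t)) 0 (c t)"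
      using unchart_T[OF j dn[OF t], of 0] by (simp add: rel_def den_def unchart_def)
    ultimately show ?thesis unfolding \<delta>_def using gp_eq_iff[OF j, of 0] by simp
  qed
  ultimately show ?thesis using r(1) by blast
qed

definition energy :: "complex \<Rightarrow> complex \<Rightarrow> complex" where
  "energy x y = 1/2 * x * y^2 + \<gamma> * y - 1/2 * x^3 - 2*\<alpha> * x^2 - 2*\<beta> * x"

text \<open>The derivative along the solution vanishes on a punctured disc, which is connected, so
  one constant serves on both sides of the singular time.\<close>

lemma energy_conserved:
  assumes "\<forall>\<^sub>F t in at t0. \<forall>i. ((\<lambda>s. c s $ i) has_field_derivative system_rhs \<alpha> \<beta> \<gamma> t (c t) $ i) (at t)"
  obtains h where "\<forall>\<^sub>F t in at t0. energy (c t $ 1) (c t $ 2) = h"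
proof -
  obtain r where r: "r > 0" "\<And>t. t \<in> ball t0 r \<Longrightarrow> t \<noteq> t0 \<Longrightarrow>
      \<forall>i. ((\<lambda>s. c s $ i) has_field_derivative system_rhs \<alpha> \<beta> \<gamma> t (c t) $ i) (at t)"
    using assms unfolding eventually_at by (auto simp: dist_commute)
  let ?S = "ball t0 r - {t0}"
  have D: "((\<lambda>s. energy (c s $ 1) (c s $ 2)) has_field_derivative 0) (at t)" if t: "t \<in> ?S" for t
  proof -
    define x y where "x = c t $ 1" and "y = c t $ 2"
    have X: "((\<lambda>s. c s $ 1) has_field_derivative x * y + \<gamma>) (at t)"
      and Y: "((\<lambda>s. c s $ 2) has_field_derivative 3/2 * x^2 - 1/2 * y^2 + 4*\<alpha> * x + 2*\<beta>) (at t)"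
      using r(2)[of t] t unfolding forall_2 rhs_simps by (simp_all add: x_def y_def)
    show ?thesis unfolding energy_def
      by (auto intro!: derivative_eq_intros X Y simp: x_def[symmetric] y_def[symmetric])
        (simp add: field_simps power2_eq_square power3_eq_cube)
  qed
  have "connected ?S" by (rule connected_punctured_ball) simp
  moreover have "open ?S" by (intro open_delete open_ball)
  moreover have "continuous_on ?S (\<lambda>s. energy (c s $ 1) (c s $ 2))"
    using D by (meson DERIV_isCont continuous_at_imp_continuous_on)
  ultimately have "(\<lambda>s. energy (c s $ 1) (c s $ 2)) constant_on ?S"
    by (intro DERIV_zero_connected_constant_on[of _ "{}"]) (use D in auto)
  then obtain h where "\<And>t. t \<in> ?S \<Longrightarrow> energy (c t $ 1) (c t $ 2) = h"
    unfolding constant_on_def by blast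
  moreover have "\<forall>\<^sub>F t in at t0. t \<in> ?S"
    using r(1) unfolding eventually_at by (auto simp: dist_commute intro!: exI[of _ r])
  ultimately have "\<forall>\<^sub>F t in at t0. energy (c t $ 1) (c t $ 2) = h" by (auto elim: eventually_mono)
  then show ?thesis by (rule that)
qed

text \<open>In chart 1 the Hamiltonian is quadratic in q = y_1. One factor of the quadratic term is
  kept in the form \<open>p + k * (1/x)^2\<close>, which equals - q / x^3 but is seen to tend to 0
  as y / x tends to 1, before anything is known about q. Thus the factor of q has limit - 1 at a
  pole of x, and q can be solved for.\<close>

lemma energy_chart1:
  fixes x y :: complex
  assumes "x \<noteq> 0"
  defines "q \<equiv> - ((y - x - 2*\<alpha>) * x + 2*\<alpha>^2 - 2*\<beta> + \<gamma>) * x" and "k \<equiv> 2*\<alpha>^2 - 2*\<beta> + \<gamma>" and "p \<equiv> y / x - 1 - 2*\<alpha> * (1 / x)"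
  shows "energy x y = q * (- 1 - 2*\<alpha> * (1/x) + (k - \<gamma>) * (1/x)^2 - 1/2 * (p + k * (1/x)^2)) +
     (1/2 * k^2 * (1/x) - 2*\<alpha> * k + 2*\<alpha> * \<gamma> - \<gamma> * k * (1/x))"
proof -
  obtain u where u: "1 / x = u" "x * u = 1" using assms(1) by simp
  have yx: "y / x = y * u" using u(1) by (metis times_divide_eq_right mult.right_neutral)
  show ?thesis unfolding q_def k_def p_def energy_def yx u(1) using u(2) by algebra
qed

text \<open>The corresponding identity for y / x tending to - 1; here the factor of q has limit
  1.\<close>

lemma energy_chart2:
  fixes x y :: complex
  assumes "x \<noteq> 0"
  defines "q \<equiv> - ((y + x + 2*\<alpha>) * x - 2*\<alpha>^2 + 2*\<beta> + \<gamma>) * x" and "k \<equiv> 2*\<alpha>^2 - 2*\<beta> - \<gamma>" and "p \<equiv> y / x + 1 + 2*\<alpha> * (1 / x)"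
  shows "energy x y = q * (1 + 2*\<alpha> * (1/x) - (k + \<gamma>) * (1/x)^2 + 1/2 * (k * (1/x)^2 - p)) +
     (1/2 * k^2 * (1/x) - 2*\<alpha> * k - 2*\<alpha> * \<gamma> + \<gamma> * k * (1/x))"
proof -
  obtain u where u: "1 / x = u" "x * u = 1" using assms(1) by simp
  have yx: "y / x = y * u" using u(1) by (metis times_divide_eq_right mult.right_neutral)
  show ?thesis unfolding q_def k_def p_def energy_def yx u(1) using u(2) by algebra
qed

text \<open>The energy equation is multiplied by 2 / x^3 and the square in y / x is completed. At a
  pole of x with constant energy the right-hand side tends to 1.\<close>

lemma energy_at_infinity:
  assumes "x \<noteq> 0"
  shows "(y / x + \<gamma> * (1/x)^2)^2 = 1 + 2 * energy x y * (1/x)^3 + 4*\<alpha> * (1/x) + 4*\<beta> * (1/x)^2 + \<gamma>^2 * (1/x)^4"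
proof -
  obtain u where u: "1 / x = u" "x * u = 1" using assms by simp
  have yx: "y / x = y * u" using u(1) by (metis times_divide_eq_right mult.right_neutral)
  show ?thesis unfolding energy_def yx u(1) using u(2) by algebra
qed

text \<open>Meromorphic coordinates leave three cases. If both limits are finite, chart 0 suffices;
  if x is finite and y has a pole, chart 3 is used; at a pole of x the ratio y / x tends to 1 or -
  1, which selects chart 1 or chart 2.\<close>

lemma solutions_extend:
  assumes sol: "meromorphic_solution_near (system_rhs \<alpha> \<beta> \<gamma>) t0 c"
  shows "\<exists>r>0. \<exists>\<delta>. holomorphic_map (submanifold complex_line (ball t0 r)) (glued_space 4 T) \<delta> \<and>
           (\<forall>t\<in>ball t0 r - {t0}. \<delta> t = gp 0 (c t) t)"
proof -
  define X Y where "X = (\<lambda>t. c t $ 1)" and "Y = (\<lambda>t. c t $ 2)"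
  have mer: "X meromorphic_on {t0}" "Y meromorphic_on {t0}"
    and ode: "\<forall>\<^sub>F t in at t0. \<forall>i. ((\<lambda>s. c s $ i) has_field_derivative system_rhs \<alpha> \<beta> \<gamma> t (c t) $ i) (at t)"
    using sol unfolding meromorphic_solution_near_def X_def Y_def by auto
  have fd: "\<forall>\<^sub>F t in at t0. \<forall>i. (\<lambda>s. c s $ i) field_differentiable at t"
    using ode by eventually_elim (auto simp: field_differentiable_def)
  obtain h where h: "\<forall>\<^sub>F t in at t0. energy (X t) (Y t) = h"
    using energy_conserved[OF ode] unfolding X_def Y_def by blast
  have lim_or_pole: "(\<exists>l. (F \<longlongrightarrow> l) (at t0)) \<or> is_pole F t0" if "F meromorphic_on {t0}" for F
    using meromorphic_on_not_essential[OF that] unfolding not_essential_def by auto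
  have pole: "((\<lambda>t. 1 / F t) \<longlongrightarrow> 0) (at t0)" "\<forall>\<^sub>F t in at t0. F t \<noteq> 0" if "is_pole F t0" for F :: "complex \<Rightarrow> complex"
  proof -
    have "filterlim F at_infinity (at t0)" using that unfolding is_pole_def .
    then have "((\<lambda>t. inverse (F t)) \<longlongrightarrow> 0) (at t0)"
      by (rule filterlim_compose[OF tendsto_inverse_0])
    then show "((\<lambda>t. 1 / F t) \<longlongrightarrow> 0) (at t0)" by (simp add: inverse_eq_divide)
    show "\<forall>\<^sub>F t in at t0. F t \<noteq> 0" using that by (rule non_zero_neighbour_pole)
  qed
  consider (xy) x0 y0 where "(X \<longlongrightarrow> x0) (at t0)" "(Y \<longlongrightarrow> y0) (at t0)"
    | (x) "is_pole X t0" | (y) x0 where "(X \<longlongrightarrow> x0) (at t0)" "is_pole Y t0"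
    using lim_or_pole[OF mer(1)] lim_or_pole[OF mer(2)] by blast
  then show ?thesis
  proof cases
    case xy
    have "\<forall>\<^sub>F t in at t0. (\<forall>i. (\<lambda>s. c s $ i) field_differentiable at t) \<and> den 0 (c t) \<noteq> 0"
      using fd by eventually_elim (simp add: den_def)
    then show ?thesis
      by (rule solution_extends_in_chart[rotated]) (use xy in \<open>simp_all add: T_simps X_def Y_def\<close>)
  next
    case y
    note p = pole[OF y(2)]
    have d: "\<forall>\<^sub>F t in at t0. (\<forall>i. (\<lambda>s. c s $ i) field_differentiable at t) \<and> den 3 (c t) \<noteq> 0"
      using eventually_conj[OF fd p(2)] by eventually_elim (simp add: den_def Y_def)
    \<comment> \<open>Solved for the terms that contain y, the energy equation makes x_3 = - (x * y
      + 2 * \<gamma>) * y a polynomial in x, so it has a limit although y has a pole.\<close>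
    have "((\<lambda>t. - 2 * (h + 1/2 * X t^3 + 2*\<alpha> * X t^2 + 2*\<beta> * X t)) \<longlongrightarrow>
        - 2 * (h + 1/2 * x0^3 + 2*\<alpha> * x0^2 + 2*\<beta> * x0)) (at t0)"
      by (intro tendsto_intros y(1))
    moreover have "\<forall>\<^sub>F t in at t0. - 2 * (h + 1/2 * X t^3 + 2*\<alpha> * X t^2 + 2*\<beta> * X t) = - (X t * Y t + 2*\<gamma>) * Y t"
      using h
    proof eventually_elim
      case (elim t)
      show ?case unfolding elim[symmetric] energy_def by (simp add: field_simps power2_eq_square)
    qed
    ultimately have "((\<lambda>t. - (X t * Y t + 2*\<gamma>) * Y t) \<longlongrightarrow>
        - 2 * (h + 1/2 * x0^3 + 2*\<alpha> * x0^2 + 2*\<beta> * x0)) (at t0)"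
      by (rule Lim_transform_eventually)
    then show ?thesis
      by (intro solution_extends_in_chart[OF _ d]) (use p(1) in \<open>simp_all add: T_simps X_def Y_def\<close>)
  next
    case x
    note p = pole[OF x]
    \<comment> \<open>A meromorphic function has a limit or a pole. This one has no pole because its
      square tends to 1, and the existence of the limit excludes alternation between the signs 1 and
      - 1.\<close>
    define v where "v = (\<lambda>t. Y t / X t + \<gamma> * (1 / X t)^2)"
    have vm: "v meromorphic_on {t0}" unfolding v_def by (intro meromorphic_intros mer)
    have "((\<lambda>t. 1 + 2 * h * (1 / X t)^3 + 4*\<alpha> * (1 / X t) + 4*\<beta> * (1 / X t)^2 + \<gamma>^2 * (1 / X t)^4) \<longlongrightarrow>
        1 + 2 * h * 0^3 + 4*\<alpha> * 0 + 4*\<beta> * 0^2 + \<gamma>^2 * 0^4) (at t0)"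
      by (intro tendsto_intros p(1))
    moreover have "\<forall>\<^sub>F t in at t0. 1 + 2 * h * (1 / X t)^3 + 4*\<alpha> * (1 / X t) + 4*\<beta> * (1 / X t)^2 + \<gamma>^2 * (1 / X t)^4 = (v t)^2"
      using h p(2) by eventually_elim (simp add: v_def energy_at_infinity)
    ultimately have v2: "((\<lambda>t. (v t)^2) \<longlongrightarrow> 1) (at t0)" by (simp add: Lim_transform_eventually)
    have "\<not> is_pole v t0"
    proof
      assume "is_pole v t0"
      note pv = pole[OF this]
      have "((\<lambda>t. (1 / v t)^2 * (v t)^2) \<longlongrightarrow> 0^2 * 1) (at t0)" by (intro tendsto_intros pv(1) v2)
      moreover have "\<forall>\<^sub>F t in at t0. (1 / v t)^2 * (v t)^2 = 1"
        using pv(2) by eventually_elim (simp add: power_divide)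
      ultimately have "((\<lambda>_. 1 :: complex) \<longlongrightarrow> 0^2 * 1) (at t0)" by (rule Lim_transform_eventually)
      then show False by (simp add: tendsto_const_iff)
    qed
    with lim_or_pole[OF vm] have "\<exists>l. (v \<longlongrightarrow> l) (at t0)" by simp
    then obtain l where l: "(v \<longlongrightarrow> l) (at t0)" by (elim exE)
    have "l^2 = 1" by (rule tendsto_unique[OF _ tendsto_power[OF l] v2]) simp
    then have l1: "l = 1 \<or> l = - 1" by (simp add: power2_eq_1_iff)
    have "((\<lambda>t. v t - \<gamma> * (1 / X t)^2) \<longlongrightarrow> l - \<gamma> * 0^2) (at t0)" by (intro tendsto_intros l p(1))
    then have yx: "((\<lambda>t. Y t / X t) \<longlongrightarrow> l) (at t0)" by (simp add: v_def)
    have d: "\<forall>\<^sub>F t in at t0. (\<forall>i. (\<lambda>s. c s $ i) field_differentiable at t) \<and> den j (c t) \<noteq> 0" if "j = 1 \<or> j = 2" for j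
      using eventually_conj[OF fd p(2)] by eventually_elim (use that in \<open>auto simp: den_def X_def\<close>)
    show ?thesis
    proof (rule disjE[OF l1])
      assume l: "l = 1"
      define k where "k = 2*\<alpha>^2 - 2*\<beta> + \<gamma>"
      define E R where "E = (\<lambda>t. - 1 - 2*\<alpha> * (1/X t) + (k - \<gamma>) * (1/X t)^2 - 1/2 * (Y t / X t - 1 - 2*\<alpha> * (1 / X t) + k * (1/X t)^2))"
        and "R = (\<lambda>t. 1/2 * k^2 * (1/X t) - 2*\<alpha> * k + 2*\<alpha> * \<gamma> - \<gamma> * k * (1/X t))"
      have "(E \<longlongrightarrow> - 1 - 2*\<alpha> * 0 + (k - \<gamma>) * 0^2 - 1/2 * (1 - 1 - 2*\<alpha> * 0 + k * 0^2)) (at t0)"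
        unfolding E_def using yx unfolding l by (intro tendsto_intros p(1))
      then have E: "(E \<longlongrightarrow> - 1) (at t0)" by simp
      have R: "(R \<longlongrightarrow> 1/2 * k^2 * 0 - 2*\<alpha> * k + 2*\<alpha> * \<gamma> - \<gamma> * k * 0) (at t0)"
        unfolding R_def by (intro tendsto_intros p(1))
      have "\<forall>\<^sub>F t in at t0. E t \<noteq> 0" by (rule tendsto_imp_eventually_ne[OF E]) simp
      with h p(2) have "\<forall>\<^sub>F t in at t0. (h - R t) / E t =
          - ((Y t - X t - 2*\<alpha>) * X t + 2*\<alpha>^2 - 2*\<beta> + \<gamma>) * X t"
      proof eventually_elim
        case (elim t)
        have "energy (X t) (Y t) = - ((Y t - X t - 2*\<alpha>) * X t + 2*\<alpha>^2 - 2*\<beta> + \<gamma>) * X t * E t + R t"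
          unfolding E_def R_def k_def by (rule energy_chart1[OF elim(2)])
        then show ?case using elim by (simp add: nonzero_divide_eq_eq)
      qed
      moreover have "((\<lambda>t. (h - R t) / E t) \<longlongrightarrow> (h - (1/2 * k^2 * 0 - 2*\<alpha> * k + 2*\<alpha> * \<gamma> - \<gamma> * k * 0)) / - 1) (at t0)"
        by (intro tendsto_intros R E) simp
      ultimately have "((\<lambda>t. - ((Y t - X t - 2*\<alpha>) * X t + 2*\<alpha>^2 - 2*\<beta> + \<gamma>) * X t) \<longlongrightarrow>
          (h - (1/2 * k^2 * 0 - 2*\<alpha> * k + 2*\<alpha> * \<gamma> - \<gamma> * k * 0)) / - 1) (at t0)"
        by (rule Lim_transform_eventually[rotated])
      then show ?thesis
        by (intro solution_extends_in_chart[OF _ d[of 1]]) (use p(1) in \<open>simp_all add: T_simps X_def Y_def\<close>)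
    next
      assume l: "l = - 1"
      define k where "k = 2*\<alpha>^2 - 2*\<beta> - \<gamma>"
      define E R where "E = (\<lambda>t. 1 + 2*\<alpha> * (1/X t) - (k + \<gamma>) * (1/X t)^2 + 1/2 * (k * (1/X t)^2 - (Y t / X t + 1 + 2*\<alpha> * (1 / X t))))"
        and "R = (\<lambda>t. 1/2 * k^2 * (1/X t) - 2*\<alpha> * k - 2*\<alpha> * \<gamma> + \<gamma> * k * (1/X t))"
      have "(E \<longlongrightarrow> 1 + 2*\<alpha> * 0 - (k + \<gamma>) * 0^2 + 1/2 * (k * 0^2 - (- 1 + 1 + 2*\<alpha> * 0))) (at t0)"
        unfolding E_def using yx unfolding l by (intro tendsto_intros p(1))
      then have E: "(E \<longlongrightarrow> 1) (at t0)" by simp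
      have R: "(R \<longlongrightarrow> 1/2 * k^2 * 0 - 2*\<alpha> * k - 2*\<alpha> * \<gamma> + \<gamma> * k * 0) (at t0)"
        unfolding R_def by (intro tendsto_intros p(1))
      have "\<forall>\<^sub>F t in at t0. E t \<noteq> 0" by (rule tendsto_imp_eventually_ne[OF E]) simp
      with h p(2) have "\<forall>\<^sub>F t in at t0. (h - R t) / E t =
          - ((Y t + X t + 2*\<alpha>) * X t - 2*\<alpha>^2 + 2*\<beta> + \<gamma>) * X t"
      proof eventually_elim
        case (elim t)
        have "energy (X t) (Y t) = - ((Y t + X t + 2*\<alpha>) * X t - 2*\<alpha>^2 + 2*\<beta> + \<gamma>) * X t * E t + R t"
          unfolding E_def R_def k_def by (rule energy_chart2[OF elim(2)])
        then show ?case using elim by (simp add: nonzero_divide_eq_eq)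
      qed
      moreover have "((\<lambda>t. (h - R t) / E t) \<longlongrightarrow> (h - (1/2 * k^2 * 0 - 2*\<alpha> * k - 2*\<alpha> * \<gamma> + \<gamma> * k * 0)) / 1) (at t0)"
        by (intro tendsto_intros R E) simp
      ultimately have "((\<lambda>t. - ((Y t + X t + 2*\<alpha>) * X t - 2*\<alpha>^2 + 2*\<beta> + \<gamma>) * X t) \<longlongrightarrow>
          (h - (1/2 * k^2 * 0 - 2*\<alpha> * k - 2*\<alpha> * \<gamma> + \<gamma> * k * 0)) / 1) (at t0)"
        by (rule Lim_transform_eventually[rotated])
      then show ?thesis
        by (intro solution_extends_in_chart[OF _ d[of 2]]) (use p(1) in \<open>simp_all add: T_simps X_def Y_def\<close>)
    qed
  qed
qed

lemma phase_space: "is_phase_space (system_rhs \<alpha> \<beta> \<gamma>) 4 T"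
  unfolding is_phase_space_def
proof (intro conjI ballI allI impI)
  show "complex_manifold (glued_space 4 T)" by (rule space_manifold(1))
  show "holomorphic_map (glued_space 4 T) complex_line time_of"
    by (rule holomorphic_mapI[OF space_manifold(1) complex_line_manifold(1)]) (use time_submersive in blast)
  have "t \<in> time_of ` points (glued_space 4 T)" for t
  proof -
    let ?v = "vec t :: complex ^ 3"
    have "gp 0 (vector [?v $ 1, ?v $ 2]) (?v $ 3) \<in> points (glued_space 4 T)"
      unfolding space_manifold(4) by (rule UN_I[of 0]) (simp, rule rangeI)
    moreover have "time_of (gp 0 (vector [?v $ 1, ?v $ 2]) (?v $ 3)) = t"
      by (simp add: time_of_gp)
    ultimately show ?thesis by (rule image_eqI[rotated, OF _ sym])
  qed
  then show "time_of ` points (glued_space 4 T) = UNIV" by blast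
  show "submersive_at (glued_space 4 T) complex_line time_of P" if "P \<in> points (glued_space 4 T)" for P
    using time_submersive[OF that] by blast
  show "\<exists>A. (\<forall>i. poly_in_xy (A i)) \<and> rewritten_system (system_rhs \<alpha> \<beta> \<gamma>) (T j) A" if "j < 4" for j
    using rewritten[OF that] chart_rhs_poly by (intro exI[of _ "\<lambda>i _ z. chart_rhs j i z"]) simp
  show "\<exists>r>0. \<exists>\<delta>. holomorphic_map (submanifold complex_line (ball t0 r)) (glued_space 4 T) \<delta> \<and>
      (\<forall>t\<in>ball t0 r - {t0}. \<delta> t = gp 0 (c t) t)"
    if "meromorphic_solution_near (system_rhs \<alpha> \<beta> \<gamma>) t0 c" for t0 c
    by (rule solutions_extend[OF that])
qed

end

section \<open>The fibre as an open subset of the surface\<close>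

lemma base_chart_inj: "base_chart \<alpha> \<beta> \<gamma> j z = base_chart \<alpha> \<beta> \<gamma> j w \<longleftrightarrow> z = w"
  by (auto simp: base_chart_def hpoint_eq_iff vector2_eq_iff)

lemma base_chart_hpoint:
  obtains b c where "base_chart \<alpha> \<beta> \<gamma> j z = hpoint (z $ 1) b c" "b \<noteq> 0 \<or> c \<noteq> 0"
  unfolding base_chart_def by (metis one_neq_zero)

lemma base_chart_neq_exc: "l \<in> points P1 \<Longrightarrow> n \<ge> 3 \<Longrightarrow> base_chart \<alpha> \<beta> \<gamma> j z \<noteq> exc n l"
  using base_chart_hpoint[of \<alpha> \<beta> \<gamma> j z] exc_neq_hpoint by metis

text \<open>From here on the surface is known only through its points and the charts that
  \<open>nine_fold_blowup\<close> provides.\<close>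

locale cubic_surface = cubic_system \<alpha> \<beta> \<gamma> for \<alpha> \<beta> \<gamma> +
  fixes S :: "((nat \<times> (complex ^ 2)) set, 2) cmanifold"
  assumes S: "complex_manifold S" and cS: "countable (atlas S)"
    and points_S: "points S = (plane_label ` points P2 - base_point ` {..<3}) \<union>
       (\<Union>j<3. exc (3 + 3 * j) ` (points P1 - {line 1 0}) \<union> exc (4 + 3 * j) ` (points P1 - {line 1 0})
          \<union> exc (5 + 3 * j) ` points P1)"
    and plane: "mchart S UNIV (\<lambda>z. hpoint 1 (z $ 1) (z $ 2))"
    and infinity: "mchart S {z. \<forall>j<3. hpoint (z $ 1) 1 (z $ 2) \<noteq> base_point j} (\<lambda>z. hpoint (z $ 1) 1 (z $ 2))"
    and tower1: "\<forall>j<3. \<exists>D. mchart S D (tower1 (3 + 3 * j) (base_chart \<alpha> \<beta> \<gamma> j)) \<and> (\<forall>z. z $ 2 = 0 \<longrightarrow> z \<in> D)"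
    and tower2: "\<forall>j<3. mchart S UNIV (tower2 (3 + 3 * j) (base_chart \<alpha> \<beta> \<gamma> j))"
    and tower3: "\<forall>j<3. mchart S UNIV (tower3 (3 + 3 * j) (base_chart \<alpha> \<beta> \<gamma> j))"
    and tower_top: "\<forall>j<3. mchart S UNIV (tower_top (3 + 3 * j) (base_chart \<alpha> \<beta> \<gamma> j))"
begin

text \<open>\<open>tower_top\<close> has the coordinates u and v / u^3. Over the first two base
  points these are x_k and - y_k, over the third they are y_3 and - x_3; hence the signs and the
  exchange of coordinates.\<close>

definition emb :: "nat \<Rightarrow> complex ^ 2 \<Rightarrow> (nat \<times> (complex ^ 2)) set" where
  "emb k p = (if k = 0 then hpoint 1 (p $ 1) (p $ 2)
     else tower_top (3 * k) (base_chart \<alpha> \<beta> \<gamma> (k - 1))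
       (if k = 3 then vector [p $ 2, - p $ 1] else vector [p $ 1, - p $ 2]))"

lemma mchart_emb:
  assumes "k < 4" shows "mchart S UNIV (emb k)"
proof (cases "k = 0")
  case True
  then show ?thesis by (intro mchart_cong[OF plane]) (simp add: emb_def)
next
  case False
  then have t: "mchart S UNIV (tower_top (3 * k) (base_chart \<alpha> \<beta> \<gamma> (k - 1)))"
    using tower_top[rule_format, of "k - 1"] assms less_4_cases[OF assms] by (elim disjE) simp_all
  let ?s = "\<lambda>p :: complex ^ 2. if k = 3 then vector [p $ 2, - p $ 1] else vector [p $ 1, - p $ 2] :: complex ^ 2"
  let ?i = "\<lambda>p :: complex ^ 2. if k = 3 then vector [- p $ 2, p $ 1] else vector [p $ 1, - p $ 2] :: complex ^ 2"
  have si: "?s (?i p) = p" "?i (?s p) = p" for p by (simp_all add: vector2_eq_iff)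
  have r: "range ?s = UNIV" by (rule surjI[of ?s ?i, OF si(1)])
  have h: "holo_on W ?s" "holo_on W ?i" for W
    by (cases "k = 3"; simp add: holo_on_vector2 cdiff_intros)+
  have "mchart S UNIV (tower_top (3 * k) (base_chart \<alpha> \<beta> \<gamma> (k - 1)) \<circ> ?s)"
  proof (rule mchart_compose[OF S t])
    show "open (range ?s)" unfolding r by simp
  qed (rule h open_UNIV subset_UNIV si)+
  then show ?thesis by (rule mchart_cong) (use False in \<open>simp add: emb_def\<close>)
qed

lemma emb_plane:
  assumes "k < 4" "den k p \<noteq> 0" shows "emb k p = hpoint 1 (B k p $ 1) (B k p $ 2)"
  using less_4_cases[OF assms(1)] assms(2)
  by (elim disjE) (auto simp: emb_def den_def unchart_def tower_top_def base_chart_def hpoint_eq_iff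
      field_simps power2_eq_square power3_eq_cube)

lemma emb_exc:
  assumes "k < 4" "den k p = 0"
  shows "emb k p = exc (3 * k + 2) (line 1 (- (if k = 3 then p $ 1 else p $ 2)))" "k > 0"
  using less_4_cases[OF assms(1)] assms(2) by (auto simp: emb_def den_def tower_top_def)

text \<open>Points over the plane are compared by their (x, y)-coordinates, the others by label and
  direction of an exceptional point, and the two kinds never coincide. This makes
  \<open>embed\<close>, defined through an arbitrary representative, well defined and
  injective.\<close>

lemma emb_eq_iff:
  assumes "j < 4" "k < 4" shows "emb j p = emb k q \<longleftrightarrow> rel j p k q"
proof -
  consider "den j p \<noteq> 0" "den k q \<noteq> 0" | "den j p = 0" "den k q \<noteq> 0" | "den j p \<noteq> 0" "den k q = 0"
    | "den j p = 0" "den k q = 0" by blast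
  then show ?thesis
  proof cases
    case 1
    then have "emb j p = emb k q \<longleftrightarrow> B j p = B k q"
      using emb_plane assms by (auto simp: hpoint_eq_iff vector2_eq_iff)
    then show ?thesis using 1 by (auto simp: rel_def)
  next
    case 4
    then have jk: "j > 0" "k > 0" using emb_exc(2) assms by blast+
    have "emb j p = emb k q \<longleftrightarrow> j = k \<and> (if j = 3 then p $ 1 = q $ 1 else p $ 2 = q $ 2)"
      using emb_exc(1)[of j p] emb_exc(1)[of k q] 4 assms by (auto simp: exc_eq_iff line_eq_iff in_P1_line)
    also have "\<dots> \<longleftrightarrow> j = k \<and> p = q"
      using 4 jk less_4_cases[OF assms(1)] by (auto simp: den_def vector2_eq_iff)
    finally show ?thesis using 4 by (simp add: rel_def)
  qed (use emb_exc(1)[of j p] emb_exc(1)[of k q] emb_plane[of j p] emb_plane[of k q] emb_exc(2)[of j p]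
      emb_exc(2)[of k q] assms in_P1_line exc_neq_hpoint exc_neq_hpoint[symmetric] in \<open>auto simp: rel_def\<close>)
qed

definition embed :: "chart_point set \<Rightarrow> (nat \<times> (complex ^ 2)) set" where
  "embed P = (case (SOME x. x \<in> P) of (j, p, t) \<Rightarrow> emb j p)"

lemma embed_gp:
  assumes "j < 4" shows "embed (gp j p t) = emb j p"
proof -
  have "(j, p, t) \<in> gp j p t" using assms by (simp add: mem_gp)
  then have "(SOME x. x \<in> gp j p t) \<in> gp j p t" by (rule someI)
  moreover obtain k q s where "(SOME x. x \<in> gp j p t) = (k, q, s)" by (metis prod_cases3)
  ultimately show ?thesis unfolding embed_def using assms emb_eq_iff[of j k p q] by (simp add: mem_gp)
qed

abbreviation "X \<equiv> glued_fibre 4 T"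

lemma image_embed: "embed ` points (X t) = (\<Union>j<4. range (emb j))"
  unfolding fibre_manifold(4) image_UN image_comp o_def by (simp add: embed_gp)

lemma open_embed: "openin (mtop S) (embed ` points (X t))"
  unfolding image_embed using mchart_openin[OF S mchart_emb open_UNIV order_refl] by blast

lemma biholomorphic_embed: "biholomorphic (X t) (submanifold S (embed ` points (X t))) embed"
proof -
  note F = fibre_manifold[where t = t]
  have inj: "inj_on embed (points (X t))"
  proof (rule inj_onI)
    fix x y assume xy: "x \<in> points (X t)" "y \<in> points (X t)" "embed x = embed y"
    obtain j p k q where "j < 4" "x = gp j p t" "k < 4" "y = gp k q t"
      using xy(1,2) unfolding F(4) by blast
    then show "x = y" using xy(3) by (simp add: embed_gp emb_eq_iff gp_eq_iff)
  qed
  have sub: "embed ` points (X t) \<subseteq> points S"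
    using openin_subset[OF open_embed] by (simp add: topspace_mtop[OF S])
  then have W: "points S \<inter> embed ` points (X t) = embed ` points (X t)" by blast
  have c: "mchart (submanifold S (embed ` points (X t))) UNIV (emb j)" if "j < 4" for j
    using mchart_submanifold[OF S mchart_emb[OF that]] image_embed[of t] that by blast
  have pt: "x \<in> points (X t) \<Longrightarrow> \<exists>j p. j < 4 \<and> x = gp j p t" for x unfolding F(4) by blast
  have inv: "inv_into (points (X t)) embed (emb j p) = gp j p t" if "j < 4" for j p
    using inv_into_f_f[OF inj, of "gp j p t"] that F(4) embed_gp[OF that, of p t] by auto
  show ?thesis
  proof (rule biholomorphicI[OF F(1), where g = "inv_into (points (X t)) embed"])
    show "complex_manifold (submanifold S (embed ` points (X t)))"
      by (rule complex_manifold_submanifold[OF S cS]) (simp add: W open_embed)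
  next
    fix x assume "x \<in> points (X t)"
    then obtain j p where j: "j < 4" "x = gp j p t" using pt by blast
    show "hol_at (X t) (submanifold S (embed ` points (X t))) embed x"
      by (rule hol_atI[OF F(2)[OF j(1)] c[OF j(1)] holo_on_id, of _ p]) (use j embed_gp in auto)
  next
    fix y assume "y \<in> points (submanifold S (embed ` points (X t)))"
    then obtain j p where j: "j < 4" "y = emb j p" using image_embed by (auto simp: image_iff)
    show "hol_at (submanifold S (embed ` points (X t))) (X t) (inv_into (points (X t)) embed) y"
      by (rule hol_atI[OF c[OF j(1)] F(2)[OF j(1)] holo_on_id, of _ p]) (use j inv in auto)
  qed (use inj in \<open>auto simp: f_inv_into_f\<close>)
qed

section \<open>Which labelled points lie in the surface and in the embedded fibre\<close>

lemma hpoint_in_S: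
  assumes "a \<noteq> 0 \<or> b \<noteq> 0 \<or> c \<noteq> 0"
  shows "hpoint a b c \<in> points S \<longleftrightarrow> (\<forall>j<3. hpoint a b c \<noteq> base_point j)"
proof -
  have "vector [a, b, c] \<noteq> (0 :: complex ^ 3)" using assms by (auto simp: vector3_eq_iff)
  then have "hpoint a b c \<in> plane_label ` points P2" unfolding hpoint_def points_P2 by blast
  moreover have "hpoint a b c \<notin> exc n ` points P1" if "n \<ge> 3" for n
    using exc_neq_hpoint[OF _ that] by (metis imageE)
  then have "hpoint a b c \<notin> exc (3 + 3 * j) ` points P1" "hpoint a b c \<notin> exc (4 + 3 * j) ` points P1"
    "hpoint a b c \<notin> exc (5 + 3 * j) ` points P1" for j by simp_all
  ultimately show ?thesis unfolding points_S by blast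
qed

lemma exc_in_S:
  assumes "l \<in> points P1" "m \<ge> 3"
  shows "exc m l \<in> points S \<longleftrightarrow>
    (\<exists>j<3. (m = 3 + 3 * j \<or> m = 4 + 3 * j) \<and> l \<noteq> line 1 0 \<or> m = 5 + 3 * j)"
proof -
  have "exc m l \<notin> plane_label ` points P2"
  proof
    assume "exc m l \<in> plane_label ` points P2"
    then obtain v :: "complex ^ 3" where "exc m l = plane_label (line_through v)"
      unfolding points_P2 by blast
    moreover have "v = vector [v $ 1, v $ 2, v $ 3]" by (simp add: vector3_eq_iff)
    ultimately have "exc m l = hpoint (v $ 1) (v $ 2) (v $ 3)" unfolding hpoint_def by metis
    then show False using exc_neq_hpoint assms by blast
  qed
  then show ?thesis unfolding points_S using assms(1) by (auto simp: image_iff exc_eq_iff)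
qed

lemma points_S_cases:
  assumes "q \<in> points S"
  obtains a b c where "a \<noteq> 0 \<or> b \<noteq> 0 \<or> c \<noteq> 0" "q = hpoint a b c" | m l where "l \<in> points P1" "m \<ge> 3" "q = exc m l"
proof (cases "q \<in> plane_label ` points P2")
  case True
  then obtain v :: "complex ^ 3" where v: "v \<noteq> 0" "q = plane_label (line_through v)"
    unfolding points_P2 by blast
  moreover have e: "v = vector [v $ 1, v $ 2, v $ 3]" by (simp add: vector3_eq_iff)
  ultimately have "q = hpoint (v $ 1) (v $ 2) (v $ 3)" unfolding hpoint_def by metis
  moreover have "v $ 1 \<noteq> 0 \<or> v $ 2 \<noteq> 0 \<or> v $ 3 \<noteq> 0" using v(1) by (auto simp: vector3_eq_iff)
  ultimately show ?thesis using that(1) by blast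
next
  case False
  then obtain j where "q \<in> exc (3 + 3 * j) ` points P1 \<union> exc (4 + 3 * j) ` points P1
      \<union> exc (5 + 3 * j) ` points P1" using assms unfolding points_S by blast
  then obtain m l where "m \<ge> 3" "l \<in> points P1" "q = exc m l" by (elim UnE imageE) (rule that; simp)+
  then show ?thesis using that(2) by blast
qed

lemma hpoint_in_embed:
  assumes "a \<noteq> 0 \<or> b \<noteq> 0 \<or> c \<noteq> 0" shows "hpoint a b c \<in> embed ` points (X t) \<longleftrightarrow> a \<noteq> 0"
  unfolding image_embed
proof
  assume "hpoint a b c \<in> (\<Union>j<4. range (emb j))"
  then obtain j p where j: "j < 4" "hpoint a b c = emb j p" by auto
  then show "a \<noteq> 0"
    using emb_plane[of j p] emb_exc(1)[of j p] emb_exc(2)[of j p] exc_neq_hpoint[symmetric] in_P1_line(2) assms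
    by (cases "den j p = 0") (auto simp: hpoint_eq_iff)
next
  assume "a \<noteq> 0"
  then have "hpoint a b c = emb 0 (vector [b / a, c / a])" by (simp add: emb_def hpoint_eq_iff)
  then show "hpoint a b c \<in> (\<Union>j<4. range (emb j))" by force
qed

lemma exc_in_embed:
  assumes "l \<in> points P1" "m \<ge> 3"
  shows "exc m l \<in> embed ` points (X t) \<longleftrightarrow> (\<exists>j<3. m = 5 + 3 * j) \<and> l \<noteq> line 0 1"
  unfolding image_embed
proof
  assume "exc m l \<in> (\<Union>j<4. range (emb j))"
  then obtain k p where k: "k < 4" "exc m l = emb k p" by auto
  then have d: "den k p = 0" using emb_plane[of k p] exc_neq_hpoint[OF assms] by metis
  note e = emb_exc[OF k(1) d]
  have "m = 3 * k + 2" "l = line 1 (- (if k = 3 then p $ 1 else p $ 2))"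
    using k(2) unfolding e(1) using exc_eq_iff[OF assms(1)] by blast+
  moreover have "k - 1 < 3" "3 * k + 2 = 5 + 3 * (k - 1)" using k(1) e(2) by auto
  ultimately show "(\<exists>j<3. m = 5 + 3 * j) \<and> l \<noteq> line 0 1" by (metis line_eq_iff mult_zero_right mult_1 zero_neq_one)
next
  assume "(\<exists>j<3. m = 5 + 3 * j) \<and> l \<noteq> line 0 1"
  then obtain j where j: "j < 3" "m = 5 + 3 * j" "l \<noteq> line 0 1" by blast
  obtain w where w: "l = line 1 w" using P1_cases'[OF assms(1)] j(3) by blast
  have "emb (j + 1) (vector [if j = 2 then - w else 0, if j = 2 then 0 else - w]) = exc m l"
    using j(1,2) w by (subst emb_exc(1)) (auto simp: den_def)
  then show "exc m l \<in> (\<Union>j<4. range (emb j))"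
    using j(1) by (intro UN_I[of "j + 1"]) (auto simp: image_iff)
qed

end

section \<open>The boundary curves\<close>

definition arm_curve :: "nat \<Rightarrow> (complex ^ 2) set \<Rightarrow> (nat \<times> (complex ^ 2)) set" where
  "arm_curve n l = (if l = line 1 0 then exc (n + 1) (line 0 1) else exc n l)"

definition infinity_curve :: "(complex ^ 2) set \<Rightarrow> (nat \<times> (complex ^ 2)) set" where
  "infinity_curve l = (if l = line 0 1 then exc 9 (line 0 1)
     else if l = line 1 1 then exc 3 (line 0 1) else if l = line 1 (- 1) then exc 6 (line 0 1)
     else hpoint 0 1 (THE w. l = line 1 w))"

lemma infinity_curve_simps:
  "infinity_curve (line 0 1) = exc 9 (line 0 1)" "infinity_curve (line 1 1) = exc 3 (line 0 1)"
  "infinity_curve (line 1 (- 1)) = exc 6 (line 0 1)"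
  "w \<noteq> 1 \<Longrightarrow> w \<noteq> - 1 \<Longrightarrow> infinity_curve (line 1 w) = hpoint 0 1 w"
  by (auto simp: infinity_curve_def line_eq_iff)

lemma arm_curve_simps [simp]:
  "arm_curve n (line w 1) = exc n (line w 1)"
  "arm_curve n (line 1 w) = (if w = 0 then exc (n + 1) (line 0 1) else exc n (line 1 w))"
  by (auto simp: arm_curve_def line_eq_iff)

lemma exc_in_arm:
  assumes "l \<in> points P1"
  shows "exc m l \<in> arm_curve n ` points P1 \<longleftrightarrow> m = n \<and> l \<noteq> line 1 0 \<or> m = n + 1 \<and> l = line 0 1"
proof
  assume "exc m l \<in> arm_curve n ` points P1"
  then obtain x where "x \<in> points P1" "exc m l = arm_curve n x" by (rule imageE) simp
  then show "m = n \<and> l \<noteq> line 1 0 \<or> m = n + 1 \<and> l = line 0 1"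
    using assms by (simp add: arm_curve_def exc_eq_iff split: if_splits)
next
  assume "m = n \<and> l \<noteq> line 1 0 \<or> m = n + 1 \<and> l = line 0 1"
  then consider "m = n" "l \<noteq> line 1 0" | "m = n + 1" "l = line 0 1" by blast
  then show "exc m l \<in> arm_curve n ` points P1"
  proof cases
    case 1
    then show ?thesis using assms by (intro image_eqI[of _ _ l]) (simp_all add: arm_curve_def)
  next
    case 2
    then show ?thesis using in_P1_line by (intro image_eqI[of _ _ "line 1 0"]) simp_all
  qed
qed

lemma hpoint_notin_arm: "n \<ge> 3 \<Longrightarrow> hpoint a b c \<notin> arm_curve n ` points P1"
proof
  assume n: "n \<ge> 3" and "hpoint a b c \<in> arm_curve n ` points P1"
  then obtain x where "x \<in> points P1" "hpoint a b c = arm_curve n x" by blast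
  then show False using n exc_neq_hpoint[of x n a b c] exc_neq_hpoint[of "line 0 1" "n + 1" a b c] in_P1_line
    by (simp add: arm_curve_def split: if_splits)
qed

lemma arm_curve_inj: "inj_on (arm_curve n) (points P1)"
proof (rule inj_onI)
  fix x y assume "x \<in> points P1" "y \<in> points P1" "arm_curve n x = arm_curve n y"
  then show "x = y" using in_P1_line by (simp add: arm_curve_def exc_eq_iff split: if_splits)
qed

lemma exc_in_infinity:
  assumes "l \<in> points P1" "m \<ge> 3"
  shows "exc m l \<in> infinity_curve ` points P1 \<longleftrightarrow> (\<exists>j<3. m = 3 + 3 * j) \<and> l = line 0 1"
proof
  assume "exc m l \<in> infinity_curve ` points P1"
  then obtain x where "x \<in> points P1" "exc m l = infinity_curve x" by (rule imageE) simp
  then show "(\<exists>j<3. m = 3 + 3 * j) \<and> l = line 0 1"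
    using assms exc_neq_hpoint[OF assms]
    by (auto simp: infinity_curve_def exc_eq_iff split: if_splits)
next
  assume "(\<exists>j<3. m = 3 + 3 * j) \<and> l = line 0 1"
  then obtain j where j: "j < 3" "m = 3 + 3 * j" "l = line 0 1" by blast
  then have "j = 0 \<or> j = 1 \<or> j = 2" by auto
  then have "exc m l = infinity_curve (if j = 0 then line 1 1 else if j = 1 then line 1 (- 1) else line 0 1)"
    using j infinity_curve_simps by auto
  then show "exc m l \<in> infinity_curve ` points P1" using in_P1_line by auto
qed

lemma hpoint_in_infinity:
  assumes "a \<noteq> 0 \<or> b \<noteq> 0 \<or> c \<noteq> 0"
  shows "hpoint a b c \<in> infinity_curve ` points P1 \<longleftrightarrow> a = 0 \<and> (\<forall>j<3. hpoint a b c \<noteq> base_point j)"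
proof
  assume "hpoint a b c \<in> infinity_curve ` points P1"
  then obtain x where x: "x \<in> points P1" "hpoint a b c = infinity_curve x" by (rule imageE) simp
  have n: "hpoint a b c \<noteq> exc 9 (line 0 1)" "hpoint a b c \<noteq> exc 3 (line 0 1)" "hpoint a b c \<noteq> exc 6 (line 0 1)"
    using exc_neq_hpoint[OF in_P1_line(1)] by (simp_all add: eq_commute[of "hpoint a b c"])
  obtain w where w: "x = line 1 w" using P1_cases'[OF x(1)] x(2) n(1) infinity_curve_simps(1) by metis
  then have nw: "w \<noteq> 1" "w \<noteq> - 1" using x(2) n infinity_curve_simps by auto
  have "b * w \<noteq> - b" if "b \<noteq> 0" using nw(2) that by (metis mult_cancel_left mult_minus1_right)
  with nw show "a = 0 \<and> (\<forall>j<3. hpoint a b c \<noteq> base_point j)"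
    using x(2) w infinity_curve_simps(4)[of w] assms
    by (auto simp: all_less_3 base_point_def hpoint_eq_iff dest: sym)
next
  assume *: "a = 0 \<and> (\<forall>j<3. hpoint a b c \<noteq> base_point j)"
  then have "b \<noteq> 0" "c / b \<noteq> 1" "c / b \<noteq> - 1"
    using assms by (auto simp: all_less_3 base_point_def hpoint_eq_iff field_simps)
  then have "hpoint a b c = infinity_curve (line 1 (c / b))"
    using * infinity_curve_simps(4)[of "c / b"] by (simp add: hpoint_eq_iff)
  then show "hpoint a b c \<in> infinity_curve ` points P1" using in_P1_line by auto
qed

lemma infinity_curve_inj: "inj_on infinity_curve (points P1)"
proof (rule inj_onI)
  fix x y assume xy: "x \<in> points P1" "y \<in> points P1" "infinity_curve x = infinity_curve y"
  have n: "exc m (line 0 1) \<noteq> hpoint 0 1 w" "hpoint 0 1 w \<noteq> exc m (line 0 1)" if "m \<ge> 3" for m w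
    using exc_neq_hpoint[OF in_P1_line(1) that] by metis+
  have *: "x = line 0 1 \<or> x = line 1 1 \<or> x = line 1 (- 1) \<or> (\<exists>w. w \<noteq> 1 \<and> w \<noteq> - 1 \<and> x = line 1 w)"
    if "x \<in> points P1" for x
    using that
  proof (rule P1_cases')
    fix w assume "x = line 1 w"
    then show ?thesis by metis
  qed simp
  show "x = y" using *[OF xy(1)] *[OF xy(2)] xy(3)
    by (elim disjE exE conjE) (simp_all add: infinity_curve_simps exc_eq_iff in_P1_line n hpoint_eq_iff)
qed

text \<open>The parameter of the line at infinity centred at base point \<open>j\<close>, chosen to
  match the second coordinate of \<open>base_chart\<close> there.\<close>

definition line_param :: "nat \<Rightarrow> complex \<Rightarrow> (complex ^ 2) set" where
  "line_param j s = (if j = 0 then line 1 (1 + s) else if j = 1 then line 1 (- 1 + s) else line s 1)"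

context cubic_surface
begin

text \<open>Chart images lie in the surface, and the base points have been removed from it.\<close>

lemma tower1_notin_base: "mchart S D (tower1 n \<sigma>) \<Longrightarrow> z \<in> D \<Longrightarrow> j < 3 \<Longrightarrow> tower1 n \<sigma> z \<noteq> base_point j"
proof
  assume "mchart S D (tower1 n \<sigma>)" "z \<in> D" "j < 3" and e: "tower1 n \<sigma> z = base_point j"
  then have "tower1 n \<sigma> z \<in> points S" using mchartD(3) by blast
  moreover obtain b c where "base_point j = hpoint 0 b c" "b \<noteq> 0 \<or> c \<noteq> 0" using base_point_hpoint by blast
  ultimately show False using e \<open>j < 3\<close> hpoint_in_S[of 0 b c] by auto
qed

lemma infinity_curve_tower1:
  assumes j: "j < 3" and c: "mchart S D (tower1 (3 + 3 * j) (base_chart \<alpha> \<beta> \<gamma> j))" and D: "vector [0, s] \<in> D"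
  shows "infinity_curve (line_param j s) = tower1 (3 + 3 * j) (base_chart \<alpha> \<beta> \<gamma> j) (vector [0, s])"
proof (cases "s = 0")
  case True
  moreover have "j = 0 \<or> j = 1 \<or> j = 2" using j by linarith
  ultimately show ?thesis by (elim disjE) (simp_all add: line_param_def tower1_def infinity_curve_simps)
next
  case False
  have b: "tower1 (3 + 3 * j) (base_chart \<alpha> \<beta> \<gamma> j) (vector [0, s]) =
      (if j = 2 then hpoint 0 s 1 else hpoint 0 1 (if j = 0 then 1 + s else - 1 + s))"
    using False j by (simp add: tower1_def base_chart_def)
  have n: "\<forall>k<3. tower1 (3 + 3 * j) (base_chart \<alpha> \<beta> \<gamma> j) (vector [0, s]) \<noteq> base_point k"
    using tower1_notin_base[OF c D] by blast
  consider "j = 0" | "j = 1" | "j = 2" using j by linarith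
  then show ?thesis
  proof cases
    case 1
    then have "1 + s \<noteq> 1" "1 + s \<noteq> - 1" using n unfolding b by (auto simp: all_less_3 base_point_def hpoint_eq_iff)
    then show ?thesis using infinity_curve_simps(4)[of "1 + s"] 1 unfolding b by (simp add: line_param_def)
  next
    case 2
    then have "- 1 + s \<noteq> 1" "- 1 + s \<noteq> - 1" using n unfolding b by (auto simp: all_less_3 base_point_def hpoint_eq_iff)
    then show ?thesis using infinity_curve_simps(4)[of "- 1 + s"] 2 unfolding b by (simp add: line_param_def)
  next
    case 3
    then have "1 / s \<noteq> 1" "1 / s \<noteq> - 1"
      using n False unfolding b by (auto simp: all_less_3 base_point_def hpoint_eq_iff field_simps)
    then show ?thesis using infinity_curve_simps(4)[of "1 / s"] 3 False line_flip[OF False] unfolding b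
      by (simp add: line_param_def hpoint_eq_iff)
  qed
qed

lemma embedded_arm:
  assumes c1: "mchart S D \<sigma>" "\<And>r. vector [r, 0] \<in> D \<and> \<sigma> (vector [r, 0]) = exc n (line r 1)"
    and c2: "mchart S UNIV \<tau>"
      "\<And>s. \<tau> (vector [0, s]) = (if s = 0 then exc (n + 1) (line 0 1) else exc n (line 1 s))"
  shows "embedded_P1 S (arm_curve n)"
proof (rule embedded_P1I[OF S arm_curve_inj])
  have ax: "axis_line 1 0 w = vector [w $ 1, 0]" "axis_line 2 0 w = vector [0, w $ 1]" for w
    by (simp_all add: axis_line_def vector2_eq_iff)
  fix x assume "x \<in> points P1"
  then show "straight_at S (arm_curve n) x"
  proof (rule P1_cases)
    fix w assume w: "x = line 1 w"
    show ?thesis unfolding straight_at_def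
      by (intro exI[of _ UNIV] exI[of _ "\<lambda>z :: complex ^ 1. line 1 (z $ 1)"] exI[of _ \<tau>] exI[of _ "2 :: 2"]
          exI[of _ "0 :: complex"] exI[of _ "vec w"] conjI ballI P1_manifold(3) c2(1))
        (simp_all add: w ax c2(2))
  next
    fix w assume w: "x = line w 1"
    show ?thesis unfolding straight_at_def
      by (intro exI[of _ UNIV] exI[of _ "\<lambda>z :: complex ^ 1. line (z $ 1) 1"] exI[of _ D] exI[of _ \<sigma>] exI[of _ "1 :: 2"]
          exI[of _ "0 :: complex"] exI[of _ "vec w"] conjI ballI P1_manifold(4) c1(1)) (simp_all add: w ax c1(2))
  qed
qed

lemma embedded_arm1: "j < 3 \<Longrightarrow> embedded_P1 S (arm_curve (3 + 3 * j))"
proof -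
  assume j: "j < 3"
  obtain D where D: "mchart S D (tower1 (3 + 3 * j) (base_chart \<alpha> \<beta> \<gamma> j))" "\<forall>z. z $ 2 = 0 \<longrightarrow> z \<in> D"
    using tower1 j by blast
  show ?thesis
    by (rule embedded_arm[OF D(1) _ tower2[rule_format, OF j]])
      (use D(2) in \<open>simp_all add: tower1_def tower2_def\<close>)
qed

lemma embedded_arm2:
  assumes j: "j < 3" shows "embedded_P1 S (arm_curve (4 + 3 * j))"
  by (rule embedded_arm[OF tower2[rule_format, OF j] _ tower3[rule_format, OF j]])
    (simp_all add: tower2_def tower3_def)

lemma embedded_infinity: "embedded_P1 S infinity_curve"
proof (rule embedded_P1I[OF S infinity_curve_inj])
  have ax: "axis_line 2 c w = vector [0, w $ 1 + c]" for w c
    by (simp add: axis_line_def vector2_eq_iff)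
  have special: "straight_at S infinity_curve (line_param j 0)"
    if j: "j < 3" and \<sigma>: "mchart P1 UNIV \<sigma>" "\<And>w. \<sigma> w = line_param j (w $ 1 + c)" for j \<sigma> c
  proof -
    obtain D where D: "mchart S D (tower1 (3 + 3 * j) (base_chart \<alpha> \<beta> \<gamma> j))" "\<forall>z. z $ 2 = 0 \<longrightarrow> z \<in> D"
      using tower1 j by blast
    let ?W = "{w \<in> UNIV. axis_line 2 c w \<in> D}"
    have "open ?W" by (rule holo_on_preimage[OF holo_on_axis_line open_UNIV mchartD(1)[OF D(1)]])
    then have W: "mchart P1 ?W \<sigma>" by (intro mchart_restrict[OF P1_manifold(1) \<sigma>(1)]) auto
    have "infinity_curve (\<sigma> w) = tower1 (3 + 3 * j) (base_chart \<alpha> \<beta> \<gamma> j) (axis_line 2 c w)" if "w \<in> ?W" for w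
      using infinity_curve_tower1[OF j D(1), of "w $ 1 + c"] that by (simp add: ax \<sigma>(2))
    moreover have "vec (- c) \<in> ?W" "\<sigma> (vec (- c)) = line_param j 0" using D(2) \<sigma>(2) by (simp_all add: ax)
    ultimately show ?thesis unfolding straight_at_def using W D(1) by blast
  qed
  fix x assume "x \<in> points P1"
  then consider "x = line_param 2 0" | "x = line_param 0 0" | "x = line_param 1 0" | w where "x = line 1 w" "w \<noteq> 1" "w \<noteq> - 1"
    unfolding line_param_def by (rule P1_cases') (auto simp del: arm_curve_simps)
  then show "straight_at S infinity_curve x"
  proof cases
    case 1
    then show ?thesis using special[OF _ P1_manifold(4), of 2 0] by (simp add: line_param_def)
  next
    case 2
    then show ?thesis using special[OF _ P1_manifold(3), of 0 "- 1"] by (simp add: line_param_def)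
  next
    case 3
    then show ?thesis using special[OF _ P1_manifold(3), of 1 1] by (simp add: line_param_def)
  next
    case 4
    let ?W = "{w \<in> UNIV :: (complex ^ 1) set. axis_line 2 0 w \<in> {z. \<forall>j<3. hpoint (z $ 1) 1 (z $ 2) \<noteq> base_point j}}"
    have W: "?W = {w. w $ 1 \<noteq> 1 \<and> w $ 1 \<noteq> - 1}" by (auto simp: ax all_less_3 base_point_def hpoint_eq_iff)
    have "open ?W" by (rule holo_on_preimage[OF holo_on_axis_line open_UNIV mchartD(1)[OF infinity]])
    then have c: "mchart P1 ?W (\<lambda>z. line 1 (z $ 1))"
      by (intro mchart_restrict[OF P1_manifold(1,3)]) auto
    show ?thesis unfolding straight_at_def
      by (intro exI[of _ ?W] exI[of _ "\<lambda>z :: complex ^ 1. line 1 (z $ 1)"] exI[of _ "2 :: 2"]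
          exI[of _ "0 :: complex"] exI[of _ "vec w"] exI[of _ "\<lambda>z. hpoint (z $ 1) 1 (z $ 2)"]
          exI[of _ "{z. \<forall>j<3. hpoint (z $ 1) 1 (z $ 2) \<noteq> base_point j}"] conjI ballI c infinity)
        (use 4 W in \<open>simp_all add: ax infinity_curve_simps set_eq_iff\<close>)
  qed
qed

text \<open>Nodes \<open>2 * j + 1\<close> and \<open>2 * j + 2\<close> of the diagram form arm
  \<open>j\<close>, from the centre outwards. The arithmetic in the index produces their labels
  \<open>3 + 3 * j\<close> and \<open>4 + 3 * j\<close>.\<close>

definition curve :: "nat \<Rightarrow> (complex ^ 2) set \<Rightarrow> (nat \<times> (complex ^ 2)) set" where
  "curve v = (if v = 0 then infinity_curve else arm_curve (v + 2 + (v - 1) div 2))"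

lemma curve_simps:
  "curve 0 = infinity_curve" "curve (Suc (2 * j)) = arm_curve (3 + 3 * j)"
  "curve (Suc (Suc (2 * j))) = arm_curve (4 + 3 * j)"
proof -
  have "Suc (2 * j) + 2 + (Suc (2 * j) - 1) div 2 = 3 + 3 * j"
    "Suc (Suc (2 * j)) + 2 + (Suc (Suc (2 * j)) - 1) div 2 = 4 + 3 * j" by simp_all
  then show "curve 0 = infinity_curve" "curve (Suc (2 * j)) = arm_curve (3 + 3 * j)"
    "curve (Suc (Suc (2 * j))) = arm_curve (4 + 3 * j)" unfolding curve_def by (metis nat.distinct(1))+
qed

lemma nodes: "fst affine_E6 = insert 0 (\<Union>j<3. {Suc (2 * j), Suc (Suc (2 * j))})"
  unfolding affine_E6_def lessThan_3 by auto

text \<open>Every point of the surface is an \<open>hpoint\<close> or an \<open>exc\<close> point,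
  and for both kinds membership in the surface, in the fibre and in each curve has been made
  explicit. That the curves stay inside the surface is read off from the holomorphy of their
  parametrizations.\<close>

lemma boundary: "points S - embed ` points (X t) = (\<Union>v\<in>fst affine_E6. curve v ` points P1)"
proof -
  have U: "(\<Union>v\<in>fst affine_E6. curve v ` points P1) = infinity_curve ` points P1 \<union>
      (\<Union>j<3. arm_curve (3 + 3 * j) ` points P1 \<union> arm_curve (4 + 3 * j) ` points P1)"
    unfolding nodes using curve_simps by auto
  have h: "hpoint a b c \<in> points S - embed ` points (X t) \<longleftrightarrow> hpoint a b c \<in> (\<Union>v\<in>fst affine_E6. curve v ` points P1)"
    if "a \<noteq> 0 \<or> b \<noteq> 0 \<or> c \<noteq> 0" for a b c
    using that hpoint_notin_arm unfolding U
    by (auto simp: hpoint_in_S hpoint_in_embed hpoint_in_infinity)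
  have e: "exc m l \<in> points S - embed ` points (X t) \<longleftrightarrow> exc m l \<in> (\<Union>v\<in>fst affine_E6. curve v ` points P1)"
    if "l \<in> points P1" "m \<ge> 3" for m l
  proof -
    have "line 0 1 \<noteq> line 1 0" by (simp add: line_eq_iff)
    then show ?thesis unfolding U using that
      by (simp add: exc_in_S exc_in_embed exc_in_infinity exc_in_arm) (auto; presburger)
  qed
  have "q \<in> points S" if q: "q \<in> (\<Union>v\<in>fst affine_E6. curve v ` points P1)" for q
  proof -
    have "embedded_P1 S (curve v)" if v: "v \<in> fst affine_E6" for v
    proof -
      consider "v = 0" | j where "j < 3" "v = Suc (2 * j)" | j where "j < 3" "v = Suc (Suc (2 * j))"
        using v unfolding nodes by auto
      then show ?thesis by cases (simp_all only: curve_simps embedded_arm1 embedded_arm2 embedded_infinity)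
    qed
    moreover obtain v x where v: "v \<in> fst affine_E6" "x \<in> points P1" "q = curve v x" using q by blast
    ultimately have "holomorphic_map P1 S (curve v)" unfolding embedded_P1_def by simp
    then show ?thesis using holomorphic_mapD(1) v(2,3) by simp
  qed
  note sub = this
  show ?thesis
  proof (rule set_eqI)
    fix q
    show "q \<in> points S - embed ` points (X t) \<longleftrightarrow> q \<in> (\<Union>v\<in>fst affine_E6. curve v ` points P1)"
    proof (cases "q \<in> points S")
      case True
      then show ?thesis
      proof (rule points_S_cases)
        fix a b c assume "a \<noteq> 0 \<or> b \<noteq> 0 \<or> c \<noteq> 0" "q = hpoint a b c"
        then show ?thesis using h by simp
      next
        fix m l assume "l \<in> points P1" "m \<ge> 3" "q = exc m l"
        then show ?thesis using e by simp
      qed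
    qed (use sub[of q] in blast)
  qed
qed

end

lemma open_slice:
  assumes "open (D :: (complex ^ 2) set)" shows "open {v. vector [0, v + c] \<in> D}"
proof -
  have e: "(vector [0, v + c] :: complex ^ 2) = (\<chi> i. if i = 1 then 0 else v + c)" for v
    by (simp add: vector2_eq_iff)
  have "continuous_on UNIV (\<lambda>v. vector [0, v + c] :: complex ^ 2)"
    unfolding e
  proof (rule continuous_on_vec_lambda)
    show "continuous_on UNIV (\<lambda>v. if i = 1 then 0 else v + c)" for i :: 2
      by (cases "i = 1") (auto intro!: continuous_intros)
  qed
  from open_vimage[OF assms this] show ?thesis by (simp add: vimage_def)
qed

section \<open>Adjacency in the diagram and intersection numbers\<close>

lemma node_cases:
  assumes "v \<in> fst affine_E6"
  obtains "v = 0" | j where "j < 3" "v = Suc (2 * j)" | j where "j < 3" "v = Suc (Suc (2 * j))"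
proof -
  have "v \<le> 6" using assms by (simp add: affine_E6_def)
  then have "v = 0 \<or> v = Suc (2 * ((v - 1) div 2)) \<or> v = Suc (Suc (2 * ((v - 1) div 2)))" "(v - 1) div 2 < 3"
    by presburger+
  then show ?thesis using that by metis
qed

lemma edge_iff:
  assumes "j < 3" "k < 3"
  shows "{0, Suc (2 * j)} \<in> snd affine_E6" "{Suc (2 * j), 0} \<in> snd affine_E6"
    "{0, Suc (Suc (2 * j))} \<notin> snd affine_E6" "{Suc (Suc (2 * j)), 0} \<notin> snd affine_E6"
    "{Suc (2 * j), Suc (Suc (2 * k))} \<in> snd affine_E6 \<longleftrightarrow> j = k"
    "{Suc (Suc (2 * k)), Suc (2 * j)} \<in> snd affine_E6 \<longleftrightarrow> j = k"
    "{Suc (2 * j), Suc (2 * k)} \<notin> snd affine_E6"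
    "{Suc (Suc (2 * j)), Suc (Suc (2 * k))} \<notin> snd affine_E6"
proof -
  have "j = 0 \<or> j = 1 \<or> j = 2" "k = 0 \<or> k = 1 \<or> k = 2" using assms by auto
  then show "{0, Suc (2 * j)} \<in> snd affine_E6" "{Suc (2 * j), 0} \<in> snd affine_E6"
    "{0, Suc (Suc (2 * j))} \<notin> snd affine_E6" "{Suc (Suc (2 * j)), 0} \<notin> snd affine_E6"
    "{Suc (2 * j), Suc (Suc (2 * k))} \<in> snd affine_E6 \<longleftrightarrow> j = k"
    "{Suc (Suc (2 * k)), Suc (2 * j)} \<in> snd affine_E6 \<longleftrightarrow> j = k"
    "{Suc (2 * j), Suc (2 * k)} \<notin> snd affine_E6"
    "{Suc (Suc (2 * j)), Suc (Suc (2 * k))} \<notin> snd affine_E6"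
    unfolding affine_E6_def by (elim disjE; simp add: doubleton_eq_iff)+
qed

lemma arm_disjoint:
  assumes "n \<noteq> m" "n + 1 \<noteq> m" "m + 1 \<noteq> n" "x \<in> points P1"
  shows "arm_curve n x \<notin> arm_curve m ` points P1"
  using assms in_P1_line exc_in_arm[of x n m] exc_in_arm[of "line 0 1" "n + 1" m]
  by (cases "x = line 1 0") (simp_all add: arm_curve_def[of n])

context cubic_surface
begin

lemma hol_curve:
  assumes "v \<in> fst affine_E6" shows "embedded_P1 S (curve v)" "holomorphic_map P1 S (curve v)"
proof -
  show "embedded_P1 S (curve v)"
    using assms by (rule node_cases) (simp_all only: curve_simps embedded_arm1 embedded_arm2 embedded_infinity)
  then show "holomorphic_map P1 S (curve v)" unfolding embedded_P1_def by simp
qed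

lemma inj_curves: "inj_on (\<lambda>v. curve v ` points P1) (fst affine_E6)"
proof (rule inj_onI)
  have p: "line 1 2 \<in> points P1" "line 1 2 \<noteq> line 1 0" "line 1 2 \<noteq> line 0 1"
    using in_P1_line by (simp_all add: line_eq_iff)
  have h: "infinity_curve (line 1 2) = hpoint 0 1 2" by (simp add: infinity_curve_simps(4))
  fix v w assume vw: "v \<in> fst affine_E6" "w \<in> fst affine_E6" "curve v ` points P1 = curve w ` points P1"
  then have "curve v (line 1 2) \<in> curve w ` points P1" using p(1) by blast
  then show "v = w"
    by (rule_tac node_cases[OF vw(1)]; rule_tac node_cases[OF vw(2)])
      (simp_all add: curve_simps h hpoint_notin_arm exc_in_arm exc_in_infinity p)
qed

text \<open>The exceptional points on the line at infinity carry labels divisible by 3, those on an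
  outer arm curve the labels \<open>4 + 3 * j\<close> or \<open>5 + 3 * j\<close>.\<close>

lemma infinity_arm_disjoint:
  assumes "x \<in> points P1" shows "infinity_curve x \<notin> arm_curve (4 + 3 * j) ` points P1"
proof
  assume "infinity_curve x \<in> arm_curve (4 + 3 * j) ` points P1"
  then obtain y where y: "y \<in> points P1" "infinity_curve x = arm_curve (4 + 3 * j) y" by blast
  then obtain m l where m: "infinity_curve x = exc m l" "l \<in> points P1" "m = 4 + 3 * j \<or> m = 5 + 3 * j"
    using in_P1_line(1)[of 0] that by (cases "y = line 1 0") (simp_all add: arm_curve_def)
  have "exc m l \<in> infinity_curve ` points P1" using imageI[OF assms, of infinity_curve] m(1) by simp
  then have "\<exists>k<3. m = 3 + 3 * k" using exc_in_infinity[of l m] m(2,3) by auto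
  then show False using m(3) by presburger
qed

lemma arm_infinity_disjoint:
  "x \<in> points P1 \<Longrightarrow> arm_curve (4 + 3 * j) x \<notin> infinity_curve ` points P1"
proof
  assume x: "x \<in> points P1" and "arm_curve (4 + 3 * j) x \<in> infinity_curve ` points P1"
  then obtain y where "y \<in> points P1" "infinity_curve y = arm_curve (4 + 3 * j) x" by (metis imageE)
  then show False using infinity_arm_disjoint[of y j] imageI[OF x, of "arm_curve (4 + 3 * j)"] by simp
qed

lemma tower1_curves:
  assumes j: "j < 3" and c: "mchart S D (tower1 (3 + 3 * j) (base_chart \<alpha> \<beta> \<gamma> j))" and z: "z \<in> D"
  shows "tower1 (3 + 3 * j) (base_chart \<alpha> \<beta> \<gamma> j) z \<in> arm_curve (3 + 3 * j) ` points P1 \<longleftrightarrow> z $ 2 = 0"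
    "tower1 (3 + 3 * j) (base_chart \<alpha> \<beta> \<gamma> j) z \<in> infinity_curve ` points P1 \<longleftrightarrow> z $ 1 = 0"
proof -
  have nb: "\<forall>k<3. tower1 (3 + 3 * j) (base_chart \<alpha> \<beta> \<gamma> j) z \<noteq> base_point k"
    using tower1_notin_base[OF c z] by blast
  obtain a b where h: "base_chart \<alpha> \<beta> \<gamma> j (vector [z $ 1 * z $ 2, z $ 2]) = hpoint (z $ 1 * z $ 2) a b" "a \<noteq> 0 \<or> b \<noteq> 0"
    using base_chart_hpoint[of \<alpha> \<beta> \<gamma> j "vector [z $ 1 * z $ 2, z $ 2]"] by auto
  show "tower1 (3 + 3 * j) (base_chart \<alpha> \<beta> \<gamma> j) z \<in> arm_curve (3 + 3 * j) ` points P1 \<longleftrightarrow> z $ 2 = 0"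
    using in_P1_line h by (cases "z $ 2 = 0") (simp_all add: tower1_def exc_in_arm hpoint_notin_arm line_eq_iff)
  show "tower1 (3 + 3 * j) (base_chart \<alpha> \<beta> \<gamma> j) z \<in> infinity_curve ` points P1 \<longleftrightarrow> z $ 1 = 0"
  proof (cases "z $ 2 = 0")
    case True
    then show ?thesis using in_P1_line j by (simp add: tower1_def exc_in_infinity line_eq_iff)
  next
    case False
    then show ?thesis using nb h j by (simp add: tower1_def hpoint_in_infinity)
  qed
qed

lemma tower2_curves:
  "tower2 (3 + 3 * j) (base_chart \<alpha> \<beta> \<gamma> j) z \<in> arm_curve (3 + 3 * j) ` points P1 \<longleftrightarrow> z $ 1 = 0"
  "tower2 (3 + 3 * j) (base_chart \<alpha> \<beta> \<gamma> j) z \<in> arm_curve (4 + 3 * j) ` points P1 \<longleftrightarrow> z $ 2 = 0"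
proof -
  obtain a b where h: "base_chart \<alpha> \<beta> \<gamma> j (vector [z $ 1 * z $ 2, z $ 1 * z $ 2 ^ 2]) = hpoint (z $ 1 * z $ 2) a b"
    using base_chart_hpoint[of \<alpha> \<beta> \<gamma> j "vector [z $ 1 * z $ 2, z $ 1 * z $ 2 ^ 2]"] by (metis vector_2(1))
  show "tower2 (3 + 3 * j) (base_chart \<alpha> \<beta> \<gamma> j) z \<in> arm_curve (3 + 3 * j) ` points P1 \<longleftrightarrow> z $ 1 = 0"
    "tower2 (3 + 3 * j) (base_chart \<alpha> \<beta> \<gamma> j) z \<in> arm_curve (4 + 3 * j) ` points P1 \<longleftrightarrow> z $ 2 = 0"
    using in_P1_line h by (simp_all add: tower2_def exc_in_arm hpoint_notin_arm line_eq_iff)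
qed

lemma tower3_curves:
  "tower3 (3 + 3 * j) (base_chart \<alpha> \<beta> \<gamma> j) z \<in> arm_curve (4 + 3 * j) ` points P1 \<longleftrightarrow> z $ 1 = 0"
proof -
  obtain a b where h: "base_chart \<alpha> \<beta> \<gamma> j (vector [z $ 1 * z $ 2, (z $ 1)^2 * z $ 2 ^ 3]) = hpoint (z $ 1 * z $ 2) a b"
    using base_chart_hpoint[of \<alpha> \<beta> \<gamma> j "vector [z $ 1 * z $ 2, (z $ 1)^2 * z $ 2 ^ 3]"] by (metis vector_2(1))
  show ?thesis
    using in_P1_line h by (simp_all add: tower3_def exc_in_arm hpoint_notin_arm line_eq_iff)
qed

lemma arm_self_intersection:
  assumes f: "holomorphic_map P1 S (arm_curve n)"
    and c1: "mchart S D \<sigma>" "\<And>r. vector [r, 0] \<in> D \<and> \<sigma> (vector [r, 0]) = exc n (line r 1)"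
      "\<And>z. z \<in> D \<Longrightarrow> \<sigma> z \<in> arm_curve n ` points P1 \<longleftrightarrow> z $ 2 = 0"
    and c2: "mchart S UNIV \<tau>" "\<And>s. \<tau> (vector [0, s]) = (if s = 0 then exc (n + 1) (line 0 1) else exc n (line 1 s))"
      "\<And>z. \<tau> z \<in> arm_curve n ` points P1 \<longleftrightarrow> z $ 1 = 0"
    and tr: "\<And>z w. z \<in> D \<Longrightarrow> \<sigma> z = \<tau> w \<Longrightarrow> w $ 2 \<noteq> 0 \<and> z $ 2 = w $ 1 * (w $ 2)^2"
  shows "has_intersection_number S (arm_curve n) (arm_curve n ` points P1) (- 2)"
proof -
  let ?C = "arm_curve n ` points P1"
  have i1: "inv_into D \<sigma> (\<sigma> z) = z" if "z \<in> D" for z using mchartD(2)[OF c1(1)] that by simp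
  have i2: "inv_into UNIV \<tau> (\<tau> z) = z" for z using mchartD(2)[OF c2(1)] by simp
  have ov: "\<exists>z w. z \<in> D \<and> q = \<sigma> z \<and> q = \<tau> w" if "q \<in> \<sigma> ` D" "q \<in> range \<tau>" for q using that by blast
  have ft: "arm_curve n (line 1 s) = \<tau> (vector [0, s])" for s using c2(2) by simp
  have fs: "arm_curve n (line r 1) = \<sigma> (vector [r, 0])" for r using c1(2) by simp
  have h: "hfun S (range \<tau>) (\<lambda>q. inv_into UNIV \<tau> q $ 2)" by (rule hfun_chart[OF S c2(1)]) auto
  have nt: "\<tau> (vector [0, 0]) \<notin> \<sigma> ` D" using tr[of _ "vector [0, 0]"] by (auto dest: sym)
  have "has_intersection_number S (arm_curve n) ?C (\<Sum>x\<in>{line 1 0}. - 2)"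
  proof (rule intersection_number[OF S cS f local_equation_coord[OF S cS c1(1) c1(3)],
        where U = "\<lambda>_. range \<tau>" and h = "\<lambda>_ q. inv_into UNIV \<tau> q $ 1"
        and G = "\<lambda>_ q. 1 / (inv_into UNIV \<tau> q $ 2)^2" and s = "\<lambda>_ x. 1 / (inv_into UNIV \<tau> (arm_curve n x) $ 2)^2"])
    show "finite {line 1 0}" "{line 1 0} \<subseteq> points P1" using in_P1_line by auto
    show "local_equation S ?C (range \<tau>) (\<lambda>q. inv_into UNIV \<tau> q $ 1)"
      using local_equation_coord[OF S cS c2(1), of ?C 1] c2(3) by simp
    show "p1_order (\<lambda>x. 1 / (inv_into UNIV \<tau> (arm_curve n x) $ 2)^2) x (- 2)" if "x \<in> {line 1 0}" for x
    proof -
      have "p1_order (\<lambda>x. inv_into UNIV \<tau> (arm_curve n x) $ 2) (line 1 0) 1"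
        by (rule p1_order_affine[of UNIV]) (simp_all add: ft i2 del: arm_curve_simps)
      from p1_order_divide[OF this, of 2] show ?thesis using that by simp
    qed
    show "arm_curve n x \<in> \<sigma> ` D \<longleftrightarrow> x \<notin> {line 1 0}" if "x \<in> points P1" for x
      using that
    proof (rule P1_cases)
      fix w assume w: "x = line w 1"
      have "\<sigma> (vector [w, 0]) \<in> \<sigma> ` D" using c1(2)[of w] by blast
      then show ?thesis using w fs[of w] by (simp add: line_eq_iff del: arm_curve_simps)
    next
      fix w assume w: "x = line 1 w"
      show ?thesis
      proof (cases "w = 0")
        case True
        then show ?thesis using w nt ft[of 0] by (simp del: arm_curve_simps)
      next
        case False
        then have x: "x = line (1 / w) 1" using w line_flip[of "1 / w"] by simp
        have "\<sigma> (vector [1 / w, 0]) \<in> \<sigma> ` D" using c1(2)[of "1 / w"] by blast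
        then show ?thesis using x fs[of "1 / w"] by (simp add: line_eq_iff del: arm_curve_simps)
      qed
    qed
    show "arm_curve n x \<in> range \<tau>" if "x \<in> {line 1 0}" for x using that ft[of 0] by (simp del: arm_curve_simps)
    show "hfun S (\<sigma> ` D \<inter> range \<tau>) (\<lambda>q. 1 / (inv_into UNIV \<tau> q $ 2)^2)"
    proof (rule hfun_divide[OF hfun_const hfun_power[OF hfun_subset[OF h]]])
      show "(inv_into UNIV \<tau> q $ 2)^2 \<noteq> 0" if "q \<in> \<sigma> ` D \<inter> range \<tau>" for q
        using that ov[of q] tr i2 by auto
    qed simp
    show "1 / (inv_into UNIV \<tau> q $ 2)^2 \<noteq> 0 \<and>
        inv_into UNIV \<tau> q $ 1 = 1 / (inv_into UNIV \<tau> q $ 2)^2 * inv_into D \<sigma> q $ 2"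
      if q: "q \<in> \<sigma> ` D" "q \<in> range \<tau>" for q
    proof -
      obtain z w where zw: "z \<in> D" "q = \<sigma> z" "q = \<tau> w" using ov[OF q] by blast
      then have "w $ 2 \<noteq> 0" "z $ 2 = w $ 1 * (w $ 2)^2" using tr[of z w] by auto
      then show ?thesis using i1[OF zw(1)] i2[of w] zw(2,3) by simp
    qed
  qed auto
  then show ?thesis by simp
qed

lemma tower_transition:
  assumes "j < 3"
  shows "tower1 (3 + 3 * j) (base_chart \<alpha> \<beta> \<gamma> j) z = tower2 (3 + 3 * j) (base_chart \<alpha> \<beta> \<gamma> j) w \<Longrightarrow>
      w $ 2 \<noteq> 0 \<and> z $ 2 = w $ 1 * (w $ 2)^2"
    and "tower2 (3 + 3 * j) (base_chart \<alpha> \<beta> \<gamma> j) z = tower3 (3 + 3 * j) (base_chart \<alpha> \<beta> \<gamma> j) w \<Longrightarrow>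
      w $ 2 \<noteq> 0 \<and> z $ 2 = w $ 1 * (w $ 2)^2"
proof -
  let ?\<sigma> = "base_chart \<alpha> \<beta> \<gamma> j"
  have n: "exc m l \<noteq> ?\<sigma> v" "?\<sigma> v \<noteq> exc m l" if "l \<in> points P1" "m \<ge> 3" for m l v
    using base_chart_neq_exc[OF that] by metis+
  note s = in_P1_line n base_chart_inj vector2_eq_iff exc_eq_iff line_eq_iff
  show "w $ 2 \<noteq> 0 \<and> z $ 2 = w $ 1 * (w $ 2)^2" if "tower1 (3 + 3 * j) ?\<sigma> z = tower2 (3 + 3 * j) ?\<sigma> w"
    using that by (auto simp: tower1_def tower2_def s split: if_splits)
  show "w $ 2 \<noteq> 0 \<and> z $ 2 = w $ 1 * (w $ 2)^2" if "tower2 (3 + 3 * j) ?\<sigma> z = tower3 (3 + 3 * j) ?\<sigma> w"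
  proof (cases "z $ 1 = 0 \<or> z $ 2 = 0 \<or> w $ 1 = 0 \<or> w $ 2 = 0")
    case True
    then show ?thesis using that by (auto simp: tower2_def tower3_def s split: if_splits)
  next
    case False
    then have e: "z $ 1 * z $ 2 = w $ 1 * w $ 2" "z $ 1 * (z $ 2)^2 = (w $ 1)^2 * (w $ 2)^3"
      using that by (simp_all add: tower2_def tower3_def s)
    \<comment> \<open>The left-hand side of the second equation is (z $ 1 * z $ 2) * z $ 2, and its
      first factor is rewritten by the first equation; the common factor is nonzero in this
      case.\<close>
    then have "(w $ 1 * w $ 2) * z $ 2 = (w $ 1 * w $ 2) * (w $ 1 * (w $ 2)^2)" by algebra
    then show ?thesis using False by simp
  qed
qed

lemma arm_nodes:
  assumes "j < 3"
  shows "holomorphic_map P1 S (arm_curve (3 + 3 * j))" "holomorphic_map P1 S (arm_curve (4 + 3 * j))"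
    "openin (mtop S) (points S - arm_curve (3 + 3 * j) ` points P1)"
    "openin (mtop S) (points S - arm_curve (4 + 3 * j) ` points P1)"
  using embedded_arm1[OF assms] embedded_arm2[OF assms] unfolding embedded_P1_def
  by (auto intro: curve_closed[OF S])

lemma infinity_node:
  "holomorphic_map P1 S infinity_curve" "openin (mtop S) (points S - infinity_curve ` points P1)"
  using embedded_infinity unfolding embedded_P1_def by (auto intro: curve_closed[OF S])

lemma arm_self:
  assumes j: "j < 3"
  shows "has_intersection_number S (arm_curve (3 + 3 * j)) (arm_curve (3 + 3 * j) ` points P1) (- 2)"
    "has_intersection_number S (arm_curve (4 + 3 * j)) (arm_curve (4 + 3 * j) ` points P1) (- 2)"
proof -
  obtain D where D: "mchart S D (tower1 (3 + 3 * j) (base_chart \<alpha> \<beta> \<gamma> j))" "\<forall>z. z $ 2 = 0 \<longrightarrow> z \<in> D"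
    using tower1 j by blast
  show "has_intersection_number S (arm_curve (3 + 3 * j)) (arm_curve (3 + 3 * j) ` points P1) (- 2)"
  proof (rule arm_self_intersection[OF arm_nodes(1)[OF j] D(1) _ tower1_curves(1)[OF j D(1)] tower2[rule_format, OF j]
        _ tower2_curves(1) tower_transition(1)[OF j]])
  qed (use D(2) in \<open>simp_all add: tower1_def tower2_def\<close>)
  show "has_intersection_number S (arm_curve (4 + 3 * j)) (arm_curve (4 + 3 * j) ` points P1) (- 2)"
  proof (rule arm_self_intersection[OF arm_nodes(2)[OF j] tower2[rule_format, OF j] _ tower2_curves(2)
        tower3[rule_format, OF j] _ tower3_curves tower_transition(2)[OF j]])
  qed (simp_all add: tower2_def tower3_def)
qed

text \<open>Along the line at infinity the second coordinate of \<open>tower1\<close> is the centred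
  parameter of \<open>line_param\<close>, which has a simple zero. The shift in
  \<open>open_slice\<close> transfers the domain to the standard parameter.\<close>

lemma infinity_order:
  assumes j: "j < 3" and c: "mchart S D (tower1 (3 + 3 * j) (base_chart \<alpha> \<beta> \<gamma> j))" and D: "\<forall>z. z $ 2 = 0 \<longrightarrow> z \<in> D"
  shows "p1_order (\<lambda>x. inv_into D (tower1 (3 + 3 * j) (base_chart \<alpha> \<beta> \<gamma> j)) (infinity_curve x) $ 2) (line_param j 0) 1"
    (is "p1_order ?s _ _")
proof -
  have s: "?s (line_param j v) = v" if "vector [0, v] \<in> D" for v
    using infinity_curve_tower1[OF j c that] mchartD(2)[OF c] that by simp
  have o: "open {v. vector [0, v + a] \<in> D}" for a by (rule open_slice[OF mchartD(1)[OF c]])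
  have z: "(vector [0, 0] :: complex ^ 2) \<in> D" using D by simp
  consider "j = 0" | "j = 1" | "j = 2" using j by linarith
  then show ?thesis
  proof cases
    case 1
    have "p1_order ?s (line 1 1) 1"
      by (rule p1_order_affine[OF o[of "- 1"]]) (use z s 1 in \<open>simp_all add: line_param_def\<close>, metis add.commute diff_add_cancel)
    then show ?thesis using 1 by (simp add: line_param_def)
  next
    case 2
    have "p1_order ?s (line 1 (- 1)) 1"
      by (rule p1_order_affine[OF o[of 1]]) (use z s 2 in \<open>simp_all add: line_param_def\<close>, metis add_diff_cancel_left' add.commute)
    then show ?thesis using 2 by (simp add: line_param_def)
  next
    case 3
    have "p1_order ?s (line 0 1) 1"
      by (rule p1_order_infinity[OF o[of 0]]) (use z s 3 in \<open>simp_all add: line_param_def\<close>)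
    then show ?thesis using 3 by (simp add: line_param_def)
  qed
qed

lemma infinity_meets_arm:
  assumes x: "x \<in> points P1" and j: "j < 3"
  shows "infinity_curve x \<in> arm_curve (3 + 3 * j) ` points P1 \<longleftrightarrow> x = line_param j 0"
proof -
  have l: "infinity_curve (line_param k 0) = exc (3 + 3 * k) (line 0 1)" if "k < 3" for k
  proof -
    have "k = 0 \<or> k = 1 \<or> k = 2" using that by linarith
    then show ?thesis by (elim disjE) (simp_all add: line_param_def infinity_curve_simps)
  qed
  have e: "infinity_curve (line_param k 0) \<in> arm_curve (3 + 3 * j) ` points P1 \<longleftrightarrow> k = j" if "k < 3" for k
    unfolding l[OF that] using in_P1_line by (simp add: exc_in_arm line_eq_iff) presburger
  have ne: "line_param k 0 = line_param j 0 \<longleftrightarrow> k = j" if "k < 3" for k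
  proof
    assume "line_param k 0 = line_param j 0"
    then have "exc (3 + 3 * k) (line 0 1) = exc (3 + 3 * j) (line 0 1)" using l[OF that] l[OF j] by simp
    then show "k = j" by (simp add: exc_eq_iff in_P1_line)
  qed simp
  consider k where "k < 3" "x = line_param k 0" | w where "w \<noteq> 1" "w \<noteq> - 1" "x = line 1 w"
  proof -
    have "(\<exists>k<3. x = line_param k 0) \<or> (\<exists>w. w \<noteq> 1 \<and> w \<noteq> - 1 \<and> x = line 1 w)"
      using x
    proof (rule P1_cases')
      fix w assume "x = line 1 w"
      then show ?thesis unfolding line_param_def all_less_3
        by (cases "w = 1"; cases "w = - 1") (auto intro: exI[of _ 0] exI[of _ 1])
    next
      assume "x = line 0 1"
      then show ?thesis unfolding line_param_def by (intro disjI1 exI[of _ 2]) simp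
    qed
    then show ?thesis using that by blast
  qed
  then show ?thesis
  proof cases
    case 1
    then show ?thesis using e ne by simp
  next
    case 2
    then have "x \<noteq> line_param j 0" by (auto simp: line_param_def line_eq_iff)
    moreover have "infinity_curve x \<notin> arm_curve (3 + 3 * j) ` points P1"
      using 2 infinity_curve_simps(4)[of w] hpoint_notin_arm by simp
    ultimately show ?thesis by simp
  qed
qed

lemma line_param_in_P1: "line_param j s \<in> points P1"
  using in_P1_line by (simp add: line_param_def)

lemma arm_meets_infinity:
  assumes x: "x \<in> points P1" and j: "j < 3"
  shows "arm_curve (3 + 3 * j) x \<in> infinity_curve ` points P1 \<longleftrightarrow> x = line 0 1"
  using x in_P1_line j by (auto simp: arm_curve_def exc_in_infinity line_eq_iff) presburger

lemma arms_meet: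
  assumes x: "x \<in> points P1"
  shows "arm_curve (3 + 3 * j) x \<in> arm_curve (4 + 3 * j) ` points P1 \<longleftrightarrow> x = line 1 0"
    "arm_curve (4 + 3 * j) x \<in> arm_curve (3 + 3 * j) ` points P1 \<longleftrightarrow> x = line 0 1"
  using x in_P1_line exc_in_arm[of "line 0 1" _ "3 + 3 * j"] exc_in_arm[of "line 0 1" _ "4 + 3 * j"]
    exc_in_arm[OF x, of _ "3 + 3 * j"] exc_in_arm[OF x, of _ "4 + 3 * j"]
  by (simp_all add: arm_curve_def[of _ x] line_eq_iff)

text \<open>The two curves are the coordinate axes of \<open>tower1\<close> and cross at its origin,
  so the equation of each restricts to a local parameter on the other.\<close>

lemma infinity_arm_number:
  assumes j: "j < 3"
  shows "has_intersection_number S infinity_curve (arm_curve (3 + 3 * j) ` points P1) 1"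
    "has_intersection_number S (arm_curve (3 + 3 * j)) (infinity_curve ` points P1) 1"
proof -
  obtain D where D: "mchart S D (tower1 (3 + 3 * j) (base_chart \<alpha> \<beta> \<gamma> j))" "\<forall>z. z $ 2 = 0 \<longrightarrow> z \<in> D"
    using tower1 j by blast
  let ?\<sigma> = "tower1 (3 + 3 * j) (base_chart \<alpha> \<beta> \<gamma> j)"
  have z: "(vector [r, 0] :: complex ^ 2) \<in> D" for r using D(2) by simp
  have ii: "inv_into D ?\<sigma> (?\<sigma> (vector [r, 0])) = vector [r, 0]" for r
    using mchartD(2)[OF D(1)] z by simp
  have f: "arm_curve (3 + 3 * j) (line r 1) = ?\<sigma> (vector [r, 0])" for r by (simp add: tower1_def)
  show "has_intersection_number S infinity_curve (arm_curve (3 + 3 * j) ` points P1) 1"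
  proof (rule intersection_number_transversal[OF S cS infinity_node(1) arm_nodes(3)[OF j] line_param_in_P1
        infinity_meets_arm[OF _ j] D(1) _ tower1_curves(1)[OF j D(1)] infinity_order[OF j D]])
    show "infinity_curve (line_param j 0) \<in> ?\<sigma> ` D"
      using infinity_curve_tower1[OF j D(1) z] z by simp
  qed
  show "has_intersection_number S (arm_curve (3 + 3 * j)) (infinity_curve ` points P1) 1"
  proof (rule intersection_number_transversal[OF S cS arm_nodes(1)[OF j] infinity_node(2) in_P1_line(1)
        arm_meets_infinity[OF _ j] D(1) _ tower1_curves(2)[OF j D(1)]])
    show "arm_curve (3 + 3 * j) (line 0 1) \<in> ?\<sigma> ` D" unfolding f using z by blast
    show "p1_order (\<lambda>x. inv_into D ?\<sigma> (arm_curve (3 + 3 * j) x) $ 1) (line 0 1) 1"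
      by (rule p1_order_infinity[of UNIV]) (simp_all add: f ii del: arm_curve_simps)
  qed
qed

text \<open>The same argument at the origin of \<open>tower2\<close>, whose axes are the inner and
  the outer curve of the arm.\<close>

lemma arm_arm_number:
  assumes j: "j < 3"
  shows "has_intersection_number S (arm_curve (3 + 3 * j)) (arm_curve (4 + 3 * j) ` points P1) 1"
    "has_intersection_number S (arm_curve (4 + 3 * j)) (arm_curve (3 + 3 * j) ` points P1) 1"
proof -
  let ?\<sigma> = "tower2 (3 + 3 * j) (base_chart \<alpha> \<beta> \<gamma> j)"
  note c = tower2[rule_format, OF j]
  have ii: "inv_into UNIV ?\<sigma> (?\<sigma> z) = z" for z using mchartD(2)[OF c] by simp
  have f: "arm_curve (3 + 3 * j) (line 1 s) = ?\<sigma> (vector [0, s])"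
    "arm_curve (4 + 3 * j) (line s 1) = ?\<sigma> (vector [s, 0])" for s by (simp_all add: tower2_def)
  show "has_intersection_number S (arm_curve (3 + 3 * j)) (arm_curve (4 + 3 * j) ` points P1) 1"
  proof (rule intersection_number_transversal[OF S cS arm_nodes(1,4)[OF j] in_P1_line(2) arms_meet(1)
        c _ tower2_curves(2)])
    show "p1_order (\<lambda>x. inv_into UNIV ?\<sigma> (arm_curve (3 + 3 * j) x) $ 2) (line 1 0) 1"
      by (rule p1_order_affine[of UNIV]) (simp_all add: f ii del: arm_curve_simps)
    show "arm_curve (3 + 3 * j) (line 1 0) \<in> range ?\<sigma>" unfolding f by (rule rangeI)
  qed
  show "has_intersection_number S (arm_curve (4 + 3 * j)) (arm_curve (3 + 3 * j) ` points P1) 1"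
  proof (rule intersection_number_transversal[OF S cS arm_nodes(2,3)[OF j] in_P1_line(1) arms_meet(2)
        c _ tower2_curves(1)])
    show "p1_order (\<lambda>x. inv_into UNIV ?\<sigma> (arm_curve (4 + 3 * j) x) $ 1) (line 0 1) 1"
      by (rule p1_order_infinity[of UNIV]) (simp_all add: f ii del: arm_curve_simps)
    show "arm_curve (4 + 3 * j) (line 0 1) \<in> range ?\<sigma>" unfolding f by (rule rangeI)
  qed
qed

text \<open>Away from the base points the line at infinity has the equation 1 / x, and the section
  is 1. Over the first two base points the equation of the strict transform is 1 / x divided by that
  of the exceptional curve, so the section acquires a simple pole. At the third base point 1 / x has
  a vanishing denominator, which accounts for the self-intersection 1 of a line in the plane; the
  blow-up cancels it, leaving a unit, and the section stays 1. The total is - 1 - 1 + 0.\<close>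

lemma infinity_self:
  "has_intersection_number S infinity_curve (infinity_curve ` points P1) (- 2)"
proof -
  let ?C = "infinity_curve ` points P1"
  let ?A = "{z. \<forall>j<3. hpoint (z $ 1) 1 (z $ 2) \<noteq> base_point j}"
  let ?\<theta> = "\<lambda>z :: complex ^ 2. hpoint (z $ 1) 1 (z $ 2)"
  let ?t = "\<lambda>j. tower1 (3 + 3 * j) (base_chart \<alpha> \<beta> \<gamma> j)"
  have "\<forall>j. \<exists>D. j < 3 \<longrightarrow> mchart S D (?t j) \<and> (\<forall>z. z $ 2 = 0 \<longrightarrow> z \<in> D)" using tower1 by blast
  then obtain D where "\<forall>j. j < 3 \<longrightarrow> mchart S (D j) (?t j) \<and> (\<forall>z. z $ 2 = 0 \<longrightarrow> z \<in> D j)"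
    by (rule choice[THEN exE])
  then have c: "mchart S (D j) (?t j)" "\<forall>z. z $ 2 = 0 \<longrightarrow> z \<in> D j" if "j < 3" for j using that by blast+
  let ?i = "\<lambda>j. inv_into (D j) (?t j)"
  have i: "?i j (?t j z) = z" if "j < 3" "z \<in> D j" for j z using mchartD(2)[OF c(1)] that by simp
  have i0: "inv_into ?A ?\<theta> (?\<theta> z) = z" if "z \<in> ?A" for z using inv_into_f_f[OF mchartD(2)[OF infinity] that] by simp
  define J where "J x = (if x = line 0 1 then 2 else if x = line 1 1 then 0 else 1 :: nat)" for x
  define G where "G j q = (if j = 2 then 1 - 2 * \<gamma> * (?i j q $ 1)^2 * ?i j q $ 2 else 1 / (?i j q $ 2) ^ 1)" for j q
  let ?X = "{line 1 1, line 1 (- 1), line 0 1}"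
  have Jp: "J x < 3" "line_param (J x) 0 = x" if "x \<in> ?X" for x
    using that by (auto simp: J_def line_param_def line_eq_iff)
  have Jinj: "J x \<noteq> J y" if "x \<in> ?X" "y \<in> ?X" "x \<noteq> y" for x y using Jp that by metis
  have top: "infinity_curve x = exc (3 + 3 * J x) (line 0 1)" if "x \<in> ?X" for x
    using that by (auto simp: J_def infinity_curve_simps line_eq_iff)
  have img: "?t j z \<in> ?\<theta> ` ?A \<Longrightarrow> z $ 2 \<noteq> 0" for j z
    using exc_neq_hpoint[OF in_P1_line(1)[of "z $ 1"], of "3 + 3 * j"] by (auto simp: tower1_def)
  have img2: "?t j z \<in> ?\<theta> ` ?A" if j: "j < 2" "z \<in> D j" "z $ 2 \<noteq> 0" for j z
  proof -
    have "\<exists>v. ?t j z = ?\<theta> (vector [z $ 1 * z $ 2, v])" using j(1,3) by (auto simp: tower1_def base_chart_def)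
    then obtain v where v: "?t j z = ?\<theta> (vector [z $ 1 * z $ 2, v])" ..
    moreover have "\<forall>k<3. ?t j z \<noteq> base_point k" using tower1_notin_base[OF c(1)] j by simp
    ultimately have "(vector [z $ 1 * z $ 2, v] :: complex ^ 2) \<in> ?A" by simp
    then show ?thesis using v by blast
  qed
  have rel: "G j q \<noteq> 0 \<and> ?i j q $ 1 = G j q * inv_into ?A ?\<theta> q $ 1"
    if j: "j < 3" and q: "q \<in> ?\<theta> ` ?A" "q \<in> ?t j ` D j" for j q
  proof -
    obtain w where w: "w \<in> ?A" "q = ?\<theta> w" using q(1) by blast
    obtain z where z: "z \<in> D j" "q = ?t j z" using q(2) by blast
    have nz: "z $ 2 \<noteq> 0" using img[of j z] z(2) q(1) by simp
    have e: "base_chart \<alpha> \<beta> \<gamma> j (vector [z $ 1 * z $ 2, z $ 2]) = ?\<theta> w"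
      using z(2) w(2) nz by (simp add: tower1_def)
    show ?thesis
    proof (cases "j = 2")
      case True
      then have "(- 2*\<gamma> * (z $ 1 * z $ 2)^2 + z $ 2) * w $ 1 = z $ 1 * z $ 2"
        and k: "(- 2*\<gamma> * (z $ 1 * z $ 2)^2 + z $ 2) * w $ 2 = 1"
        using e by (simp_all add: base_chart_def hpoint_eq_iff)
      \<comment> \<open>After the blow-up z $ 2 is a common factor of numerator and denominator.
        What remains of the denominator is nonzero because multiplying it by z $ 2 * w $ 2 gives
        1.\<close>
      moreover have b: "- 2*\<gamma> * (z $ 1 * z $ 2)^2 + z $ 2 = z $ 2 * (1 - 2 * \<gamma> * (z $ 1)^2 * z $ 2)"
        by algebra
      ultimately have "z $ 2 * ((1 - 2 * \<gamma> * (z $ 1)^2 * z $ 2) * w $ 1) = z $ 2 * z $ 1"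
        by (simp only: mult.assoc mult.commute mult.left_commute)
      then have "z $ 1 = (1 - 2 * \<gamma> * (z $ 1)^2 * z $ 2) * w $ 1" using nz by simp
      moreover have "1 - 2 * \<gamma> * (z $ 1)^2 * z $ 2 \<noteq> 0" using k unfolding b by auto
      ultimately show ?thesis using True i[OF j z(1)] i0[OF w(1)] z(2) w(2) unfolding G_def by simp
    next
      case False
      then have "z $ 1 * z $ 2 = w $ 1" using e j by (auto simp: base_chart_def hpoint_eq_iff split: if_splits)
      then show ?thesis using False nz i[OF j z(1)] i0[OF w(1)] z(2) w(2) unfolding G_def by (simp add: field_simps)
    qed
  qed
  have hi: "hfun S (?t j ` D j) (\<lambda>q. ?i j q $ k)" if "j < 3" for j k
    by (rule hfun_chart[OF S c(1)[OF that]]) auto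
  have hG: "hfun S (?\<theta> ` ?A \<inter> ?t j ` D j) (G j)" if j: "j < 3" for j
  proof (cases "j = 2")
    case True
    then have e: "G j = (\<lambda>q. 1 - 2 * \<gamma> * (?i j q $ 1)^2 * ?i j q $ 2)" by (simp add: G_def fun_eq_iff)
    have "hfun S (?t j ` D j) (G j)" unfolding e
      by (rule hfun_chart[OF S c(1)[OF j], where g = "\<lambda>z. 1 - 2 * \<gamma> * (z $ 1)^2 * z $ 2"])
        (intro cdiff_intros)
    then show ?thesis by (rule hfun_subset) (rule Int_lower2)
  next
    case False
    have "hfun S (?\<theta> ` ?A \<inter> ?t j ` D j) (\<lambda>q. 1 / (?i j q $ 2) ^ 1)"
    proof (rule hfun_divide[OF hfun_const hfun_power[OF hfun_subset[OF hi[OF j]]]])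
      fix q assume "q \<in> ?\<theta> ` ?A \<inter> ?t j ` D j"
      then have q: "q \<in> ?\<theta> ` ?A" "q \<in> ?t j ` D j" by blast+
      then obtain z where z: "z \<in> D j" "q = ?t j z" by blast
      then show "(?i j q $ 2) ^ 1 \<noteq> 0" using img[of j z] q(1) i[OF j z(1)] by simp
    qed simp
    moreover have "G j = (\<lambda>q. 1 / (?i j q $ 2) ^ 1)" using False by (simp add: G_def fun_eq_iff)
    ultimately show ?thesis by simp
  qed
  \<comment> \<open>At the third base point the factor \<open>G\<close> restricts to 1 on the curve,
    because z $ 1 = 0 there.\<close>
  define s where "s x = (if J x = 2 then (\<lambda>_. 1) else (\<lambda>y. 1 / (?i (J x) (infinity_curve y) $ 2) ^ 1))" for x
  have "has_intersection_number S infinity_curve ?C (\<Sum>x\<in>?X. if x = line 0 1 then 0 else - 1)"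
  proof (rule intersection_number[OF S cS infinity_node(1), where U = "\<lambda>x. ?t (J x) ` D (J x)"
        and h = "\<lambda>x q. ?i (J x) q $ 1" and G = "\<lambda>x. G (J x)" and s = s])
    show "local_equation S ?C (?\<theta> ` ?A) (\<lambda>q. inv_into ?A ?\<theta> q $ 1)"
      by (rule local_equation_coord[OF S cS infinity]) (simp add: hpoint_in_infinity)
    show "finite ?X" "?X \<subseteq> points P1" using in_P1_line by auto
    show "infinity_curve x \<in> ?\<theta> ` ?A \<longleftrightarrow> x \<notin> ?X" if "x \<in> points P1" for x
      using that
    proof (rule P1_cases')
      fix w assume x: "x = line 1 w"
      show ?thesis
      proof (cases "x \<in> ?X")
        case True
        have "exc (3 + 3 * J x) (line 0 1) \<notin> ?\<theta> ` ?A"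
          using exc_neq_hpoint[OF in_P1_line(1)[of 0], of "3 + 3 * J x"] by auto
        then show ?thesis using True top by simp
      next
        case False
        then have "w \<noteq> 1" "w \<noteq> - 1" using x by auto
        then have "infinity_curve x = ?\<theta> (vector [0, w])" "(vector [0, w] :: complex ^ 2) \<in> ?A"
          using x by (simp_all add: infinity_curve_simps all_less_3 base_point_def hpoint_eq_iff)
        then show ?thesis using False by blast
      qed
    next
      assume x: "x = line 0 1"
      have "exc (3 + 3 * J x) (line 0 1) \<notin> ?\<theta> ` ?A"
        using exc_neq_hpoint[OF in_P1_line(1)[of 0], of "3 + 3 * J x"] by auto
      then show ?thesis using x top by simp
    qed
  next
    fix x assume x: "x \<in> ?X"
    note J = Jp[OF x]
    have z: "vector [0, 0] \<in> D (J x)" using c(2)[OF J(1)] by simp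
    show "local_equation S ?C (?t (J x) ` D (J x)) (\<lambda>q. ?i (J x) q $ 1)"
      by (rule local_equation_coord[OF S cS c(1)[OF J(1)] tower1_curves(2)[OF J(1) c(1)[OF J(1)]]])
    show "infinity_curve x \<in> ?t (J x) ` D (J x)"
      using infinity_curve_tower1[OF J(1) c(1)[OF J(1)] z] z J(2) by simp
    show "hfun S (?\<theta> ` ?A \<inter> ?t (J x) ` D (J x)) (G (J x))" by (rule hG[OF J(1)])
    show "p1_order (s x) x (if x = line 0 1 then 0 else - 1)"
    proof (cases "x = line 0 1")
      case True
      have "p1_order (\<lambda>_. 1) x 0"
        by (rule p1_order_0[of "points P1"])
          (use x in_P1_line hfun_const openin_topspace[of "mtop P1"] topspace_mtop[OF P1_manifold(1)] in auto)
      then show ?thesis using True by (simp add: s_def J_def)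
    next
      case False
      then have "J x \<noteq> 2" by (simp add: J_def)
      moreover have "p1_order (\<lambda>y. 1 / (?i (J x) (infinity_curve y) $ 2) ^ 1) x (- int 1 * 1)"
        using p1_order_divide[OF infinity_order[OF J(1) c[OF J(1)]], of 1] J(2) by simp
      ultimately show ?thesis using False unfolding s_def by simp
    qed
    show "s x y = G (J x) (infinity_curve y)"
      if y: "y \<in> points P1" "infinity_curve y \<in> ?\<theta> ` ?A" "infinity_curve y \<in> ?t (J x) ` D (J x)" for y
    proof (cases "J x = 2")
      case True
      obtain z where z: "z \<in> D (J x)" "infinity_curve y = ?t (J x) z" using y(3) by blast
      have "z $ 1 = 0" using tower1_curves(2)[OF J(1) c(1)[OF J(1)] z(1)] z(2) imageI[OF y(1), of infinity_curve] by simp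
      then show ?thesis using True i[OF J(1) z(1)] unfolding s_def G_def z(2) by simp
    qed (simp add: s_def G_def)
  next
    fix x q assume "x \<in> ?X" "q \<in> ?\<theta> ` ?A" "q \<in> ?t (J x) ` D (J x)"
    then show "G (J x) q \<noteq> 0 \<and> ?i (J x) q $ 1 = G (J x) q * inv_into ?A ?\<theta> q $ 1"
      using rel[OF Jp(1)] by blast
  next
    \<comment> \<open>Exceptional points over different base points differ, so a common point of two
      towers is not exceptional; over one of the first two base points it then lies in the chart
      with second homogeneous coordinate 1. Of two different base points at least one is among the
      first two, so every overlap is covered.\<close>
    have sep: "q \<in> ?\<theta> ` ?A" if "j < 2" "k < 3" "j \<noteq> k" "q \<in> ?t j ` D j" "q \<in> ?t k ` D k" for j k q
    proof -
      obtain z where z: "z \<in> D j" "q = ?t j z" using \<open>q \<in> ?t j ` D j\<close> by blast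
      obtain w where w: "w \<in> D k" "q = ?t k w" using \<open>q \<in> ?t k ` D k\<close> by blast
      have "z $ 2 \<noteq> 0"
      proof
        assume "z $ 2 = 0"
        then have "q \<in> arm_curve (3 + 3 * j) ` points P1"
          using tower1_curves(1)[OF _ c(1) z(1)] z(2) that(1) by simp
        then show False using z w that in_P1_line \<open>z $ 2 = 0\<close> base_chart_neq_exc[OF in_P1_line(1), of "3 + 3 * j"]
          by (auto simp: tower1_def exc_eq_iff split: if_splits)
      qed
      then show ?thesis using img2[OF that(1) z(1)] z(2) by simp
    qed
    fix x y assume xy: "x \<in> ?X" "y \<in> ?X" "x \<noteq> y"
    have "J x < 2 \<or> J y < 2" using Jinj[OF xy] Jp(1)[OF xy(1)] Jp(1)[OF xy(2)] by linarith
    then show "?t (J x) ` D (J x) \<inter> ?t (J y) ` D (J y) \<subseteq> ?\<theta> ` ?A"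
    proof (rule disjE; intro subsetI; elim IntE)
      fix q assume "J x < 2" "q \<in> ?t (J x) ` D (J x)" "q \<in> ?t (J y) ` D (J y)"
      then show "q \<in> ?\<theta> ` ?A" using sep[of "J x" "J y" q] Jinj[OF xy] Jp(1)[OF xy(2)] by blast
    next
      fix q assume "J y < 2" "q \<in> ?t (J x) ` D (J x)" "q \<in> ?t (J y) ` D (J y)"
      then show "q \<in> ?\<theta> ` ?A" using sep[of "J y" "J x" q] Jinj[OF xy(2,1)] xy(3) Jp(1)[OF xy(1)] by blast
    qed
  qed
  moreover have "(\<Sum>x\<in>?X. if x = line 0 1 then 0 else - 1) = (- 2 :: int)"
    by (simp add: line_eq_iff)
  ultimately show ?thesis by simp
qed

lemma curve_intersection_numbers:
  assumes "v \<in> fst affine_E6" "w \<in> fst affine_E6"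
  shows "has_intersection_number S (curve v) (curve w ` points P1)
     (if v = w then -2 else if {v, w} \<in> snd affine_E6 then 1 else 0)"
proof -
  note d = intersection_number_disjoint[OF S cS]
  have a: "has_intersection_number S (arm_curve n) (arm_curve m ` points P1) 0"
    if "holomorphic_map P1 S (arm_curve n)" "openin (mtop S) (points S - arm_curve m ` points P1)"
      "n \<noteq> m" "n + 1 \<noteq> m" "m + 1 \<noteq> n" for n m
    using d[OF that(1,2)] arm_disjoint[OF that(3-5)] by blast
  show ?thesis
  proof (rule node_cases[OF assms(1)]; rule_tac node_cases[OF assms(2)])
    assume "v = 0" "w = 0"
    then show ?thesis using infinity_self by (simp add: curve_simps)
  next
    fix k assume "v = 0" "k < 3" "w = Suc (2 * k)"
    then show ?thesis using infinity_arm_number(1) edge_iff(1) by (simp add: curve_simps)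
  next
    fix k assume "v = 0" "k < 3" "w = Suc (Suc (2 * k))"
    then show ?thesis using d[OF infinity_node(1) arm_nodes(4) infinity_arm_disjoint] edge_iff(3)
      by (simp add: curve_simps)
  next
    fix j assume "j < 3" "v = Suc (2 * j)" "w = 0"
    then show ?thesis using infinity_arm_number(2) edge_iff(2) by (simp add: curve_simps)
  next
    fix j k assume "j < 3" "v = Suc (2 * j)" "k < 3" "w = Suc (2 * k)"
    then show ?thesis using arm_self(1)[of j] a[OF arm_nodes(1,3), of j k] edge_iff(7)[of j k]
      by (cases "j = k") (simp_all add: curve_simps)
  next
    fix j k assume "j < 3" "v = Suc (2 * j)" "k < 3" "w = Suc (Suc (2 * k))"
    then show ?thesis using arm_arm_number(1)[of j] a[OF arm_nodes(1,4), of j k] edge_iff(5)[of j k]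
      by (cases "j = k") (simp_all add: curve_simps)
  next
    fix j assume "j < 3" "v = Suc (Suc (2 * j))" "w = 0"
    then show ?thesis using d[OF arm_nodes(2) infinity_node(2) arm_infinity_disjoint] edge_iff(4)
      by (simp add: curve_simps)
  next
    fix j k assume "j < 3" "v = Suc (Suc (2 * j))" "k < 3" "w = Suc (2 * k)"
    then show ?thesis using arm_arm_number(2)[of j] a[OF arm_nodes(2,3), of j k] edge_iff(6)[of k j]
      by (cases "j = k") (simp_all add: curve_simps)
  next
    fix j k assume "j < 3" "v = Suc (Suc (2 * j))" "k < 3" "w = Suc (Suc (2 * k))"
    then show ?thesis using arm_self(2)[of j] a[OF arm_nodes(2,4), of j k] edge_iff(8)[of j k]
      by (cases "j = k") (simp_all add: curve_simps)
  qed
qed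

end

context cubic_system
begin

lemma surface:
  "has_surface_of_type affine_E6 (glued_fibre 4 T t) (\<lambda>z. glued_point 4 T 0 z t)"
proof -
  obtain S \<rho> where it: "iterated_blowup_P2 S \<rho>" "complex_manifold S" "countable (atlas S)"
    "\<forall>z :: complex ^ 2. \<rho> (hpoint 1 (z $ 1) (z $ 2)) = line_through (vector [1, z $ 1, z $ 2])"
    "points S = (plane_label ` points P2 - base_point ` {..<3}) \<union>
       (\<Union>j<3. exc (3 + 3 * j) ` (points P1 - {line 1 0}) \<union> exc (4 + 3 * j) ` (points P1 - {line 1 0})
          \<union> exc (5 + 3 * j) ` points P1)"
    "mchart S UNIV (\<lambda>z. hpoint 1 (z $ 1) (z $ 2))"
    "mchart S {z. \<forall>j<3. hpoint (z $ 1) 1 (z $ 2) \<noteq> base_point j} (\<lambda>z. hpoint (z $ 1) 1 (z $ 2))"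
    "\<forall>j<3. \<exists>D. mchart S D (tower1 (3 + 3 * j) (base_chart \<alpha> \<beta> \<gamma> j)) \<and> (\<forall>z. z $ 2 = 0 \<longrightarrow> z \<in> D)"
    "\<forall>j<3. mchart S UNIV (tower2 (3 + 3 * j) (base_chart \<alpha> \<beta> \<gamma> j))"
    "\<forall>j<3. mchart S UNIV (tower3 (3 + 3 * j) (base_chart \<alpha> \<beta> \<gamma> j))"
    "\<forall>j<3. mchart S UNIV (tower_top (3 + 3 * j) (base_chart \<alpha> \<beta> \<gamma> j))"
    by (rule nine_fold_blowup[of \<alpha> \<beta> \<gamma>])
  interpret cubic_surface \<alpha> \<beta> \<gamma> S by unfold_locales (rule it)+
  have "\<rho> (embed (gp 0 z t)) = line_through (vector [1, z $ 1, z $ 2])" for z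
    using it(4) by (simp add: embed_gp emb_def)
  then show ?thesis
    unfolding has_surface_of_type_def
    by (intro exI[of _ S] exI[of _ \<rho>] exI[of _ embed] exI[of _ curve] conjI ballI allI it(1) open_embed
        biholomorphic_embed hol_curve(1) inj_curves boundary curve_intersection_numbers) simp
qed

end

theorem theorem27p2:
  fixes \<alpha> \<beta> \<gamma> :: complex
  shows "(\<forall>j<4. \<forall>t. birational_map (system_charts \<alpha> \<beta> \<gamma> j t) \<and> symplectic_map (system_charts \<alpha> \<beta> \<gamma> j t)) \<and>
         is_phase_space (system_rhs \<alpha> \<beta> \<gamma>) 4 (system_charts \<alpha> \<beta> \<gamma>) \<and>
         (\<forall>t. has_surface_of_type affine_E6 (glued_fibre 4 (system_charts \<alpha> \<beta> \<gamma>) t)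
                (\<lambda>z. glued_point 4 (system_charts \<alpha> \<beta> \<gamma>) 0 z t))"
proof -
  interpret cubic_system \<alpha> \<beta> \<gamma> .
  show ?thesis using birational symplectic phase_space surface by blast
qed

end
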